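(* Let $C$ and $D$ be (small) categories. There are natural isomorphisms $$N(C\times D)\cong NC\times ND\qquad\text{and}\qquad N(D^C)\cong (ND)^{NC}$$ of simplicial spaces. The functor $N\colon\mathrm{Cat}\to s\mathcal{S}$ is a full embedding of categories. Furthermore, a functor $f\colon C\to D$ is an equivalence of categories if and only if $Nf$ is a weak equivalence of simplicial spaces (i.e. a weak equivalence of simplicial sets in each degree).
   Context: $\mathrm{Cat}$ is the category of small categories and functors; $D^C$ is the category of functors $C\to D$ and natural transformations. $\mathcal{S}$ is the category of simplicial sets ("spaces"). $\mathbf{\Delta}$ is the category with objects the categories $[n]=\{0\to1\to\cdots\to n\}$ and all functors; $s\mathcal{S}$ is the category of functors $\mathbf{\Delta}^{op}\to\mathcal{S}$, $[n]\mapsto X_n$ (simplicial spaces). A space is regarded as a constant simplicial space. $\mathrm{Map}(X,Y)$ is the space whose $n$-simplices are the maps $X\times\Delta[n]\to Y$; $F(k)$ is the simplicial space $[n]\mapsto\mathbf{\Delta}([n],[k])$ (discrete). The internal hom of $s\mathcal{S}$ is $Y^X$ with $(Y^X)_k=\mathrm{Map}(X\times F(k),Y)$. For a category $C$, $\mathrm{iso}\,C$ denotes its maximal subgroupoid (all objects and all isomorphisms). The classifying diagram of $C$ is the simplicial space $NC$ with $(NC)_m=\mathrm{nerve}(\mathrm{iso}(C^{[m]}))$. *)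

theory Defs
  imports "HOL-Homology.Homology"
begin

section \<open>Small categories, functors, natural transformations\<close>

text \<open>
  Every operation is required to be \<^const>\<open>undefined\<close> outside its domain, here and in all
  structures below. Hence HOL equality of two such structures is equality of the mathematical
  objects, and a set of functors or maps contains each functor or map exactly once.
\<close>

record ('o, 'a) cat =
  Obj :: "'o set"
  Arr :: "'a set"
  Dom :: "'a \<Rightarrow> 'o"
  Cod :: "'a \<Rightarrow> 'o"
  Ide :: "'o \<Rightarrow> 'a"
  Comp :: "'a \<Rightarrow> 'a \<Rightarrow> 'a"

definition composable :: "('o, 'a) cat \<Rightarrow> 'a \<Rightarrow> 'a \<Rightarrow> bool" where
  "composable C g f \<longleftrightarrow> g \<in> Arr C \<and> f \<in> Arr C \<and> Dom C g = Cod C f"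

definition category :: "('o, 'a) cat \<Rightarrow> bool" where
  "category C \<longleftrightarrow>
     Dom C \<in> Arr C \<rightarrow>\<^sub>E Obj C \<and>
     Cod C \<in> Arr C \<rightarrow>\<^sub>E Obj C \<and>
     Ide C \<in> Obj C \<rightarrow>\<^sub>E Arr C \<and>
     (\<forall>x\<in>Obj C. Dom C (Ide C x) = x \<and> Cod C (Ide C x) = x) \<and>
     (\<forall>g f. composable C g f \<longrightarrow>
        Comp C g f \<in> Arr C \<and> Dom C (Comp C g f) = Dom C f \<and> Cod C (Comp C g f) = Cod C g) \<and>
     (\<forall>g f. \<not> composable C g f \<longrightarrow> Comp C g f = undefined) \<and>
     (\<forall>f\<in>Arr C. Comp C f (Ide C (Dom C f)) = f \<and> Comp C (Ide C (Cod C f)) f = f) \<and>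
     (\<forall>h g f. composable C h g \<longrightarrow> composable C g f \<longrightarrow>
        Comp C h (Comp C g f) = Comp C (Comp C h g) f)"

record ('o, 'a, 'p, 'b) funct =
  FObj :: "'o \<Rightarrow> 'p"
  FArr :: "'a \<Rightarrow> 'b"

definition Fun :: "('o, 'a) cat \<Rightarrow> ('p, 'b) cat \<Rightarrow> ('o, 'a, 'p, 'b) funct set" where
  "Fun C D = {F.
     FObj F \<in> Obj C \<rightarrow>\<^sub>E Obj D \<and>
     FArr F \<in> Arr C \<rightarrow>\<^sub>E Arr D \<and>
     (\<forall>f\<in>Arr C. Dom D (FArr F f) = FObj F (Dom C f) \<and> Cod D (FArr F f) = FObj F (Cod C f)) \<and>
     (\<forall>x\<in>Obj C. FArr F (Ide C x) = Ide D (FObj F x)) \<and>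
     (\<forall>g f. composable C g f \<longrightarrow> FArr F (Comp C g f) = Comp D (FArr F g) (FArr F f))}"

definition id_fun :: "('o, 'a) cat \<Rightarrow> ('o, 'a, 'o, 'a) funct" where
  "id_fun C = \<lparr>FObj = (\<lambda>x\<in>Obj C. x), FArr = (\<lambda>f\<in>Arr C. f)\<rparr>"

text \<open>\<open>comp_fun C G F\<close> is the composite of \<open>F\<close> followed by \<open>G\<close>, where \<open>C\<close> is the source of \<open>F\<close>.\<close>

definition comp_fun ::
  "('o, 'a) cat \<Rightarrow> ('p, 'b, 'q, 'c) funct \<Rightarrow> ('o, 'a, 'p, 'b) funct \<Rightarrow> ('o, 'a, 'q, 'c) funct" where
  "comp_fun C G F =
     \<lparr>FObj = compose (Obj C) (FObj G) (FObj F), FArr = compose (Arr C) (FArr G) (FArr F)\<rparr>"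

record ('o, 'a, 'p, 'b) nattr =
  NSrc :: "('o, 'a, 'p, 'b) funct"
  NTgt :: "('o, 'a, 'p, 'b) funct"
  NComp :: "'o \<Rightarrow> 'b"

definition Nat_trans :: "('o, 'a) cat \<Rightarrow> ('p, 'b) cat \<Rightarrow> ('o, 'a, 'p, 'b) nattr set" where
  "Nat_trans C D = {\<alpha>.
     NSrc \<alpha> \<in> Fun C D \<and> NTgt \<alpha> \<in> Fun C D \<and>
     NComp \<alpha> \<in> Obj C \<rightarrow>\<^sub>E Arr D \<and>
     (\<forall>x\<in>Obj C. Dom D (NComp \<alpha> x) = FObj (NSrc \<alpha>) x \<and> Cod D (NComp \<alpha> x) = FObj (NTgt \<alpha>) x) \<and>
     (\<forall>f\<in>Arr C. Comp D (NComp \<alpha> (Cod C f)) (FArr (NSrc \<alpha>) f) =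
                 Comp D (FArr (NTgt \<alpha>) f) (NComp \<alpha> (Dom C f)))}"

text \<open>The functor category: \<open>fun_cat C D\<close> is $D^C$.\<close>

definition fun_cat ::
  "('o, 'a) cat \<Rightarrow> ('p, 'b) cat \<Rightarrow> (('o, 'a, 'p, 'b) funct, ('o, 'a, 'p, 'b) nattr) cat" where
  "fun_cat C D =
     \<lparr>Obj = Fun C D,
      Arr = Nat_trans C D,
      Dom = (\<lambda>\<alpha>\<in>Nat_trans C D. NSrc \<alpha>),
      Cod = (\<lambda>\<alpha>\<in>Nat_trans C D. NTgt \<alpha>),
      Ide = (\<lambda>F\<in>Fun C D. \<lparr>NSrc = F, NTgt = F, NComp = (\<lambda>x\<in>Obj C. Ide D (FObj F x))\<rparr>),
      Comp = (\<lambda>\<beta> \<alpha>. if \<beta> \<in> Nat_trans C D \<and> \<alpha> \<in> Nat_trans C D \<and> NSrc \<beta> = NTgt \<alpha>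
        then \<lparr>NSrc = NSrc \<alpha>, NTgt = NTgt \<beta>, NComp = (\<lambda>x\<in>Obj C. Comp D (NComp \<beta> x) (NComp \<alpha> x))\<rparr>
        else undefined)\<rparr>"

text \<open>
  For \<open>u\<close> from \<open>C'\<close> to \<open>C\<close> and \<open>v\<close> from \<open>D\<close> to \<open>D'\<close>, the induced functor
  from $D^C$ to $D'^{C'}$, which sends \<open>F\<close> to \<open>v F u\<close>.
\<close>

definition fun_cat_map ::
  "('o1, 'a1) cat \<Rightarrow> ('o, 'a) cat \<Rightarrow> ('p, 'b) cat \<Rightarrow>
   ('o1, 'a1, 'o, 'a) funct \<Rightarrow> ('p, 'b, 'p1, 'b1) funct \<Rightarrow>
   (('o, 'a, 'p, 'b) funct, ('o, 'a, 'p, 'b) nattr,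
    ('o1, 'a1, 'p1, 'b1) funct, ('o1, 'a1, 'p1, 'b1) nattr) funct" where
  "fun_cat_map C' C D u v =
     (let H = (\<lambda>F. comp_fun C' v (comp_fun C' F u)) in
      \<lparr>FObj = (\<lambda>F\<in>Fun C D. H F),
       FArr = (\<lambda>\<alpha>\<in>Nat_trans C D.
         \<lparr>NSrc = H (NSrc \<alpha>), NTgt = H (NTgt \<alpha>), NComp = (\<lambda>x\<in>Obj C'. FArr v (NComp \<alpha> (FObj u x)))\<rparr>)\<rparr>)"

definition prod_cat :: "('o, 'a) cat \<Rightarrow> ('p, 'b) cat \<Rightarrow> ('o \<times> 'p, 'a \<times> 'b) cat" where
  "prod_cat C D =
     \<lparr>Obj = Obj C \<times> Obj D,
      Arr = Arr C \<times> Arr D,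
      Dom = (\<lambda>(f, g)\<in>Arr C \<times> Arr D. (Dom C f, Dom D g)),
      Cod = (\<lambda>(f, g)\<in>Arr C \<times> Arr D. (Cod C f, Cod D g)),
      Ide = (\<lambda>(x, y)\<in>Obj C \<times> Obj D. (Ide C x, Ide D y)),
      Comp = (\<lambda>g f. if composable C (fst g) (fst f) \<and> composable D (snd g) (snd f)
        then (Comp C (fst g) (fst f), Comp D (snd g) (snd f)) else undefined)\<rparr>"

definition fun_prod ::
  "('o, 'a) cat \<Rightarrow> ('p, 'b) cat \<Rightarrow> ('o, 'a, 'o1, 'a1) funct \<Rightarrow> ('p, 'b, 'p1, 'b1) funct \<Rightarrow>
   ('o \<times> 'p, 'a \<times> 'b, 'o1 \<times> 'p1, 'a1 \<times> 'b1) funct" where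
  "fun_prod C D u v =
     \<lparr>FObj = (\<lambda>(x, y)\<in>Obj C \<times> Obj D. (FObj u x, FObj v y)),
      FArr = (\<lambda>(f, g)\<in>Arr C \<times> Arr D. (FArr u f, FArr v g))\<rparr>"

definition iso_arrows :: "('o, 'a) cat \<Rightarrow> 'a set" where
  "iso_arrows C = {f \<in> Arr C. \<exists>g. composable C g f \<and> composable C f g \<and>
     Comp C g f = Ide C (Dom C f) \<and> Comp C f g = Ide C (Cod C f)}"

text \<open>The maximal subgroupoid $\mathrm{iso}\,C$, and the functor it induces from a functor \<open>F\<close> out of \<open>C\<close>.\<close>

definition iso_cat :: "('o, 'a) cat \<Rightarrow> ('o, 'a) cat" where
  "iso_cat C =
     \<lparr>Obj = Obj C,
      Arr = iso_arrows C,
      Dom = restrict (Dom C) (iso_arrows C),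
      Cod = restrict (Cod C) (iso_arrows C),
      Ide = Ide C,
      Comp = (\<lambda>g f. if g \<in> iso_arrows C \<and> f \<in> iso_arrows C then Comp C g f else undefined)\<rparr>"

definition iso_fun :: "('o, 'a) cat \<Rightarrow> ('o, 'a, 'p, 'b) funct \<Rightarrow> ('o, 'a, 'p, 'b) funct" where
  "iso_fun C F = \<lparr>FObj = FObj F, FArr = restrict (FArr F) (iso_arrows C)\<rparr>"

definition naturally_isomorphic ::
  "('o, 'a) cat \<Rightarrow> ('p, 'b) cat \<Rightarrow> ('o, 'a, 'p, 'b) funct \<Rightarrow> ('o, 'a, 'p, 'b) funct \<Rightarrow> bool" where
  "naturally_isomorphic C D F G \<longleftrightarrow>
     (\<exists>\<alpha>\<in>iso_arrows (fun_cat C D). Dom (fun_cat C D) \<alpha> = F \<and> Cod (fun_cat C D) \<alpha> = G)"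

definition equivalence_of_categories ::
  "('o, 'a) cat \<Rightarrow> ('p, 'b) cat \<Rightarrow> ('o, 'a, 'p, 'b) funct \<Rightarrow> bool" where
  "equivalence_of_categories C D F \<longleftrightarrow> F \<in> Fun C D \<and>
     (\<exists>G\<in>Fun D C. naturally_isomorphic C C (comp_fun C G F) (id_fun C) \<and>
                  naturally_isomorphic D D (comp_fun D F G) (id_fun D))"


section \<open>Simplicial sets and simplicial spaces\<close>

text \<open>The category $[n]$; the arrow from \<open>i\<close> to \<open>j\<close> is the pair \<open>(i, j)\<close>.\<close>

definition ordinal :: "nat \<Rightarrow> (nat, nat \<times> nat) cat" where
  "ordinal n =
     (let A = {(i, j). i \<le> j \<and> j \<le> n} in
      \<lparr>Obj = {..n},
       Arr = A,
       Dom = restrict fst A,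
       Cod = restrict snd A,
       Ide = (\<lambda>i\<in>{..n}. (i, i)),
       Comp = (\<lambda>g f. if g \<in> A \<and> f \<in> A \<and> fst g = snd f then (fst f, snd g) else undefined)\<rparr>)"

type_synonym delta = "(nat, nat \<times> nat, nat, nat \<times> nat) funct"

abbreviation Delta :: "nat \<Rightarrow> nat \<Rightarrow> delta set" where
  "Delta m n \<equiv> Fun (ordinal m) (ordinal n)"

text \<open>
  A functor from $\mathbf{\Delta}^{op}$ to sets: the set \<open>Sim X n\<close> of \<open>n\<close>-simplices is its value
  at $[n]$, and \<open>Act X m n \<theta>\<close>, from \<open>Sim X n\<close> to \<open>Sim X m\<close>, is its value at
  \<open>\<theta> \<in> Delta m n\<close>.
\<close>

record 'x sset =
  Sim :: "nat \<Rightarrow> 'x set"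
  Act :: "nat \<Rightarrow> nat \<Rightarrow> delta \<Rightarrow> 'x \<Rightarrow> 'x"

definition is_sset :: "'x sset \<Rightarrow> bool" where
  "is_sset X \<longleftrightarrow>
     (\<forall>m n. Act X m n \<in> Delta m n \<rightarrow>\<^sub>E (Sim X n \<rightarrow>\<^sub>E Sim X m)) \<and>
     (\<forall>n. Act X n n (id_fun (ordinal n)) = (\<lambda>x\<in>Sim X n. x)) \<and>
     (\<forall>l m n. \<forall>\<eta>\<in>Delta l m. \<forall>\<theta>\<in>Delta m n.
        Act X l n (comp_fun (ordinal l) \<theta> \<eta>) = compose (Sim X n) (Act X l m \<eta>) (Act X m n \<theta>))"

definition sset_hom :: "'x sset \<Rightarrow> 'y sset \<Rightarrow> (nat \<Rightarrow> 'x \<Rightarrow> 'y) set" where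
  "sset_hom X Y = {f.
     (\<forall>n. f n \<in> Sim X n \<rightarrow>\<^sub>E Sim Y n) \<and>
     (\<forall>m n. \<forall>\<theta>\<in>Delta m n. \<forall>x\<in>Sim X n. f m (Act X m n \<theta> x) = Act Y m n \<theta> (f n x))}"

definition sset_id :: "'x sset \<Rightarrow> nat \<Rightarrow> 'x \<Rightarrow> 'x" where
  "sset_id X = (\<lambda>n. \<lambda>x\<in>Sim X n. x)"

definition sset_comp :: "'x sset \<Rightarrow> (nat \<Rightarrow> 'y \<Rightarrow> 'z) \<Rightarrow> (nat \<Rightarrow> 'x \<Rightarrow> 'y) \<Rightarrow> nat \<Rightarrow> 'x \<Rightarrow> 'z" where
  "sset_comp X g f = (\<lambda>n. compose (Sim X n) (g n) (f n))"

text \<open>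
  A functor from $\mathbf{\Delta}^{op}$ to simplicial sets: the space \<open>Lev X m\<close> is its value at
  $[m]$, and \<open>SAct X m n \<theta>\<close>, from \<open>Lev X n\<close> to \<open>Lev X m\<close>, is its value at
  \<open>\<theta> \<in> Delta m n\<close>.
\<close>

record 'x sspace =
  Lev :: "nat \<Rightarrow> 'x sset"
  SAct :: "nat \<Rightarrow> nat \<Rightarrow> delta \<Rightarrow> nat \<Rightarrow> 'x \<Rightarrow> 'x"

definition is_sspace :: "'x sspace \<Rightarrow> bool" where
  "is_sspace X \<longleftrightarrow>
     (\<forall>m. is_sset (Lev X m)) \<and>
     (\<forall>m n. SAct X m n \<in> Delta m n \<rightarrow>\<^sub>E sset_hom (Lev X n) (Lev X m)) \<and>
     (\<forall>n. SAct X n n (id_fun (ordinal n)) = sset_id (Lev X n)) \<and>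
     (\<forall>l m n. \<forall>\<eta>\<in>Delta l m. \<forall>\<theta>\<in>Delta m n.
        SAct X l n (comp_fun (ordinal l) \<theta> \<eta>) = sset_comp (Lev X n) (SAct X l m \<eta>) (SAct X m n \<theta>))"

definition sspace_hom :: "'x sspace \<Rightarrow> 'y sspace \<Rightarrow> (nat \<Rightarrow> nat \<Rightarrow> 'x \<Rightarrow> 'y) set" where
  "sspace_hom X Y = {f.
     (\<forall>m. f m \<in> sset_hom (Lev X m) (Lev Y m)) \<and>
     (\<forall>m n. \<forall>\<theta>\<in>Delta m n.
        sset_comp (Lev X n) (f m) (SAct X m n \<theta>) = sset_comp (Lev X n) (SAct Y m n \<theta>) (f n))}"

definition sspace_id :: "'x sspace \<Rightarrow> nat \<Rightarrow> nat \<Rightarrow> 'x \<Rightarrow> 'x" where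
  "sspace_id X = (\<lambda>m. sset_id (Lev X m))"

definition sspace_comp ::
  "'x sspace \<Rightarrow> (nat \<Rightarrow> nat \<Rightarrow> 'y \<Rightarrow> 'z) \<Rightarrow> (nat \<Rightarrow> nat \<Rightarrow> 'x \<Rightarrow> 'y) \<Rightarrow> nat \<Rightarrow> nat \<Rightarrow> 'x \<Rightarrow> 'z" where
  "sspace_comp X g f = (\<lambda>m. sset_comp (Lev X m) (g m) (f m))"

definition sspace_iso :: "'x sspace \<Rightarrow> 'y sspace \<Rightarrow> (nat \<Rightarrow> nat \<Rightarrow> 'x \<Rightarrow> 'y) \<Rightarrow> bool" where
  "sspace_iso X Y f \<longleftrightarrow> is_sspace X \<and> is_sspace Y \<and> f \<in> sspace_hom X Y \<and>
     (\<exists>g\<in>sspace_hom Y X. sspace_comp X g f = sspace_id X \<and> sspace_comp Y f g = sspace_id Y)"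


section \<open>Products, mapping spaces and internal homs of simplicial spaces\<close>

definition prod_sset :: "'x sset \<Rightarrow> 'y sset \<Rightarrow> ('x \<times> 'y) sset" where
  "prod_sset X Y =
     \<lparr>Sim = (\<lambda>n. Sim X n \<times> Sim Y n),
      Act = (\<lambda>m n. \<lambda>\<theta>\<in>Delta m n. \<lambda>(x, y)\<in>Sim X n \<times> Sim Y n. (Act X m n \<theta> x, Act Y m n \<theta> y))\<rparr>"

definition prod_sset_map ::
  "'x sset \<Rightarrow> 'y sset \<Rightarrow> (nat \<Rightarrow> 'x \<Rightarrow> 'x1) \<Rightarrow> (nat \<Rightarrow> 'y \<Rightarrow> 'y1) \<Rightarrow> nat \<Rightarrow> 'x \<times> 'y \<Rightarrow> 'x1 \<times> 'y1" where
  "prod_sset_map X Y f g = (\<lambda>n. \<lambda>(x, y)\<in>Sim X n \<times> Sim Y n. (f n x, g n y))"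

definition prod_sspace :: "'x sspace \<Rightarrow> 'y sspace \<Rightarrow> ('x \<times> 'y) sspace" where
  "prod_sspace X Y =
     \<lparr>Lev = (\<lambda>m. prod_sset (Lev X m) (Lev Y m)),
      SAct = (\<lambda>m n. \<lambda>\<theta>\<in>Delta m n. prod_sset_map (Lev X n) (Lev Y n) (SAct X m n \<theta>) (SAct Y m n \<theta>))\<rparr>"

definition prod_sspace_map ::
  "'x sspace \<Rightarrow> 'y sspace \<Rightarrow> (nat \<Rightarrow> nat \<Rightarrow> 'x \<Rightarrow> 'x1) \<Rightarrow> (nat \<Rightarrow> nat \<Rightarrow> 'y \<Rightarrow> 'y1) \<Rightarrow>
   nat \<Rightarrow> nat \<Rightarrow> 'x \<times> 'y \<Rightarrow> 'x1 \<times> 'y1" where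
  "prod_sspace_map X Y f g = (\<lambda>m. prod_sset_map (Lev X m) (Lev Y m) (f m) (g m))"

text \<open>
  The standard simplex $\Delta[n]$ as a constant simplicial space, and the map
  from $\Delta[m]$ to $\Delta[n]$ induced by \<open>\<theta> \<in> Delta m n\<close>.
\<close>

definition std_simplex :: "nat \<Rightarrow> delta sset" where
  "std_simplex n =
     \<lparr>Sim = (\<lambda>k. Delta k n),
      Act = (\<lambda>j k. \<lambda>\<eta>\<in>Delta j k. \<lambda>\<sigma>\<in>Delta k n. comp_fun (ordinal j) \<sigma> \<eta>)\<rparr>"

definition const_sspace :: "'x sset \<Rightarrow> 'x sspace" where
  "const_sspace K = \<lparr>Lev = (\<lambda>m. K), SAct = (\<lambda>m n. \<lambda>\<theta>\<in>Delta m n. sset_id K)\<rparr>"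

abbreviation simplex_sspace :: "nat \<Rightarrow> delta sspace" where
  "simplex_sspace n \<equiv> const_sspace (std_simplex n)"

definition simplex_sspace_map :: "nat \<Rightarrow> delta \<Rightarrow> nat \<Rightarrow> nat \<Rightarrow> delta \<Rightarrow> delta" where
  "simplex_sspace_map m \<theta> = (\<lambda>_ k. \<lambda>\<sigma>\<in>Delta k m. comp_fun (ordinal k) \<theta> \<sigma>)"

definition discrete_sset :: "'x set \<Rightarrow> 'x sset" where
  "discrete_sset S = \<lparr>Sim = (\<lambda>n. S), Act = (\<lambda>m n. \<lambda>\<theta>\<in>Delta m n. \<lambda>x\<in>S. x)\<rparr>"

text \<open>The simplicial space $F(k)$, and the map from $F(j)$ to $F(k)$ induced by \<open>\<theta> \<in> Delta j k\<close>.\<close>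

definition F_sspace :: "nat \<Rightarrow> delta sspace" where
  "F_sspace k =
     \<lparr>Lev = (\<lambda>n. discrete_sset (Delta n k)),
      SAct = (\<lambda>m n. \<lambda>\<eta>\<in>Delta m n. \<lambda>_. \<lambda>\<sigma>\<in>Delta n k. comp_fun (ordinal m) \<sigma> \<eta>)\<rparr>"

definition F_sspace_map :: "nat \<Rightarrow> delta \<Rightarrow> nat \<Rightarrow> nat \<Rightarrow> delta \<Rightarrow> delta" where
  "F_sspace_map j \<theta> = (\<lambda>n _. \<lambda>\<sigma>\<in>Delta n j. comp_fun (ordinal n) \<theta> \<sigma>)"

definition Map :: "'x sspace \<Rightarrow> 'y sspace \<Rightarrow> (nat \<Rightarrow> nat \<Rightarrow> 'x \<times> delta \<Rightarrow> 'y) sset" where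
  "Map X Y =
     \<lparr>Sim = (\<lambda>n. sspace_hom (prod_sspace X (simplex_sspace n)) Y),
      Act = (\<lambda>m n. \<lambda>\<theta>\<in>Delta m n. \<lambda>h\<in>sspace_hom (prod_sspace X (simplex_sspace n)) Y.
        sspace_comp (prod_sspace X (simplex_sspace m)) h
          (prod_sspace_map X (simplex_sspace m) (sspace_id X) (simplex_sspace_map m \<theta>)))\<rparr>"

text \<open>
  For \<open>a\<close> from \<open>X'\<close> to \<open>X\<close> and \<open>b\<close> from \<open>Y\<close> to \<open>Y'\<close>, the induced map
  from \<open>Map X Y\<close> to \<open>Map X' Y'\<close>.
\<close>

definition Map_map ::
  "'x1 sspace \<Rightarrow> 'x sspace \<Rightarrow> 'y sspace \<Rightarrow>
   (nat \<Rightarrow> nat \<Rightarrow> 'x1 \<Rightarrow> 'x) \<Rightarrow> (nat \<Rightarrow> nat \<Rightarrow> 'y \<Rightarrow> 'y1) \<Rightarrow>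
   nat \<Rightarrow> (nat \<Rightarrow> nat \<Rightarrow> 'x \<times> delta \<Rightarrow> 'y) \<Rightarrow> (nat \<Rightarrow> nat \<Rightarrow> 'x1 \<times> delta \<Rightarrow> 'y1)" where
  "Map_map X' X Y a b = (\<lambda>n. \<lambda>h\<in>Sim (Map X Y) n.
     (let P = prod_sspace X' (simplex_sspace n) in
      sspace_comp P b (sspace_comp P h
        (prod_sspace_map X' (simplex_sspace n) a (sspace_id (simplex_sspace n))))))"

text \<open>The internal hom: \<open>sspace_exp X Y\<close> is $Y^X$.\<close>

definition sspace_exp ::
  "'x sspace \<Rightarrow> 'y sspace \<Rightarrow> (nat \<Rightarrow> nat \<Rightarrow> ('x \<times> delta) \<times> delta \<Rightarrow> 'y) sspace" where
  "sspace_exp X Y =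
     \<lparr>Lev = (\<lambda>k. Map (prod_sspace X (F_sspace k)) Y),
      SAct = (\<lambda>j k. \<lambda>\<theta>\<in>Delta j k.
        Map_map (prod_sspace X (F_sspace j)) (prod_sspace X (F_sspace k)) Y
          (prod_sspace_map X (F_sspace j) (sspace_id X) (F_sspace_map j \<theta>)) (sspace_id Y))\<rparr>"

definition sspace_exp_map ::
  "'x1 sspace \<Rightarrow> 'x sspace \<Rightarrow> 'y sspace \<Rightarrow>
   (nat \<Rightarrow> nat \<Rightarrow> 'x1 \<Rightarrow> 'x) \<Rightarrow> (nat \<Rightarrow> nat \<Rightarrow> 'y \<Rightarrow> 'y1) \<Rightarrow>
   nat \<Rightarrow> nat \<Rightarrow> (nat \<Rightarrow> nat \<Rightarrow> ('x \<times> delta) \<times> delta \<Rightarrow> 'y) \<Rightarrow>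
   (nat \<Rightarrow> nat \<Rightarrow> ('x1 \<times> delta) \<times> delta \<Rightarrow> 'y1)" where
  "sspace_exp_map X' X Y a b = (\<lambda>k.
     Map_map (prod_sspace X' (F_sspace k)) (prod_sspace X (F_sspace k)) Y
       (prod_sspace_map X' (F_sspace k) a (sspace_id (F_sspace k))) b)"


section \<open>The classifying diagram\<close>

definition nerve :: "('o, 'a) cat \<Rightarrow> (nat, nat \<times> nat, 'o, 'a) funct sset" where
  "nerve C =
     \<lparr>Sim = (\<lambda>n. Fun (ordinal n) C),
      Act = (\<lambda>m n. \<lambda>\<theta>\<in>Delta m n. \<lambda>\<sigma>\<in>Fun (ordinal n) C. comp_fun (ordinal m) \<sigma> \<theta>)\<rparr>"

definition nerve_map ::
  "('o, 'a) cat \<Rightarrow> ('o, 'a, 'p, 'b) funct \<Rightarrow>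
   nat \<Rightarrow> (nat, nat \<times> nat, 'o, 'a) funct \<Rightarrow> (nat, nat \<times> nat, 'p, 'b) funct" where
  "nerve_map C F = (\<lambda>n. \<lambda>\<sigma>\<in>Fun (ordinal n) C. comp_fun (ordinal n) F \<sigma>)"

type_synonym ('o, 'a) csimp =
  "(nat, nat \<times> nat, (nat, nat \<times> nat, 'o, 'a) funct, (nat, nat \<times> nat, 'o, 'a) nattr) funct"

text \<open>The simplicial space $NC$, and the map \<open>Nf\<close> induced by a functor \<open>f\<close> out of \<open>C\<close>.\<close>

definition classifying_diagram :: "('o, 'a) cat \<Rightarrow> ('o, 'a) csimp sspace" where
  "classifying_diagram C =
     \<lparr>Lev = (\<lambda>m. nerve (iso_cat (fun_cat (ordinal m) C))),
      SAct = (\<lambda>m n. \<lambda>\<theta>\<in>Delta m n.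
        nerve_map (iso_cat (fun_cat (ordinal n) C))
          (iso_fun (fun_cat (ordinal n) C)
            (fun_cat_map (ordinal m) (ordinal n) C \<theta> (id_fun C))))\<rparr>"

definition classifying_map ::
  "('o, 'a) cat \<Rightarrow> ('o, 'a, 'p, 'b) funct \<Rightarrow> nat \<Rightarrow> nat \<Rightarrow> ('o, 'a) csimp \<Rightarrow> ('p, 'b) csimp" where
  "classifying_map C f = (\<lambda>m.
     nerve_map (iso_cat (fun_cat (ordinal m) C))
       (iso_fun (fun_cat (ordinal m) C)
         (fun_cat_map (ordinal m) (ordinal m) C (id_fun (ordinal m)) f)))"


section \<open>Geometric realization and weak equivalences\<close>

definition quotient_topology :: "'p topology \<Rightarrow> ('p \<Rightarrow> 'q) \<Rightarrow> 'q topology" where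
  "quotient_topology T q =
     topology (\<lambda>U. U \<subseteq> q ` topspace T \<and> openin T {p \<in> topspace T. q p \<in> U})"

lemma openin_quotient_topology:
  "openin (quotient_topology T q) U \<longleftrightarrow>
     U \<subseteq> q ` topspace T \<and> openin T {p \<in> topspace T. q p \<in> U}"
proof -
  have "istopology (\<lambda>U. U \<subseteq> q ` topspace T \<and> openin T {p \<in> topspace T. q p \<in> U})"
    (is "istopology ?L")
    unfolding istopology_def
  proof (intro conjI allI impI)
    fix U V assume "?L U" "?L V"
    moreover have "{p \<in> topspace T. q p \<in> U \<inter> V} =
        {p \<in> topspace T. q p \<in> U} \<inter> {p \<in> topspace T. q p \<in> V}" by auto
    ultimately show "U \<inter> V \<subseteq> q ` topspace T" "openin T {p \<in> topspace T. q p \<in> U \<inter> V}"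
      by auto
  next
    fix K assume K: "\<forall>U\<in>K. ?L U"
    moreover have "{p \<in> topspace T. q p \<in> \<Union>K} = (\<Union>U\<in>K. {p \<in> topspace T. q p \<in> U})" by auto
    ultimately show "\<Union>K \<subseteq> q ` topspace T" "openin T {p \<in> topspace T. q p \<in> \<Union>K}"
      by auto
  qed
  then show ?thesis
    by (simp add: quotient_topology_def)
qed

text \<open>The disjoint union, over all simplices \<open>(n, x)\<close>, of the topological \<open>n\<close>-simplex.\<close>

definition pre_realization :: "'x sset \<Rightarrow> ((nat \<times> 'x) \<times> (nat \<Rightarrow> real)) topology" where
  "pre_realization X =
     sum_topology (\<lambda>(n, x). subtopology (powertop_real UNIV) (standard_simplex n))
       {(n, x). x \<in> Sim X n}"

text \<open>The affine map of topological simplices that is given on vertices by \<open>\<theta> \<in> Delta m n\<close>.\<close>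

definition simplex_push :: "nat \<Rightarrow> delta \<Rightarrow> (nat \<Rightarrow> real) \<Rightarrow> nat \<Rightarrow> real" where
  "simplex_push m \<theta> t = (\<lambda>j. \<Sum>i | i \<le> m \<and> FObj \<theta> i = j. t i)"

definition gluing ::
  "'x sset \<Rightarrow> (((nat \<times> 'x) \<times> (nat \<Rightarrow> real)) \<times> ((nat \<times> 'x) \<times> (nat \<Rightarrow> real))) set" where
  "gluing X = {(((m, Act X m n \<theta> x), t), ((n, x), simplex_push m \<theta> t)) | m n \<theta> x t.
     \<theta> \<in> Delta m n \<and> x \<in> Sim X n \<and> t \<in> standard_simplex m}"

definition realization_rel ::
  "'x sset \<Rightarrow> (((nat \<times> 'x) \<times> (nat \<Rightarrow> real)) \<times> ((nat \<times> 'x) \<times> (nat \<Rightarrow> real))) set" where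
  "realization_rel X = (gluing X \<union> (gluing X)\<inverse>)\<^sup>*"

text \<open>Points of the geometric realization are equivalence classes of points of the disjoint union.\<close>

definition realization :: "'x sset \<Rightarrow> ((nat \<times> 'x) \<times> (nat \<Rightarrow> real)) set topology" where
  "realization X = quotient_topology (pre_realization X) (\<lambda>p. realization_rel X `` {p})"

definition realization_map ::
  "'y sset \<Rightarrow> (nat \<Rightarrow> 'x \<Rightarrow> 'y) \<Rightarrow>
   ((nat \<times> 'x) \<times> (nat \<Rightarrow> real)) set \<Rightarrow> ((nat \<times> 'y) \<times> (nat \<Rightarrow> real)) set" where
  "realization_map Y f c = realization_rel Y `` ((\<lambda>((n, x), t). ((n, f n x), t)) ` c)"

definition homotopy_equivalence_map :: "'p topology \<Rightarrow> 'q topology \<Rightarrow> ('p \<Rightarrow> 'q) \<Rightarrow> bool" where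
  "homotopy_equivalence_map S T f \<longleftrightarrow> continuous_map S T f \<and>
     (\<exists>g. continuous_map T S g \<and>
          homotopic_with (\<lambda>_. True) S S (g \<circ> f) id \<and>
          homotopic_with (\<lambda>_. True) T T (f \<circ> g) id)"

text \<open>
  Quillen's definition: a weak equivalence of simplicial sets is a map whose geometric realization
  is a homotopy equivalence. (Realizations are CW complexes, so weak homotopy equivalences
  between them are the same thing.)
\<close>

definition weak_equivalence :: "'x sset \<Rightarrow> 'y sset \<Rightarrow> (nat \<Rightarrow> 'x \<Rightarrow> 'y) \<Rightarrow> bool" where
  "weak_equivalence X Y f \<longleftrightarrow> f \<in> sset_hom X Y \<and>
     homotopy_equivalence_map (realization X) (realization Y) (realization_map Y f)"

definition levelwise_weak_equivalence ::
  "'x sspace \<Rightarrow> 'y sspace \<Rightarrow> (nat \<Rightarrow> nat \<Rightarrow> 'x \<Rightarrow> 'y) \<Rightarrow> bool" where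
  "levelwise_weak_equivalence X Y f \<longleftrightarrow> f \<in> sspace_hom X Y \<and>
     (\<forall>m. weak_equivalence (Lev X m) (Lev Y m) (f m))"

end

theory Submission
  imports Defs "HOL-Analysis.Analysis"
begin

text \<open>
  An \<open>n\<close>-simplex of $NC_m$ is the same as a functor $[m]\times[n]\to C$ that inverts all arrows of $[n]$,
  so products, natural transformations and functors can be read off from such grids. For the exponential law,
  a map out of $NC\times F(k)\times\Delta[n]$ is determined by its values on simplices of shape $(1,1)$; such a
  value depends only on the diagonal of the square, and these values assemble to a functor from
  $C\times[k]\times[n]$. The case $k=n=0$ is full faithfulness.

  A natural isomorphism between two functors joins their images of a simplex to a simplex of twice the size, and
  moving barycentric coordinates from one half to the other is a homotopy between the realized maps.
  Conversely, a path in the realization of a nerve of a groupoid has a holonomy, an arrow of the groupoid that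
  is invariant under homotopy, so a homotopy equivalence of realizations is fully faithful and essentially
  surjective on groupoids. In level 0 this gives essential surjectivity and bijectivity of \<open>f\<close> on
  isomorphisms, and in level 1 full faithfulness.
\<close>

section \<open>Categories and functors\<close>

text \<open>Three obstacles shape the proof. In a simplex of NC only one grid direction is
  invertible, so an arbitrary arrow of C is visible only through the square that is constant in the
  invertible direction; a general square must be compared with such a constant one before a map of
  diagrams can be read as a functor. Secondly, joining two images of a simplex needs an arrow from
  the last vertex of the first copy to the first vertex of the second; it exists because every level
  of NC is the nerve of a groupoid. Thirdly, a homotopy inverse of a realized map is merely
  continuous and has no simplicial description. It acts on paths, though, and holonomy turns paths
  back into arrows. A point of the realization has many representatives, so it is replaced by a step
  function with transition arrows, which is invariant under all gluings; continuity becomes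
  agreement off sets of small measure. The constants 1/2, 1/4 and 1/8 keep the total measure of the
  exceptional sets that meet in one argument below 1: then they leave a common point of [0, 1), and
  the comparison of vertices made there is independent of choices.\<close>

lemma category_simps [simp]:
  assumes "category C"
  shows Dom_in: "f \<in> Arr C \<Longrightarrow> Dom C f \<in> Obj C"
    and Cod_in: "f \<in> Arr C \<Longrightarrow> Cod C f \<in> Obj C"
    and Ide_in: "x \<in> Obj C \<Longrightarrow> Ide C x \<in> Arr C"
    and Dom_Ide: "x \<in> Obj C \<Longrightarrow> Dom C (Ide C x) = x"
    and Cod_Ide: "x \<in> Obj C \<Longrightarrow> Cod C (Ide C x) = x"
    and Comp_in: "g \<in> Arr C \<Longrightarrow> f \<in> Arr C \<Longrightarrow> Dom C g = Cod C f \<Longrightarrow> Comp C g f \<in> Arr C"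
    and Dom_Comp: "g \<in> Arr C \<Longrightarrow> f \<in> Arr C \<Longrightarrow> Dom C g = Cod C f \<Longrightarrow> Dom C (Comp C g f) = Dom C f"
    and Cod_Comp: "g \<in> Arr C \<Longrightarrow> f \<in> Arr C \<Longrightarrow> Dom C g = Cod C f \<Longrightarrow> Cod C (Comp C g f) = Cod C g"
    and Comp_Ide: "f \<in> Arr C \<Longrightarrow> x = Dom C f \<Longrightarrow> Comp C f (Ide C x) = f"
    and Ide_Comp: "f \<in> Arr C \<Longrightarrow> x = Cod C f \<Longrightarrow> Comp C (Ide C x) f = f"
  using assms unfolding category_def composable_def by (auto simp: PiE_iff)

lemma Comp_assoc:
  assumes "category C" "h \<in> Arr C" "g \<in> Arr C" "f \<in> Arr C" "Dom C h = Cod C g" "Dom C g = Cod C f"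
  shows "Comp C (Comp C h g) f = Comp C h (Comp C g f)"
  using assms unfolding category_def composable_def by metis

lemma Dom_undef: "category C \<Longrightarrow> f \<notin> Arr C \<Longrightarrow> Dom C f = undefined"
  and Cod_undef: "category C \<Longrightarrow> f \<notin> Arr C \<Longrightarrow> Cod C f = undefined"
  and Ide_undef: "category C \<Longrightarrow> x \<notin> Obj C \<Longrightarrow> Ide C x = undefined"
  and Comp_undef: "category C \<Longrightarrow> \<not> composable C g f \<Longrightarrow> Comp C g f = undefined"
  unfolding category_def by (auto simp: PiE_iff extensional_def)

lemma categoryI:
  assumes "\<And>f. f \<in> Arr C \<Longrightarrow> Dom C f \<in> Obj C" "\<And>f. f \<notin> Arr C \<Longrightarrow> Dom C f = undefined"
    and "\<And>f. f \<in> Arr C \<Longrightarrow> Cod C f \<in> Obj C" "\<And>f. f \<notin> Arr C \<Longrightarrow> Cod C f = undefined"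
    and "\<And>x. x \<in> Obj C \<Longrightarrow> Ide C x \<in> Arr C" "\<And>x. x \<notin> Obj C \<Longrightarrow> Ide C x = undefined"
    and "\<And>x. x \<in> Obj C \<Longrightarrow> Dom C (Ide C x) = x" "\<And>x. x \<in> Obj C \<Longrightarrow> Cod C (Ide C x) = x"
    and "\<And>g f. g \<in> Arr C \<Longrightarrow> f \<in> Arr C \<Longrightarrow> Dom C g = Cod C f \<Longrightarrow>
      Comp C g f \<in> Arr C \<and> Dom C (Comp C g f) = Dom C f \<and> Cod C (Comp C g f) = Cod C g"
    and "\<And>g f. \<not> composable C g f \<Longrightarrow> Comp C g f = undefined"
    and "\<And>f. f \<in> Arr C \<Longrightarrow> Comp C f (Ide C (Dom C f)) = f"
    and "\<And>f. f \<in> Arr C \<Longrightarrow> Comp C (Ide C (Cod C f)) f = f"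
    and "\<And>h g f. h \<in> Arr C \<Longrightarrow> g \<in> Arr C \<Longrightarrow> f \<in> Arr C \<Longrightarrow> Dom C h = Cod C g \<Longrightarrow> Dom C g = Cod C f \<Longrightarrow>
      Comp C h (Comp C g f) = Comp C (Comp C h g) f"
  shows "category C"
  unfolding category_def using assms by (auto simp: PiE_iff extensional_def composable_def)

lemma FunI:
  assumes "\<And>x. x \<in> Obj C \<Longrightarrow> FObj F x \<in> Obj D" "\<And>x. x \<notin> Obj C \<Longrightarrow> FObj F x = undefined"
    and "\<And>f. f \<in> Arr C \<Longrightarrow> FArr F f \<in> Arr D" "\<And>f. f \<notin> Arr C \<Longrightarrow> FArr F f = undefined"
    and "\<And>f. f \<in> Arr C \<Longrightarrow> Dom D (FArr F f) = FObj F (Dom C f)"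
    and "\<And>f. f \<in> Arr C \<Longrightarrow> Cod D (FArr F f) = FObj F (Cod C f)"
    and "\<And>x. x \<in> Obj C \<Longrightarrow> FArr F (Ide C x) = Ide D (FObj F x)"
    and "\<And>g f. g \<in> Arr C \<Longrightarrow> f \<in> Arr C \<Longrightarrow> Dom C g = Cod C f \<Longrightarrow>
      FArr F (Comp C g f) = Comp D (FArr F g) (FArr F f)"
  shows "F \<in> Fun C D"
  unfolding Fun_def using assms by (auto simp: PiE_iff extensional_def composable_def)

lemma Fun_simps:
  assumes "F \<in> Fun C D"
  shows "x \<in> Obj C \<Longrightarrow> FObj F x \<in> Obj D"
    and "f \<in> Arr C \<Longrightarrow> FArr F f \<in> Arr D"
    and "f \<in> Arr C \<Longrightarrow> Dom D (FArr F f) = FObj F (Dom C f)"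
    and "f \<in> Arr C \<Longrightarrow> Cod D (FArr F f) = FObj F (Cod C f)"
    and "x \<in> Obj C \<Longrightarrow> FArr F (Ide C x) = Ide D (FObj F x)"
  using assms by (auto simp: Fun_def PiE_iff)

lemma Fun_Comp:
  assumes "F \<in> Fun C D"
  shows "g \<in> Arr C \<Longrightarrow> f \<in> Arr C \<Longrightarrow> Dom C g = Cod C f \<Longrightarrow>
      FArr F (Comp C g f) = Comp D (FArr F g) (FArr F f)"
  using assms by (auto simp: Fun_def PiE_iff composable_def)

lemma Fun_undef:
  assumes "F \<in> Fun C D"
  shows "x \<notin> Obj C \<Longrightarrow> FObj F x = undefined" "f \<notin> Arr C \<Longrightarrow> FArr F f = undefined"
  using assms by (auto simp: Fun_def PiE_iff extensional_def)

lemma Fun_ext: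
  fixes F G :: "('o, 'a, 'p, 'b) funct"
  assumes "F \<in> Fun C D" "G \<in> Fun C D" "\<And>x. x \<in> Obj C \<Longrightarrow> FObj F x = FObj G x"
    "\<And>f. f \<in> Arr C \<Longrightarrow> FArr F f = FArr G f"
  shows "F = G"
proof (rule funct.equality)
  show "FObj F = FObj G"
    using assms Fun_undef(1)[OF assms(1)] Fun_undef(1)[OF assms(2)] by (metis ext)
  show "FArr F = FArr G"
    using assms Fun_undef(2)[OF assms(1)] Fun_undef(2)[OF assms(2)] by (metis ext)
qed simp

text \<open>Objects are the sources of their identities, so the action on arrows already determines
  a functor. Most equalities of functors below are proved this way.\<close>

lemma Fun_ext_Arr:
  fixes F G :: "('o, 'a, 'p, 'b) funct"
  assumes "category C" "category D" "F \<in> Fun C D" "G \<in> Fun C D"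
    and "\<And>f. f \<in> Arr C \<Longrightarrow> FArr F f = FArr G f"
  shows "F = G"
  using assms(3,4)
proof (rule Fun_ext)
  fix x assume x: "x \<in> Obj C"
  have "FObj F x = Dom D (FArr F (Ide C x))" "FObj G x = Dom D (FArr G (Ide C x))"
    using x assms(1-4) by (simp_all add: Fun_simps)
  then show "FObj F x = FObj G x"
    using assms(1,5) x by simp
qed (use assms in auto)

lemma FObj_comp_fun [simp]: "x \<in> Obj C \<Longrightarrow> FObj (comp_fun C G F) x = FObj G (FObj F x)"
  and FArr_comp_fun [simp]: "f \<in> Arr C \<Longrightarrow> FArr (comp_fun C G F) f = FArr G (FArr F f)"
  and FObj_id_fun [simp]: "x \<in> Obj C \<Longrightarrow> FObj (id_fun C) x = x"
  and FArr_id_fun [simp]: "f \<in> Arr C \<Longrightarrow> FArr (id_fun C) f = f"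
  by (auto simp: comp_fun_def id_fun_def compose_def)

lemma comp_fun_in:
  assumes "category C" "F \<in> Fun C D" "G \<in> Fun D E"
  shows "comp_fun C G F \<in> Fun C E"
  using assms
  by (intro FunI) (auto simp: Fun_simps Fun_Comp comp_fun_def compose_def)

lemma id_fun_in: "category C \<Longrightarrow> id_fun C \<in> Fun C C"
  by (intro FunI) (auto simp: id_fun_def)

text \<open>F carries C into D, where the restriction built into \<open>comp_fun D H G\<close> is
  invisible; hence the equality is literal.\<close>

lemma comp_fun_assoc:
  assumes "F \<in> Fun C D"
  shows "comp_fun C H (comp_fun C G F) = comp_fun C (comp_fun D H G) F"
  using assms by (auto simp: comp_fun_def compose_def fun_eq_iff Fun_simps)

lemma comp_fun_id:
  assumes "F \<in> Fun C D"
  shows "comp_fun C F (id_fun C) = F" "comp_fun C (id_fun D) F = F"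
  using assms Fun_undef[OF assms] Fun_simps[OF assms]
  by (auto intro!: funct.equality ext simp: comp_fun_def compose_def id_fun_def)

section \<open>Isomorphisms\<close>

text \<open>Meaningful for isomorphisms, where the choice is immaterial because inverses are unique
  (\<open>inverse_arr_unique\<close>).\<close>

definition inverse_arr :: "('o, 'a) cat \<Rightarrow> 'a \<Rightarrow> 'a" where
  "inverse_arr C f = (SOME g. composable C g f \<and> composable C f g \<and>
     Comp C g f = Ide C (Dom C f) \<and> Comp C f g = Ide C (Cod C f))"

lemma iso_arrowsI:
  assumes "f \<in> Arr C" "g \<in> Arr C" "Dom C g = Cod C f" "Dom C f = Cod C g"
    "Comp C g f = Ide C (Dom C f)" "Comp C f g = Ide C (Cod C f)"
  shows "f \<in> iso_arrows C"
  using assms unfolding iso_arrows_def composable_def by auto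

lemma iso_arrows_Arr [simp]: "f \<in> iso_arrows C \<Longrightarrow> f \<in> Arr C"
  by (simp add: iso_arrows_def)

lemma inverse_arr:
  assumes "f \<in> iso_arrows C"
  shows inverse_arr_Arr [simp]: "inverse_arr C f \<in> Arr C"
    and Dom_inverse_arr [simp]: "Dom C (inverse_arr C f) = Cod C f"
    and Cod_inverse_arr [simp]: "Cod C (inverse_arr C f) = Dom C f"
    and inverse_arr_Comp [simp]: "Comp C (inverse_arr C f) f = Ide C (Dom C f)"
    and Comp_inverse_arr [simp]: "Comp C f (inverse_arr C f) = Ide C (Cod C f)"
proof -
  have "\<exists>g. composable C g f \<and> composable C f g \<and>
     Comp C g f = Ide C (Dom C f) \<and> Comp C f g = Ide C (Cod C f)"
    using assms unfolding iso_arrows_def by blast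
  from someI_ex[OF this, folded inverse_arr_def]
  show "inverse_arr C f \<in> Arr C" "Dom C (inverse_arr C f) = Cod C f"
    "Cod C (inverse_arr C f) = Dom C f" "Comp C (inverse_arr C f) f = Ide C (Dom C f)"
    "Comp C f (inverse_arr C f) = Ide C (Cod C f)"
    unfolding composable_def by metis+
qed

lemma inverse_arr_iso [simp]: "f \<in> iso_arrows C \<Longrightarrow> inverse_arr C f \<in> iso_arrows C"
  by (rule iso_arrowsI[where g = f]) auto

text \<open>\<open>Comp_assoc\<close> nests composites to the right, so cancellation of f against
  its inverse is wanted in the form where a further factor g precedes them.\<close>

lemma left_cancel_iso:
  assumes C: "category C" and f: "f \<in> iso_arrows C" and g: "g \<in> Arr C" "Cod C g = Dom C f"
  shows "Comp C (inverse_arr C f) (Comp C f g) = g"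
  using assms by (simp flip: Comp_assoc)

lemma left_cancel_inverse:
  assumes C: "category C" and f: "f \<in> iso_arrows C" and g: "g \<in> Arr C" "Cod C g = Cod C f"
  shows "Comp C f (Comp C (inverse_arr C f) g) = g"
  using assms by (simp flip: Comp_assoc)

lemma inverse_arr_unique:
  assumes C: "category C" and f: "f \<in> iso_arrows C" and g: "g \<in> Arr C" "Cod C g = Dom C f"
    and "Comp C f g = Ide C (Cod C f)"
  shows "inverse_arr C f = g"
  using left_cancel_iso[OF assms(1-4)] assms by simp

lemma iso_cancel_left:
  assumes C: "category C" and f: "f \<in> iso_arrows C" and g: "g \<in> Arr C" "Cod C g = Dom C f"
    and h: "h \<in> Arr C" "Cod C h = Dom C f" and eq: "Comp C f g = Comp C f h"
  shows "g = h"
  using left_cancel_iso[OF C f g] left_cancel_iso[OF C f h] eq by metis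

lemma iso_cancel_right:
  assumes C: "category C" and f: "f \<in> iso_arrows C" and g: "g \<in> Arr C" "Dom C g = Cod C f"
    and h: "h \<in> Arr C" "Dom C h = Cod C f" and eq: "Comp C g f = Comp C h f"
  shows "g = h"
proof -
  have "Comp C (Comp C g f) (inverse_arr C f) = g" "Comp C (Comp C h f) (inverse_arr C f) = h"
    using C f g h by (simp_all add: Comp_assoc)
  then show ?thesis using eq by metis
qed

lemma Ide_iso [simp]: "category C \<Longrightarrow> x \<in> Obj C \<Longrightarrow> Ide C x \<in> iso_arrows C"
  by (rule iso_arrowsI[where g = "Ide C x"]) auto

lemma inverse_Ide [simp]: "category C \<Longrightarrow> x \<in> Obj C \<Longrightarrow> inverse_arr C (Ide C x) = Ide C x"
  by (rule inverse_arr_unique) auto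

lemma Comp_iso [simp]:
  assumes C: "category C" and f: "f \<in> iso_arrows C" and g: "g \<in> iso_arrows C" and "Dom C g = Cod C f"
  shows "Comp C g f \<in> iso_arrows C"
  by (rule iso_arrowsI[where g = "Comp C (inverse_arr C f) (inverse_arr C g)"])
     (use assms in \<open>simp_all add: Comp_assoc left_cancel_iso left_cancel_inverse\<close>)

lemma Fun_iso:
  assumes C: "category C" and F: "F \<in> Fun C D" and f: "f \<in> iso_arrows C"
  shows "FArr F f \<in> iso_arrows D"
  by (rule iso_arrowsI[where g = "FArr F (inverse_arr C f)"])
     (use assms in \<open>simp_all add: Fun_simps[OF F] flip: Fun_Comp[OF F]\<close>)

lemma Fun_inverse:
  assumes C: "category C" and D: "category D" and F: "F \<in> Fun C D" and f: "f \<in> iso_arrows C"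
  shows "FArr F (inverse_arr C f) = inverse_arr D (FArr F f)"
  by (rule inverse_arr_unique[symmetric])
     (use assms Fun_iso[OF C F f] in \<open>simp_all add: Fun_simps[OF F] flip: Fun_Comp[OF F]\<close>)

lemma iso_cat_simps [simp]:
  "Obj (iso_cat C) = Obj C" "Arr (iso_cat C) = iso_arrows C"
  "f \<in> iso_arrows C \<Longrightarrow> Dom (iso_cat C) f = Dom C f"
  "f \<in> iso_arrows C \<Longrightarrow> Cod (iso_cat C) f = Cod C f"
  "Ide (iso_cat C) = Ide C"
  "g \<in> iso_arrows C \<Longrightarrow> f \<in> iso_arrows C \<Longrightarrow> Comp (iso_cat C) g f = Comp C g f"
  by (auto simp: iso_cat_def)

lemma category_iso_cat [simp]:
  assumes C: "category C" shows "category (iso_cat C)"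
proof (rule categoryI)
  fix g f assume n: "\<not> composable (iso_cat C) g f"
  show "Comp (iso_cat C) g f = undefined"
  proof (cases "g \<in> iso_arrows C \<and> f \<in> iso_arrows C")
    case True
    then have "\<not> composable C g f" using n by (auto simp: composable_def)
    then show ?thesis using C True by (simp add: Comp_undef)
  qed (auto simp: iso_cat_def)
qed (use C in \<open>auto simp: Comp_assoc Ide_undef\<close>, auto simp: iso_cat_def)

lemma iso_arrows_iso_cat [simp]:
  assumes C: "category C" shows "iso_arrows (iso_cat C) = iso_arrows C"
proof
  show "iso_arrows (iso_cat C) \<subseteq> iso_arrows C" by (auto dest: iso_arrows_Arr)
  show "iso_arrows C \<subseteq> iso_arrows (iso_cat C)"
  proof
    fix f assume "f \<in> iso_arrows C"
    then show "f \<in> iso_arrows (iso_cat C)"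
      by (intro iso_arrowsI[where g = "inverse_arr C f"]) auto
  qed
qed

lemma iso_fun_in:
  assumes C: "category C" and F: "F \<in> Fun C D"
  shows "iso_fun C F \<in> Fun (iso_cat C) (iso_cat D)"
  by (rule FunI)
     (use assms Fun_iso[OF C F] in \<open>auto simp: Fun_simps[OF F] Fun_Comp[OF F] Fun_undef[OF F] iso_fun_def\<close>)

lemma FObj_iso_fun [simp]: "FObj (iso_fun C F) = FObj F"
  and FArr_iso_fun [simp]: "f \<in> iso_arrows C \<Longrightarrow> FArr (iso_fun C F) f = FArr F f"
  by (auto simp: iso_fun_def)

lemma iso_fun_comp:
  assumes C: "category C" and F: "F \<in> Fun C D"
  shows "iso_fun C (comp_fun C G F) = comp_fun (iso_cat C) (iso_fun D G) (iso_fun C F)"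
  using Fun_iso[OF C F]
  by (intro funct.equality) (auto simp: iso_fun_def comp_fun_def compose_def restrict_def fun_eq_iff)

lemma iso_fun_id: "iso_fun C (id_fun C) = id_fun (iso_cat C)"
  by (auto simp: iso_fun_def id_fun_def restrict_def fun_eq_iff)

lemma Fun_iso_cat_incl:
  assumes C: "category C" and B: "category B" and F: "F \<in> Fun B (iso_cat C)"
  shows "F \<in> Fun B C"
proof -
  have i: "f \<in> Arr B \<Longrightarrow> FArr F f \<in> iso_arrows C" for f
    using Fun_simps(2)[OF F] by simp
  show ?thesis
    by (rule FunI) (use Fun_simps[OF F] Fun_undef[OF F] Fun_Comp[OF F] i B in auto)
qed

lemma Fun_iso_catI:
  assumes C: "category C" and B: "category B" and F: "F \<in> Fun B C"
    and i: "\<And>f. f \<in> Arr B \<Longrightarrow> FArr F f \<in> iso_arrows C"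
  shows "F \<in> Fun B (iso_cat C)"
  by (rule FunI) (use Fun_simps[OF F] Fun_undef[OF F] Fun_Comp[OF F] i B in auto)

section \<open>Functor categories\<close>

lemma NatI:
  assumes "NSrc \<alpha> \<in> Fun C D" "NTgt \<alpha> \<in> Fun C D"
    and "\<And>x. x \<in> Obj C \<Longrightarrow> NComp \<alpha> x \<in> Arr D" "\<And>x. x \<notin> Obj C \<Longrightarrow> NComp \<alpha> x = undefined"
    and "\<And>x. x \<in> Obj C \<Longrightarrow> Dom D (NComp \<alpha> x) = FObj (NSrc \<alpha>) x"
    and "\<And>x. x \<in> Obj C \<Longrightarrow> Cod D (NComp \<alpha> x) = FObj (NTgt \<alpha>) x"
    and "\<And>f. f \<in> Arr C \<Longrightarrow> Comp D (NComp \<alpha> (Cod C f)) (FArr (NSrc \<alpha>) f) =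
                 Comp D (FArr (NTgt \<alpha>) f) (NComp \<alpha> (Dom C f))"
  shows "\<alpha> \<in> Nat_trans C D"
  using assms unfolding Nat_trans_def by (auto simp: PiE_iff extensional_def)

lemma Nat_simps:
  assumes "\<alpha> \<in> Nat_trans C D"
  shows "NSrc \<alpha> \<in> Fun C D" "NTgt \<alpha> \<in> Fun C D"
    and "x \<in> Obj C \<Longrightarrow> NComp \<alpha> x \<in> Arr D"
    and "x \<in> Obj C \<Longrightarrow> Dom D (NComp \<alpha> x) = FObj (NSrc \<alpha>) x"
    and "x \<in> Obj C \<Longrightarrow> Cod D (NComp \<alpha> x) = FObj (NTgt \<alpha>) x"
  using assms unfolding Nat_trans_def by (auto simp: PiE_iff extensional_def)

lemma Nat_nat:
  assumes "\<alpha> \<in> Nat_trans C D" "f \<in> Arr C"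
  shows "Comp D (NComp \<alpha> (Cod C f)) (FArr (NSrc \<alpha>) f) = Comp D (FArr (NTgt \<alpha>) f) (NComp \<alpha> (Dom C f))"
  using assms unfolding Nat_trans_def by (auto simp: PiE_iff extensional_def)

lemma Nat_undef: "\<alpha> \<in> Nat_trans C D \<Longrightarrow> x \<notin> Obj C \<Longrightarrow> NComp \<alpha> x = undefined"
  unfolding Nat_trans_def by (auto simp: PiE_iff extensional_def)

lemma Nat_ext:
  fixes \<alpha> \<beta> :: "('o, 'a, 'p, 'b) nattr"
  assumes "\<alpha> \<in> Nat_trans C D" "\<beta> \<in> Nat_trans C D" "NSrc \<alpha> = NSrc \<beta>" "NTgt \<alpha> = NTgt \<beta>"
    "\<And>x. x \<in> Obj C \<Longrightarrow> NComp \<alpha> x = NComp \<beta> x"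
  shows "\<alpha> = \<beta>"
proof (rule nattr.equality)
  show "NComp \<alpha> = NComp \<beta>"
    using assms(5) Nat_undef[OF assms(1)] Nat_undef[OF assms(2)] by (metis ext)
qed (use assms in auto)

lemma fun_cat_simps [simp]:
  "Obj (fun_cat C D) = Fun C D" "Arr (fun_cat C D) = Nat_trans C D"
  "\<alpha> \<in> Nat_trans C D \<Longrightarrow> Dom (fun_cat C D) \<alpha> = NSrc \<alpha>"
  "\<alpha> \<in> Nat_trans C D \<Longrightarrow> Cod (fun_cat C D) \<alpha> = NTgt \<alpha>"
  "F \<in> Fun C D \<Longrightarrow> NSrc (Ide (fun_cat C D) F) = F"
  "F \<in> Fun C D \<Longrightarrow> NTgt (Ide (fun_cat C D) F) = F"
  "F \<in> Fun C D \<Longrightarrow> x \<in> Obj C \<Longrightarrow> NComp (Ide (fun_cat C D) F) x = Ide D (FObj F x)"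
  "\<beta> \<in> Nat_trans C D \<Longrightarrow> \<alpha> \<in> Nat_trans C D \<Longrightarrow> NSrc \<beta> = NTgt \<alpha> \<Longrightarrow>
    NSrc (Comp (fun_cat C D) \<beta> \<alpha>) = NSrc \<alpha>"
  "\<beta> \<in> Nat_trans C D \<Longrightarrow> \<alpha> \<in> Nat_trans C D \<Longrightarrow> NSrc \<beta> = NTgt \<alpha> \<Longrightarrow>
    NTgt (Comp (fun_cat C D) \<beta> \<alpha>) = NTgt \<beta>"
  "\<beta> \<in> Nat_trans C D \<Longrightarrow> \<alpha> \<in> Nat_trans C D \<Longrightarrow> NSrc \<beta> = NTgt \<alpha> \<Longrightarrow> x \<in> Obj C \<Longrightarrow>
    NComp (Comp (fun_cat C D) \<beta> \<alpha>) x = Comp D (NComp \<beta> x) (NComp \<alpha> x)"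
  by (auto simp: fun_cat_def)

lemma Ide_fun_cat_in:
  assumes "category C" "category D" "F \<in> Fun C D"
  shows "Ide (fun_cat C D) F \<in> Nat_trans C D"
  using assms by (intro NatI) (auto simp: Fun_simps[OF assms(3)], auto simp: fun_cat_def)

lemma Comp_fun_cat_in:
  assumes C: "category C" and D: "category D" and a: "\<alpha> \<in> Nat_trans C D" and b: "\<beta> \<in> Nat_trans C D"
    and "NSrc \<beta> = NTgt \<alpha>"
  shows "Comp (fun_cat C D) \<beta> \<alpha> \<in> Nat_trans C D"
proof (rule NatI)
  fix f assume f: "f \<in> Arr C"
  note F = Fun_simps[OF Nat_simps(1)[OF a]] Fun_simps[OF Nat_simps(2)[OF a]] Fun_simps[OF Nat_simps(2)[OF b]]
  have "Comp D (Comp D (NComp \<beta> (Cod C f)) (NComp \<alpha> (Cod C f))) (FArr (NSrc \<alpha>) f) =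
    Comp D (NComp \<beta> (Cod C f)) (Comp D (NComp \<alpha> (Cod C f)) (FArr (NSrc \<alpha>) f))"
    using assms f by (simp add: Comp_assoc Nat_simps[OF a] Nat_simps[OF b] F)
  also have "\<dots> = Comp D (Comp D (NComp \<beta> (Cod C f)) (FArr (NTgt \<alpha>) f)) (NComp \<alpha> (Dom C f))"
    using assms f by (simp add: Comp_assoc Nat_nat Nat_simps[OF a] Nat_simps[OF b] F)
  also have "\<dots> = Comp D (FArr (NTgt \<beta>) f) (Comp D (NComp \<beta> (Dom C f)) (NComp \<alpha> (Dom C f)))"
    using assms f Nat_nat[OF b f] by (simp add: Comp_assoc Nat_simps[OF a] Nat_simps[OF b] F)
  finally show "Comp D (NComp (Comp (fun_cat C D) \<beta> \<alpha>) (Cod C f)) (FArr (NSrc (Comp (fun_cat C D) \<beta> \<alpha>)) f) =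
         Comp D (FArr (NTgt (Comp (fun_cat C D) \<beta> \<alpha>)) f) (NComp (Comp (fun_cat C D) \<beta> \<alpha>) (Dom C f))"
    using assms f by simp
qed (use assms in \<open>auto simp: Nat_simps[OF a] Nat_simps[OF b]\<close>, auto simp: fun_cat_def)

lemma category_fun_cat [simp]:
  assumes C: "category C" and D: "category D"
  shows "category (fun_cat C D)"
proof (rule categoryI)
  fix \<alpha> assume a: "\<alpha> \<in> Arr (fun_cat C D)"
  then show "Comp (fun_cat C D) \<alpha> (Ide (fun_cat C D) (Dom (fun_cat C D) \<alpha>)) = \<alpha>"
    using assms by (intro Nat_ext[where C = C and D = D])
      (auto simp: Nat_simps Ide_fun_cat_in intro!: Comp_fun_cat_in)
  show "Comp (fun_cat C D) (Ide (fun_cat C D) (Cod (fun_cat C D) \<alpha>)) \<alpha> = \<alpha>"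
    using assms a by (intro Nat_ext[where C = C and D = D])
      (auto simp: Nat_simps Ide_fun_cat_in intro!: Comp_fun_cat_in)
next
  fix \<gamma> \<beta> \<alpha> assume "\<gamma> \<in> Arr (fun_cat C D)" "\<beta> \<in> Arr (fun_cat C D)" "\<alpha> \<in> Arr (fun_cat C D)"
    "Dom (fun_cat C D) \<gamma> = Cod (fun_cat C D) \<beta>" "Dom (fun_cat C D) \<beta> = Cod (fun_cat C D) \<alpha>"
  then show "Comp (fun_cat C D) \<gamma> (Comp (fun_cat C D) \<beta> \<alpha>) = Comp (fun_cat C D) (Comp (fun_cat C D) \<gamma> \<beta>) \<alpha>"
    using assms by (intro Nat_ext[where C = C and D = D])
      (auto simp: Nat_simps Comp_fun_cat_in Comp_assoc)
next
  fix \<beta> \<alpha> assume "\<not> composable (fun_cat C D) \<beta> \<alpha>"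
  then have "\<not> (\<beta> \<in> Nat_trans C D \<and> \<alpha> \<in> Nat_trans C D \<and> NSrc \<beta> = NTgt \<alpha>)"
    by (auto simp: composable_def)
  then show "Comp (fun_cat C D) \<beta> \<alpha> = undefined"
    by (auto simp: fun_cat_def)
qed (use assms in \<open>auto simp: Nat_simps Ide_fun_cat_in Comp_fun_cat_in\<close>, auto simp: fun_cat_def)

text \<open>Componentwise inverses are again natural: composing the naturality square of \<alpha>
  with them on both sides gives the square of the inverse. Invertibility in a functor category
  thereby becomes a condition on single arrows of D.\<close>

lemma iso_arrows_fun_cat:
  assumes C: "category C" and D: "category D"
  shows "\<alpha> \<in> iso_arrows (fun_cat C D) \<longleftrightarrow>
    \<alpha> \<in> Nat_trans C D \<and> (\<forall>x\<in>Obj C. NComp \<alpha> x \<in> iso_arrows D)"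
proof
  assume i: "\<alpha> \<in> iso_arrows (fun_cat C D)"
  let ?b = "inverse_arr (fun_cat C D) \<alpha>"
  have a: "\<alpha> \<in> Nat_trans C D" and b: "?b \<in> Nat_trans C D"
    using iso_arrows_Arr[OF i] inverse_arr(1)[OF i] by simp_all
  have s: "NSrc ?b = NTgt \<alpha>" "NTgt ?b = NSrc \<alpha>"
    using inverse_arr(2,3)[OF i] a b by simp_all
  have "NComp \<alpha> x \<in> iso_arrows D" if x: "x \<in> Obj C" for x
  proof (rule iso_arrowsI[where g = "NComp ?b x"])
    show "Comp D (NComp ?b x) (NComp \<alpha> x) = Ide D (Dom D (NComp \<alpha> x))"
      using arg_cong[OF inverse_arr(4)[OF i], of "\<lambda>u. NComp u x"] a b s x by (simp add: Nat_simps)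
    show "Comp D (NComp \<alpha> x) (NComp ?b x) = Ide D (Cod D (NComp \<alpha> x))"
      using arg_cong[OF inverse_arr(5)[OF i], of "\<lambda>u. NComp u x"] a b s x by (simp add: Nat_simps)
  qed (use a b s x in \<open>auto simp: Nat_simps\<close>)
  with a show "\<alpha> \<in> Nat_trans C D \<and> (\<forall>x\<in>Obj C. NComp \<alpha> x \<in> iso_arrows D)" by simp
next
  assume r: "\<alpha> \<in> Nat_trans C D \<and> (\<forall>x\<in>Obj C. NComp \<alpha> x \<in> iso_arrows D)"
  then have a: "\<alpha> \<in> Nat_trans C D" and i: "\<And>x. x\<in>Obj C \<Longrightarrow> NComp \<alpha> x \<in> iso_arrows D" by auto
  note F = Fun_simps[OF Nat_simps(1)[OF a]] Fun_simps[OF Nat_simps(2)[OF a]]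
  define \<beta> where "\<beta> = \<lparr>NSrc = NTgt \<alpha>, NTgt = NSrc \<alpha>, NComp = (\<lambda>x\<in>Obj C. inverse_arr D (NComp \<alpha> x))\<rparr>"
  have b: "\<beta> \<in> Nat_trans C D"
  proof (rule NatI)
    fix f assume f: "f \<in> Arr C"
    let ?x = "NComp \<alpha> (Cod C f)" and ?y = "NComp \<alpha> (Dom C f)"
    \<comment> \<open>Insert \<open>?y\<close> composed with its inverse; naturality of \<alpha>
      then brings \<open>?x\<close> next to its own inverse.\<close>
    have "Comp D (inverse_arr D ?x) (FArr (NTgt \<alpha>) f) =
      Comp D (inverse_arr D ?x) (Comp D (Comp D (FArr (NTgt \<alpha>) f) ?y) (inverse_arr D ?y))"
      using C D f i by (simp add: Comp_assoc Nat_simps[OF a] F)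
    also have "\<dots> = Comp D (inverse_arr D ?x) (Comp D ?x (Comp D (FArr (NSrc \<alpha>) f) (inverse_arr D ?y)))"
      using C D f i by (simp add: Comp_assoc Nat_simps[OF a] F flip: Nat_nat[OF a f])
    also have "\<dots> = Comp D (FArr (NSrc \<alpha>) f) (inverse_arr D ?y)"
      using C D f i by (simp add: left_cancel_iso Nat_simps[OF a] F)
    finally have "Comp D (inverse_arr D ?x) (FArr (NTgt \<alpha>) f) = Comp D (FArr (NSrc \<alpha>) f) (inverse_arr D ?y)" .
    then show "Comp D (NComp \<beta> (Cod C f)) (FArr (NSrc \<beta>) f) = Comp D (FArr (NTgt \<beta>) f) (NComp \<beta> (Dom C f))"
      using C f by (simp add: \<beta>_def)
  qed (use a i in \<open>auto simp: \<beta>_def Nat_simps\<close>)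
  have s: "NSrc \<beta> = NTgt \<alpha>" "NTgt \<beta> = NSrc \<alpha>" by (auto simp: \<beta>_def)
  have \<beta>_comp: "x \<in> Obj C \<Longrightarrow> NComp \<beta> x = inverse_arr D (NComp \<alpha> x)" for x
    by (simp add: \<beta>_def)
  show "\<alpha> \<in> iso_arrows (fun_cat C D)"
  proof (rule iso_arrowsI[where g = \<beta>])
    have "Comp (fun_cat C D) \<beta> \<alpha> = Ide (fun_cat C D) (NSrc \<alpha>)"
      by (rule Nat_ext[OF Comp_fun_cat_in[OF C D a b s(1)] Ide_fun_cat_in[OF C D Nat_simps(1)[OF a]]])
        (use a b s i in \<open>simp_all add: Nat_simps[OF a] \<beta>_comp\<close>)
    then show "Comp (fun_cat C D) \<beta> \<alpha> = Ide (fun_cat C D) (Dom (fun_cat C D) \<alpha>)"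
      using a by simp
    have "Comp (fun_cat C D) \<alpha> \<beta> = Ide (fun_cat C D) (NTgt \<alpha>)"
      by (rule Nat_ext[OF Comp_fun_cat_in[OF C D b a s(2)[symmetric]] Ide_fun_cat_in[OF C D Nat_simps(2)[OF a]]])
        (use a b s i in \<open>simp_all add: Nat_simps[OF a] \<beta>_comp\<close>)
    then show "Comp (fun_cat C D) \<alpha> \<beta> = Ide (fun_cat C D) (Cod (fun_cat C D) \<alpha>)"
      using a by simp
  qed (use a b s in auto)
qed

lemma fun_cat_map_simps [simp]:
  "F \<in> Fun C D \<Longrightarrow> FObj (fun_cat_map C' C D u v) F = comp_fun C' v (comp_fun C' F u)"
  "\<alpha> \<in> Nat_trans C D \<Longrightarrow> NSrc (FArr (fun_cat_map C' C D u v) \<alpha>) = comp_fun C' v (comp_fun C' (NSrc \<alpha>) u)"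
  "\<alpha> \<in> Nat_trans C D \<Longrightarrow> NTgt (FArr (fun_cat_map C' C D u v) \<alpha>) = comp_fun C' v (comp_fun C' (NTgt \<alpha>) u)"
  "\<alpha> \<in> Nat_trans C D \<Longrightarrow> x \<in> Obj C' \<Longrightarrow> NComp (FArr (fun_cat_map C' C D u v) \<alpha>) x = FArr v (NComp \<alpha> (FObj u x))"
  by (auto simp: fun_cat_map_def Let_def)

lemma fun_cat_map_undef:
  "F \<notin> Fun C D \<Longrightarrow> FObj (fun_cat_map C' C D u v) F = undefined"
  "\<alpha> \<notin> Nat_trans C D \<Longrightarrow> FArr (fun_cat_map C' C D u v) \<alpha> = undefined"
  "\<alpha> \<in> Nat_trans C D \<Longrightarrow> x \<notin> Obj C' \<Longrightarrow> NComp (FArr (fun_cat_map C' C D u v) \<alpha>) x = undefined"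
  by (auto simp: fun_cat_map_def Let_def)

lemma comp_comp_in:
  assumes "category C'" "category C" "F \<in> Fun C D" "u \<in> Fun C' C" "v \<in> Fun D D'"
  shows "comp_fun C' v (comp_fun C' F u) \<in> Fun C' D'"
  using assms by (auto intro: comp_fun_in)

lemma fun_cat_map_Nat:
  assumes "category C'" "category C" "category D" "u \<in> Fun C' C" "v \<in> Fun D D'" "\<alpha> \<in> Nat_trans C D"
  shows "FArr (fun_cat_map C' C D u v) \<alpha> \<in> Nat_trans C' D'"
proof (rule NatI)
  note F = Fun_simps[OF Nat_simps(1)[OF assms(6)]] Fun_simps[OF Nat_simps(2)[OF assms(6)]]
    Fun_simps[OF assms(4)] Fun_simps[OF assms(5)]
  note G = comp_comp_in[OF assms(1,2) _ assms(4,5)]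
  show "NSrc (FArr (fun_cat_map C' C D u v) \<alpha>) \<in> Fun C' D'" "NTgt (FArr (fun_cat_map C' C D u v) \<alpha>) \<in> Fun C' D'"
    using assms(6) by (simp_all add: G Nat_simps)
  fix x assume x: "x \<in> Obj C'"
  show "NComp (FArr (fun_cat_map C' C D u v) \<alpha>) x \<in> Arr D'"
    "Dom D' (NComp (FArr (fun_cat_map C' C D u v) \<alpha>) x) = FObj (NSrc (FArr (fun_cat_map C' C D u v) \<alpha>)) x"
    "Cod D' (NComp (FArr (fun_cat_map C' C D u v) \<alpha>) x) = FObj (NTgt (FArr (fun_cat_map C' C D u v) \<alpha>)) x"
    using assms(6) x by (simp_all add: F Nat_simps[OF assms(6)])
next
  note F = Fun_simps[OF Nat_simps(1)[OF assms(6)]] Fun_simps[OF Nat_simps(2)[OF assms(6)]]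
    Fun_simps[OF assms(4)] Fun_simps[OF assms(5)]
  fix f assume f: "f \<in> Arr C'"
  show "Comp D' (NComp (FArr (fun_cat_map C' C D u v) \<alpha>) (Cod C' f)) (FArr (NSrc (FArr (fun_cat_map C' C D u v) \<alpha>)) f) =
    Comp D' (FArr (NTgt (FArr (fun_cat_map C' C D u v) \<alpha>)) f) (NComp (FArr (fun_cat_map C' C D u v) \<alpha>) (Dom C' f))"
    using assms f Nat_nat[OF assms(6), of "FArr u f"]
    by (simp add: F Nat_simps[OF assms(6)] flip: Fun_Comp[OF assms(5)])
qed (use assms(6) in \<open>simp add: fun_cat_map_undef\<close>)

lemma fun_cat_map_in:
  assumes "category C'" "category C" "category D" "category D'" "u \<in> Fun C' C" "v \<in> Fun D D'"
  shows "fun_cat_map C' C D u v \<in> Fun (fun_cat C D) (fun_cat C' D')"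
proof (rule FunI)
  note H = fun_cat_map_Nat[OF assms(1,2,3,5,6)] and G = comp_comp_in[OF assms(1,2) _ assms(5,6)]
  note U = Fun_simps[OF assms(5)] Fun_simps[OF assms(6)]
  {
    fix F assume "F \<in> Obj (fun_cat C D)"
    then have F: "F \<in> Fun C D" by simp
    note I = Ide_fun_cat_in[OF assms(2,3) F]
    show "FObj (fun_cat_map C' C D u v) F \<in> Obj (fun_cat C' D')"
      using F G by simp
    show "FArr (fun_cat_map C' C D u v) (Ide (fun_cat C D) F) = Ide (fun_cat C' D') (FObj (fun_cat_map C' C D u v) F)"
      by (rule Nat_ext[OF H[OF I]])
        (use assms G[OF F] I F in \<open>simp_all add: Ide_fun_cat_in U Fun_simps[OF F]\<close>)
  }
  {
    fix \<alpha> assume "\<alpha> \<in> Arr (fun_cat C D)"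
    then have a: "\<alpha> \<in> Nat_trans C D" by simp
    show "FArr (fun_cat_map C' C D u v) \<alpha> \<in> Arr (fun_cat C' D')"
      "Dom (fun_cat C' D') (FArr (fun_cat_map C' C D u v) \<alpha>) = FObj (fun_cat_map C' C D u v) (Dom (fun_cat C D) \<alpha>)"
      "Cod (fun_cat C' D') (FArr (fun_cat_map C' C D u v) \<alpha>) = FObj (fun_cat_map C' C D u v) (Cod (fun_cat C D) \<alpha>)"
      using H[OF a] a Nat_simps[OF a] by simp_all
  }
  fix \<beta> \<alpha> assume "\<beta> \<in> Arr (fun_cat C D)" "\<alpha> \<in> Arr (fun_cat C D)" "Dom (fun_cat C D) \<beta> = Cod (fun_cat C D) \<alpha>"
  then have a: "\<alpha> \<in> Nat_trans C D" and b: "\<beta> \<in> Nat_trans C D" and s: "NSrc \<beta> = NTgt \<alpha>" by simp_all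
  note c = Comp_fun_cat_in[OF assms(2,3) a b s]
  have "Comp (fun_cat C' D') (FArr (fun_cat_map C' C D u v) \<beta>) (FArr (fun_cat_map C' C D u v) \<alpha>) \<in> Nat_trans C' D'"
    by (rule Comp_fun_cat_in) (use assms H[OF a] H[OF b] a b s in simp_all)
  then show "FArr (fun_cat_map C' C D u v) (Comp (fun_cat C D) \<beta> \<alpha>) =
    Comp (fun_cat C' D') (FArr (fun_cat_map C' C D u v) \<beta>) (FArr (fun_cat_map C' C D u v) \<alpha>)"
    by (rule Nat_ext[OF H[OF c]])
      (use a b s c H[OF a] H[OF b] in \<open>simp_all add: U Nat_simps[OF a] Nat_simps[OF b] Fun_Comp[OF assms(6)]\<close>)
qed (simp_all add: fun_cat_map_undef)

text \<open>One law for both variables, contravariant in the exponent and covariant in the base.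
  With identities put into one or the other variable it yields the simplicial identities of NC, the
  compatibility of Nf with the operators, and the functoriality of N.\<close>

lemma fun_cat_map_comp:
  assumes "category C''" "category C'" "category C" "category D" "category D'"
    "u' \<in> Fun C'' C'" "u \<in> Fun C' C" "v \<in> Fun D D'" "v' \<in> Fun D' D''" "category D''"
  shows "fun_cat_map C'' C D (comp_fun C'' u u') (comp_fun D v' v) =
    comp_fun (fun_cat C D) (fun_cat_map C'' C' D' u' v') (fun_cat_map C' C D u v)"
proof -
  have 1: "fun_cat_map C' C D u v \<in> Fun (fun_cat C D) (fun_cat C' D')" 
    using assms by (intro fun_cat_map_in) auto
  have 2: "fun_cat_map C'' C' D' u' v' \<in> Fun (fun_cat C' D') (fun_cat C'' D'')"
    using assms by (intro fun_cat_map_in) auto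
  have u: "comp_fun C'' u u' \<in> Fun C'' C" and v: "comp_fun D v' v \<in> Fun D D''" 
    using assms by (auto intro: comp_fun_in)
  have 3: "fun_cat_map C'' C D (comp_fun C'' u u') (comp_fun D v' v) \<in> Fun (fun_cat C D) (fun_cat C'' D'')"
    using assms u v by (intro fun_cat_map_in) auto
  have eq: "comp_fun C'' (comp_fun D v' v) (comp_fun C'' F (comp_fun C'' u u')) =
    comp_fun C'' v' (comp_fun C'' (comp_fun C' v (comp_fun C' F u)) u')" if "F \<in> Fun C D" for F
    using assms(6,7) that by (auto simp: comp_fun_def compose_def fun_eq_iff Fun_simps[OF that] Fun_simps[OF assms(6)] Fun_simps[OF assms(7)])
  show ?thesis
  proof (rule Fun_ext[OF 3 comp_fun_in[OF _ 1 2]])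
    fix F assume "F \<in> Obj (fun_cat C D)"
    then show "FObj (fun_cat_map C'' C D (comp_fun C'' u u') (comp_fun D v' v)) F =
      FObj (comp_fun (fun_cat C D) (fun_cat_map C'' C' D' u' v') (fun_cat_map C' C D u v)) F"
      using assms Fun_simps(1)[OF 1, of F] eq by simp
  next
    fix \<alpha> assume a: "\<alpha> \<in> Arr (fun_cat C D)"
    have b: "FArr (fun_cat_map C' C D u v) \<alpha> \<in> Nat_trans C' D'" 
      using Fun_simps(2)[OF 1 a] by simp
    show "FArr (fun_cat_map C'' C D (comp_fun C'' u u') (comp_fun D v' v)) \<alpha> =
      FArr (comp_fun (fun_cat C D) (fun_cat_map C'' C' D' u' v') (fun_cat_map C' C D u v)) \<alpha>"
    proof (rule Nat_ext[where C = C'' and D = D''])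
      show "FArr (fun_cat_map C'' C D (comp_fun C'' u u') (comp_fun D v' v)) \<alpha> \<in> Nat_trans C'' D''"
        using Fun_simps(2)[OF 3 a] by simp
      show "FArr (comp_fun (fun_cat C D) (fun_cat_map C'' C' D' u' v') (fun_cat_map C' C D u v)) \<alpha> \<in> Nat_trans C'' D''"
        using Fun_simps(2)[OF 2, of "FArr (fun_cat_map C' C D u v) \<alpha>"] a b by simp
    qed (use a b eq Nat_simps[of \<alpha> C D] in \<open>simp_all add: Fun_simps[OF assms(6)] Fun_simps[OF assms(7)]\<close>)
  qed (use assms in auto)
qed

lemma fun_cat_map_id:
  assumes "category C" "category D"
  shows "fun_cat_map C C D (id_fun C) (id_fun D) = id_fun (fun_cat C D)"
proof (rule Fun_ext)
  show "fun_cat_map C C D (id_fun C) (id_fun D) \<in> Fun (fun_cat C D) (fun_cat C D)"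
    using assms by (intro fun_cat_map_in id_fun_in)
  show "id_fun (fun_cat C D) \<in> Fun (fun_cat C D) (fun_cat C D)"
    using assms by (intro id_fun_in category_fun_cat)
  fix F assume "F \<in> Obj (fun_cat C D)"
  then have F: "F \<in> Fun C D" by simp
  show "FObj (fun_cat_map C C D (id_fun C) (id_fun D)) F = FObj (id_fun (fun_cat C D)) F"
    using F by (simp add: comp_fun_id[OF F])
next
  fix \<alpha> assume "\<alpha> \<in> Arr (fun_cat C D)"
  then have a: "\<alpha> \<in> Nat_trans C D" by simp
  show "FArr (fun_cat_map C C D (id_fun C) (id_fun D)) \<alpha> = FArr (id_fun (fun_cat C D)) \<alpha>"
    by (rule Nat_ext[OF fun_cat_map_Nat[OF assms(1,1,2) id_fun_in id_fun_in a]])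
      (use assms a in \<open>simp_all add: Nat_simps[OF a] comp_fun_id[OF Nat_simps(1)[OF a]] comp_fun_id[OF Nat_simps(2)[OF a]]\<close>)
qed

section \<open>Products, ordinals and currying\<close>

lemma prod_cat_simps [simp]:
  "Obj (prod_cat C D) = Obj C \<times> Obj D" "Arr (prod_cat C D) = Arr C \<times> Arr D"
  "f \<in> Arr C \<Longrightarrow> g \<in> Arr D \<Longrightarrow> Dom (prod_cat C D) (f, g) = (Dom C f, Dom D g)"
  "f \<in> Arr C \<Longrightarrow> g \<in> Arr D \<Longrightarrow> Cod (prod_cat C D) (f, g) = (Cod C f, Cod D g)"
  "x \<in> Obj C \<Longrightarrow> y \<in> Obj D \<Longrightarrow> Ide (prod_cat C D) (x, y) = (Ide C x, Ide D y)"
  "f' \<in> Arr C \<Longrightarrow> f \<in> Arr C \<Longrightarrow> Dom C f' = Cod C f \<Longrightarrow> g' \<in> Arr D \<Longrightarrow> g \<in> Arr D \<Longrightarrow> Dom D g' = Cod D g \<Longrightarrow>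
    Comp (prod_cat C D) (f', g') (f, g) = (Comp C f' f, Comp D g' g)"
  by (auto simp: prod_cat_def composable_def)

lemma prod_cat_undef:
  "fg \<notin> Arr C \<times> Arr D \<Longrightarrow> Dom (prod_cat C D) fg = undefined"
  "fg \<notin> Arr C \<times> Arr D \<Longrightarrow> Cod (prod_cat C D) fg = undefined"
  "xy \<notin> Obj C \<times> Obj D \<Longrightarrow> Ide (prod_cat C D) xy = undefined"
  by (auto simp: prod_cat_def)

lemma category_prod_cat [simp]:
  assumes C: "category C" and D: "category D"
  shows "category (prod_cat C D)"
proof (rule categoryI)
  fix g f assume "\<not> composable (prod_cat C D) g f"
  moreover have "composable (prod_cat C D) g f"
    if "composable C (fst g) (fst f)" "composable D (snd g) (snd f)"
    using that by (cases g; cases f) (auto simp: composable_def)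
  ultimately show "Comp (prod_cat C D) g f = undefined"
    by (auto simp: prod_cat_def)
qed (use C D in \<open>auto simp: Comp_assoc prod_cat_undef\<close>)

definition fun_pair :: "('o, 'a) cat \<Rightarrow> ('o, 'a, 'p, 'b) funct \<Rightarrow> ('o, 'a, 'q, 'c) funct \<Rightarrow>
    ('o, 'a, 'p \<times> 'q, 'b \<times> 'c) funct" where
  "fun_pair A F G = \<lparr>FObj = (\<lambda>x\<in>Obj A. (FObj F x, FObj G x)), FArr = (\<lambda>f\<in>Arr A. (FArr F f, FArr G f))\<rparr>"

definition fun_fst :: "('o, 'a) cat \<Rightarrow> ('p, 'b) cat \<Rightarrow> ('o \<times> 'p, 'a \<times> 'b, 'o, 'a) funct" where
  "fun_fst C D = \<lparr>FObj = (\<lambda>x\<in>Obj C \<times> Obj D. fst x), FArr = (\<lambda>f\<in>Arr C \<times> Arr D. fst f)\<rparr>"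

definition fun_snd :: "('o, 'a) cat \<Rightarrow> ('p, 'b) cat \<Rightarrow> ('o \<times> 'p, 'a \<times> 'b, 'p, 'b) funct" where
  "fun_snd C D = \<lparr>FObj = (\<lambda>x\<in>Obj C \<times> Obj D. snd x), FArr = (\<lambda>f\<in>Arr C \<times> Arr D. snd f)\<rparr>"

lemma fun_pair_simps [simp]:
  "x \<in> Obj A \<Longrightarrow> FObj (fun_pair A F G) x = (FObj F x, FObj G x)"
  "f \<in> Arr A \<Longrightarrow> FArr (fun_pair A F G) f = (FArr F f, FArr G f)"
  "x \<in> Obj C \<Longrightarrow> y \<in> Obj D \<Longrightarrow> FObj (fun_fst C D) (x, y) = x"
  "f \<in> Arr C \<Longrightarrow> g \<in> Arr D \<Longrightarrow> FArr (fun_fst C D) (f, g) = f"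
  "x \<in> Obj C \<Longrightarrow> y \<in> Obj D \<Longrightarrow> FObj (fun_snd C D) (x, y) = y"
  "f \<in> Arr C \<Longrightarrow> g \<in> Arr D \<Longrightarrow> FArr (fun_snd C D) (f, g) = g"
  "x \<in> Obj C \<Longrightarrow> y \<in> Obj D \<Longrightarrow> FObj (fun_prod C D u v) (x, y) = (FObj u x, FObj v y)"
  "f \<in> Arr C \<Longrightarrow> g \<in> Arr D \<Longrightarrow> FArr (fun_prod C D u v) (f, g) = (FArr u f, FArr v g)"
  by (auto simp: fun_pair_def fun_fst_def fun_snd_def fun_prod_def)

lemma fun_pair_in:
  assumes A: "category A" and F: "F \<in> Fun A C" and G: "G \<in> Fun A D"
  shows "fun_pair A F G \<in> Fun A (prod_cat C D)"
  by (rule FunI) (use A in \<open>simp_all add: Fun_simps[OF F] Fun_simps[OF G] Fun_Comp[OF F] Fun_Comp[OF G]\<close>,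
    simp_all add: fun_pair_def)

lemma fun_fst_in:
  assumes "category C" "category D" shows "fun_fst C D \<in> Fun (prod_cat C D) C"
  by (rule FunI) (use assms in \<open>auto simp: fun_fst_def\<close>)

lemma fun_snd_in:
  assumes "category C" "category D" shows "fun_snd C D \<in> Fun (prod_cat C D) D"
  by (rule FunI) (use assms in \<open>auto simp: fun_snd_def\<close>)

lemma fun_prod_in:
  assumes C: "category C" and D: "category D" and u: "u \<in> Fun C C'" and v: "v \<in> Fun D D'"
  shows "fun_prod C D u v \<in> Fun (prod_cat C D) (prod_cat C' D')"
proof (rule FunI)
  fix x assume "x \<in> Obj (prod_cat C D)"
  then show "FObj (fun_prod C D u v) x \<in> Obj (prod_cat C' D')"
    "FArr (fun_prod C D u v) (Ide (prod_cat C D) x) = Ide (prod_cat C' D') (FObj (fun_prod C D u v) x)"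
    using C D by (cases x; simp add: Fun_simps[OF u] Fun_simps[OF v])+
next
  fix f assume "f \<in> Arr (prod_cat C D)"
  then show "FArr (fun_prod C D u v) f \<in> Arr (prod_cat C' D')"
    "Dom (prod_cat C' D') (FArr (fun_prod C D u v) f) = FObj (fun_prod C D u v) (Dom (prod_cat C D) f)"
    "Cod (prod_cat C' D') (FArr (fun_prod C D u v) f) = FObj (fun_prod C D u v) (Cod (prod_cat C D) f)"
    using C D by (cases f; simp add: Fun_simps[OF u] Fun_simps[OF v])+
next
  fix g f assume "g \<in> Arr (prod_cat C D)" "f \<in> Arr (prod_cat C D)" "Dom (prod_cat C D) g = Cod (prod_cat C D) f"
  then show "FArr (fun_prod C D u v) (Comp (prod_cat C D) g f) =
      Comp (prod_cat C' D') (FArr (fun_prod C D u v) g) (FArr (fun_prod C D u v) f)"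
    using C D by (cases g; cases f; simp add: Fun_simps[OF u] Fun_simps[OF v] Fun_Comp[OF u] Fun_Comp[OF v])
qed (auto simp: fun_prod_def)

lemma fun_prod_comp:
  assumes C: "category C" and D: "category D" and u: "u \<in> Fun C C'" and v: "v \<in> Fun D D'"
  shows "comp_fun (prod_cat C D) (fun_prod C' D' u' v') (fun_prod C D u v) =
    fun_prod C D (comp_fun C u' u) (comp_fun D v' v)"
  by (auto simp: fun_prod_def comp_fun_def compose_def fun_eq_iff Fun_simps[OF u] Fun_simps[OF v])

lemma fun_prod_id: "fun_prod C D (id_fun C) (id_fun D) = id_fun (prod_cat C D)"
  by (auto simp: fun_prod_def id_fun_def fun_eq_iff)

lemma fun_pair_comp:
  assumes "category B" and u: "u \<in> Fun B A"
  shows "comp_fun B (fun_pair A F G) u = fun_pair B (comp_fun B F u) (comp_fun B G u)"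
  by (auto simp: fun_pair_def comp_fun_def compose_def fun_eq_iff Fun_simps[OF u])

lemma fun_prod_fst_snd:
  assumes C: "category C" and D: "category D" and u: "u \<in> Fun C C'" and v: "v \<in> Fun D D'"
  shows "comp_fun (prod_cat C D) (fun_fst C' D') (fun_prod C D u v) = comp_fun (prod_cat C D) u (fun_fst C D)"
    and "comp_fun (prod_cat C D) (fun_snd C' D') (fun_prod C D u v) = comp_fun (prod_cat C D) v (fun_snd C D)"
  by (auto simp: fun_prod_def fun_fst_def fun_snd_def comp_fun_def compose_def fun_eq_iff Fun_simps[OF u] Fun_simps[OF v])

lemma fun_pair_proj:
  assumes A: "category A" and F: "F \<in> Fun A C" and G: "G \<in> Fun A D"
  shows "comp_fun A (fun_fst C D) (fun_pair A F G) = F" "comp_fun A (fun_snd C D) (fun_pair A F G) = G"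
  by (auto simp: fun_pair_def fun_fst_def fun_snd_def comp_fun_def compose_def Fun_undef[OF F] Fun_undef[OF G]
      Fun_simps[OF F] Fun_simps[OF G] intro!: funct.equality)

section \<open>The ordinals [n] and the maps between them\<close>

lemma ordinal_simps [simp]:
  "Obj (ordinal n) = {..n}" "(i, j) \<in> Arr (ordinal n) \<longleftrightarrow> i \<le> j \<and> j \<le> n"
  "i \<le> j \<Longrightarrow> j \<le> n \<Longrightarrow> Dom (ordinal n) (i, j) = i" "i \<le> j \<Longrightarrow> j \<le> n \<Longrightarrow> Cod (ordinal n) (i, j) = j"
  "i \<le> n \<Longrightarrow> Ide (ordinal n) i = (i, i)"
  "i \<le> j \<Longrightarrow> j \<le> k \<Longrightarrow> k \<le> n \<Longrightarrow> Comp (ordinal n) (j, k) (i, j) = (i, k)"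
  by (auto simp: ordinal_def Let_def)

lemma Arr_ordinal: "f \<in> Arr (ordinal n) \<longleftrightarrow> (\<exists>i j. f = (i, j) \<and> i \<le> j \<and> j \<le> n)"
  by (cases f) auto

lemma category_ordinal [simp]: "category (ordinal n)"
proof (rule categoryI)
  fix f assume "f \<in> Arr (ordinal n)"
  then show "Dom (ordinal n) f \<in> Obj (ordinal n)" "Cod (ordinal n) f \<in> Obj (ordinal n)"
    "Comp (ordinal n) f (Ide (ordinal n) (Dom (ordinal n) f)) = f"
    "Comp (ordinal n) (Ide (ordinal n) (Cod (ordinal n) f)) f = f"
    by (cases f; simp)+
next
  fix f assume "f \<notin> Arr (ordinal n)"
  then show "Dom (ordinal n) f = undefined" "Cod (ordinal n) f = undefined"
    by (simp_all add: ordinal_def Let_def restrict_def)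
next
  fix x assume "x \<notin> Obj (ordinal n)"
  then show "Ide (ordinal n) x = undefined" by (simp add: ordinal_def Let_def)
next
  fix g f assume "g \<in> Arr (ordinal n)" "f \<in> Arr (ordinal n)" "Dom (ordinal n) g = Cod (ordinal n) f"
  then show "Comp (ordinal n) g f \<in> Arr (ordinal n) \<and> Dom (ordinal n) (Comp (ordinal n) g f) = Dom (ordinal n) f \<and>
      Cod (ordinal n) (Comp (ordinal n) g f) = Cod (ordinal n) g"
    by (cases g; cases f) auto
next
  fix g f assume "\<not> composable (ordinal n) g f"
  then show "Comp (ordinal n) g f = undefined"
    by (cases g; cases f) (auto simp: composable_def ordinal_def Let_def)
next
  fix h g f assume "h \<in> Arr (ordinal n)" "g \<in> Arr (ordinal n)" "f \<in> Arr (ordinal n)"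
    "Dom (ordinal n) h = Cod (ordinal n) g" "Dom (ordinal n) g = Cod (ordinal n) f"
  then show "Comp (ordinal n) h (Comp (ordinal n) g f) = Comp (ordinal n) (Comp (ordinal n) h g) f"
    by (cases h; cases g; cases f) auto
qed auto

text \<open>An ordinal has at most one arrow between two objects, so a map of ordinals is its
  monotone vertex map. The concrete operators of the later constructions are given in this
  form.\<close>

definition delta_of :: "nat \<Rightarrow> (nat \<Rightarrow> nat) \<Rightarrow> delta" where
  "delta_of m f = \<lparr>FObj = (\<lambda>i\<in>{..m}. f i), FArr = (\<lambda>(i, j)\<in>Arr (ordinal m). (f i, f j))\<rparr>"

lemma delta_of_simps [simp]:
  "i \<le> m \<Longrightarrow> FObj (delta_of m f) i = f i"
  "i \<le> j \<Longrightarrow> j \<le> m \<Longrightarrow> FArr (delta_of m f) (i, j) = (f i, f j)"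
  by (auto simp: delta_of_def)

lemma delta_of_in:
  assumes "\<And>i j. i \<le> j \<Longrightarrow> j \<le> m \<Longrightarrow> f i \<le> f j" "\<And>i. i \<le> m \<Longrightarrow> f i \<le> n"
  shows "delta_of m f \<in> Delta m n"
proof (rule FunI)
  fix a assume "a \<in> Arr (ordinal m)"
  then show "FArr (delta_of m f) a \<in> Arr (ordinal n)"
    "Dom (ordinal n) (FArr (delta_of m f) a) = FObj (delta_of m f) (Dom (ordinal m) a)"
    "Cod (ordinal n) (FArr (delta_of m f) a) = FObj (delta_of m f) (Cod (ordinal m) a)"
    using assms by (cases a; simp)+
next
  fix b a assume "b \<in> Arr (ordinal m)" "a \<in> Arr (ordinal m)" "Dom (ordinal m) b = Cod (ordinal m) a"
  then show "FArr (delta_of m f) (Comp (ordinal m) b a) = Comp (ordinal n) (FArr (delta_of m f) b) (FArr (delta_of m f) a)"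
    using assms by (cases b; cases a) auto
qed (use assms in simp_all, simp_all add: delta_of_def)

lemma Delta_simps:
  assumes t: "\<theta> \<in> Delta m n"
  shows Delta_FArr: "i \<le> j \<Longrightarrow> j \<le> m \<Longrightarrow> FArr \<theta> (i, j) = (FObj \<theta> i, FObj \<theta> j)"
    and Delta_mono: "i \<le> j \<Longrightarrow> j \<le> m \<Longrightarrow> FObj \<theta> i \<le> FObj \<theta> j"
    and Delta_le: "i \<le> m \<Longrightarrow> FObj \<theta> i \<le> n"
proof -
  {
    assume ij: "i \<le> j" "j \<le> m"
    obtain p q where pq: "FArr \<theta> (i, j) = (p, q)" "p \<le> q" "q \<le> n"
      using Fun_simps(2)[OF t, of "(i, j)"] ij by (auto simp: Arr_ordinal)
    then show "FArr \<theta> (i, j) = (FObj \<theta> i, FObj \<theta> j)" "FObj \<theta> i \<le> FObj \<theta> j"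
      using Fun_simps(3,4)[OF t, of "(i, j)"] ij by auto
  }
  show "i \<le> m \<Longrightarrow> FObj \<theta> i \<le> n" using Fun_simps(1)[OF t, of i] by simp
qed

lemma Delta_ext:
  assumes t: "\<theta> \<in> Delta m n" "\<theta>' \<in> Delta m n" and "\<And>i. i \<le> m \<Longrightarrow> FObj \<theta> i = FObj \<theta>' i"
  shows "\<theta> = \<theta>'"
  using t by (rule Fun_ext) (use assms in \<open>auto simp: Arr_ordinal Delta_FArr[OF t(1)] Delta_FArr[OF t(2)]\<close>)

lemma Delta_comp: "\<eta> \<in> Delta l m \<Longrightarrow> \<theta> \<in> Delta m n \<Longrightarrow> comp_fun (ordinal l) \<theta> \<eta> \<in> Delta l n"
  by (rule comp_fun_in) auto

lemma Delta_id: "id_fun (ordinal n) \<in> Delta n n"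
  by (rule id_fun_in) auto

section \<open>Functors on a product and functors into a functor category\<close>

definition uncurry :: "('o, 'a) cat \<Rightarrow> ('p, 'b) cat \<Rightarrow> ('q, 'c) cat \<Rightarrow>
    ('p, 'b, ('o, 'a, 'q, 'c) funct, ('o, 'a, 'q, 'c) nattr) funct \<Rightarrow> ('o \<times> 'p, 'a \<times> 'b, 'q, 'c) funct" where
  "uncurry A B C x =
     \<lparr>FObj = (\<lambda>(a, b)\<in>Obj A \<times> Obj B. FObj (FObj x b) a),
      FArr = (\<lambda>(f, g)\<in>Arr A \<times> Arr B. Comp C (NComp (FArr x g) (Cod A f)) (FArr (FObj x (Dom B g)) f))\<rparr>"

definition curry_fun :: "('o, 'a) cat \<Rightarrow> ('p, 'b) cat \<Rightarrow> ('o \<times> 'p, 'a \<times> 'b, 'q, 'c) funct \<Rightarrow>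
    ('p, 'b, ('o, 'a, 'q, 'c) funct, ('o, 'a, 'q, 'c) nattr) funct" where
  "curry_fun A B \<gamma> =
     (let H = (\<lambda>b. \<lparr>FObj = (\<lambda>a\<in>Obj A. FObj \<gamma> (a, b)), FArr = (\<lambda>f\<in>Arr A. FArr \<gamma> (f, Ide B b))\<rparr>) in
      \<lparr>FObj = (\<lambda>b\<in>Obj B. H b),
       FArr = (\<lambda>g\<in>Arr B. \<lparr>NSrc = H (Dom B g), NTgt = H (Cod B g), NComp = (\<lambda>a\<in>Obj A. FArr \<gamma> (Ide A a, g))\<rparr>)\<rparr>)"

lemma uncurry_simps [simp]:
  "a \<in> Obj A \<Longrightarrow> b \<in> Obj B \<Longrightarrow> FObj (uncurry A B C x) (a, b) = FObj (FObj x b) a"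
  "f \<in> Arr A \<Longrightarrow> g \<in> Arr B \<Longrightarrow>
    FArr (uncurry A B C x) (f, g) = Comp C (NComp (FArr x g) (Cod A f)) (FArr (FObj x (Dom B g)) f)"
  by (auto simp: uncurry_def)

lemma Fun_fun_catD:
  assumes x: "x \<in> Fun B (fun_cat A C)"
  shows "b \<in> Obj B \<Longrightarrow> FObj x b \<in> Fun A C" "g \<in> Arr B \<Longrightarrow> FArr x g \<in> Nat_trans A C"
    "g \<in> Arr B \<Longrightarrow> NSrc (FArr x g) = FObj x (Dom B g)" "g \<in> Arr B \<Longrightarrow> NTgt (FArr x g) = FObj x (Cod B g)"
  using Fun_simps[OF x] by auto

text \<open>The image of (f, g) is the diagonal of a naturality square: along f in the functor at
  the source of g, then along the component of \<open>FArr x g\<close>. Going round the other way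
  would give the same arrow, and this is what makes composites work.\<close>

lemma uncurry_in:
  assumes A: "category A" and B: "category B" and C: "category C" and x: "x \<in> Fun B (fun_cat A C)"
  shows "uncurry A B C x \<in> Fun (prod_cat A B) C"
proof (rule FunI)
  note X = Fun_fun_catD[OF x]
  note N = Nat_simps[OF X(2)]
  note O = Fun_simps[OF X(1)]
  {
    fix ab assume "ab \<in> Obj (prod_cat A B)"
    then obtain a b where ab: "ab = (a, b)" "a \<in> Obj A" "b \<in> Obj B" by auto
    then show "FObj (uncurry A B C x) ab \<in> Obj C" by (simp add: O)
    have "FArr x (Ide B b) = Ide (fun_cat A C) (FObj x b)" using Fun_simps(5)[OF x] ab by simp
    then show "FArr (uncurry A B C x) (Ide (prod_cat A B) ab) = Ide C (FObj (uncurry A B C x) ab)"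
      using ab A B C X(1) by (simp add: O)
  }
  {
    fix fg assume "fg \<in> Arr (prod_cat A B)"
    then obtain f g where fg: "fg = (f, g)" "f \<in> Arr A" "g \<in> Arr B" by auto
    then show "FArr (uncurry A B C x) fg \<in> Arr C"
      "Dom C (FArr (uncurry A B C x) fg) = FObj (uncurry A B C x) (Dom (prod_cat A B) fg)"
      "Cod C (FArr (uncurry A B C x) fg) = FObj (uncurry A B C x) (Cod (prod_cat A B) fg)"
      using A B C by (simp_all add: O N X)
  }
  fix g' g assume gg: "g' \<in> Arr (prod_cat A B)" "g \<in> Arr (prod_cat A B)" "Dom (prod_cat A B) g' = Cod (prod_cat A B) g"
  obtain f u f' u' where fu: "g = (f, u)" "f \<in> Arr A" "u \<in> Arr B" "g' = (f', u')" "f' \<in> Arr A" "u' \<in> Arr B"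
    using gg by auto
  then have d: "Dom A f' = Cod A f" "Dom B u' = Cod B u" using gg by auto
  let ?n' = "NComp (FArr x u') (Cod A f')" and ?n = "NComp (FArr x u)" and ?F = "FObj x (Dom B u)" and ?F' = "FObj x (Cod B u)"
  \<comment> \<open>The one point that is not formal: the two middle factors of the composite are
    exchanged by naturality of \<open>FArr x u\<close> along f'.\<close>
  have nat: "Comp C (?n (Cod A f')) (FArr ?F f') = Comp C (FArr ?F' f') (?n (Cod A f))"
    using Nat_nat[OF X(2), of u f'] fu X d by simp
  have "FArr (uncurry A B C x) (Comp (prod_cat A B) g' g) =
    Comp C (Comp C ?n' (?n (Cod A f'))) (Comp C (FArr ?F f') (FArr ?F f))"
    using fu d A B C by (simp add: X Fun_Comp[OF x] Fun_Comp[OF X(1)])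
  also have "\<dots> = Comp C ?n' (Comp C (Comp C (?n (Cod A f')) (FArr ?F f')) (FArr ?F f))"
    using fu d A B C by (simp add: Comp_assoc X O N)
  also have "\<dots> = Comp C (Comp C ?n' (FArr ?F' f')) (Comp C (?n (Cod A f)) (FArr ?F f))"
    unfolding nat using fu d A B C by (simp add: Comp_assoc X O N)
  finally show "FArr (uncurry A B C x) (Comp (prod_cat A B) g' g) =
      Comp C (FArr (uncurry A B C x) g') (FArr (uncurry A B C x) g)"
    using fu d by simp
qed (auto simp: uncurry_def)

text \<open>On each axis one of the two factors is an identity. These restrictions recover x
  completely, and they express the invertibility of its components through the uncurried
  functor.\<close>

lemma uncurry_left:
  assumes A: "category A" and B: "category B" and C: "category C" and x: "x \<in> Fun B (fun_cat A C)"
  shows "f \<in> Arr A \<Longrightarrow> b \<in> Obj B \<Longrightarrow> FArr (uncurry A B C x) (f, Ide B b) = FArr (FObj x b) f"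
    and "a \<in> Obj A \<Longrightarrow> g \<in> Arr B \<Longrightarrow> FArr (uncurry A B C x) (Ide A a, g) = NComp (FArr x g) a"
proof -
  note X = Fun_fun_catD[OF x]
  note N = Nat_simps[OF X(2)]
  note O = Fun_simps[OF X(1)]
  show "f \<in> Arr A \<Longrightarrow> b \<in> Obj B \<Longrightarrow> FArr (uncurry A B C x) (f, Ide B b) = FArr (FObj x b) f"
    using A B C X(1) Fun_simps(5)[OF x, of b] by (simp add: O)
  show "a \<in> Obj A \<Longrightarrow> g \<in> Arr B \<Longrightarrow> FArr (uncurry A B C x) (Ide A a, g) = NComp (FArr x g) a"
    using A B C by (simp add: O N X)
qed

lemma uncurry_inj:
  fixes x y :: "('p, 'b, ('o, 'a, 'q, 'c) funct, ('o, 'a, 'q, 'c) nattr) funct"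
  assumes A: "category A" and B: "category B" and C: "category C" and x: "x \<in> Fun B (fun_cat A C)"
    and y: "y \<in> Fun B (fun_cat A C)" and eq: "uncurry A B C x = uncurry A B C y"
  shows "x = y"
proof -
  have o: "FObj x b = FObj y b" if b: "b \<in> Obj B" for b
    by (rule Fun_ext_Arr[OF A C Fun_fun_catD(1)[OF x b] Fun_fun_catD(1)[OF y b]])
      (use uncurry_left(1)[OF A B C x, of _ b] uncurry_left(1)[OF A B C y, of _ b] eq b in simp)
  show ?thesis
  proof (rule Fun_ext[OF x y o])
    fix g assume g: "g \<in> Arr B"
    show "FArr x g = FArr y g"
      by (rule Nat_ext[OF Fun_fun_catD(2)[OF x g] Fun_fun_catD(2)[OF y g]])
        (use uncurry_left(2)[OF A B C x, of _ g] uncurry_left(2)[OF A B C y, of _ g] eq g B o in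
          \<open>simp_all add: Fun_fun_catD[OF x] Fun_fun_catD[OF y]\<close>)
  qed auto
qed

lemma curry_fun_simps:
  "b \<in> Obj B \<Longrightarrow> a \<in> Obj A \<Longrightarrow> FObj (FObj (curry_fun A B \<gamma>) b) a = FObj \<gamma> (a, b)"
  "b \<in> Obj B \<Longrightarrow> f \<in> Arr A \<Longrightarrow> FArr (FObj (curry_fun A B \<gamma>) b) f = FArr \<gamma> (f, Ide B b)"
  "category B \<Longrightarrow> g \<in> Arr B \<Longrightarrow> NSrc (FArr (curry_fun A B \<gamma>) g) = FObj (curry_fun A B \<gamma>) (Dom B g)"
  "category B \<Longrightarrow> g \<in> Arr B \<Longrightarrow> NTgt (FArr (curry_fun A B \<gamma>) g) = FObj (curry_fun A B \<gamma>) (Cod B g)"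
  "g \<in> Arr B \<Longrightarrow> a \<in> Obj A \<Longrightarrow> NComp (FArr (curry_fun A B \<gamma>) g) a = FArr \<gamma> (Ide A a, g)"
  by (auto simp: curry_fun_def Let_def)

lemma curry_fun_in:
  assumes A: "category A" and B: "category B" and C: "category C" and g: "\<gamma> \<in> Fun (prod_cat A B) C"
  shows "curry_fun A B \<gamma> \<in> Fun B (fun_cat A C)"
proof (rule FunI)
  note S = curry_fun_simps
  note G = Fun_simps[OF g]
  have G5: "a \<in> Obj A \<Longrightarrow> b \<in> Obj B \<Longrightarrow> FArr \<gamma> (Ide A a, Ide B b) = Ide C (FObj \<gamma> (a, b))" for a b
    using G(5)[of "(a, b)"] by simp
  have GC: "Comp C (FArr \<gamma> (f', g')) (FArr \<gamma> (f, g)) = FArr \<gamma> (Comp A f' f, Comp B g' g)"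
    if "f' \<in> Arr A" "f \<in> Arr A" "g' \<in> Arr B" "g \<in> Arr B" "Dom A f' = Cod A f" "Dom B g' = Cod B g" for f' f g' g
    using Fun_Comp[OF g, of "(f', g')" "(f, g)"] that by simp
  have 1: "FObj (curry_fun A B \<gamma>) b \<in> Fun A C" if b: "b \<in> Obj B" for b
    by (rule FunI) (use A B C b in \<open>simp_all add: S G G5 GC\<close>, simp_all add: curry_fun_def)
  have 2: "FArr (curry_fun A B \<gamma>) u \<in> Nat_trans A C" if u: "u \<in> Arr B" for u
    by (rule NatI) (use A B C u in \<open>simp_all add: S G G5 GC 1\<close>, simp_all add: curry_fun_def)
  {
    fix b assume b: "b \<in> Obj B"
    show "FObj (curry_fun A B \<gamma>) b \<in> Obj (fun_cat A C)" using 1[OF b] by simp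
    show "FArr (curry_fun A B \<gamma>) (Ide B b) = Ide (fun_cat A C) (FObj (curry_fun A B \<gamma>) b)"
      by (rule Nat_ext[OF 2 Ide_fun_cat_in[OF A C 1[OF b]]])
        (use A B C b 1[OF b] in \<open>simp_all add: S G5\<close>)
  }
  {
    fix u assume u: "u \<in> Arr B"
    show "FArr (curry_fun A B \<gamma>) u \<in> Arr (fun_cat A C)" using 2[OF u] by simp
    show "Dom (fun_cat A C) (FArr (curry_fun A B \<gamma>) u) = FObj (curry_fun A B \<gamma>) (Dom B u)"
      "Cod (fun_cat A C) (FArr (curry_fun A B \<gamma>) u) = FObj (curry_fun A B \<gamma>) (Cod B u)"
      using 2[OF u] u B by (simp_all add: S)
  }
  fix u' u assume u: "u' \<in> Arr B" "u \<in> Arr B" "Dom B u' = Cod B u"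
  have s: "NSrc (FArr (curry_fun A B \<gamma>) u') = NTgt (FArr (curry_fun A B \<gamma>) u)" using u B by (simp add: S)
  show "FArr (curry_fun A B \<gamma>) (Comp B u' u) =
      Comp (fun_cat A C) (FArr (curry_fun A B \<gamma>) u') (FArr (curry_fun A B \<gamma>) u)"
    by (rule Nat_ext[OF 2 Comp_fun_cat_in[OF A C 2[OF u(2)] 2[OF u(1)] s]])
      (use u A B C 2[OF u(1)] 2[OF u(2)] s in \<open>simp_all add: S GC\<close>)
qed (simp_all add: curry_fun_def)

text \<open>Every arrow (f, u) is (id, u) after (f, id), and \<open>uncurry\<close> multiplies the
  two values in exactly this order.\<close>

lemma uncurry_curry:
  fixes \<gamma> :: "('o \<times> 'p, 'a \<times> 'b, 'q, 'c) funct"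
  assumes A: "category A" and B: "category B" and C: "category C" and g: "\<gamma> \<in> Fun (prod_cat A B) C"
  shows "uncurry A B C (curry_fun A B \<gamma>) = \<gamma>"
proof (rule Fun_ext_Arr[OF _ C uncurry_in[OF A B C curry_fun_in[OF A B C g]] g])
  fix fg assume "fg \<in> Arr (prod_cat A B)"
  then obtain f u where fu: "fg = (f, u)" "f \<in> Arr A" "u \<in> Arr B" by auto
  then show "FArr (uncurry A B C (curry_fun A B \<gamma>)) fg = FArr \<gamma> fg"
    using A B Fun_Comp[OF g, of "(Ide A (Cod A f), u)" "(f, Ide B (Dom B u))"] by (simp add: curry_fun_simps)
qed (use A B in simp)

text \<open>Naturality in all three categories at once. After it, simplicial operators and induced
  maps are mere pre- and postcomposition.\<close>

lemma uncurry_natural: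
  assumes A: "category A" and B: "category B" and C: "category C" and x: "x \<in> Fun B (fun_cat A C)"
    and A': "category A'" and B': "category B'" and C': "category C'"
    and u: "u \<in> Fun A' A" and v: "v \<in> Fun C C'" and w: "w \<in> Fun B' B"
  shows "uncurry A' B' C' (comp_fun B' (comp_fun B (fun_cat_map A' A C u v) x) w) =
    comp_fun (prod_cat A' B') v (comp_fun (prod_cat A' B') (uncurry A B C x) (fun_prod A' B' u w))"
proof (rule Fun_ext_Arr[OF _ C'])
  note X = Fun_fun_catD[OF x]
  note N = Nat_simps[OF X(2)]
  note O = Fun_simps[OF X(1)]
  note U = Fun_simps[OF u] Fun_simps[OF w]
  have c: "comp_fun B' (comp_fun B (fun_cat_map A' A C u v) x) w \<in> Fun B' (fun_cat A' C')"
    using assms by (intro comp_fun_in[OF B' w] comp_fun_in[OF B x] fun_cat_map_in) auto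
  show "uncurry A' B' C' (comp_fun B' (comp_fun B (fun_cat_map A' A C u v) x) w) \<in> Fun (prod_cat A' B') C'"
    by (rule uncurry_in[OF A' B' C' c])
  show "comp_fun (prod_cat A' B') v (comp_fun (prod_cat A' B') (uncurry A B C x) (fun_prod A' B' u w)) \<in> Fun (prod_cat A' B') C'"
    by (intro comp_fun_in[OF _ _ v] comp_fun_in[OF _ _ uncurry_in[OF A B C x]] fun_prod_in u w) (use A' B' in auto)
  fix fg assume "fg \<in> Arr (prod_cat A' B')"
  then obtain f g where fg: "fg = (f, g)" "f \<in> Arr A'" "g \<in> Arr B'" by auto
  then show "FArr (uncurry A' B' C' (comp_fun B' (comp_fun B (fun_cat_map A' A C u v) x) w)) fg =
    FArr (comp_fun (prod_cat A' B') v (comp_fun (prod_cat A' B') (uncurry A B C x) (fun_prod A' B' u w))) fg"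
    using A B C A' B' by (simp add: U X O N Fun_Comp[OF v])
qed (use A' B' in simp)

text \<open>Isomorphisms of functors are detected on components, and by \<open>uncurry_left\<close>
  the components are the values on pairs (identity, g). So landing in the maximal subgroupoid means
  inverting one of the two directions of the product.\<close>

lemma Fun_iso_fun_cat_iff:
  assumes A: "category A" and B: "category B" and C: "category C"
  shows "x \<in> Fun B (iso_cat (fun_cat A C)) \<longleftrightarrow> x \<in> Fun B (fun_cat A C) \<and>
    (\<forall>a\<in>Obj A. \<forall>g\<in>Arr B. FArr (uncurry A B C x) (Ide A a, g) \<in> iso_arrows C)"
proof
  assume x: "x \<in> Fun B (iso_cat (fun_cat A C))"
  then have x': "x \<in> Fun B (fun_cat A C)" using Fun_iso_cat_incl[of "fun_cat A C" B x] A B C by simp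
  have "FArr (uncurry A B C x) (Ide A a, g) \<in> iso_arrows C" if "a \<in> Obj A" "g \<in> Arr B" for a g
    using Fun_simps(2)[OF x, of g] that uncurry_left(2)[OF A B C x'] by (simp add: iso_arrows_fun_cat[OF A C])
  with x' show "x \<in> Fun B (fun_cat A C) \<and>
    (\<forall>a\<in>Obj A. \<forall>g\<in>Arr B. FArr (uncurry A B C x) (Ide A a, g) \<in> iso_arrows C)" by blast
next
  assume r: "x \<in> Fun B (fun_cat A C) \<and>
    (\<forall>a\<in>Obj A. \<forall>g\<in>Arr B. FArr (uncurry A B C x) (Ide A a, g) \<in> iso_arrows C)"
  then have x: "x \<in> Fun B (fun_cat A C)" by simp
  show "x \<in> Fun B (iso_cat (fun_cat A C))"
  proof (rule Fun_iso_catI[OF _ B x])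
    fix g assume g: "g \<in> Arr B"
    then have "NComp (FArr x g) a \<in> iso_arrows C" if "a \<in> Obj A" for a
      using r uncurry_left(2)[OF A B C x that g] that by metis
    then show "FArr x g \<in> iso_arrows (fun_cat A C)"
      using Fun_fun_catD(2)[OF x g] by (simp add: iso_arrows_fun_cat[OF A C])
  qed (use A C in simp)
qed

section \<open>Nerves and the classifying diagram\<close>

lemma nerve_simps [simp]:
  "Sim (nerve C) n = Fun (ordinal n) C"
  "\<theta> \<in> Delta m n \<Longrightarrow> \<sigma> \<in> Fun (ordinal n) C \<Longrightarrow> Act (nerve C) m n \<theta> \<sigma> = comp_fun (ordinal m) \<sigma> \<theta>"
  "\<sigma> \<in> Fun (ordinal n) C \<Longrightarrow> nerve_map C F n \<sigma> = comp_fun (ordinal n) F \<sigma>"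
  by (auto simp: nerve_def nerve_map_def)

lemma is_ssetI:
  assumes "\<And>m n \<theta>. \<theta> \<notin> Delta m n \<Longrightarrow> Act X m n \<theta> = undefined"
    and "\<And>m n \<theta> x. \<theta> \<in> Delta m n \<Longrightarrow> x \<notin> Sim X n \<Longrightarrow> Act X m n \<theta> x = undefined"
    and "\<And>m n \<theta> x. \<theta> \<in> Delta m n \<Longrightarrow> x \<in> Sim X n \<Longrightarrow> Act X m n \<theta> x \<in> Sim X m"
    and "\<And>n x. x \<in> Sim X n \<Longrightarrow> Act X n n (id_fun (ordinal n)) x = x"
    and "\<And>l m n \<eta> \<theta> x. \<eta> \<in> Delta l m \<Longrightarrow> \<theta> \<in> Delta m n \<Longrightarrow> x \<in> Sim X n \<Longrightarrow>
      Act X l n (comp_fun (ordinal l) \<theta> \<eta>) x = Act X l m \<eta> (Act X m n \<theta> x)"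
  shows "is_sset X"
  unfolding is_sset_def
proof (intro conjI allI ballI)
  fix m n show "Act X m n \<in> Delta m n \<rightarrow>\<^sub>E Sim X n \<rightarrow>\<^sub>E Sim X m"
    using assms by (auto simp: PiE_iff extensional_def)
  show "Act X n n (id_fun (ordinal n)) = (\<lambda>x\<in>Sim X n. x)"
    using assms(4) assms(2)[OF Delta_id] by (auto simp: fun_eq_iff)
  fix l \<eta> \<theta> assume "\<eta> \<in> Delta l m" "\<theta> \<in> Delta m n"
  then show "Act X l n (comp_fun (ordinal l) \<theta> \<eta>) = compose (Sim X n) (Act X l m \<eta>) (Act X m n \<theta>)"
    using assms(5) assms(2)[OF Delta_comp] by (auto simp: fun_eq_iff compose_def)
qed

lemma is_ssetD:
  assumes "is_sset X"
  shows "\<theta> \<in> Delta m n \<Longrightarrow> x \<in> Sim X n \<Longrightarrow> Act X m n \<theta> x \<in> Sim X m"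
    and "x \<in> Sim X n \<Longrightarrow> Act X n n (id_fun (ordinal n)) x = x"
    and "\<eta> \<in> Delta l m \<Longrightarrow> \<theta> \<in> Delta m n \<Longrightarrow> x \<in> Sim X n \<Longrightarrow>
      Act X l n (comp_fun (ordinal l) \<theta> \<eta>) x = Act X l m \<eta> (Act X m n \<theta> x)"
    and "\<theta> \<notin> Delta m n \<Longrightarrow> Act X m n \<theta> = undefined"
    and "\<theta> \<in> Delta m n \<Longrightarrow> x \<notin> Sim X n \<Longrightarrow> Act X m n \<theta> x = undefined"
proof -
  have 1: "Act X m n \<in> Delta m n \<rightarrow>\<^sub>E Sim X n \<rightarrow>\<^sub>E Sim X m"
    and 2: "Act X n n (id_fun (ordinal n)) = (\<lambda>x\<in>Sim X n. x)" for m n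
    using assms unfolding is_sset_def by auto
  have 3: "\<eta> \<in> Delta l m \<Longrightarrow> \<theta> \<in> Delta m n \<Longrightarrow>
      Act X l n (comp_fun (ordinal l) \<theta> \<eta>) = compose (Sim X n) (Act X l m \<eta>) (Act X m n \<theta>)"
    using assms unfolding is_sset_def by auto
  show "\<theta> \<in> Delta m n \<Longrightarrow> x \<in> Sim X n \<Longrightarrow> Act X m n \<theta> x \<in> Sim X m" using 1 by blast
  show "x \<in> Sim X n \<Longrightarrow> Act X n n (id_fun (ordinal n)) x = x" using 2 by simp
  show "\<eta> \<in> Delta l m \<Longrightarrow> \<theta> \<in> Delta m n \<Longrightarrow> x \<in> Sim X n \<Longrightarrow>
      Act X l n (comp_fun (ordinal l) \<theta> \<eta>) x = Act X l m \<eta> (Act X m n \<theta> x)"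
    using 3 by (simp add: compose_def)
  show "\<theta> \<notin> Delta m n \<Longrightarrow> Act X m n \<theta> = undefined" using 1[of m n] by (simp add: PiE_iff extensional_def)
  show "\<theta> \<in> Delta m n \<Longrightarrow> x \<notin> Sim X n \<Longrightarrow> Act X m n \<theta> x = undefined"
    using 1[of m n] by (auto simp: PiE_iff extensional_def)
qed

lemma sset_homI:
  assumes "\<And>n x. x \<in> Sim X n \<Longrightarrow> f n x \<in> Sim Y n" "\<And>n x. x \<notin> Sim X n \<Longrightarrow> f n x = undefined"
    "\<And>m n \<theta> x. \<theta> \<in> Delta m n \<Longrightarrow> x \<in> Sim X n \<Longrightarrow> f m (Act X m n \<theta> x) = Act Y m n \<theta> (f n x)"
  shows "f \<in> sset_hom X Y"
  using assms by (auto simp: sset_hom_def PiE_iff extensional_def)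

lemma sset_homD:
  assumes "f \<in> sset_hom X Y"
  shows "x \<in> Sim X n \<Longrightarrow> f n x \<in> Sim Y n" "x \<notin> Sim X n \<Longrightarrow> f n x = undefined"
    "\<theta> \<in> Delta m n \<Longrightarrow> x \<in> Sim X n \<Longrightarrow> f m (Act X m n \<theta> x) = Act Y m n \<theta> (f n x)"
  using assms by (auto simp: sset_hom_def PiE_iff extensional_def)

lemma sset_comp_apply [simp]: "x \<in> Sim X n \<Longrightarrow> sset_comp X g f n x = g n (f n x)"
  and sset_id_apply [simp]: "x \<in> Sim X n \<Longrightarrow> sset_id X n x = x"
  and sset_comp_undef: "x \<notin> Sim X n \<Longrightarrow> sset_comp X g f n x = undefined"
  and sset_id_undef: "x \<notin> Sim X n \<Longrightarrow> sset_id X n x = undefined"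
  by (auto simp: sset_comp_def sset_id_def compose_def)

lemma sset_comp_eqI:
  assumes "\<And>n x. x \<in> Sim X n \<Longrightarrow> g n (f n x) = g' n (f' n x)"
  shows "sset_comp X g f = sset_comp X g' f'"
  using assms by (auto simp: sset_comp_def compose_def fun_eq_iff)

lemma sset_hom_ext:
  assumes "f \<in> sset_hom X Y" "g \<in> sset_hom X Z" "\<And>n x. x \<in> Sim X n \<Longrightarrow> f n x = g n x"
  shows "f = g"
proof (intro ext)
  fix n x show "f n x = g n x"
    using assms(3) sset_homD(2)[OF assms(1)] sset_homD(2)[OF assms(2)] by (cases "x \<in> Sim X n") auto
qed

lemma sset_comp_in:
  assumes f: "f \<in> sset_hom X Y" and g: "g \<in> sset_hom Y Z" and X: "is_sset X"
  shows "sset_comp X g f \<in> sset_hom X Z"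
  by (rule sset_homI)
    (simp_all add: sset_homD[OF f] sset_homD[OF g] is_ssetD[OF X] sset_comp_undef)

lemma sset_id_in: "is_sset X \<Longrightarrow> sset_id X \<in> sset_hom X X"
  by (rule sset_homI) (simp_all add: is_ssetD sset_id_undef)

lemma is_sset_nerve [simp]:
  assumes C: "category C" shows "is_sset (nerve C)"
proof (rule is_ssetI)
  fix l m n \<eta> \<theta> \<sigma> assume e: "\<eta> \<in> Delta l m" and t: "\<theta> \<in> Delta m n" and s: "\<sigma> \<in> Sim (nerve C) n"
  have "comp_fun (ordinal m) \<sigma> \<theta> \<in> Fun (ordinal m) C" using t s by (auto intro: comp_fun_in)
  then show "Act (nerve C) l n (comp_fun (ordinal l) \<theta> \<eta>) \<sigma> = Act (nerve C) l m \<eta> (Act (nerve C) m n \<theta> \<sigma>)"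
    using e t s by (simp add: Delta_comp comp_fun_assoc[OF e])
next
  fix m n \<theta> \<sigma> assume "\<theta> \<in> Delta m n" "\<sigma> \<in> Sim (nerve C) n"
  then show "Act (nerve C) m n \<theta> \<sigma> \<in> Sim (nerve C) m" by (auto intro: comp_fun_in)
next
  fix n \<sigma> assume "\<sigma> \<in> Sim (nerve C) n"
  then have s: "\<sigma> \<in> Fun (ordinal n) C" by simp
  then show "Act (nerve C) n n (id_fun (ordinal n)) \<sigma> = \<sigma>"
    by (simp add: Delta_id comp_fun_id[OF s])
qed (auto simp: nerve_def)

lemma nerve_map_in:
  assumes F: "F \<in> Fun C D" shows "nerve_map C F \<in> sset_hom (nerve C) (nerve D)"
proof (rule sset_homI)
  fix n \<sigma> assume "\<sigma> \<in> Sim (nerve C) n"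
  then show "nerve_map C F n \<sigma> \<in> Sim (nerve D) n" using F by (auto intro: comp_fun_in)
next
  fix m n \<theta> \<sigma> assume t: "\<theta> \<in> Delta m n" and s: "\<sigma> \<in> Sim (nerve C) n"
  then have "comp_fun (ordinal m) \<sigma> \<theta> \<in> Fun (ordinal m) C" "comp_fun (ordinal n) F \<sigma> \<in> Fun (ordinal n) D"
    using F by (auto intro: comp_fun_in)
  then show "nerve_map C F m (Act (nerve C) m n \<theta> \<sigma>) = Act (nerve D) m n \<theta> (nerve_map C F n \<sigma>)"
    using t s by (simp add: comp_fun_assoc[OF t])
qed (auto simp: nerve_map_def)

lemma nerve_map_comp:
  assumes F: "F \<in> Fun C D"
  shows "nerve_map C (comp_fun C G F) = sset_comp (nerve C) (nerve_map D G) (nerve_map C F)"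
proof (intro ext)
  fix n \<sigma> show "nerve_map C (comp_fun C G F) n \<sigma> = sset_comp (nerve C) (nerve_map D G) (nerve_map C F) n \<sigma>"
  proof (cases "\<sigma> \<in> Fun (ordinal n) C")
    case True
    then have "comp_fun (ordinal n) F \<sigma> \<in> Fun (ordinal n) D" using F by (auto intro: comp_fun_in)
    with True show ?thesis by (simp add: comp_fun_assoc[OF True])
  qed (auto simp: nerve_map_def sset_comp_undef)
qed

lemma nerve_map_id: "nerve_map C (id_fun C) = sset_id (nerve C)"
  by (auto simp: nerve_map_def sset_id_def fun_eq_iff comp_fun_id)

section \<open>The groupoids whose nerves are the levels of NC\<close>

definition level_cat :: "('o, 'a) cat \<Rightarrow> nat \<Rightarrow>
    ((nat, nat \<times> nat, 'o, 'a) funct, (nat, nat \<times> nat, 'o, 'a) nattr) cat" where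
  "level_cat C m = iso_cat (fun_cat (ordinal m) C)"

text \<open>Covers both kinds of structure: the operators of NC when f is an identity, and the map
  Nf when \<theta> is an identity. Statements that mix the two then follow from the single law
  \<open>level_fun_comp\<close>.\<close>

definition level_fun where
  "level_fun C m n \<theta> f = iso_fun (fun_cat (ordinal n) C) (fun_cat_map (ordinal m) (ordinal n) C \<theta> f)"

lemma category_level_cat [simp]: "category C \<Longrightarrow> category (level_cat C m)"
  by (simp add: level_cat_def)

lemma Obj_level_cat: "Obj (level_cat C m) = Fun (ordinal m) C"
  by (simp add: level_cat_def)

lemma level_fun_in:
  assumes "category C" "category D" "\<theta> \<in> Delta m n" "f \<in> Fun C D"
  shows "level_fun C m n \<theta> f \<in> Fun (level_cat C n) (level_cat D m)"
  unfolding level_fun_def level_cat_def using assms by (intro iso_fun_in fun_cat_map_in) auto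

lemma level_fun_comp:
  assumes "category C" "category D" "category E" "\<eta> \<in> Delta l m" "\<theta> \<in> Delta m n" "f \<in> Fun C D" "g \<in> Fun D E"
  shows "level_fun C l n (comp_fun (ordinal l) \<theta> \<eta>) (comp_fun C g f) =
    comp_fun (level_cat C n) (level_fun D l m \<eta> g) (level_fun C m n \<theta> f)"
proof -
  have 1: "fun_cat_map (ordinal m) (ordinal n) C \<theta> f \<in> Fun (fun_cat (ordinal n) C) (fun_cat (ordinal m) D)"
    using assms by (intro fun_cat_map_in) auto
  have "fun_cat_map (ordinal l) (ordinal n) C (comp_fun (ordinal l) \<theta> \<eta>) (comp_fun C g f) =
    comp_fun (fun_cat (ordinal n) C) (fun_cat_map (ordinal l) (ordinal m) D \<eta> g) (fun_cat_map (ordinal m) (ordinal n) C \<theta> f)"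
    using assms by (intro fun_cat_map_comp) auto
  then show ?thesis
    unfolding level_fun_def level_cat_def using assms by (simp add: iso_fun_comp[OF _ 1])
qed

lemma level_fun_id:
  assumes "category C" shows "level_fun C n n (id_fun (ordinal n)) (id_fun C) = id_fun (level_cat C n)"
  unfolding level_fun_def level_cat_def using assms by (simp add: fun_cat_map_id iso_fun_id)

lemma classifying_diagram_simps [simp]:
  "Lev (classifying_diagram C) m = nerve (level_cat C m)"
  "\<theta> \<in> Delta m n \<Longrightarrow> SAct (classifying_diagram C) m n \<theta> = nerve_map (level_cat C n) (level_fun C m n \<theta> (id_fun C))"
  by (auto simp: classifying_diagram_def level_cat_def level_fun_def)

lemma classifying_map_eq:
  "classifying_map C f m = nerve_map (level_cat C m) (level_fun C m m (id_fun (ordinal m)) f)"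
  by (auto simp: classifying_map_def level_cat_def level_fun_def)

section \<open>The functor N from categories to simplicial spaces\<close>

lemma is_sspaceI:
  assumes "\<And>m. is_sset (Lev X m)" "\<And>m n \<theta>. \<theta> \<notin> Delta m n \<Longrightarrow> SAct X m n \<theta> = undefined"
    "\<And>m n \<theta>. \<theta> \<in> Delta m n \<Longrightarrow> SAct X m n \<theta> \<in> sset_hom (Lev X n) (Lev X m)"
    "\<And>n. SAct X n n (id_fun (ordinal n)) = sset_id (Lev X n)"
    "\<And>l m n \<eta> \<theta>. \<eta>\<in>Delta l m \<Longrightarrow> \<theta>\<in>Delta m n \<Longrightarrow>
        SAct X l n (comp_fun (ordinal l) \<theta> \<eta>) = sset_comp (Lev X n) (SAct X l m \<eta>) (SAct X m n \<theta>)"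
  shows "is_sspace X"
  using assms unfolding is_sspace_def by (auto simp: PiE_iff extensional_def)

lemma is_sspaceD:
  assumes "is_sspace X"
  shows "is_sset (Lev X m)" "\<theta> \<notin> Delta m n \<Longrightarrow> SAct X m n \<theta> = undefined"
    "\<theta> \<in> Delta m n \<Longrightarrow> SAct X m n \<theta> \<in> sset_hom (Lev X n) (Lev X m)"
    "SAct X n n (id_fun (ordinal n)) = sset_id (Lev X n)"
    "\<eta>\<in>Delta l m \<Longrightarrow> \<theta>\<in>Delta m n \<Longrightarrow>
        SAct X l n (comp_fun (ordinal l) \<theta> \<eta>) = sset_comp (Lev X n) (SAct X l m \<eta>) (SAct X m n \<theta>)"
  using assms unfolding is_sspace_def by (auto simp: PiE_iff extensional_def)

lemma sspace_homI:
  assumes "\<And>m. f m \<in> sset_hom (Lev X m) (Lev Y m)"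
    "\<And>m n \<theta> k x. \<theta> \<in> Delta m n \<Longrightarrow> x \<in> Sim (Lev X n) k \<Longrightarrow> f m k (SAct X m n \<theta> k x) = SAct Y m n \<theta> k (f n k x)"
  shows "f \<in> sspace_hom X Y"
  using assms unfolding sspace_hom_def by (auto intro!: sset_comp_eqI)

lemma sspace_homD:
  assumes "f \<in> sspace_hom X Y"
  shows "f m \<in> sset_hom (Lev X m) (Lev Y m)"
    and "\<theta> \<in> Delta m n \<Longrightarrow> x \<in> Sim (Lev X n) k \<Longrightarrow> f m k (SAct X m n \<theta> k x) = SAct Y m n \<theta> k (f n k x)"
proof -
  show "f m \<in> sset_hom (Lev X m) (Lev Y m)" using assms unfolding sspace_hom_def by auto
  assume "\<theta> \<in> Delta m n" and x: "x \<in> Sim (Lev X n) k"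
  then have "sset_comp (Lev X n) (f m) (SAct X m n \<theta>) = sset_comp (Lev X n) (SAct Y m n \<theta>) (f n)"
    using assms unfolding sspace_hom_def by auto
  then have "sset_comp (Lev X n) (f m) (SAct X m n \<theta>) k x = sset_comp (Lev X n) (SAct Y m n \<theta>) (f n) k x" by simp
  then show "f m k (SAct X m n \<theta> k x) = SAct Y m n \<theta> k (f n k x)" using x by simp
qed

lemma is_sspace_classifying_diagram:
  assumes C: "category C" shows "is_sspace (classifying_diagram C)"
proof (rule is_sspaceI)
  fix l m n \<eta> \<theta> assume e: "\<eta> \<in> Delta l m" and t: "\<theta> \<in> Delta m n"
  note i = id_fun_in[OF C]
  have "level_fun C l n (comp_fun (ordinal l) \<theta> \<eta>) (id_fun C) =
      comp_fun (level_cat C n) (level_fun C l m \<eta> (id_fun C)) (level_fun C m n \<theta> (id_fun C))"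
    using level_fun_comp[OF C C C e t i i] comp_fun_id[OF i] by simp
  then show "SAct (classifying_diagram C) l n (comp_fun (ordinal l) \<theta> \<eta>) =
    sset_comp (Lev (classifying_diagram C) n) (SAct (classifying_diagram C) l m \<eta>) (SAct (classifying_diagram C) m n \<theta>)"
    using e t by (simp add: Delta_comp nerve_map_comp[OF level_fun_in[OF C C t i]])
qed (use C in \<open>simp_all add: nerve_map_in level_fun_in id_fun_in Delta_id level_fun_id nerve_map_id\<close>,
    simp add: classifying_diagram_def)

text \<open>Both composites in the compatibility square are \<open>level_fun\<close> of the pair
  (\<theta>, f), factored in the two possible orders.\<close>

lemma classifying_map_in:
  assumes C: "category C" and D: "category D" and f: "f \<in> Fun C D"
  shows "classifying_map C f \<in> sspace_hom (classifying_diagram C) (classifying_diagram D)"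
proof (rule sspace_homI)
  fix m show "classifying_map C f m \<in> sset_hom (Lev (classifying_diagram C) m) (Lev (classifying_diagram D) m)"
    unfolding classifying_map_eq using assms by (simp add: nerve_map_in level_fun_in Delta_id)
next
  fix m n \<theta> k x assume t: "\<theta> \<in> Delta m n" and "x \<in> Sim (Lev (classifying_diagram C) n) k"
  then have x: "x \<in> Fun (ordinal k) (level_cat C n)" by simp
  note i = id_fun_in[OF C] id_fun_in[OF D]
  have "level_fun C m n \<theta> f = comp_fun (level_cat C n) (level_fun C m m (id_fun (ordinal m)) f) (level_fun C m n \<theta> (id_fun C))"
    using level_fun_comp[OF C C D Delta_id t i(1) f] comp_fun_id[OF f] comp_fun_id[OF t] by simp
  moreover have "level_fun C m n \<theta> f = comp_fun (level_cat C n) (level_fun D m n \<theta> (id_fun D)) (level_fun C n n (id_fun (ordinal n)) f)"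
    using level_fun_comp[OF C D D t Delta_id f i(2)] comp_fun_id[OF f] comp_fun_id[OF t] by simp
  ultimately have eq: "comp_fun (level_cat C n) (level_fun C m m (id_fun (ordinal m)) f) (level_fun C m n \<theta> (id_fun C)) =
    comp_fun (level_cat C n) (level_fun D m n \<theta> (id_fun D)) (level_fun C n n (id_fun (ordinal n)) f)" by metis
  have 1: "level_fun C m n \<theta> (id_fun C) \<in> Fun (level_cat C n) (level_cat C m)"
    and 2: "level_fun C n n (id_fun (ordinal n)) f \<in> Fun (level_cat C n) (level_cat D n)"
    using assms t by (auto intro!: level_fun_in id_fun_in)
  show "classifying_map C f m k (SAct (classifying_diagram C) m n \<theta> k x) =
    SAct (classifying_diagram D) m n \<theta> k (classifying_map C f n k x)"
    using t x comp_fun_in[OF category_ordinal x 1] comp_fun_in[OF category_ordinal x 2] eq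
    by (simp add: classifying_map_eq comp_fun_assoc[OF x])
qed

lemma classifying_map_comp:
  assumes C: "category C" and D: "category D" and E: "category E" and f: "f \<in> Fun C D" and g: "g \<in> Fun D E"
  shows "classifying_map C (comp_fun C g f) =
        sspace_comp (classifying_diagram C) (classifying_map D g) (classifying_map C f)"
proof
  fix m
  have "level_fun C m m (id_fun (ordinal m)) (comp_fun C g f) =
    comp_fun (level_cat C m) (level_fun D m m (id_fun (ordinal m)) g) (level_fun C m m (id_fun (ordinal m)) f)"
    using level_fun_comp[OF C D E Delta_id Delta_id f g] comp_fun_id[OF Delta_id] by simp
  then show "classifying_map C (comp_fun C g f) m =
      sspace_comp (classifying_diagram C) (classifying_map D g) (classifying_map C f) m"
    by (simp add: classifying_map_eq sspace_comp_def nerve_map_comp[OF level_fun_in[OF C D Delta_id f]])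
qed

lemma classifying_map_id:
  assumes "category C" shows "classifying_map C (id_fun C) = sspace_id (classifying_diagram C)"
  using assms by (simp add: fun_eq_iff classifying_map_eq sspace_id_def level_fun_id nerve_map_id)

section \<open>Simplices of the classifying diagram as grids\<close>

definition flat :: "('o, 'a) cat \<Rightarrow> nat \<Rightarrow> nat \<Rightarrow> ('o, 'a) csimp \<Rightarrow>
    (nat \<times> nat, (nat \<times> nat) \<times> (nat \<times> nat), 'o, 'a) funct" where
  "flat C m n x = uncurry (ordinal m) (ordinal n) C x"

abbreviation grid :: "nat \<Rightarrow> nat \<Rightarrow> (nat \<times> nat, (nat \<times> nat) \<times> (nat \<times> nat)) cat" where
  "grid m n \<equiv> prod_cat (ordinal m) (ordinal n)"

text \<open>The first coordinate is the categorical direction, with arbitrary arrows of C; the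
  second is the spatial one, whose arrows are the components of natural isomorphisms.\<close>

definition Grid :: "('o, 'a) cat \<Rightarrow> nat \<Rightarrow> nat \<Rightarrow> (nat \<times> nat, (nat \<times> nat) \<times> (nat \<times> nat), 'o, 'a) funct set" where
  "Grid C m n = {\<gamma> \<in> Fun (grid m n) C. \<forall>i p q. i \<le> m \<longrightarrow> p \<le> q \<longrightarrow> q \<le> n \<longrightarrow> FArr \<gamma> ((i, i), (p, q)) \<in> iso_arrows C}"

lemma Fun_level_cat_iff:
  assumes C: "category C"
  shows "x \<in> Fun (ordinal n) (level_cat C m) \<longleftrightarrow> x \<in> Fun (ordinal n) (fun_cat (ordinal m) C) \<and> flat C m n x \<in> Grid C m n"
proof -
  have "(\<forall>a\<in>Obj (ordinal m). \<forall>g\<in>Arr (ordinal n). FArr (flat C m n x) (Ide (ordinal m) a, g) \<in> iso_arrows C) \<longleftrightarrow>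
    flat C m n x \<in> Grid C m n" if "x \<in> Fun (ordinal n) (fun_cat (ordinal m) C)"
    using uncurry_in[OF _ _ C that] by (auto simp: Grid_def Arr_ordinal flat_def simp del: uncurry_simps)
  then show ?thesis
    unfolding level_cat_def using Fun_iso_fun_cat_iff[of "ordinal m" "ordinal n" C x] C
    by (auto simp: flat_def)
qed

lemma flat_Grid: "category C \<Longrightarrow> x \<in> Fun (ordinal n) (level_cat C m) \<Longrightarrow> flat C m n x \<in> Grid C m n"
  by (simp add: Fun_level_cat_iff)

lemma flat_inj:
  "category C \<Longrightarrow> x \<in> Fun (ordinal n) (level_cat C m) \<Longrightarrow> y \<in> Fun (ordinal n) (level_cat C m) \<Longrightarrow>
    flat C m n x = flat C m n y \<Longrightarrow> x = y"
  unfolding Fun_level_cat_iff flat_def by (auto intro: uncurry_inj[of "ordinal m" "ordinal n" C])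

definition unflat :: "('o, 'a) cat \<Rightarrow> nat \<Rightarrow> nat \<Rightarrow> (nat \<times> nat, (nat \<times> nat) \<times> (nat \<times> nat), 'o, 'a) funct \<Rightarrow> ('o, 'a) csimp" where
  "unflat C m n \<gamma> = curry_fun (ordinal m) (ordinal n) \<gamma>"

lemma flat_unflat [simp]:
  "category C \<Longrightarrow> \<gamma> \<in> Grid C m n \<Longrightarrow> flat C m n (unflat C m n \<gamma>) = \<gamma>"
  unfolding flat_def unflat_def Grid_def by (auto intro: uncurry_curry)

lemma unflat_in:
  "category C \<Longrightarrow> \<gamma> \<in> Grid C m n \<Longrightarrow> unflat C m n \<gamma> \<in> Fun (ordinal n) (level_cat C m)"
  using flat_unflat[of C \<gamma> m n] unfolding Fun_level_cat_iff
  by (auto simp: unflat_def Grid_def intro!: curry_fun_in)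

text \<open>In grid form every operator is precomposition with a product of maps of ordinals, and Nf
  is postcomposition with f. From here on the comparison maps are treated through grids, without
  natural transformations.\<close>

lemma flat_natural:
  assumes C: "category C" and D: "category D" and x: "x \<in> Fun (ordinal n) (level_cat C m)"
    and t: "\<theta> \<in> Delta m' m" and f: "f \<in> Fun C D" and e: "\<eta> \<in> Delta n' n"
  shows "flat D m' n' (comp_fun (ordinal n') (comp_fun (ordinal n) (level_fun C m' m \<theta> f) x) \<eta>) =
    comp_fun (grid m' n') f (comp_fun (grid m' n') (flat C m n x) (fun_prod (ordinal m') (ordinal n') \<theta> \<eta>))"
proof -
  \<comment> \<open>All arrows in the image of x are isomorphisms, so the restriction performed by
    \<open>iso_fun\<close> does not change the composite.\<close>
  have "comp_fun (ordinal n) (level_fun C m' m \<theta> f) x = comp_fun (ordinal n) (fun_cat_map (ordinal m') (ordinal m) C \<theta> f) x"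
    using Fun_simps(2)[OF x] unfolding level_fun_def comp_fun_def compose_def
    by (auto simp: level_cat_def fun_eq_iff)
  then show ?thesis
    unfolding flat_def using assms
    by (simp add: uncurry_natural Fun_level_cat_iff)
qed

lemma flat_Act:
  assumes C: "category C" and x: "x \<in> Fun (ordinal n) (level_cat C m)" and e: "\<eta> \<in> Delta n' n"
  shows "flat C m n' (comp_fun (ordinal n') x \<eta>) =
    comp_fun (grid m n') (flat C m n x) (fun_prod (ordinal m) (ordinal n') (id_fun (ordinal m)) \<eta>)"
proof -
  have "comp_fun (grid m n') (flat C m n x) (fun_prod (ordinal m) (ordinal n') (id_fun (ordinal m)) \<eta>) \<in> Fun (grid m n') C"
    using C flat_Grid[OF C x] by (auto simp: Grid_def intro!: comp_fun_in[OF _ fun_prod_in[OF _ _ Delta_id e]])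
  then show ?thesis
    using flat_natural[OF C C x Delta_id id_fun_in[OF C] e] comp_fun_id[OF x] by (simp add: level_fun_id[OF C] comp_fun_id)
qed

lemma flat_SAct:
  assumes C: "category C" and x: "x \<in> Fun (ordinal n) (level_cat C m)" and t: "\<theta> \<in> Delta m' m"
  shows "flat C m' n (comp_fun (ordinal n) (level_fun C m' m \<theta> (id_fun C)) x) =
    comp_fun (grid m' n) (flat C m n x) (fun_prod (ordinal m') (ordinal n) \<theta> (id_fun (ordinal n)))"
proof -
  have 1: "comp_fun (grid m' n) (flat C m n x) (fun_prod (ordinal m') (ordinal n) \<theta> (id_fun (ordinal n))) \<in> Fun (grid m' n) C"
    using C flat_Grid[OF C x] by (auto simp: Grid_def intro!: comp_fun_in[OF _ fun_prod_in[OF _ _ t Delta_id]])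
  have 2: "comp_fun (ordinal n) (level_fun C m' m \<theta> (id_fun C)) x \<in> Fun (ordinal n) (level_cat C m')"
    using C by (intro comp_fun_in[OF _ x level_fun_in[OF C C t id_fun_in]]) auto
  show ?thesis
    using flat_natural[OF C C x t id_fun_in[OF C] Delta_id] comp_fun_id[OF 1] comp_fun_id[OF 2] by simp
qed

lemma flat_map:
  assumes C: "category C" and D: "category D" and x: "x \<in> Fun (ordinal n) (level_cat C m)" and f: "f \<in> Fun C D"
  shows "flat D m n (classifying_map C f m n x) = comp_fun (grid m n) f (flat C m n x)"
proof -
  have 1: "comp_fun (ordinal n) (level_fun C m m (id_fun (ordinal m)) f) x \<in> Fun (ordinal n) (level_cat D m)"
    by (intro comp_fun_in[OF _ x level_fun_in[OF C D Delta_id f]]) auto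
  have 2: "flat C m n x \<in> Fun (grid m n) C" using flat_Grid[OF C x] by (simp add: Grid_def)
  show ?thesis
    using flat_natural[OF C D x Delta_id f Delta_id] comp_fun_id[OF 1] comp_fun_id[OF 2] x
    by (simp add: classifying_map_eq fun_prod_id)
qed

lemma comp_Grid:
  assumes C: "category C" and g: "\<gamma> \<in> Grid C m n" and t: "\<theta> \<in> Delta m' m" and e: "\<eta> \<in> Delta n' n"
  shows "comp_fun (grid m' n') \<gamma> (fun_prod (ordinal m') (ordinal n') \<theta> \<eta>) \<in> Grid C m' n'"
  using g unfolding Grid_def
  by (auto intro!: comp_fun_in[OF _ fun_prod_in[OF _ _ t e]] simp: Delta_simps[OF t] Delta_simps[OF e])

section \<open>Products, mapping spaces and internal homs\<close>

lemma sspace_comp_apply [simp]: "x \<in> Sim (Lev X m) k \<Longrightarrow> sspace_comp X g f m k x = g m k (f m k x)"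
  and sspace_id_apply [simp]: "x \<in> Sim (Lev X m) k \<Longrightarrow> sspace_id X m k x = x"
  and sspace_comp_undef: "x \<notin> Sim (Lev X m) k \<Longrightarrow> sspace_comp X g f m k x = undefined"
  and sspace_id_undef: "x \<notin> Sim (Lev X m) k \<Longrightarrow> sspace_id X m k x = undefined"
  by (auto simp: sspace_comp_def sspace_id_def sset_comp_undef sset_id_undef)

lemma sspace_comp_eqI:
  assumes "\<And>m k x. x \<in> Sim (Lev X m) k \<Longrightarrow> g m k (f m k x) = g' m k (f' m k x)"
  shows "sspace_comp X g f = sspace_comp X g' f'"
  using assms by (auto simp: sspace_comp_def intro!: ext sset_comp_eqI)

lemma sspace_hom_Sim:
  "f \<in> sspace_hom X Y \<Longrightarrow> x \<in> Sim (Lev X m) k \<Longrightarrow> f m k x \<in> Sim (Lev Y m) k"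
  "f \<in> sspace_hom X Y \<Longrightarrow> x \<notin> Sim (Lev X m) k \<Longrightarrow> f m k x = undefined"
  "f \<in> sspace_hom X Y \<Longrightarrow> \<theta> \<in> Delta j k \<Longrightarrow> x \<in> Sim (Lev X m) k \<Longrightarrow>
    f m j (Act (Lev X m) j k \<theta> x) = Act (Lev Y m) j k \<theta> (f m k x)"
  by (metis sset_homD sspace_homD(1))+

lemma sspace_hom_ext:
  assumes "f \<in> sspace_hom X Y" "g \<in> sspace_hom X Z" "\<And>m k x. x \<in> Sim (Lev X m) k \<Longrightarrow> f m k x = g m k x"
  shows "f = g"
proof
  fix m show "f m = g m"
    by (rule sset_hom_ext[OF sspace_homD(1)[OF assms(1)] sspace_homD(1)[OF assms(2)]]) (rule assms(3))
qed

lemma sspace_homI2: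
  assumes "\<And>m k x. x \<in> Sim (Lev X m) k \<Longrightarrow> f m k x \<in> Sim (Lev Y m) k"
    "\<And>m k x. x \<notin> Sim (Lev X m) k \<Longrightarrow> f m k x = undefined"
    "\<And>m j k \<theta> x. \<theta> \<in> Delta j k \<Longrightarrow> x \<in> Sim (Lev X m) k \<Longrightarrow>
      f m j (Act (Lev X m) j k \<theta> x) = Act (Lev Y m) j k \<theta> (f m k x)"
    "\<And>m n \<theta> k x. \<theta> \<in> Delta m n \<Longrightarrow> x \<in> Sim (Lev X n) k \<Longrightarrow> f m k (SAct X m n \<theta> k x) = SAct Y m n \<theta> k (f n k x)"
  shows "f \<in> sspace_hom X Y"
  using assms by (intro sspace_homI sset_homI) auto

lemma is_sspace_Sim:
  assumes "is_sspace X"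
  shows "\<theta> \<in> Delta m n \<Longrightarrow> x \<in> Sim (Lev X n) k \<Longrightarrow> SAct X m n \<theta> k x \<in> Sim (Lev X m) k"
    "\<theta> \<in> Delta j k \<Longrightarrow> x \<in> Sim (Lev X m) k \<Longrightarrow> Act (Lev X m) j k \<theta> x \<in> Sim (Lev X m) j"
  using sset_homD(1)[OF is_sspaceD(3)[OF assms]] is_ssetD(1)[OF is_sspaceD(1)[OF assms]] by blast+

lemma sspace_comp_in:
  assumes f: "f \<in> sspace_hom X Y" and g: "g \<in> sspace_hom Y Z" and X: "is_sspace X"
  shows "sspace_comp X g f \<in> sspace_hom X Z"
  by (rule sspace_homI2)
    (simp_all add: sspace_hom_Sim[OF f] sspace_hom_Sim[OF g] sspace_comp_undef sspace_homD(2)[OF f] sspace_homD(2)[OF g]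
      is_sspace_Sim[OF X])

lemma sspace_id_in: "is_sspace X \<Longrightarrow> sspace_id X \<in> sspace_hom X X"
  by (rule sspace_homI2) (simp_all add: sspace_id_undef is_sspace_Sim)

text \<open>The inverse of a bijective natural map is natural, so an isomorphism of simplicial
  spaces may be checked as a bijection in each bidegree.\<close>

lemma bij_sspace_iso:
  assumes X: "is_sspace X" and Y: "is_sspace Y" and f: "f \<in> sspace_hom X Y"
    and bij: "\<And>m k. bij_betw (f m k) (Sim (Lev X m) k) (Sim (Lev Y m) k)"
  shows "sspace_iso X Y f"
proof -
  \<comment> \<open>The value \<open>undefined\<close> off the simplices is what membership in
    \<open>sspace_hom Y X\<close> demands.\<close>
  define g where "g m k y = (if y \<in> Sim (Lev Y m) k then inv_into (Sim (Lev X m) k) (f m k) y else undefined)" for m k y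
  have g1: "g m k y \<in> Sim (Lev X m) k" "f m k (g m k y) = y" if "y \<in> Sim (Lev Y m) k" for m k y
    using that bij[of m k] by (auto simp: g_def bij_betw_def inv_into_into f_inv_into_f)
  have g2: "g m k (f m k x) = x" if "x \<in> Sim (Lev X m) k" for m k x
    using that bij[of m k] sspace_hom_Sim(1)[OF f that] by (auto simp: g_def bij_betw_def)
  have "g \<in> sspace_hom Y X"
  proof (rule sspace_homI2)
    fix m j k \<theta> y assume "\<theta> \<in> Delta j k" "y \<in> Sim (Lev Y m) k"
    then show "g m j (Act (Lev Y m) j k \<theta> y) = Act (Lev X m) j k \<theta> (g m k y)"
      using g2[of "Act (Lev X m) j k \<theta> (g m k y)" m j] g1[of y m k] X
      by (simp add: sspace_hom_Sim(3)[OF f] is_sspace_Sim[OF X])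
  next
    fix m n \<theta> k y assume "\<theta> \<in> Delta m n" "y \<in> Sim (Lev Y n) k"
    then show "g m k (SAct Y m n \<theta> k y) = SAct X m n \<theta> k (g n k y)"
      using g2[of "SAct X m n \<theta> k (g n k y)" m k] g1[of y n k] X
      by (simp add: sspace_homD(2)[OF f] is_sspace_Sim[OF X])
  qed (use g1 in \<open>auto simp: g_def\<close>)
  moreover have "sspace_comp X g f = sspace_id X" "sspace_comp Y f g = sspace_id Y"
    using g1 g2 by (auto simp: fun_eq_iff sspace_comp_def sset_comp_def compose_def sspace_id_def sset_id_def)
  ultimately show ?thesis using X Y f unfolding sspace_iso_def by blast
qed

section \<open>Binary products of simplicial spaces\<close>

lemma prod_sspace_simps [simp]:
  "Sim (Lev (prod_sspace X Y) m) k = Sim (Lev X m) k \<times> Sim (Lev Y m) k"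
  "\<theta> \<in> Delta j k \<Longrightarrow> x \<in> Sim (Lev X m) k \<Longrightarrow> y \<in> Sim (Lev Y m) k \<Longrightarrow>
    Act (Lev (prod_sspace X Y) m) j k \<theta> (x, y) = (Act (Lev X m) j k \<theta> x, Act (Lev Y m) j k \<theta> y)"
  "\<theta> \<in> Delta m n \<Longrightarrow> x \<in> Sim (Lev X n) k \<Longrightarrow> y \<in> Sim (Lev Y n) k \<Longrightarrow>
    SAct (prod_sspace X Y) m n \<theta> k (x, y) = (SAct X m n \<theta> k x, SAct Y m n \<theta> k y)"
  "x \<in> Sim (Lev X m) k \<Longrightarrow> y \<in> Sim (Lev Y m) k \<Longrightarrow>
    prod_sspace_map X Y a b m k (x, y) = (a m k x, b m k y)"
  by (auto simp: prod_sspace_def prod_sset_def prod_sset_map_def prod_sspace_map_def)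

lemma prod_sspace_undef:
  "\<theta> \<notin> Delta j k \<Longrightarrow> Act (Lev (prod_sspace X Y) m) j k \<theta> = undefined"
  "\<theta> \<in> Delta j k \<Longrightarrow> xy \<notin> Sim (Lev X m) k \<times> Sim (Lev Y m) k \<Longrightarrow>
    Act (Lev (prod_sspace X Y) m) j k \<theta> xy = undefined"
  "\<theta> \<notin> Delta m n \<Longrightarrow> SAct (prod_sspace X Y) m n \<theta> = undefined"
  "\<theta> \<in> Delta m n \<Longrightarrow> xy \<notin> Sim (Lev X n) k \<times> Sim (Lev Y n) k \<Longrightarrow>
    SAct (prod_sspace X Y) m n \<theta> k xy = undefined"
  "xy \<notin> Sim (Lev X m) k \<times> Sim (Lev Y m) k \<Longrightarrow> prod_sspace_map X Y a b m k xy = undefined"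
  by (auto simp: prod_sspace_def prod_sset_def prod_sset_map_def prod_sspace_map_def)

lemma is_sspaceI2:
  assumes "\<And>m. is_sset (Lev X m)" "\<And>m n \<theta>. \<theta> \<notin> Delta m n \<Longrightarrow> SAct X m n \<theta> = undefined"
    "\<And>m n \<theta> k x. \<theta> \<in> Delta m n \<Longrightarrow> x \<in> Sim (Lev X n) k \<Longrightarrow> SAct X m n \<theta> k x \<in> Sim (Lev X m) k"
    "\<And>m n \<theta> k x. \<theta> \<in> Delta m n \<Longrightarrow> x \<notin> Sim (Lev X n) k \<Longrightarrow> SAct X m n \<theta> k x = undefined"
    "\<And>m n \<theta> j k \<eta> x. \<theta> \<in> Delta m n \<Longrightarrow> \<eta> \<in> Delta j k \<Longrightarrow> x \<in> Sim (Lev X n) k \<Longrightarrow>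
      SAct X m n \<theta> j (Act (Lev X n) j k \<eta> x) = Act (Lev X m) j k \<eta> (SAct X m n \<theta> k x)"
    "\<And>n k x. x \<in> Sim (Lev X n) k \<Longrightarrow> SAct X n n (id_fun (ordinal n)) k x = x"
    "\<And>l m n \<eta> \<theta> k x. \<eta> \<in> Delta l m \<Longrightarrow> \<theta> \<in> Delta m n \<Longrightarrow> x \<in> Sim (Lev X n) k \<Longrightarrow>
        SAct X l n (comp_fun (ordinal l) \<theta> \<eta>) k x = SAct X l m \<eta> k (SAct X m n \<theta> k x)"
  shows "is_sspace X"
proof (rule is_sspaceI)
  show h: "SAct X m n \<theta> \<in> sset_hom (Lev X n) (Lev X m)" if "\<theta> \<in> Delta m n" for m n \<theta>
    by (rule sset_homI) (use assms that in auto)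
  show "SAct X n n (id_fun (ordinal n)) = sset_id (Lev X n)" for n
    by (rule sset_hom_ext[OF h[OF Delta_id] sset_id_in[OF assms(1)]]) (simp add: assms(6))
  fix l m n \<eta> \<theta> assume "\<eta> \<in> Delta l m" "\<theta> \<in> Delta m n"
  then show "SAct X l n (comp_fun (ordinal l) \<theta> \<eta>) = sset_comp (Lev X n) (SAct X l m \<eta>) (SAct X m n \<theta>)"
    by (intro sset_hom_ext[OF h[OF Delta_comp] sset_comp_in[OF h h]]) (auto simp: assms(1,7))
qed (use assms in auto)

lemma is_sspaceD2:
  assumes X: "is_sspace X"
  shows "\<theta> \<in> Delta m n \<Longrightarrow> \<eta> \<in> Delta j k \<Longrightarrow> x \<in> Sim (Lev X n) k \<Longrightarrow>
      SAct X m n \<theta> j (Act (Lev X n) j k \<eta> x) = Act (Lev X m) j k \<eta> (SAct X m n \<theta> k x)"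
    and "x \<in> Sim (Lev X n) k \<Longrightarrow> SAct X n n (id_fun (ordinal n)) k x = x"
    and "\<eta> \<in> Delta l m \<Longrightarrow> \<theta> \<in> Delta m n \<Longrightarrow> x \<in> Sim (Lev X n) k \<Longrightarrow>
        SAct X l n (comp_fun (ordinal l) \<theta> \<eta>) k x = SAct X l m \<eta> k (SAct X m n \<theta> k x)"
    and "x \<in> Sim (Lev X n) k \<Longrightarrow> Act (Lev X n) k k (id_fun (ordinal k)) x = x"
    and "\<eta> \<in> Delta i j \<Longrightarrow> \<theta> \<in> Delta j k \<Longrightarrow> x \<in> Sim (Lev X n) k \<Longrightarrow>
        Act (Lev X n) i k (comp_fun (ordinal i) \<theta> \<eta>) x = Act (Lev X n) i j \<eta> (Act (Lev X n) j k \<theta> x)"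
  using sset_homD(3)[OF is_sspaceD(3)[OF X]] is_sspaceD(4,5)[OF X] is_ssetD(2,3)[OF is_sspaceD(1)[OF X]] by auto

lemma is_sspace_prod:
  assumes X: "is_sspace X" and Y: "is_sspace Y"
  shows "is_sspace (prod_sspace X Y)"
proof (rule is_sspaceI2)
  fix m show "is_sset (Lev (prod_sspace X Y) m)"
  proof (rule is_ssetI)
    fix l m' n \<eta> \<theta> x assume "\<eta> \<in> Delta l m'" "\<theta> \<in> Delta m' n" "x \<in> Sim (Lev (prod_sspace X Y) m) n"
    then show "Act (Lev (prod_sspace X Y) m) l n (comp_fun (ordinal l) \<theta> \<eta>) x =
        Act (Lev (prod_sspace X Y) m) l m' \<eta> (Act (Lev (prod_sspace X Y) m) m' n \<theta> x)"
      by (auto simp: is_sspaceD2[OF X] is_sspaceD2[OF Y] Delta_comp is_sspace_Sim[OF X] is_sspace_Sim[OF Y])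
  qed (auto simp: prod_sspace_undef is_sspace_Sim[OF X] is_sspace_Sim[OF Y] is_sspaceD2[OF X] is_sspaceD2[OF Y] Delta_id)
qed (auto simp: prod_sspace_undef is_sspace_Sim[OF X] is_sspace_Sim[OF Y] is_sspaceD2[OF X] is_sspaceD2[OF Y] Delta_id Delta_comp)

lemma prod_sspace_map_in:
  assumes a: "a \<in> sspace_hom X X'" and b: "b \<in> sspace_hom Y Y'" and X: "is_sspace X" and Y: "is_sspace Y"
  shows "prod_sspace_map X Y a b \<in> sspace_hom (prod_sspace X Y) (prod_sspace X' Y')"
  by (rule sspace_homI2)
    (auto simp: prod_sspace_undef sspace_hom_Sim[OF a] sspace_hom_Sim[OF b] sspace_homD(2)[OF a] sspace_homD(2)[OF b]
      is_sspace_Sim[OF X] is_sspace_Sim[OF Y])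

section \<open>The standard simplices and the spaces F(k)\<close>

lemma simplex_sspace_simps [simp]:
  "Sim (Lev (simplex_sspace n) m) k = Delta k n"
  "\<theta> \<in> Delta j k \<Longrightarrow> \<sigma> \<in> Delta k n \<Longrightarrow> Act (Lev (simplex_sspace n) m) j k \<theta> \<sigma> = comp_fun (ordinal j) \<sigma> \<theta>"
  "\<theta> \<in> Delta m m' \<Longrightarrow> \<sigma> \<in> Delta k n \<Longrightarrow> SAct (simplex_sspace n) m m' \<theta> k \<sigma> = \<sigma>"
  by (auto simp: const_sspace_def std_simplex_def sset_id_def)

lemma is_sspace_simplex: "is_sspace (simplex_sspace n)"
proof (rule is_sspaceI2)
  fix m show "is_sset (Lev (simplex_sspace n) m)"
  proof (rule is_ssetI)
    fix l m' k \<eta> \<theta> x assume "\<eta> \<in> Delta l m'" "\<theta> \<in> Delta m' k" "x \<in> Sim (Lev (simplex_sspace n) m) k"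
    then show "Act (Lev (simplex_sspace n) m) l k (comp_fun (ordinal l) \<theta> \<eta>) x =
        Act (Lev (simplex_sspace n) m) l m' \<eta> (Act (Lev (simplex_sspace n) m) m' k \<theta> x)"
      by (simp add: Delta_comp comp_fun_assoc)
  next
    fix m' k \<theta> x assume "\<theta> \<in> Delta m' k" "x \<notin> Sim (Lev (simplex_sspace n) m) k"
    then show "Act (Lev (simplex_sspace n) m) m' k \<theta> x = undefined"
      by (simp add: const_sspace_def std_simplex_def)
  qed (simp_all add: Delta_comp Delta_id comp_fun_id, simp add: const_sspace_def std_simplex_def)
next
  fix m m' \<theta> k \<sigma> assume "\<theta> \<in> Delta m m'" "\<sigma> \<notin> Sim (Lev (simplex_sspace n) m') k"
  then show "SAct (simplex_sspace n) m m' \<theta> k \<sigma> = undefined"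
    by (simp add: const_sspace_def std_simplex_def sset_id_def)
qed (simp_all add: Delta_comp Delta_id, simp add: const_sspace_def)

lemma simplex_sspace_map_in:
  assumes t: "\<theta> \<in> Delta m n"
  shows "simplex_sspace_map m \<theta> \<in> sspace_hom (simplex_sspace m) (simplex_sspace n)"
    and "\<sigma> \<in> Delta k m \<Longrightarrow> simplex_sspace_map m \<theta> i k \<sigma> = comp_fun (ordinal k) \<theta> \<sigma>"
  by (rule sspace_homI2) (auto simp: simplex_sspace_map_def t Delta_comp comp_fun_assoc)

lemma F_sspace_simps [simp]:
  "Sim (Lev (F_sspace k) n) j = Delta n k"
  "\<theta> \<in> Delta j j' \<Longrightarrow> \<sigma> \<in> Delta n k \<Longrightarrow> Act (Lev (F_sspace k) n) j j' \<theta> \<sigma> = \<sigma>"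
  "\<eta> \<in> Delta m n \<Longrightarrow> \<sigma> \<in> Delta n k \<Longrightarrow> SAct (F_sspace k) m n \<eta> j \<sigma> = comp_fun (ordinal m) \<sigma> \<eta>"
  by (auto simp: F_sspace_def discrete_sset_def)

lemma is_sspace_F: "is_sspace (F_sspace k)"
proof (rule is_sspaceI2)
  fix m show "is_sset (Lev (F_sspace k) m)"
    by (rule is_ssetI) (simp_all add: Delta_comp Delta_id, simp_all add: F_sspace_def discrete_sset_def)
next
  fix l m n \<eta> \<theta> j x assume "\<eta> \<in> Delta l m" "\<theta> \<in> Delta m n" "x \<in> Sim (Lev (F_sspace k) n) j"
  then show "SAct (F_sspace k) l n (comp_fun (ordinal l) \<theta> \<eta>) j x = SAct (F_sspace k) l m \<eta> j (SAct (F_sspace k) m n \<theta> j x)"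
    by (simp add: Delta_comp comp_fun_assoc)
next
  fix m n \<theta> j \<sigma> assume "\<theta> \<in> Delta m n" "\<sigma> \<notin> Sim (Lev (F_sspace k) n) j"
  then show "SAct (F_sspace k) m n \<theta> j \<sigma> = undefined" by (simp add: F_sspace_def discrete_sset_def)
qed (simp_all add: Delta_comp Delta_id comp_fun_id, simp add: F_sspace_def)

lemma F_sspace_map_in:
  assumes t: "\<theta> \<in> Delta j k"
  shows "F_sspace_map j \<theta> \<in> sspace_hom (F_sspace j) (F_sspace k)"
    and "\<sigma> \<in> Delta n j \<Longrightarrow> F_sspace_map j \<theta> n i \<sigma> = comp_fun (ordinal n) \<theta> \<sigma>"
  by (rule sspace_homI2) (auto simp: F_sspace_map_def t Delta_comp comp_fun_assoc F_sspace_def discrete_sset_def)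

section \<open>Mapping spaces and internal homs\<close>

lemma Sim_Map [simp]: "Sim (Map X Y) n = sspace_hom (prod_sspace X (simplex_sspace n)) Y"
  by (simp add: Map_def)

lemma Act_Map:
  assumes X: "is_sspace X" and t: "\<theta> \<in> Delta m n" and h: "h \<in> sspace_hom (prod_sspace X (simplex_sspace n)) Y"
  shows "Act (Map X Y) m n \<theta> h \<in> sspace_hom (prod_sspace X (simplex_sspace m)) Y"
    and "x \<in> Sim (Lev X i) k \<Longrightarrow> \<sigma> \<in> Delta k m \<Longrightarrow>
      Act (Map X Y) m n \<theta> h i k (x, \<sigma>) = h i k (x, comp_fun (ordinal k) \<theta> \<sigma>)"
proof -
  note p = prod_sspace_map_in[OF sspace_id_in[OF X] simplex_sspace_map_in(1)[OF t] X is_sspace_simplex]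
  have eq: "Act (Map X Y) m n \<theta> h = sspace_comp (prod_sspace X (simplex_sspace m)) h
          (prod_sspace_map X (simplex_sspace m) (sspace_id X) (simplex_sspace_map m \<theta>))"
    using t h by (simp add: Map_def)
  show "Act (Map X Y) m n \<theta> h \<in> sspace_hom (prod_sspace X (simplex_sspace m)) Y"
    unfolding eq by (rule sspace_comp_in[OF p h is_sspace_prod[OF X is_sspace_simplex]])
  show "x \<in> Sim (Lev X i) k \<Longrightarrow> \<sigma> \<in> Delta k m \<Longrightarrow>
      Act (Map X Y) m n \<theta> h i k (x, \<sigma>) = h i k (x, comp_fun (ordinal k) \<theta> \<sigma>)"
    unfolding eq by (simp add: simplex_sspace_map_in(2)[OF t])
qed

lemma is_sset_Map:
  assumes X: "is_sspace X" shows "is_sset (Map X Y)"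
proof (rule is_ssetI)
  fix n h assume h: "h \<in> Sim (Map X Y) n"
  then have h': "h \<in> sspace_hom (prod_sspace X (simplex_sspace n)) Y" by simp
  show "Act (Map X Y) n n (id_fun (ordinal n)) h = h"
    by (rule sspace_hom_ext[OF Act_Map(1)[OF X Delta_id h'] h'])
      (auto simp: Act_Map(2)[OF X Delta_id h'] comp_fun_id)
next
  fix l m n \<eta> \<theta> h assume e: "\<eta> \<in> Delta l m" and t: "\<theta> \<in> Delta m n" and "h \<in> Sim (Map X Y) n"
  then have h: "h \<in> sspace_hom (prod_sspace X (simplex_sspace n)) Y" by simp
  show "Act (Map X Y) l n (comp_fun (ordinal l) \<theta> \<eta>) h = Act (Map X Y) l m \<eta> (Act (Map X Y) m n \<theta> h)"
    by (rule sspace_hom_ext[OF Act_Map(1)[OF X Delta_comp[OF e t] h] Act_Map(1)[OF X e Act_Map(1)[OF X t h]]])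
      (auto simp: Act_Map(2)[OF X Delta_comp[OF e t] h] Act_Map(2)[OF X e Act_Map(1)[OF X t h]] Act_Map(2)[OF X t h]
        Delta_comp[OF _ e] comp_fun_assoc)
qed (use X in \<open>simp_all add: Act_Map(1)\<close>, simp_all add: Map_def)

lemma Map_map:
  assumes X: "is_sspace X" and X': "is_sspace X'" and a: "a \<in> sspace_hom X' X" and b: "b \<in> sspace_hom Y Y'"
    and h: "h \<in> sspace_hom (prod_sspace X (simplex_sspace n)) Y"
  shows "Map_map X' X Y a b n h \<in> sspace_hom (prod_sspace X' (simplex_sspace n)) Y'"
    and "x \<in> Sim (Lev X' i) k \<Longrightarrow> \<sigma> \<in> Delta k n \<Longrightarrow>
      Map_map X' X Y a b n h i k (x, \<sigma>) = b i k (h i k (a i k x, \<sigma>))"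
proof -
  note P = is_sspace_prod[OF X' is_sspace_simplex]
  note p = prod_sspace_map_in[OF a sspace_id_in[OF is_sspace_simplex] X' is_sspace_simplex]
  have eq: "Map_map X' X Y a b n h = sspace_comp (prod_sspace X' (simplex_sspace n)) b
      (sspace_comp (prod_sspace X' (simplex_sspace n)) h
        (prod_sspace_map X' (simplex_sspace n) a (sspace_id (simplex_sspace n))))"
    using h by (simp add: Map_map_def Let_def)
  show "Map_map X' X Y a b n h \<in> sspace_hom (prod_sspace X' (simplex_sspace n)) Y'"
    unfolding eq by (rule sspace_comp_in[OF sspace_comp_in[OF p h P] b P])
  show "x \<in> Sim (Lev X' i) k \<Longrightarrow> \<sigma> \<in> Delta k n \<Longrightarrow>
      Map_map X' X Y a b n h i k (x, \<sigma>) = b i k (h i k (a i k x, \<sigma>))"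
    unfolding eq by simp
qed

lemma exp_simps [simp]:
  "Lev (sspace_exp X Y) k = Map (prod_sspace X (F_sspace k)) Y"
  by (simp add: sspace_exp_def)

lemma exp_SAct:
  assumes X: "is_sspace X" and Y: "is_sspace Y" and t: "\<theta> \<in> Delta j k"
    and h: "h \<in> sspace_hom (prod_sspace (prod_sspace X (F_sspace k)) (simplex_sspace n)) Y"
  shows "SAct (sspace_exp X Y) j k \<theta> n h \<in> sspace_hom (prod_sspace (prod_sspace X (F_sspace j)) (simplex_sspace n)) Y"
    and "x \<in> Sim (Lev X m) p \<Longrightarrow> \<alpha> \<in> Delta m j \<Longrightarrow> \<beta> \<in> Delta p n \<Longrightarrow>
      SAct (sspace_exp X Y) j k \<theta> n h m p ((x, \<alpha>), \<beta>) = h m p ((x, comp_fun (ordinal m) \<theta> \<alpha>), \<beta>)"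
proof -
  note P = is_sspace_prod[OF X is_sspace_F]
  note p = prod_sspace_map_in[OF sspace_id_in[OF X] F_sspace_map_in(1)[OF t] X is_sspace_F]
  have eq: "SAct (sspace_exp X Y) j k \<theta> n h =
    Map_map (prod_sspace X (F_sspace j)) (prod_sspace X (F_sspace k)) Y
          (prod_sspace_map X (F_sspace j) (sspace_id X) (F_sspace_map j \<theta>)) (sspace_id Y) n h"
    using t by (simp add: sspace_exp_def)
  show "SAct (sspace_exp X Y) j k \<theta> n h \<in> sspace_hom (prod_sspace (prod_sspace X (F_sspace j)) (simplex_sspace n)) Y"
    unfolding eq by (rule Map_map(1)[OF P P p sspace_id_in[OF Y] h])
  assume "x \<in> Sim (Lev X m) p" "\<alpha> \<in> Delta m j" "\<beta> \<in> Delta p n"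
  then show "SAct (sspace_exp X Y) j k \<theta> n h m p ((x, \<alpha>), \<beta>) = h m p ((x, comp_fun (ordinal m) \<theta> \<alpha>), \<beta>)"
    unfolding eq using sspace_hom_Sim(1)[OF h] t
    by (simp add: Map_map(2)[OF P P p sspace_id_in[OF Y] h] F_sspace_map_in(2)[OF t] Delta_comp)
qed

lemma exp_undef:
  "h \<notin> sspace_hom (prod_sspace (prod_sspace X (F_sspace k)) (simplex_sspace n)) Y \<Longrightarrow> \<theta> \<in> Delta j k \<Longrightarrow>
    SAct (sspace_exp X Y) j k \<theta> n h = undefined"
  by (simp add: sspace_exp_def Map_map_def)

lemma exp_hom_ext:
  assumes "f \<in> sspace_hom (prod_sspace (prod_sspace X (F_sspace k)) (simplex_sspace n)) Y"
    "g \<in> sspace_hom (prod_sspace (prod_sspace X (F_sspace k)) (simplex_sspace n)) Y"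
    "\<And>m p x \<alpha> \<beta>. x \<in> Sim (Lev X m) p \<Longrightarrow> \<alpha> \<in> Delta m k \<Longrightarrow> \<beta> \<in> Delta p n \<Longrightarrow>
      f m p ((x, \<alpha>), \<beta>) = g m p ((x, \<alpha>), \<beta>)"
  shows "f = g"
  using assms(1,2) by (rule sspace_hom_ext) (use assms(3) in auto)

text \<open>A simplex h of the internal hom is determined by its values on triples ((x, \<alpha>),
  \<beta>). There the operators of the two directions postcompose \<alpha> and \<beta> respectively,
  so they commute and the simplicial identities are associativity.\<close>

lemma is_sspace_exp:
  assumes X: "is_sspace X" and Y: "is_sspace Y" shows "is_sspace (sspace_exp X Y)"
proof (rule is_sspaceI2)
  note P = is_sspace_prod[OF X is_sspace_F]
  fix m show "is_sset (Lev (sspace_exp X Y) m)" using is_sset_Map[OF P] by simp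
next
  note P = is_sspace_prod[OF X is_sspace_F]
  fix m n \<theta> j k \<eta> h assume t: "\<theta> \<in> Delta m n" and e: "\<eta> \<in> Delta j k" and "h \<in> Sim (Lev (sspace_exp X Y) n) k"
  then have h: "h \<in> sspace_hom (prod_sspace (prod_sspace X (F_sspace n)) (simplex_sspace k)) Y" by simp
  note A = Act_Map[OF P e h] note S = exp_SAct[OF X Y t h]
  show "SAct (sspace_exp X Y) m n \<theta> j (Act (Lev (sspace_exp X Y) n) j k \<eta> h) =
    Act (Lev (sspace_exp X Y) m) j k \<eta> (SAct (sspace_exp X Y) m n \<theta> k h)"
    unfolding exp_simps
    by (rule exp_hom_ext[OF exp_SAct(1)[OF X Y t A(1)] Act_Map(1)[OF P e S(1)]])
      (simp add: exp_SAct(2)[OF X Y t A(1)] Act_Map(2)[OF P e S(1)] A(2) S(2) Delta_comp[OF _ e] Delta_comp[OF _ t])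
next
  fix n k h assume "h \<in> Sim (Lev (sspace_exp X Y) n) k"
  then have h: "h \<in> sspace_hom (prod_sspace (prod_sspace X (F_sspace n)) (simplex_sspace k)) Y" by simp
  show "SAct (sspace_exp X Y) n n (id_fun (ordinal n)) k h = h"
    by (rule exp_hom_ext[OF exp_SAct(1)[OF X Y Delta_id h] h]) (simp add: exp_SAct(2)[OF X Y Delta_id h] comp_fun_id)
next
  fix l m n \<eta> \<theta> k h assume e: "\<eta> \<in> Delta l m" and t: "\<theta> \<in> Delta m n" and "h \<in> Sim (Lev (sspace_exp X Y) n) k"
  then have h: "h \<in> sspace_hom (prod_sspace (prod_sspace X (F_sspace n)) (simplex_sspace k)) Y" by simp
  note S = exp_SAct[OF X Y t h]
  show "SAct (sspace_exp X Y) l n (comp_fun (ordinal l) \<theta> \<eta>) k h =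
    SAct (sspace_exp X Y) l m \<eta> k (SAct (sspace_exp X Y) m n \<theta> k h)"
    by (rule exp_hom_ext[OF exp_SAct(1)[OF X Y Delta_comp[OF e t] h] exp_SAct(1)[OF X Y e S(1)]])
      (simp add: exp_SAct(2)[OF X Y Delta_comp[OF e t] h] exp_SAct(2)[OF X Y e S(1)] S(2) Delta_comp[OF _ e] comp_fun_assoc)
qed (use exp_SAct(1)[OF X Y] in \<open>simp_all add: exp_undef\<close>, simp add: sspace_exp_def)

lemma exp_map:
  assumes X: "is_sspace X" and X': "is_sspace X'" and a: "a \<in> sspace_hom X' X" and b: "b \<in> sspace_hom Y Y'"
    and h: "h \<in> sspace_hom (prod_sspace (prod_sspace X (F_sspace k)) (simplex_sspace n)) Y"
  shows "sspace_exp_map X' X Y a b k n h \<in> sspace_hom (prod_sspace (prod_sspace X' (F_sspace k)) (simplex_sspace n)) Y'"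
    and "x \<in> Sim (Lev X' m) p \<Longrightarrow> \<alpha> \<in> Delta m k \<Longrightarrow> \<beta> \<in> Delta p n \<Longrightarrow>
      sspace_exp_map X' X Y a b k n h m p ((x, \<alpha>), \<beta>) = b m p (h m p ((a m p x, \<alpha>), \<beta>))"
proof -
  note P = is_sspace_prod[OF X is_sspace_F] is_sspace_prod[OF X' is_sspace_F]
  note p = prod_sspace_map_in[OF a sspace_id_in[OF is_sspace_F] X' is_sspace_F]
  show "sspace_exp_map X' X Y a b k n h \<in> sspace_hom (prod_sspace (prod_sspace X' (F_sspace k)) (simplex_sspace n)) Y'"
    unfolding sspace_exp_map_def by (rule Map_map(1)[OF P p b h])
  show "x \<in> Sim (Lev X' m) p \<Longrightarrow> \<alpha> \<in> Delta m k \<Longrightarrow> \<beta> \<in> Delta p n \<Longrightarrow>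
      sspace_exp_map X' X Y a b k n h m p ((x, \<alpha>), \<beta>) = b m p (h m p ((a m p x, \<alpha>), \<beta>))"
    unfolding sspace_exp_map_def by (simp add: Map_map(2)[OF P p b h])
qed

section \<open>The classifying diagram of a product\<close>

definition product_comparison where
  "product_comparison C D = (\<lambda>m k. \<lambda>x\<in>Sim (Lev (classifying_diagram (prod_cat C D)) m) k.
     (classifying_map (prod_cat C D) (fun_fst C D) m k x, classifying_map (prod_cat C D) (fun_snd C D) m k x))"

lemma fun_pair_eta:
  assumes A: "category A" and C: "category C" and D: "category D" and g: "\<gamma> \<in> Fun A (prod_cat C D)"
  shows "fun_pair A (comp_fun A (fun_fst C D) \<gamma>) (comp_fun A (fun_snd C D) \<gamma>) = \<gamma>"
proof (rule Fun_ext_Arr[OF A _ fun_pair_in[OF A comp_fun_in[OF A g fun_fst_in] comp_fun_in[OF A g fun_snd_in]] g])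
  fix f assume f: "f \<in> Arr A"
  then have "FArr \<gamma> f \<in> Arr C \<times> Arr D" using Fun_simps(2)[OF g] by simp
  then show "FArr (fun_pair A (comp_fun A (fun_fst C D) \<gamma>) (comp_fun A (fun_snd C D) \<gamma>)) f = FArr \<gamma> f"
    using f by (cases "FArr \<gamma> f") simp
qed (use C D in simp_all)

lemma iso_arrows_prod:
  assumes "f \<in> iso_arrows C" "g \<in> iso_arrows D" "category C" "category D"
  shows "(f, g) \<in> iso_arrows (prod_cat C D)"
  by (rule iso_arrowsI[where g = "(inverse_arr C f, inverse_arr D g)"]) (use assms in simp_all)

text \<open>In grid form this is the universal property of the product category: a grid in the
  product is a pair of grids, and a pair of isomorphisms is an isomorphism.\<close>

lemma product_comparison_iso:
  fixes C :: "('a, 'b) cat" and D :: "('c, 'd) cat"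
  assumes C: "category C" and D: "category D"
  shows "sspace_iso (classifying_diagram (prod_cat C D))
    (prod_sspace (classifying_diagram C) (classifying_diagram D)) (product_comparison C D)"
proof (rule bij_sspace_iso)
  let ?P = "prod_cat C D"
  have P: "category ?P" using C D by simp
  note f = fun_fst_in[OF C D] and s = fun_snd_in[OF C D]
  note F = classifying_map_in[OF P C f] and S = classifying_map_in[OF P D s]
  note NP = is_sspace_classifying_diagram[OF P]
  show "is_sspace (classifying_diagram ?P)" by (rule NP)
  show "is_sspace (prod_sspace (classifying_diagram C) (classifying_diagram D))"
    by (intro is_sspace_prod is_sspace_classifying_diagram C D)
  show "product_comparison C D \<in> sspace_hom (classifying_diagram ?P) (prod_sspace (classifying_diagram C) (classifying_diagram D))"
    using is_sspace_Sim[OF NP] sspace_hom_Sim[OF F] sspace_hom_Sim[OF S] sspace_homD(2)[OF F] sspace_homD(2)[OF S]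
    by (intro sspace_homI2) (simp_all add: product_comparison_def del: classifying_diagram_simps)
  fix m k
  show "bij_betw (product_comparison C D m k) (Sim (Lev (classifying_diagram ?P) m) k)
      (Sim (Lev (prod_sspace (classifying_diagram C) (classifying_diagram D)) m) k)"
  proof (rule bij_betwI')
    fix x y assume "x \<in> Sim (Lev (classifying_diagram ?P) m) k" "y \<in> Sim (Lev (classifying_diagram ?P) m) k"
    then have x: "x \<in> Fun (ordinal k) (level_cat ?P m)" and y: "y \<in> Fun (ordinal k) (level_cat ?P m)" by simp_all
    have gx: "flat ?P m k x \<in> Fun (grid m k) ?P" and gy: "flat ?P m k y \<in> Fun (grid m k) ?P"
      using flat_Grid[OF P x] flat_Grid[OF P y] by (simp_all add: Grid_def)
    have "x = y" if eq: "product_comparison C D m k x = product_comparison C D m k y"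
    proof (rule flat_inj[OF P x y])
      have e: "classifying_map ?P (fun_fst C D) m k x = classifying_map ?P (fun_fst C D) m k y \<and>
        classifying_map ?P (fun_snd C D) m k x = classifying_map ?P (fun_snd C D) m k y"
        using eq x y unfolding product_comparison_def classifying_diagram_simps nerve_simps restrict_def by (simp only: if_True prod.inject)
      have "comp_fun (grid m k) (fun_fst C D) (flat ?P m k x) = comp_fun (grid m k) (fun_fst C D) (flat ?P m k y)"
        by (simp only: flat_map[OF P C x f, symmetric] flat_map[OF P C y f, symmetric] e)
      moreover have "comp_fun (grid m k) (fun_snd C D) (flat ?P m k x) = comp_fun (grid m k) (fun_snd C D) (flat ?P m k y)"
        by (simp only: flat_map[OF P D x s, symmetric] flat_map[OF P D y s, symmetric] e)
      moreover note fun_pair_eta[OF _ C D gx] fun_pair_eta[OF _ C D gy]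
      ultimately show "flat ?P m k x = flat ?P m k y"
        by (metis category_ordinal category_prod_cat)
    qed
    then show "(product_comparison C D m k x = product_comparison C D m k y) = (x = y)" by blast
  next
    fix x assume "x \<in> Sim (Lev (classifying_diagram ?P) m) k"
    then show "product_comparison C D m k x \<in> Sim (Lev (prod_sspace (classifying_diagram C) (classifying_diagram D)) m) k"
      using sspace_hom_Sim(1)[OF F] sspace_hom_Sim(1)[OF S] by (simp add: product_comparison_def)
  next
    fix y assume "y \<in> Sim (Lev (prod_sspace (classifying_diagram C) (classifying_diagram D)) m) k"
    then obtain a b where y: "y = (a, b)" and a: "a \<in> Fun (ordinal k) (level_cat C m)"
      and b: "b \<in> Fun (ordinal k) (level_cat D m)" by auto
    \<comment> \<open>The preimage of (a, b) is the grid with these two components.\<close>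
    let ?g = "fun_pair (grid m k) (flat C m k a) (flat D m k b)"
    have ga: "flat C m k a \<in> Fun (grid m k) C" and gb: "flat D m k b \<in> Fun (grid m k) D"
      using flat_Grid[OF C a] flat_Grid[OF D b] by (simp_all add: Grid_def)
    have g: "?g \<in> Grid ?P m k"
      using flat_Grid[OF C a] flat_Grid[OF D b] fun_pair_in[OF _ ga gb] iso_arrows_prod[OF _ _ C D]
      by (auto simp: Grid_def)
    let ?x = "unflat ?P m k ?g"
    have x: "?x \<in> Fun (ordinal k) (level_cat ?P m)" by (rule unflat_in[OF P g])
    have "flat C m k (classifying_map ?P (fun_fst C D) m k ?x) = flat C m k a"
      "flat D m k (classifying_map ?P (fun_snd C D) m k ?x) = flat D m k b"
      using fun_pair_proj[OF _ ga gb] by (simp_all add: flat_map[OF P C x f] flat_map[OF P D x s] flat_unflat[OF P g])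
    moreover have "classifying_map ?P (fun_fst C D) m k ?x \<in> Fun (ordinal k) (level_cat C m)"
      "classifying_map ?P (fun_snd C D) m k ?x \<in> Fun (ordinal k) (level_cat D m)"
      using sspace_hom_Sim(1)[OF F, of ?x m k] sspace_hom_Sim(1)[OF S, of ?x m k] x by simp_all
    ultimately have "classifying_map ?P (fun_fst C D) m k ?x = a" "classifying_map ?P (fun_snd C D) m k ?x = b"
      using flat_inj[OF C _ a] flat_inj[OF D _ b] by auto
    then show "\<exists>x\<in>Sim (Lev (classifying_diagram ?P) m) k. y = product_comparison C D m k x"
      using x y by (intro bexI[of _ ?x]) (simp_all add: product_comparison_def)
  qed
qed

text \<open>N is applied to the naturality squares of the two projections.\<close>

lemma product_comparison_natural:
  assumes C: "category C" and C': "category C'" and D: "category D" and D': "category D'"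
    and u: "u \<in> Fun C C'" and v: "v \<in> Fun D D'"
  shows "sspace_comp (classifying_diagram (prod_cat C D))
             (product_comparison C' D') (classifying_map (prod_cat C D) (fun_prod C D u v)) =
           sspace_comp (classifying_diagram (prod_cat C D))
             (prod_sspace_map (classifying_diagram C) (classifying_diagram D)
               (classifying_map C u) (classifying_map D v)) (product_comparison C D)"
proof (rule sspace_comp_eqI)
  let ?P = "prod_cat C D" and ?P' = "prod_cat C' D'"
  have P: "category ?P" and P': "category ?P'" using C D C' D' by simp_all
  note f = fun_fst_in[OF C D] and s = fun_snd_in[OF C D] and f' = fun_fst_in[OF C' D'] and s' = fun_snd_in[OF C' D']
    and uv = fun_prod_in[OF C D u v]
  fix m k x assume x: "x \<in> Sim (Lev (classifying_diagram ?P) m) k"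
  have "sspace_comp (classifying_diagram ?P) (classifying_map ?P' (fun_fst C' D')) (classifying_map ?P (fun_prod C D u v)) =
    sspace_comp (classifying_diagram ?P) (classifying_map C u) (classifying_map ?P (fun_fst C D))"
    "sspace_comp (classifying_diagram ?P) (classifying_map ?P' (fun_snd C' D')) (classifying_map ?P (fun_prod C D u v)) =
    sspace_comp (classifying_diagram ?P) (classifying_map D v) (classifying_map ?P (fun_snd C D))"
    using fun_prod_fst_snd[OF C D u v] classifying_map_comp[OF P P' C' uv f'] classifying_map_comp[OF P C C' f u]
      classifying_map_comp[OF P P' D' uv s'] classifying_map_comp[OF P D D' s v] by metis+
  from this[THEN fun_cong, THEN fun_cong, THEN fun_cong, of m k x]
  show "product_comparison C' D' m k (classifying_map ?P (fun_prod C D u v) m k x) =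
    prod_sspace_map (classifying_diagram C) (classifying_diagram D) (classifying_map C u) (classifying_map D v) m k
      (product_comparison C D m k x)"
    using x sspace_hom_Sim(1)[OF classifying_map_in[OF P P' uv] x] sspace_hom_Sim(1)[OF classifying_map_in[OF P C f] x]
      sspace_hom_Sim(1)[OF classifying_map_in[OF P D s] x]
    by (simp add: product_comparison_def del: classifying_diagram_simps)
qed

section \<open>Small grids\<close>

lemma Arr_ordinal_0: "f \<in> Arr (ordinal 0) \<longleftrightarrow> f = (0, 0)"
  and Arr_ordinal_1: "f \<in> Arr (ordinal (Suc 0)) \<longleftrightarrow> f = (0, 0) \<or> f = (0, 1) \<or> f = (1, 1)"
  and Arr_ordinal_2: "f \<in> Arr (ordinal 2) \<longleftrightarrow>
    f = (0, 0) \<or> f = (0, 1) \<or> f = (0, 2) \<or> f = (1, 1) \<or> f = (1, 2) \<or> f = (2, 2)"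
  by (cases f; auto)+

definition chain2 :: "('o, 'a) cat \<Rightarrow> 'a \<Rightarrow> 'a \<Rightarrow> (nat, nat \<times> nat, 'o, 'a) funct" where
  "chain2 C g f =
     (let ob = (\<lambda>i. if i = 0 then Dom C f else if i = 1 then Cod C f else Cod C g) in
      \<lparr>FObj = (\<lambda>i\<in>{..2}. ob i),
       FArr = (\<lambda>(i, j)\<in>Arr (ordinal 2). if i = j then Ide C (ob i)
         else if i = 0 then (if j = 1 then f else Comp C g f) else g)\<rparr>)"

lemma chain2_simps [simp]:
  "FObj (chain2 C g f) 0 = Dom C f" "FObj (chain2 C g f) 1 = Cod C f" "FObj (chain2 C g f) (Suc 0) = Cod C f"
  "FObj (chain2 C g f) 2 = Cod C g"
  "FArr (chain2 C g f) (0, 0) = Ide C (Dom C f)" "FArr (chain2 C g f) (1, 1) = Ide C (Cod C f)"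
  "FArr (chain2 C g f) (Suc 0, Suc 0) = Ide C (Cod C f)"
  "FArr (chain2 C g f) (2, 2) = Ide C (Cod C g)" "FArr (chain2 C g f) (0, 1) = f" "FArr (chain2 C g f) (0, Suc 0) = f"
  "FArr (chain2 C g f) (1, 2) = g" "FArr (chain2 C g f) (Suc 0, 2) = g" "FArr (chain2 C g f) (0, 2) = Comp C g f"
  by (simp_all add: chain2_def Let_def)

lemma chain2_in:
  assumes C: "category C" and f: "f \<in> Arr C" and g: "g \<in> Arr C" and gf: "Dom C g = Cod C f"
  shows "chain2 C g f \<in> Fun (ordinal 2) C"
proof (rule FunI)
  fix x assume "x \<in> Obj (ordinal 2)"
  then have x: "x = 0 \<or> x = 1 \<or> x = 2" by auto
  then show "FObj (chain2 C g f) x \<in> Obj C"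
    "FArr (chain2 C g f) (Ide (ordinal 2) x) = Ide C (FObj (chain2 C g f) x)"
    using C f g by auto
next
  fix a assume a: "a \<in> Arr (ordinal 2)"
  show "FArr (chain2 C g f) a \<in> Arr C"
    "Dom C (FArr (chain2 C g f) a) = FObj (chain2 C g f) (Dom (ordinal 2) a)"
    "Cod C (FArr (chain2 C g f) a) = FObj (chain2 C g f) (Cod (ordinal 2) a)"
    using a C f g gf unfolding Arr_ordinal_2 by (elim disjE; simp)+
next
  fix b a assume ba: "b \<in> Arr (ordinal 2)" "a \<in> Arr (ordinal 2)" "Dom (ordinal 2) b = Cod (ordinal 2) a"
  show "FArr (chain2 C g f) (Comp (ordinal 2) b a) = Comp C (FArr (chain2 C g f) b) (FArr (chain2 C g f) a)"
    using ba C f g gf unfolding Arr_ordinal_2 by (elim disjE; simp)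
qed (auto simp: chain2_def Let_def)

text \<open>Obtained as the first edge of the chain of f and an identity, so that functoriality is
  inherited from \<open>chain2\<close>.\<close>

definition arrow_fun :: "('o, 'a) cat \<Rightarrow> 'a \<Rightarrow> (nat, nat \<times> nat, 'o, 'a) funct" where
  "arrow_fun C f = comp_fun (ordinal 1) (chain2 C (Ide C (Cod C f)) f) (delta_of 1 (\<lambda>i. i))"

lemma arrow_fun_simps [simp]:
  "FObj (arrow_fun C f) 0 = Dom C f" "FObj (arrow_fun C f) 1 = Cod C f" "FObj (arrow_fun C f) (Suc 0) = Cod C f"
  "FArr (arrow_fun C f) (0, 0) = Ide C (Dom C f)" "FArr (arrow_fun C f) (1, 1) = Ide C (Cod C f)"
  "FArr (arrow_fun C f) (Suc 0, Suc 0) = Ide C (Cod C f)"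
  "FArr (arrow_fun C f) (0, 1) = f" "FArr (arrow_fun C f) (0, Suc 0) = f"
  by (simp_all add: arrow_fun_def)

lemma arrow_fun_in:
  assumes C: "category C" and f: "f \<in> Arr C"
  shows "arrow_fun C f \<in> Fun (ordinal 1) C"
  unfolding arrow_fun_def using assms
  by (intro comp_fun_in[OF _ delta_of_in chain2_in]) auto

definition point_fun :: "('o, 'a) cat \<Rightarrow> 'o \<Rightarrow> (nat, nat \<times> nat, 'o, 'a) funct" where
  "point_fun C x = \<lparr>FObj = (\<lambda>i\<in>{..0}. x), FArr = (\<lambda>f\<in>Arr (ordinal 0). Ide C x)\<rparr>"

lemma point_fun_simps [simp]:
  "FObj (point_fun C x) 0 = x" "FArr (point_fun C x) (0, 0) = Ide C x"
  by (simp_all add: point_fun_def)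

lemma point_fun_in: "category C \<Longrightarrow> x \<in> Obj C \<Longrightarrow> point_fun C x \<in> Fun (ordinal 0) C"
  by (rule FunI) (simp_all add: Arr_ordinal_0, simp_all add: point_fun_def Arr_ordinal_0)

text \<open>The square that is constant in the spatial direction. Its spatial edges are identities,
  hence it is an admissible grid for every f, invertible or not, and its diagonal is f.\<close>

definition arrow_grid :: "('o, 'a) cat \<Rightarrow> 'a \<Rightarrow> (nat \<times> nat, (nat \<times> nat) \<times> (nat \<times> nat), 'o, 'a) funct" where
  "arrow_grid C f = comp_fun (grid 1 1) (arrow_fun C f) (fun_fst (ordinal 1) (ordinal 1))"

lemma fst_Grid:
  assumes C: "category C" and F: "F \<in> Fun (ordinal m) C"
  shows "comp_fun (grid m n) F (fun_fst (ordinal m) (ordinal n)) \<in> Grid C m n"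
proof -
  have "FArr F (i, i) \<in> iso_arrows C" if "i \<le> m" for i
    using Fun_simps(1,5)[OF F, of i] that C by simp
  moreover have "comp_fun (grid m n) F (fun_fst (ordinal m) (ordinal n)) \<in> Fun (grid m n) C"
    by (rule comp_fun_in[OF _ fun_fst_in F]) simp_all
  ultimately show ?thesis by (simp add: Grid_def)
qed

lemma arrow_grid_in: "category C \<Longrightarrow> f \<in> Arr C \<Longrightarrow> arrow_grid C f \<in> Grid C 1 1"
  unfolding arrow_grid_def by (intro fst_Grid arrow_fun_in)

definition seg :: "nat \<times> nat \<Rightarrow> delta" where
  "seg a = delta_of 1 (\<lambda>i. if i = 0 then fst a else snd a)"

lemma seg_simps [simp]:
  "FObj (seg a) 0 = fst a" "FObj (seg a) 1 = snd a" "FObj (seg a) (Suc 0) = snd a"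
  "FArr (seg a) (0, 1) = a" "FArr (seg a) (0, Suc 0) = a" "FArr (seg a) (0, 0) = (fst a, fst a)"
  "FArr (seg a) (1, 1) = (snd a, snd a)" "FArr (seg a) (Suc 0, Suc 0) = (snd a, snd a)"
  by (simp_all add: seg_def)

lemma seg_in: "a \<in> Arr (ordinal n) \<Longrightarrow> seg a \<in> Delta 1 n"
  unfolding seg_def by (rule delta_of_in) (cases a; auto)+

lemma Delta_1_eq_seg:
  assumes "\<theta> \<in> Delta 1 n" shows "\<theta> = seg (FObj \<theta> 0, FObj \<theta> 1)"
proof (rule Delta_ext[OF assms])
  have "(FObj \<theta> 0, FObj \<theta> 1) \<in> Arr (ordinal n)" using Delta_simps[OF assms] by simp
  then show "seg (FObj \<theta> 0, FObj \<theta> 1) \<in> Delta 1 n" by (rule seg_in)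
qed (auto simp: le_Suc_eq)

lemma Obj_grid: "z \<in> Obj (grid m n) \<longleftrightarrow> (\<exists>i p. z = (i, p) \<and> i \<le> m \<and> p \<le> n)"
  and Arr_grid: "u \<in> Arr (grid m n) \<longleftrightarrow> (\<exists>i j p q. u = ((i, j), (p, q)) \<and> i \<le> j \<and> j \<le> m \<and> p \<le> q \<and> q \<le> n)"
  by (auto simp: Arr_ordinal)

text \<open>Grids are posets, so an arrow is determined by its ends.\<close>

lemma grid_Fun_ext:
  assumes B: "category B" and F: "F \<in> Fun B (grid m n)" and G: "G \<in> Fun B (grid m n)"
    and eq: "\<And>x. x \<in> Obj B \<Longrightarrow> FObj F x = FObj G x"
  shows "F = G"
  using F G eq
proof (rule Fun_ext)
  fix f assume f: "f \<in> Arr B"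
  have "u = v" if "u \<in> Arr (grid m n)" "v \<in> Arr (grid m n)" "Dom (grid m n) u = Dom (grid m n) v" "Cod (grid m n) u = Cod (grid m n) v" for u v
    using that unfolding Arr_grid by auto
  then show "FArr F f = FArr G f"
    using f B eq Fun_simps(2,3,4)[OF F f] Fun_simps(2,3,4)[OF G f] by simp
qed

text \<open>Unlike in a product of two maps of ordinals, each output coordinate may depend on both
  inputs; the auxiliary grid of \<open>val_diagonal\<close> needs this.\<close>

definition grid_map :: "nat \<Rightarrow> nat \<Rightarrow> (nat \<Rightarrow> nat \<Rightarrow> nat) \<Rightarrow> (nat \<Rightarrow> nat \<Rightarrow> nat) \<Rightarrow>
    (nat \<times> nat, (nat \<times> nat) \<times> (nat \<times> nat), nat \<times> nat, (nat \<times> nat) \<times> (nat \<times> nat)) funct" where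
  "grid_map m n r s =
     \<lparr>FObj = (\<lambda>(i, p)\<in>Obj (grid m n). (r i p, s i p)),
      FArr = (\<lambda>((i, j), (p, q))\<in>Arr (grid m n). ((r i p, r j q), (s i p, s j q)))\<rparr>"

lemma grid_map_simps [simp]:
  "i \<le> m \<Longrightarrow> p \<le> n \<Longrightarrow> FObj (grid_map m n r s) (i, p) = (r i p, s i p)"
  "i \<le> j \<Longrightarrow> j \<le> m \<Longrightarrow> p \<le> q \<Longrightarrow> q \<le> n \<Longrightarrow>
    FArr (grid_map m n r s) ((i, j), (p, q)) = ((r i p, r j q), (s i p, s j q))"
  by (auto simp: grid_map_def)

lemma grid_map_in:
  assumes "\<And>i j p q. i \<le> j \<Longrightarrow> j \<le> m \<Longrightarrow> p \<le> q \<Longrightarrow> q \<le> n \<Longrightarrow> r i p \<le> r j q \<and> s i p \<le> s j q"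
    and "\<And>i p. i \<le> m \<Longrightarrow> p \<le> n \<Longrightarrow> r i p \<le> m' \<and> s i p \<le> n'"
  shows "grid_map m n r s \<in> Fun (grid m n) (grid m' n')"
proof (rule FunI)
  fix x assume "x \<in> Obj (grid m n)"
  then obtain i p where "x = (i, p)" "i \<le> m" "p \<le> n" unfolding Obj_grid by auto
  then show "FObj (grid_map m n r s) x \<in> Obj (grid m' n')"
    "FArr (grid_map m n r s) (Ide (grid m n) x) = Ide (grid m' n') (FObj (grid_map m n r s) x)"
    using assms by simp_all
next
  fix u assume "u \<in> Arr (grid m n)"
  then obtain i j p q where "u = ((i, j), (p, q))" "i \<le> j" "j \<le> m" "p \<le> q" "q \<le> n" unfolding Arr_grid by auto
  then show "FArr (grid_map m n r s) u \<in> Arr (grid m' n')"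
    "Dom (grid m' n') (FArr (grid_map m n r s) u) = FObj (grid_map m n r s) (Dom (grid m n) u)"
    "Cod (grid m' n') (FArr (grid_map m n r s) u) = FObj (grid_map m n r s) (Cod (grid m n) u)"
    using assms by simp_all
next
  fix v u assume "v \<in> Arr (grid m n)" "u \<in> Arr (grid m n)" "Dom (grid m n) v = Cod (grid m n) u"
  then obtain i j k p q t where "u = ((i, j), (p, q))" "i \<le> j" "j \<le> m" "p \<le> q" "q \<le> n"
     "v = ((j, k), (q, t))" "j \<le> k" "k \<le> m" "q \<le> t" "t \<le> n" unfolding Arr_grid by auto
  then show "FArr (grid_map m n r s) (Comp (grid m n) v u) =
      Comp (grid m' n') (FArr (grid_map m n r s) v) (FArr (grid_map m n r s) u)"
    using assms by simp
qed (simp_all add: grid_map_def)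

section \<open>The classifying diagram of a functor category\<close>

definition exp_functors :: "('o, 'a) cat \<Rightarrow> ('p, 'b) cat \<Rightarrow> nat \<Rightarrow> nat \<Rightarrow>
    ('o \<times> nat \<times> nat, 'a \<times> (nat \<times> nat) \<times> (nat \<times> nat), 'p, 'b) funct set" where
  "exp_functors C D k n = {X \<in> Fun (prod_cat C (grid k n)) D.
     \<forall>a\<in>Obj C. \<forall>i p q. i \<le> k \<longrightarrow> p \<le> q \<longrightarrow> q \<le> n \<longrightarrow> FArr X (Ide C a, ((i, i), (p, q))) \<in> iso_arrows D}"

definition double_flat where
  "double_flat C D k n x = uncurry C (grid k n) D (flat (fun_cat C D) k n x)"

lemma double_flat_in:
  assumes C: "category C" and D: "category D" and x: "x \<in> Fun (ordinal n) (level_cat (fun_cat C D) k)"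
  shows "double_flat C D k n x \<in> exp_functors C D k n"
proof -
  have F: "category (fun_cat C D)" and G: "category (grid k n)" using C D by simp_all
  have g: "flat (fun_cat C D) k n x \<in> Grid (fun_cat C D) k n" by (rule flat_Grid[OF F x])
  then have g': "flat (fun_cat C D) k n x \<in> Fun (grid k n) (fun_cat C D)" by (simp add: Grid_def)
  have "FArr (double_flat C D k n x) (Ide C a, ((i, i), (p, q))) \<in> iso_arrows D"
    if "a \<in> Obj C" "i \<le> k" "p \<le> q" "q \<le> n" for a i p q
  proof -
    have "FArr (flat (fun_cat C D) k n x) ((i, i), (p, q)) \<in> iso_arrows (fun_cat C D)"
      using g that by (simp add: Grid_def)
    then show ?thesis
      unfolding double_flat_def using that uncurry_left(2)[OF C G D g', of a "((i, i), (p, q))"]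
      by (simp add: iso_arrows_fun_cat[OF C D] del: uncurry_simps)
  qed
  then show ?thesis
    unfolding exp_functors_def using uncurry_in[OF C G D g'] by (simp add: double_flat_def)
qed

lemma double_flat_inj:
  assumes C: "category C" and D: "category D" and x: "x \<in> Fun (ordinal n) (level_cat (fun_cat C D) k)"
    and y: "y \<in> Fun (ordinal n) (level_cat (fun_cat C D) k)" and eq: "double_flat C D k n x = double_flat C D k n y"
  shows "x = y"
proof (rule flat_inj[OF category_fun_cat[OF C D] x y])
  show "flat (fun_cat C D) k n x = flat (fun_cat C D) k n y"
    by (rule uncurry_inj[OF C _ D _ _ eq[unfolded double_flat_def]])
      (use flat_Grid[OF category_fun_cat[OF C D]] x y in \<open>simp_all add: Grid_def\<close>)
qed

lemma double_flat_surj: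
  assumes C: "category C" and D: "category D" and X: "X \<in> exp_functors C D k n"
  shows "\<exists>x\<in>Fun (ordinal n) (level_cat (fun_cat C D) k). double_flat C D k n x = X"
proof -
  have F: "category (fun_cat C D)" and G: "category (grid k n)" using C D by simp_all
  have X': "X \<in> Fun (prod_cat C (grid k n)) D" using X by (simp add: exp_functors_def)
  let ?g = "curry_fun C (grid k n) X"
  have g: "?g \<in> Fun (grid k n) (fun_cat C D)" by (rule curry_fun_in[OF C G D X'])
  have "FArr ?g ((i, i), (p, q)) \<in> iso_arrows (fun_cat C D)" if "i \<le> k" "p \<le> q" "q \<le> n" for i p q
    using that X Fun_fun_catD(2)[OF g, of "((i, i), (p, q))"]
    by (simp add: iso_arrows_fun_cat[OF C D] curry_fun_simps exp_functors_def)
  with g have "?g \<in> Grid (fun_cat C D) k n" by (simp add: Grid_def)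
  then show ?thesis
    by (intro bexI[OF _ unflat_in[OF F]]) (simp_all add: double_flat_def flat_unflat[OF F] uncurry_curry[OF C G D X'])
qed

lemma exp_functors_Fun: "X \<in> exp_functors C D k n \<Longrightarrow> X \<in> Fun (prod_cat C (grid k n)) D"
  by (simp add: exp_functors_def)

text \<open>The arrow splits as a spatial arrow over an identity of C, which X inverts by
  assumption, after an isomorphism of the product category. This extends the condition from
  identities to all isomorphisms w, as is required when X is evaluated on grids of C.\<close>

lemma exp_functors_iso:
  assumes C: "category C" and D: "category D" and X: "X \<in> exp_functors C D k n"
    and w: "w \<in> iso_arrows C" and i: "i \<le> k" "p \<le> q" "q \<le> n"
  shows "FArr X (w, ((i, i), (p, q))) \<in> iso_arrows D"
proof -
  note X' = exp_functors_Fun[OF X]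
  let ?P = "prod_cat C (grid k n)"
  have wi: "(w, ((i, i), (p, p))) \<in> iso_arrows ?P"
    by (rule iso_arrows_prod[OF w _ C]) (use i Ide_iso[of "grid k n" "(i, p)"] in simp_all)
  have "FArr X (w, ((i, i), (p, q))) = Comp D (FArr X (Ide C (Cod C w), ((i, i), (p, q)))) (FArr X (w, ((i, i), (p, p))))"
    using Fun_Comp[OF X', of "(Ide C (Cod C w), ((i, i), (p, q)))" "(w, ((i, i), (p, p)))"] C w i by simp
  moreover have "FArr X (Ide C (Cod C w), ((i, i), (p, q))) \<in> iso_arrows D"
    using X C w i by (simp add: exp_functors_def)
  moreover have "FArr X (w, ((i, i), (p, p))) \<in> iso_arrows D"
    using C by (intro Fun_iso[OF _ X' wi]) simp
  ultimately show ?thesis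
    using C D w i by (simp add: Fun_simps[OF X'])
qed

text \<open>A simplex ((\<gamma>, \<alpha>), \<beta>) of NC x F(k) x \<Delta>[n] in bidegree (m, j)
  amounts to this functor from [m] x [j] to C x [k] x [n]. The comparison map is evaluation: it
  composes the functor that x represents with this one.\<close>

definition adm_grid where
  "adm_grid m j \<gamma> \<alpha> \<beta> = fun_pair (grid m j) \<gamma> (fun_prod (ordinal m) (ordinal j) \<alpha> \<beta>)"

lemma adm_grid_in:
  assumes "\<gamma> \<in> Fun (grid m j) C" "\<alpha> \<in> Delta m k" "\<beta> \<in> Delta j n"
  shows "adm_grid m j \<gamma> \<alpha> \<beta> \<in> Fun (grid m j) (prod_cat C (grid k n))"
  unfolding adm_grid_def using assms by (intro fun_pair_in fun_prod_in) auto

lemma adm_grid_FArr: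
  assumes a: "\<alpha> \<in> Delta m k" and b: "\<beta> \<in> Delta j n" and "i \<le> i'" "i' \<le> m" "p \<le> p'" "p' \<le> j"
  shows "FArr (adm_grid m j \<gamma> \<alpha> \<beta>) ((i, i'), (p, p')) =
    (FArr \<gamma> ((i, i'), (p, p')), ((FObj \<alpha> i, FObj \<alpha> i'), (FObj \<beta> p, FObj \<beta> p')))"
  unfolding adm_grid_def using assms(3-) by (simp add: Delta_simps[OF a] Delta_simps[OF b])

lemma adm_grid_comp:
  assumes "\<theta> \<in> Delta m' m" "\<eta> \<in> Delta j' j"
  shows "comp_fun (grid m' j') (adm_grid m j \<gamma> \<alpha> \<beta>) (fun_prod (ordinal m') (ordinal j') \<theta> \<eta>) =
    adm_grid m' j' (comp_fun (grid m' j') \<gamma> (fun_prod (ordinal m') (ordinal j') \<theta> \<eta>))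
      (comp_fun (ordinal m') \<alpha> \<theta>) (comp_fun (ordinal j') \<beta> \<eta>)"
  unfolding adm_grid_def using assms
  by (simp add: fun_pair_comp[OF _ fun_prod_in] fun_prod_comp)

lemma adm_grid_map:
  assumes g: "\<gamma> \<in> Fun (grid m j) C" and a: "\<alpha> \<in> Delta m k" and b: "\<beta> \<in> Delta j n"
  shows "comp_fun (grid m j) (fun_prod C (grid k n) u (fun_prod (ordinal k) (ordinal n) \<theta> \<eta>)) (adm_grid m j \<gamma> \<alpha> \<beta>) =
    adm_grid m j (comp_fun (grid m j) u \<gamma>) (comp_fun (ordinal m) \<theta> \<alpha>) (comp_fun (ordinal j) \<eta> \<beta>)"
  unfolding adm_grid_def
  by (auto simp: fun_pair_def fun_prod_def comp_fun_def compose_def fun_eq_iff Fun_simps[OF g]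
     Fun_simps[OF a, simplified] Fun_simps[OF b, simplified] Fun_simps[OF a] Fun_simps[OF b])

lemma adm_grid_Grid:
  assumes C: "category C" and D: "category D" and X: "X \<in> exp_functors C D k n"
    and g: "\<gamma> \<in> Grid C m j" and a: "\<alpha> \<in> Delta m k" and b: "\<beta> \<in> Delta j n"
  shows "comp_fun (grid m j) X (adm_grid m j \<gamma> \<alpha> \<beta>) \<in> Grid D m j"
proof -
  have g': "\<gamma> \<in> Fun (grid m j) C" using g by (simp add: Grid_def)
  have "comp_fun (grid m j) X (adm_grid m j \<gamma> \<alpha> \<beta>) \<in> Fun (grid m j) D"
    by (rule comp_fun_in[OF _ adm_grid_in[OF g' a b] exp_functors_Fun[OF X]]) simp
  then show ?thesis
    using g by (auto simp: Grid_def adm_grid_FArr[OF a b] Delta_simps[OF a] Delta_simps[OF b] intro!: exp_functors_iso[OF C D X])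
qed

section \<open>The comparison map and its naturality\<close>

definition exp_comparison where
  "exp_comparison C D = (\<lambda>k n. \<lambda>x\<in>Sim (Lev (classifying_diagram (fun_cat C D)) k) n. \<lambda>m j.
     \<lambda>((\<sigma>, \<alpha>), \<beta>)\<in>(Sim (Lev (classifying_diagram C) m) j \<times> Delta m k) \<times> Delta j n.
       unflat D m j (comp_fun (grid m j) (double_flat C D k n x) (adm_grid m j (flat C m j \<sigma>) \<alpha> \<beta>)))"

lemma exp_comparison_apply:
  assumes C: "category C" and D: "category D" and x: "x \<in> Fun (ordinal n) (level_cat (fun_cat C D) k)"
    and s: "\<sigma> \<in> Fun (ordinal j) (level_cat C m)" and a: "\<alpha> \<in> Delta m k" and b: "\<beta> \<in> Delta j n"
  shows "exp_comparison C D k n x m j ((\<sigma>, \<alpha>), \<beta>) \<in> Fun (ordinal j) (level_cat D m)"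
    and "flat D m j (exp_comparison C D k n x m j ((\<sigma>, \<alpha>), \<beta>)) =
      comp_fun (grid m j) (double_flat C D k n x) (adm_grid m j (flat C m j \<sigma>) \<alpha> \<beta>)"
proof -
  have "exp_comparison C D k n x m j ((\<sigma>, \<alpha>), \<beta>) =
    unflat D m j (comp_fun (grid m j) (double_flat C D k n x) (adm_grid m j (flat C m j \<sigma>) \<alpha> \<beta>))"
    using x s a b by (simp add: exp_comparison_def)
  moreover have "comp_fun (grid m j) (double_flat C D k n x) (adm_grid m j (flat C m j \<sigma>) \<alpha> \<beta>) \<in> Grid D m j"
    by (rule adm_grid_Grid[OF C D double_flat_in[OF C D x] flat_Grid[OF C s] a b])
  ultimately show "exp_comparison C D k n x m j ((\<sigma>, \<alpha>), \<beta>) \<in> Fun (ordinal j) (level_cat D m)"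
    and "flat D m j (exp_comparison C D k n x m j ((\<sigma>, \<alpha>), \<beta>)) =
      comp_fun (grid m j) (double_flat C D k n x) (adm_grid m j (flat C m j \<sigma>) \<alpha> \<beta>)"
    using unflat_in[OF D] flat_unflat[OF D] by simp_all
qed

lemma classifying_SAct:
  assumes C: "category C" and x: "x \<in> Fun (ordinal k) (level_cat C n)" and t: "\<theta> \<in> Delta m n"
  shows "comp_fun (ordinal k) (level_fun C m n \<theta> (id_fun C)) x \<in> Fun (ordinal k) (level_cat C m)"
  by (rule comp_fun_in[OF _ x level_fun_in[OF C C t id_fun_in[OF C]]]) simp

text \<open>The operators precompose the admissible grid while x postcomposes it, so compatibility
  is associativity of composition; injectivity of \<open>flat\<close> brings the equations back to
  simplices.\<close>

lemma exp_comparison_Sim: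
  assumes C: "category C" and D: "category D" and x: "x \<in> Fun (ordinal n) (level_cat (fun_cat C D) k)"
  shows "exp_comparison C D k n x \<in> sspace_hom
    (prod_sspace (prod_sspace (classifying_diagram C) (F_sspace k)) (simplex_sspace n)) (classifying_diagram D)"
proof (rule sspace_homI2)
  note A = exp_comparison_apply[OF C D x]
  note X = double_flat_in[OF C D x]
  {
    fix m j z assume "z \<in> Sim (Lev (prod_sspace (prod_sspace (classifying_diagram C) (F_sspace k)) (simplex_sspace n)) m) j"
    then show "exp_comparison C D k n x m j z \<in> Sim (Lev (classifying_diagram D) m) j" using A(1) by auto
  next
    fix m j z assume "z \<notin> Sim (Lev (prod_sspace (prod_sspace (classifying_diagram C) (F_sspace k)) (simplex_sspace n)) m) j"
    then show "exp_comparison C D k n x m j z = undefined" using x by (auto simp: exp_comparison_def)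
  next
    fix m j' j \<eta> z assume e: "\<eta> \<in> Delta j' j"
      and "z \<in> Sim (Lev (prod_sspace (prod_sspace (classifying_diagram C) (F_sspace k)) (simplex_sspace n)) m) j"
    then obtain \<sigma> \<alpha> \<beta> where z: "z = ((\<sigma>, \<alpha>), \<beta>)" and s: "\<sigma> \<in> Fun (ordinal j) (level_cat C m)"
      and a: "\<alpha> \<in> Delta m k" and b: "\<beta> \<in> Delta j n" by auto
    have s': "comp_fun (ordinal j') \<sigma> \<eta> \<in> Fun (ordinal j') (level_cat C m)" by (rule comp_fun_in[OF _ e s]) simp
    have g: "flat C m j \<sigma> \<in> Fun (grid m j) C" using flat_Grid[OF C s] by (simp add: Grid_def)
    let ?y = "exp_comparison C D k n x m j ((\<sigma>, \<alpha>), \<beta>)"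
    have y: "comp_fun (ordinal j') ?y \<eta> \<in> Fun (ordinal j') (level_cat D m)" by (rule comp_fun_in[OF _ e A(1)[OF s a b]]) simp
    have "exp_comparison C D k n x m j' ((comp_fun (ordinal j') \<sigma> \<eta>, \<alpha>), comp_fun (ordinal j') \<beta> \<eta>) = comp_fun (ordinal j') ?y \<eta>"
      using adm_grid_comp[OF Delta_id[of m] e, of "flat C m j \<sigma>" \<alpha> \<beta>] comp_fun_id[OF a]
        comp_fun_assoc[OF fun_prod_in[OF category_ordinal category_ordinal Delta_id[of m] e], of "double_flat C D k n x" "adm_grid m j (flat C m j \<sigma>) \<alpha> \<beta>"]
      by (intro flat_inj[OF D A(1)[OF s' a Delta_comp[OF e b]] y])
        (simp add: A(2)[OF s' a Delta_comp[OF e b]] flat_Act[OF D A(1)[OF s a b] e] A(2)[OF s a b] flat_Act[OF C s e] Delta_id)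
    then show "exp_comparison C D k n x m j' (Act (Lev (prod_sspace (prod_sspace (classifying_diagram C) (F_sspace k)) (simplex_sspace n)) m) j' j \<eta> z) =
      Act (Lev (classifying_diagram D) m) j' j \<eta> (exp_comparison C D k n x m j z)"
      using e s a b A(1)[OF s a b] by (simp add: z)
  next
    fix m' m \<theta> j z assume t: "\<theta> \<in> Delta m' m"
      and "z \<in> Sim (Lev (prod_sspace (prod_sspace (classifying_diagram C) (F_sspace k)) (simplex_sspace n)) m) j"
    then obtain \<sigma> \<alpha> \<beta> where z: "z = ((\<sigma>, \<alpha>), \<beta>)" and s: "\<sigma> \<in> Fun (ordinal j) (level_cat C m)"
      and a: "\<alpha> \<in> Delta m k" and b: "\<beta> \<in> Delta j n" by auto
    note s' = classifying_SAct[OF C s t]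
    let ?y = "exp_comparison C D k n x m j ((\<sigma>, \<alpha>), \<beta>)"
    note y = classifying_SAct[OF D A(1)[OF s a b] t]
    have "exp_comparison C D k n x m' j ((comp_fun (ordinal j) (level_fun C m' m \<theta> (id_fun C)) \<sigma>, comp_fun (ordinal m') \<alpha> \<theta>), \<beta>) =
        comp_fun (ordinal j) (level_fun D m' m \<theta> (id_fun D)) ?y"
      using adm_grid_comp[OF t Delta_id[of j], of "flat C m j \<sigma>" \<alpha> \<beta>] comp_fun_id[OF b]
        comp_fun_assoc[OF fun_prod_in[OF category_ordinal category_ordinal t Delta_id[of j]], of "double_flat C D k n x" "adm_grid m j (flat C m j \<sigma>) \<alpha> \<beta>"]
      by (intro flat_inj[OF D A(1)[OF s' Delta_comp[OF t a] b] y])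
        (simp add: A(2)[OF s' Delta_comp[OF t a] b] flat_SAct[OF D A(1)[OF s a b] t] A(2)[OF s a b] flat_SAct[OF C s t] Delta_id)
    then show "exp_comparison C D k n x m' j (SAct (prod_sspace (prod_sspace (classifying_diagram C) (F_sspace k)) (simplex_sspace n)) m' m \<theta> j z) =
      SAct (classifying_diagram D) m' m \<theta> j (exp_comparison C D k n x m j z)"
      using t s a b A(1)[OF s a b] by (simp add: z)
  }
qed

lemma double_flat_natural:
  assumes C: "category C" and D: "category D" and C': "category C'" and D': "category D'"
    and g: "g \<in> Fun (grid k n) (fun_cat C D)"
    and u: "u \<in> Fun C' C" and v: "v \<in> Fun D D'" and t: "\<theta> \<in> Delta k' k" and e: "\<eta> \<in> Delta n' n"
  shows "uncurry C' (grid k' n') D' (comp_fun (grid k' n') (comp_fun (grid k n) (fun_cat_map C' C D u v) g) (fun_prod (ordinal k') (ordinal n') \<theta> \<eta>)) =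
    comp_fun (prod_cat C' (grid k' n')) v (comp_fun (prod_cat C' (grid k' n')) (uncurry C (grid k n) D g)
      (fun_prod C' (grid k' n') u (fun_prod (ordinal k') (ordinal n') \<theta> \<eta>)))"
  by (rule uncurry_natural[OF C _ D g C' _ D' u v fun_prod_in[OF _ _ t e]]) simp_all

lemma double_flat_precomp:
  assumes C: "category C" and D: "category D" and g: "g \<in> Fun (grid k n) (fun_cat C D)"
    and t: "\<theta> \<in> Delta k' k" and e: "\<eta> \<in> Delta n' n"
  shows "uncurry C (grid k' n') D (comp_fun (grid k' n') g (fun_prod (ordinal k') (ordinal n') \<theta> \<eta>)) =
    comp_fun (prod_cat C (grid k' n')) (uncurry C (grid k n) D g)
      (fun_prod C (grid k' n') (id_fun C) (fun_prod (ordinal k') (ordinal n') \<theta> \<eta>))"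
proof -
  have "comp_fun (prod_cat C (grid k' n')) (uncurry C (grid k n) D g)
      (fun_prod C (grid k' n') (id_fun C) (fun_prod (ordinal k') (ordinal n') \<theta> \<eta>)) \<in> Fun (prod_cat C (grid k' n')) D"
    using C D by (intro comp_fun_in[OF _ fun_prod_in[OF _ _ id_fun_in fun_prod_in[OF _ _ t e]] uncurry_in[OF _ _ _ g]]) simp_all
  then show ?thesis
    using double_flat_natural[OF C D C D g id_fun_in[OF C] id_fun_in[OF D] t e]
    by (simp add: fun_cat_map_id[OF C D] comp_fun_id[OF g] comp_fun_id)
qed

text \<open>On x the operators in k and n precompose the functor out of C x [k] x [n]; in the
  internal hom they postcompose \<alpha> and \<beta>. \<open>adm_grid_map\<close> and associativity
  identify the two actions.\<close>

lemma exp_comparison_in: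
  fixes C :: "('a, 'b) cat" and D :: "('c, 'd) cat"
  assumes C: "category C" and D: "category D"
  shows "exp_comparison C D \<in> sspace_hom (classifying_diagram (fun_cat C D))
     (sspace_exp (classifying_diagram C) (classifying_diagram D))"
proof (rule sspace_homI2)
  have F: "category (fun_cat C D)" using C D by simp
  note NC = is_sspace_classifying_diagram[OF C] and ND = is_sspace_classifying_diagram[OF D]
  note P = is_sspace_prod[OF NC is_sspace_F]
  note S = exp_comparison_Sim[OF C D]
  note A = exp_comparison_apply[OF C D]
  {
    fix k n x assume "x \<in> Sim (Lev (classifying_diagram (fun_cat C D)) k) n"
    then show "exp_comparison C D k n x \<in> Sim (Lev (sspace_exp (classifying_diagram C) (classifying_diagram D)) k) n"
      using S by simp
  next
    fix k n x assume "x \<notin> Sim (Lev (classifying_diagram (fun_cat C D)) k) n"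
    then show "exp_comparison C D k n x = undefined" unfolding exp_comparison_def by simp
  next
    fix k n' n \<eta> x assume e: "\<eta> \<in> Delta n' n" and "x \<in> Sim (Lev (classifying_diagram (fun_cat C D)) k) n"
    then have x: "x \<in> Fun (ordinal n) (level_cat (fun_cat C D) k)" by simp
    let ?x = "comp_fun (ordinal n') x \<eta>"
    have x': "?x \<in> Fun (ordinal n') (level_cat (fun_cat C D) k)" by (rule comp_fun_in[OF _ e x]) simp
    have gx: "flat (fun_cat C D) k n x \<in> Fun (grid k n) (fun_cat C D)" using flat_Grid[OF F x] by (simp add: Grid_def)
    have "exp_comparison C D k n' ?x = Act (Lev (sspace_exp (classifying_diagram C) (classifying_diagram D)) k) n' n \<eta> (exp_comparison C D k n x)"
      unfolding exp_simps
    proof (rule exp_hom_ext[OF S[OF x'] Act_Map(1)[OF P e S[OF x]]])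
      fix m j \<sigma> \<alpha> \<beta> assume "\<sigma> \<in> Sim (Lev (classifying_diagram C) m) j" and a: "\<alpha> \<in> Delta m k" and b: "\<beta> \<in> Delta j n'"
      then have s: "\<sigma> \<in> Fun (ordinal j) (level_cat C m)" by simp
      have g: "flat C m j \<sigma> \<in> Fun (grid m j) C" using flat_Grid[OF C s] by (simp add: Grid_def)
      have d: "double_flat C D k n' ?x = comp_fun (prod_cat C (grid k n')) (double_flat C D k n x)
          (fun_prod C (grid k n') (id_fun C) (fun_prod (ordinal k) (ordinal n') (id_fun (ordinal k)) \<eta>))"
        unfolding double_flat_def flat_Act[OF F x e] by (rule double_flat_precomp[OF C D gx Delta_id e])
      have "exp_comparison C D k n' ?x m j ((\<sigma>, \<alpha>), \<beta>) = exp_comparison C D k n x m j ((\<sigma>, \<alpha>), comp_fun (ordinal j) \<eta> \<beta>)"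
        by (rule flat_inj[OF D A(1)[OF x' s a b] A(1)[OF x s a Delta_comp[OF b e]]])
          (simp add: A(2)[OF x' s a b] A(2)[OF x s a Delta_comp[OF b e]] d adm_grid_map[OF g a b] comp_fun_id[OF g] comp_fun_id[OF a]
             flip: comp_fun_assoc[OF adm_grid_in[OF g a b]])
      then show "exp_comparison C D k n' ?x m j ((\<sigma>, \<alpha>), \<beta>) =
        Act (Map (prod_sspace (classifying_diagram C) (F_sspace k)) (classifying_diagram D)) n' n \<eta> (exp_comparison C D k n x) m j ((\<sigma>, \<alpha>), \<beta>)"
        using s a b by (simp add: Act_Map(2)[OF P e S[OF x]])
    qed
    then show "exp_comparison C D k n' (Act (Lev (classifying_diagram (fun_cat C D)) k) n' n \<eta> x) =
      Act (Lev (sspace_exp (classifying_diagram C) (classifying_diagram D)) k) n' n \<eta> (exp_comparison C D k n x)"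
      using e x by simp
  next
    fix k' k \<theta> n x assume t: "\<theta> \<in> Delta k' k" and "x \<in> Sim (Lev (classifying_diagram (fun_cat C D)) k) n"
    then have x: "x \<in> Fun (ordinal n) (level_cat (fun_cat C D) k)" by simp
    let ?x = "comp_fun (ordinal n) (level_fun (fun_cat C D) k' k \<theta> (id_fun (fun_cat C D))) x"
    note x' = classifying_SAct[OF F x t]
    have gx: "flat (fun_cat C D) k n x \<in> Fun (grid k n) (fun_cat C D)" using flat_Grid[OF F x] by (simp add: Grid_def)
    have "exp_comparison C D k' n ?x = SAct (sspace_exp (classifying_diagram C) (classifying_diagram D)) k' k \<theta> n (exp_comparison C D k n x)"
    proof (rule exp_hom_ext[OF S[OF x'] exp_SAct(1)[OF NC ND t S[OF x]]])
      fix m j \<sigma> \<alpha> \<beta> assume "\<sigma> \<in> Sim (Lev (classifying_diagram C) m) j" and a: "\<alpha> \<in> Delta m k'" and b: "\<beta> \<in> Delta j n"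
      then have s: "\<sigma> \<in> Fun (ordinal j) (level_cat C m)" by simp
      have g: "flat C m j \<sigma> \<in> Fun (grid m j) C" using flat_Grid[OF C s] by (simp add: Grid_def)
      have d: "double_flat C D k' n ?x = comp_fun (prod_cat C (grid k' n)) (double_flat C D k n x)
          (fun_prod C (grid k' n) (id_fun C) (fun_prod (ordinal k') (ordinal n) \<theta> (id_fun (ordinal n))))"
        unfolding double_flat_def flat_SAct[OF F x t] by (rule double_flat_precomp[OF C D gx t Delta_id])
      have "exp_comparison C D k' n ?x m j ((\<sigma>, \<alpha>), \<beta>) = exp_comparison C D k n x m j ((\<sigma>, comp_fun (ordinal m) \<theta> \<alpha>), \<beta>)"
        by (rule flat_inj[OF D A(1)[OF x' s a b] A(1)[OF x s Delta_comp[OF a t] b]])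
          (simp add: A(2)[OF x' s a b] A(2)[OF x s Delta_comp[OF a t] b] d adm_grid_map[OF g a b] comp_fun_id[OF g] comp_fun_id[OF b]
             flip: comp_fun_assoc[OF adm_grid_in[OF g a b]])
      then show "exp_comparison C D k' n ?x m j ((\<sigma>, \<alpha>), \<beta>) =
        SAct (sspace_exp (classifying_diagram C) (classifying_diagram D)) k' k \<theta> n (exp_comparison C D k n x) m j ((\<sigma>, \<alpha>), \<beta>)"
        using s a b by (simp add: exp_SAct(2)[OF NC ND t S[OF x]])
    qed
    then show "exp_comparison C D k' n (SAct (classifying_diagram (fun_cat C D)) k' k \<theta> n x) =
      SAct (sspace_exp (classifying_diagram C) (classifying_diagram D)) k' k \<theta> n (exp_comparison C D k n x)"
      using t x by simp
  }
qed

text \<open>By \<open>adm_grid_map\<close> the functor u may be moved from the argument of the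
  represented functor onto the grid, where it is the induced map of diagrams; v postcomposes on both
  sides.\<close>

lemma exp_comparison_natural:
  fixes C :: "('a, 'b) cat" and D :: "('c, 'd) cat" and C' :: "('e, 'f) cat" and D' :: "('g, 'h) cat"
  assumes C: "category C" and C': "category C'" and D: "category D" and D': "category D'"
    and u: "u \<in> Fun C' C" and v: "v \<in> Fun D D'"
  shows "sspace_comp (classifying_diagram (fun_cat C D))
             (exp_comparison C' D') (classifying_map (fun_cat C D) (fun_cat_map C' C D u v)) =
           sspace_comp (classifying_diagram (fun_cat C D))
             (sspace_exp_map (classifying_diagram C') (classifying_diagram C) (classifying_diagram D)
               (classifying_map C' u) (classifying_map D v)) (exp_comparison C D)"
proof (rule sspace_comp_eqI)
  have F: "category (fun_cat C D)" and F': "category (fun_cat C' D')" using C D C' D' by simp_all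
  note NC = is_sspace_classifying_diagram[OF C] is_sspace_classifying_diagram[OF C']
  note W = fun_cat_map_in[OF C' C D D' u v]
  note Nu = classifying_map_in[OF C' C u] and Nv = classifying_map_in[OF D D' v] and Nw = classifying_map_in[OF F F' W]
  fix k n x assume x0: "x \<in> Sim (Lev (classifying_diagram (fun_cat C D)) k) n"
  then have x: "x \<in> Fun (ordinal n) (level_cat (fun_cat C D) k)" by simp
  let ?x = "classifying_map (fun_cat C D) (fun_cat_map C' C D u v) k n x"
  have x': "?x \<in> Fun (ordinal n) (level_cat (fun_cat C' D') k)" using sspace_hom_Sim(1)[OF Nw x0] by simp
  have gx: "flat (fun_cat C D) k n x \<in> Fun (grid k n) (fun_cat C D)" using flat_Grid[OF F x] by (simp add: Grid_def)
  note E = exp_map[OF NC Nu Nv exp_comparison_Sim[OF C D x]]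
  note A = exp_comparison_apply
  show "exp_comparison C' D' k n ?x =
    sspace_exp_map (classifying_diagram C') (classifying_diagram C) (classifying_diagram D)
       (classifying_map C' u) (classifying_map D v) k n (exp_comparison C D k n x)"
  proof (rule exp_hom_ext[OF exp_comparison_Sim[OF C' D' x'] E(1)])
    fix m j \<sigma> \<alpha> \<beta> assume s0: "\<sigma> \<in> Sim (Lev (classifying_diagram C') m) j" and a: "\<alpha> \<in> Delta m k" and b: "\<beta> \<in> Delta j n"
    then have s: "\<sigma> \<in> Fun (ordinal j) (level_cat C' m)" by simp
    have us: "classifying_map C' u m j \<sigma> \<in> Fun (ordinal j) (level_cat C m)" using sspace_hom_Sim(1)[OF Nu s0] by simp
    have g: "flat C' m j \<sigma> \<in> Fun (grid m j) C'" using flat_Grid[OF C' s] by (simp add: Grid_def)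
    let ?P = "prod_cat C' (grid k n)"
    let ?fp = "fun_prod C' (grid k n) u (fun_prod (ordinal k) (ordinal n) (id_fun (ordinal k)) (id_fun (ordinal n)))"
    have fx: "flat (fun_cat C' D') k n ?x =
      comp_fun (grid k n) (comp_fun (grid k n) (fun_cat_map C' C D u v) (flat (fun_cat C D) k n x))
        (fun_prod (ordinal k) (ordinal n) (id_fun (ordinal k)) (id_fun (ordinal n)))"
      by (simp add: fun_prod_id flat_map[OF F F' x W] comp_fun_id[OF comp_fun_in[OF _ gx W]])
    have d: "double_flat C' D' k n ?x = comp_fun ?P v (comp_fun ?P (double_flat C D k n x) ?fp)"
      unfolding double_flat_def fx by (rule double_flat_natural[OF C D C' D' gx u v Delta_id Delta_id])
    note ad = adm_grid_in[OF g a b]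
    have fp: "?fp \<in> Fun ?P (prod_cat C (grid k n))" using C' by (intro fun_prod_in u Delta_id) simp_all
    have ev: "exp_comparison C D k n x m j ((classifying_map C' u m j \<sigma>, \<alpha>), \<beta>) \<in> Fun (ordinal j) (level_cat D m)"
      by (rule A(1)[OF C D x us a b])
    have vy: "classifying_map D v m j (exp_comparison C D k n x m j ((classifying_map C' u m j \<sigma>, \<alpha>), \<beta>)) \<in> Fun (ordinal j) (level_cat D' m)"
      using sspace_hom_Sim(1)[OF Nv, of _ m j] ev by simp
    have adu: "adm_grid m j (flat C m j (classifying_map C' u m j \<sigma>)) \<alpha> \<beta> = comp_fun (grid m j) ?fp (adm_grid m j (flat C' m j \<sigma>) \<alpha> \<beta>)"
      by (simp add: adm_grid_map[OF g a b] flat_map[OF C' C s u] comp_fun_id[OF a] comp_fun_id[OF b])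
    have "exp_comparison C' D' k n ?x m j ((\<sigma>, \<alpha>), \<beta>) =
      classifying_map D v m j (exp_comparison C D k n x m j ((classifying_map C' u m j \<sigma>, \<alpha>), \<beta>))"
      by (rule flat_inj[OF D' A(1)[OF C' D' x' s a b] vy])
        (simp add: A(2)[OF C' D' x' s a b] flat_map[OF D D' ev v] A(2)[OF C D x us a b] d adu flip: comp_fun_assoc[OF ad])
    then show "exp_comparison C' D' k n ?x m j ((\<sigma>, \<alpha>), \<beta>) =
      sspace_exp_map (classifying_diagram C') (classifying_diagram C) (classifying_diagram D)
        (classifying_map C' u) (classifying_map D v) k n (exp_comparison C D k n x) m j ((\<sigma>, \<alpha>), \<beta>)"
      using E(2)[OF s0 a b] by simp
  qed
qed

section \<open>Reconstructing a functor from a map of simplicial spaces\<close>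

lemma GridD: "\<gamma> \<in> Grid C m n \<Longrightarrow> \<gamma> \<in> Fun (grid m n) C"
  by (simp add: Grid_def)

definition restr_grid where
  "restr_grid \<gamma> u v = comp_fun (grid 1 1) \<gamma> (fun_prod (ordinal 1) (ordinal 1) (seg u) (seg v))"

lemma restr_grid_in:
  assumes "category C" "\<gamma> \<in> Grid C m n" "u \<in> Arr (ordinal m)" "v \<in> Arr (ordinal n)"
  shows "restr_grid \<gamma> u v \<in> Grid C 1 1"
  unfolding restr_grid_def using assms by (intro comp_Grid seg_in)

lemma Arr_grid_11: "f \<in> Arr (grid 1 1) \<longleftrightarrow> f \<in> {(0, 0), (0, 1), (1, 1)} \<times> {(0, 0), (0, 1), (1, 1)}"
  by (cases f) (auto simp: Arr_ordinal_1)

lemma seg_in_Suc [simp]: "i \<le> i' \<Longrightarrow> i' \<le> k \<Longrightarrow> seg (i, i') \<in> Delta (Suc 0) k"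
  using seg_in[of "(i, i')" k] by simp

text \<open>A grid that ignores the spatial direction contains only squares of the form
  \<open>arrow_grid\<close>. Through this the values of a family on constant squares can be related
  to each other.\<close>

lemma restr_fst:
  assumes C: "category C" and F: "F \<in> Fun (ordinal m) C" and u: "u \<in> Arr (ordinal m)" and v: "v \<in> Arr (ordinal n)"
  shows "restr_grid (comp_fun (grid m n) F (fun_fst (ordinal m) (ordinal n))) u v = arrow_grid C (FArr F u)"
proof -
  obtain i i' p p' where uv: "u = (i, i')" "i \<le> i'" "i' \<le> m" "v = (p, p')" "p \<le> p'" "p' \<le> n"
    using u v by (auto simp: Arr_ordinal)
  have I: "FArr F (q, q) = Ide C (FObj F q)" if "q \<le> m" for q using Fun_simps(5)[OF F, of q] that by simp
  have d: "Dom C (FArr F u) = FObj F i" "Cod C (FArr F u) = FObj F i'" using Fun_simps(3,4)[OF F u] uv by simp_all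
  show ?thesis
  proof (rule Fun_ext_Arr[OF _ C GridD[OF restr_grid_in[OF C fst_Grid[OF C F] u v]] GridD[OF arrow_grid_in[OF C Fun_simps(2)[OF F u]]]])
    fix f assume f: "f \<in> Arr (grid 1 1)"
    show "FArr (restr_grid (comp_fun (grid m n) F (fun_fst (ordinal m) (ordinal n))) u v) f = FArr (arrow_grid C (FArr F u)) f"
      using f uv I d unfolding Arr_grid_11 by (auto simp: restr_grid_def arrow_grid_def)
  qed simp
qed

text \<open>A map from NC x F(k) x \<Delta>[n] to ND, written on grids. \<open>H_comp\<close>
  bundles its compatibility with the operators of both directions.\<close>

locale grid_family =
  fixes C :: "('o, 'a) cat" and D :: "('p, 'b) cat" and k n :: nat
    and H :: "nat \<Rightarrow> nat \<Rightarrow> (nat \<times> nat, (nat \<times> nat) \<times> (nat \<times> nat), 'o, 'a) funct \<Rightarrow> delta \<Rightarrow> delta \<Rightarrow>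
      (nat \<times> nat, (nat \<times> nat) \<times> (nat \<times> nat), 'p, 'b) funct"
  assumes C: "category C" and D: "category D"
    and H_Grid: "\<And>m j \<gamma> \<alpha> \<beta>. \<gamma> \<in> Grid C m j \<Longrightarrow> \<alpha> \<in> Delta m k \<Longrightarrow> \<beta> \<in> Delta j n \<Longrightarrow> H m j \<gamma> \<alpha> \<beta> \<in> Grid D m j"
    and H_comp: "\<And>m j m' j' \<gamma> \<alpha> \<beta> \<theta> \<eta>. \<gamma> \<in> Grid C m j \<Longrightarrow> \<alpha> \<in> Delta m k \<Longrightarrow> \<beta> \<in> Delta j n \<Longrightarrow>
      \<theta> \<in> Delta m' m \<Longrightarrow> \<eta> \<in> Delta j' j \<Longrightarrow>
      H m' j' (comp_fun (grid m' j') \<gamma> (fun_prod (ordinal m') (ordinal j') \<theta> \<eta>))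
          (comp_fun (ordinal m') \<alpha> \<theta>) (comp_fun (ordinal j') \<beta> \<eta>) =
        comp_fun (grid m' j') (H m j \<gamma> \<alpha> \<beta>) (fun_prod (ordinal m') (ordinal j') \<theta> \<eta>)"
begin

definition val where
  "val \<gamma> a b = FArr (H 1 1 \<gamma> (seg a) (seg b)) ((0, 1), (0, 1))"

lemma H_restr:
  assumes g: "\<gamma> \<in> Grid C m j" and a: "\<alpha> \<in> Delta m k" and b: "\<beta> \<in> Delta j n"
    and i: "i \<le> i'" "i' \<le> m" "p \<le> p'" "p' \<le> j"
  shows "H 1 1 (restr_grid \<gamma> (i, i') (p, p')) (seg (FObj \<alpha> i, FObj \<alpha> i')) (seg (FObj \<beta> p, FObj \<beta> p')) =
    restr_grid (H m j \<gamma> \<alpha> \<beta>) (i, i') (p, p')"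
proof -
  have s: "seg (i, i') \<in> Delta 1 m" "seg (p, p') \<in> Delta 1 j" using i by simp_all
  have "comp_fun (ordinal 1) \<alpha> (seg (i, i')) = seg (FObj \<alpha> i, FObj \<alpha> i')"
    using Delta_1_eq_seg[OF Delta_comp[OF s(1) a]] by simp
  moreover have "comp_fun (ordinal 1) \<beta> (seg (p, p')) = seg (FObj \<beta> p, FObj \<beta> p')"
    using Delta_1_eq_seg[OF Delta_comp[OF s(2) b]] by simp
  ultimately show ?thesis
    using H_comp[OF g a b s] by (simp add: restr_grid_def)
qed

text \<open>Every arrow of a grid is the diagonal of the square that it spans, and H commutes with
  cutting out that square. Hence the diagonal values \<open>val\<close> determine H.\<close>

lemma H_FArr:
  assumes g: "\<gamma> \<in> Grid C m j" and a: "\<alpha> \<in> Delta m k" and b: "\<beta> \<in> Delta j n"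
    and i: "i \<le> i'" "i' \<le> m" "p \<le> p'" "p' \<le> j"
  shows "FArr (H m j \<gamma> \<alpha> \<beta>) ((i, i'), (p, p')) =
    val (restr_grid \<gamma> (i, i') (p, p')) (FObj \<alpha> i, FObj \<alpha> i') (FObj \<beta> p, FObj \<beta> p')"
  unfolding val_def H_restr[OF assms] using i by (simp add: restr_grid_def)

lemma H_FObj:
  assumes g: "\<gamma> \<in> Grid C m j" and a: "\<alpha> \<in> Delta m k" and b: "\<beta> \<in> Delta j n" and i: "i \<le> m" "p \<le> j"
  shows "FObj (H m j \<gamma> \<alpha> \<beta>) (i, p) =
    FObj (H 1 1 (restr_grid \<gamma> (i, i) (p, p)) (seg (FObj \<alpha> i, FObj \<alpha> i)) (seg (FObj \<beta> p, FObj \<beta> p))) (0, 0)"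
  using H_restr[OF g a b, of i i p p] i by (simp add: restr_grid_def)

text \<open>The hypothesis \<open>r\<close> says that \<gamma> is constant at its corner, and the
  two segments are constant as well. So the image square is unchanged by restriction to the corner,
  and its diagonal is the identity there.\<close>

lemma val_Ide:
  assumes g: "\<gamma> \<in> Grid C 1 1" and i: "i \<le> k" and p: "p \<le> n" and r: "restr_grid \<gamma> (0, 0) (0, 0) = \<gamma>"
  shows "val \<gamma> (i, i) (p, p) = Ide D (FObj (H 1 1 \<gamma> (seg (i, i)) (seg (p, p))) (0, 0))"
proof -
  have s: "seg (i, i) \<in> Delta 1 k" "seg (p, p) \<in> Delta 1 n" using i p by simp_all
  have "val \<gamma> (i, i) (p, p) = FArr (H 1 1 \<gamma> (seg (i, i)) (seg (p, p))) ((0, 0), (0, 0))"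
    using H_FArr[OF g s, of 0 0 0 0] r by simp
  also have "\<dots> = Ide D (FObj (H 1 1 \<gamma> (seg (i, i)) (seg (p, p))) (0, 0))"
    using Fun_simps(5)[OF GridD[OF H_Grid[OF g s]], of "(0, 0)"] by simp
  finally show ?thesis .
qed

lemma arrow_grid_restr:
  assumes "f \<in> Arr C" "u \<in> Arr (ordinal 1)" "v \<in> Arr (ordinal 1)"
  shows "restr_grid (arrow_grid C f) u v = arrow_grid C (FArr (arrow_fun C f) u)"
  unfolding arrow_grid_def[of C f] using assms C by (intro restr_fst arrow_fun_in)

text \<open>The candidate functor on C x [k] x [n]. An arrow f of C is presented to H by the square
  that is constant in the spatial direction, the only kind that is available for all f.\<close>

definition extension :: "('o \<times> nat \<times> nat, 'a \<times> (nat \<times> nat) \<times> (nat \<times> nat), 'p, 'b) funct" where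
  "extension =
     \<lparr>FObj = (\<lambda>(x, i, p)\<in>Obj (prod_cat C (grid k n)). FObj (H 1 1 (arrow_grid C (Ide C x)) (seg (i, i)) (seg (p, p))) (0, 0)),
      FArr = (\<lambda>(f, a, b)\<in>Arr (prod_cat C (grid k n)). val (arrow_grid C f) a b)\<rparr>"

lemma extension_simps [simp]:
  "x \<in> Obj C \<Longrightarrow> i \<le> k \<Longrightarrow> p \<le> n \<Longrightarrow>
    FObj extension (x, i, p) = FObj (H 1 1 (arrow_grid C (Ide C x)) (seg (i, i)) (seg (p, p))) (0, 0)"
  "f \<in> Arr C \<Longrightarrow> a \<in> Arr (ordinal k) \<Longrightarrow> b \<in> Arr (ordinal n) \<Longrightarrow> FArr extension (f, a, b) = val (arrow_grid C f) a b"
  by (auto simp: extension_def)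

lemma val_ends:
  assumes f: "f \<in> Arr C" and a: "i \<le> i'" "i' \<le> k" and b: "p \<le> p'" "p' \<le> n"
  shows "val (arrow_grid C f) (i, i') (p, p') \<in> Arr D"
    and "Dom D (val (arrow_grid C f) (i, i') (p, p')) = FObj extension (Dom C f, i, p)"
    and "Cod D (val (arrow_grid C f) (i, i') (p, p')) = FObj extension (Cod C f, i', p')"
proof -
  have s: "seg (i, i') \<in> Delta 1 k" "seg (p, p') \<in> Delta 1 n" using a b by simp_all
  note g = arrow_grid_in[OF C f]
  note h = GridD[OF H_Grid[OF g s]]
  have 1: "((0, 1), 0, 1) \<in> Arr (grid 1 1)" by simp
  show "val (arrow_grid C f) (i, i') (p, p') \<in> Arr D"
    unfolding val_def using Fun_simps(2)[OF h 1] .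
  show "Dom D (val (arrow_grid C f) (i, i') (p, p')) = FObj extension (Dom C f, i, p)"
    using C f a b Fun_simps(3)[OF h 1] H_FObj[OF g s, of 0 0] by (simp add: val_def arrow_grid_restr)
  show "Cod D (val (arrow_grid C f) (i, i') (p, p')) = FObj extension (Cod C f, i', p')"
    using C f a b Fun_simps(4)[OF h 1] H_FObj[OF g s, of 1 1] by (simp add: val_def arrow_grid_restr)
qed

text \<open>The chain of f and g, kept constant in the spatial direction, is a grid of shape [2] x
  [2]. Its squares between consecutive diagonal points carry f and g, its large square carries the
  composite, and the image of this grid is a functor.\<close>

lemma val_comp:
  assumes f: "f \<in> Arr C" and g: "g \<in> Arr C" and gf: "Dom C g = Cod C f"
    and a: "i \<le> i'" "i' \<le> i''" "i'' \<le> k" and b: "p \<le> p'" "p' \<le> p''" "p'' \<le> n"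
  shows "val (arrow_grid C (Comp C g f)) (i, i'') (p, p'') =
    Comp D (val (arrow_grid C g) (i', i'') (p', p'')) (val (arrow_grid C f) (i, i') (p, p'))"
proof -
  let ?F = "chain2 C g f"
  have F: "?F \<in> Fun (ordinal 2) C" by (rule chain2_in[OF C f g gf])
  let ?g = "comp_fun (grid 2 2) ?F (fun_fst (ordinal 2) (ordinal 2))"
  have G: "?g \<in> Grid C 2 2" by (rule fst_Grid[OF C F])
  let ?a = "delta_of 2 (\<lambda>q. if q = 0 then i else if q = 1 then i' else i'')"
  let ?b = "delta_of 2 (\<lambda>q. if q = 0 then p else if q = 1 then p' else p'')"
  have s: "?a \<in> Delta 2 k" "?b \<in> Delta 2 n" using a b by (auto intro!: delta_of_in)
  note h = GridD[OF H_Grid[OF G s]]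
  note R = restr_fst[OF C F]
  have "FArr (H 2 2 ?g ?a ?b) ((0, 2), (0, 2)) =
    Comp D (FArr (H 2 2 ?g ?a ?b) ((1, 2), (1, 2))) (FArr (H 2 2 ?g ?a ?b) ((0, 1), (0, 1)))"
    using Fun_Comp[OF h, of "((1, 2), (1, 2))" "((0, 1), (0, 1))"] by simp
  then show ?thesis
    using H_FArr[OF G s, of 0 2 0 2] H_FArr[OF G s, of 1 2 1 2] H_FArr[OF G s, of 0 1 0 1]
    by (simp add: R)
qed

lemma extension_in: "extension \<in> exp_functors C D k n"
proof -
  let ?P = "prod_cat C (grid k n)"
  have "extension \<in> Fun ?P D"
  proof (rule FunI)
    fix z assume "z \<in> Obj ?P"
    then obtain x i p where z: "z = (x, i, p)" "x \<in> Obj C" "i \<le> k" "p \<le> n" by auto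
    have s: "seg (i, i) \<in> Delta 1 k" "seg (p, p) \<in> Delta 1 n" using z by simp_all
    have g: "arrow_grid C (Ide C x) \<in> Grid C 1 1" using C z by (intro arrow_grid_in) simp_all
    show "FObj extension z \<in> Obj D"
      using z Fun_simps(1)[OF GridD[OF H_Grid[OF g s]], of "(0, 0)"] by simp
    show "FArr extension (Ide ?P z) = Ide D (FObj extension z)"
      using z C val_Ide[OF g z(3,4)] by (simp add: arrow_grid_restr)
  next
    fix z assume "z \<in> Arr ?P"
    then obtain f i i' p p' where "z = (f, (i, i'), (p, p'))" "f \<in> Arr C" "i \<le> i'" "i' \<le> k" "p \<le> p'" "p' \<le> n"
      by (auto simp: Arr_ordinal)
    then show "FArr extension z \<in> Arr D" "Dom D (FArr extension z) = FObj extension (Dom ?P z)"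
      "Cod D (FArr extension z) = FObj extension (Cod ?P z)"
      using val_ends[of f i i' p p'] by (simp_all del: extension_simps(1))
  next
    fix z' z assume "z' \<in> Arr ?P" "z \<in> Arr ?P" "Dom ?P z' = Cod ?P z"
    then obtain f g i i' i'' p p' p'' where "z = (f, (i, i'), (p, p'))" "z' = (g, (i', i''), (p', p''))"
      "f \<in> Arr C" "g \<in> Arr C" "Dom C g = Cod C f" "i \<le> i'" "i' \<le> i''" "i'' \<le> k" "p \<le> p'" "p' \<le> p''" "p'' \<le> n"
      by (auto simp: Arr_ordinal)
    then show "FArr extension (Comp ?P z' z) = Comp D (FArr extension z') (FArr extension z)"
      using C val_comp[of f g i i' i'' p p' p''] by simp
  qed (simp_all add: extension_def)
  moreover have "FArr extension (Ide C x, ((i, i), (p, q))) \<in> iso_arrows D"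
    if "x \<in> Obj C" "i \<le> k" "p \<le> q" "q \<le> n" for x i p q
  proof -
    have s: "seg (i, i) \<in> Delta 1 k" "seg (p, q) \<in> Delta 1 n" using that by simp_all
    have g: "arrow_grid C (Ide C x) \<in> Grid C 1 1" using C that by (intro arrow_grid_in) simp_all
    \<comment> \<open>The source square and its segment in [k] are constant, so the diagonal value
      is also a spatial edge of the image square; such edges are invertible by definition of
      \<open>Grid\<close>.\<close>
    have "FArr extension (Ide C x, ((i, i), (p, q))) = FArr (H 1 1 (arrow_grid C (Ide C x)) (seg (i, i)) (seg (p, q))) ((0, 0), (0, 1))"
      using H_FArr[OF g s, of 0 0 0 1] that C by (simp add: arrow_grid_restr)
    then show ?thesis using H_Grid[OF g s] by (simp add: Grid_def)
  qed
  ultimately show ?thesis by (simp add: exp_functors_def)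
qed

text \<open>
  A square and the constant square on its diagonal are both faces of one grid of shape $[3]\times[1]$,
  in which the remaining pieces of the diagonal are degenerate.
\<close>

lemma val_diagonal:
  assumes g: "\<gamma> \<in> Grid C 1 1" and i: "i \<le> i'" "i' \<le> k" and p: "p \<le> p'" "p' \<le> n"
  shows "val \<gamma> (i, i') (p, p') = val (arrow_grid C (FArr \<gamma> ((0, 1), (0, 1)))) (i, i') (p, p')"
proof -
  \<comment> \<open>Columns 0, 1, 2, 3 at height p go to (0, 0), (0, p), (1, p), (1, 1). The two
    middle columns form the given square, the outer ones are collapsed to its corners, and
    \<open>?a\<close> moves only between the middle columns.\<close>
  let ?r = "grid_map 3 1 (\<lambda>i p. if i \<le> 1 then 0 else 1) (\<lambda>i p. if i = 0 then 0 else if i = 3 then 1 else p)"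
  let ?g = "comp_fun (grid 3 1) \<gamma> ?r"
  let ?a = "delta_of 3 (\<lambda>q. if q \<le> 1 then i else i')" and ?b = "seg (p, p')"
  have r: "?r \<in> Fun (grid 3 1) (grid 1 1)" by (rule grid_map_in) auto
  note g' = GridD[OF g]
  have G: "?g \<in> Grid C 3 1"
  proof -
    have "?g \<in> Fun (grid 3 1) C" by (rule comp_fun_in[OF _ r g']) simp
    then show ?thesis using g unfolding Grid_def by auto
  qed
  have s: "?a \<in> Delta 3 k" "?b \<in> Delta 1 n" using i p by (auto intro!: delta_of_in)
  let ?h = "H 3 1 ?g ?a ?b"
  note h = GridD[OF H_Grid[OF G s]]
  have restr: "restr_grid ?g u v = comp_fun (grid 1 1) \<gamma> (comp_fun (grid 1 1) ?r (fun_prod (ordinal 1) (ordinal 1) (seg u) (seg v)))"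
    and rin: "comp_fun (grid 1 1) ?r (fun_prod (ordinal 1) (ordinal 1) (seg u) (seg v)) \<in> Fun (grid 1 1) (grid 1 1)"
    if "u \<in> Arr (ordinal 3)" "v \<in> Arr (ordinal 1)" for u v
  proof -
    have f: "fun_prod (ordinal 1) (ordinal 1) (seg u) (seg v) \<in> Fun (grid 1 1) (grid 3 1)"
      using that by (intro fun_prod_in seg_in) simp_all
    show "restr_grid ?g u v = comp_fun (grid 1 1) \<gamma> (comp_fun (grid 1 1) ?r (fun_prod (ordinal 1) (ordinal 1) (seg u) (seg v)))"
      unfolding restr_grid_def by (rule comp_fun_assoc[OF f, symmetric])
    show "comp_fun (grid 1 1) ?r (fun_prod (ordinal 1) (ordinal 1) (seg u) (seg v)) \<in> Fun (grid 1 1) (grid 1 1)"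
      by (rule comp_fun_in[OF _ f r]) simp
  qed
  have mid: "restr_grid ?g (1, 2) (0, 1) = \<gamma>"
  proof -
    have u: "(1, 2) \<in> Arr (ordinal 3)" "(0, 1) \<in> Arr (ordinal 1)" by simp_all
    have eq: "comp_fun (grid 1 1) ?r (fun_prod (ordinal 1) (ordinal 1) (seg (1, 2)) (seg (0, 1))) = id_fun (grid 1 1)"
      by (rule grid_Fun_ext[OF _ rin[OF u] id_fun_in]) (auto simp: le_Suc_eq)
    show ?thesis unfolding restr[OF u] eq by (rule comp_fun_id(1)[OF g'])
  qed
  have const: "restr_grid (restr_grid ?g u v) (0, 0) (0, 0) = restr_grid ?g u v"
    if uv: "u = (0, 1) \<and> v = (0, 0) \<or> u = (2, 3) \<and> v = (1, 1)" for u v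
  proof -
    have uv': "u \<in> Arr (ordinal 3)" "v \<in> Arr (ordinal 1)" using uv by auto
    let ?c = "comp_fun (grid 1 1) ?r (fun_prod (ordinal 1) (ordinal 1) (seg u) (seg v))"
    have f: "fun_prod (ordinal 1) (ordinal 1) (seg (0, 0)) (seg (0, 0)) \<in> Fun (grid 1 1) (grid 1 1)"
      by (intro fun_prod_in seg_in) simp_all
    have c: "comp_fun (grid 1 1) ?c (fun_prod (ordinal 1) (ordinal 1) (seg (0, 0)) (seg (0, 0))) = ?c"
      by (rule grid_Fun_ext[OF _ comp_fun_in[OF _ f rin[OF uv']] rin[OF uv']]) (use uv in \<open>auto simp: le_Suc_eq\<close>)
    show ?thesis
      unfolding restr[OF uv'] unfolding restr_grid_def
      by (rule trans[OF comp_fun_assoc[OF f, of \<gamma> ?c, symmetric] arg_cong[OF c, of "comp_fun (grid 1 1) \<gamma>"]])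
  qed
  have whole: "restr_grid ?g (0, 3) (0, 1) = arrow_grid C (FArr \<gamma> ((0, 1), (0, 1)))"
  proof (rule Fun_ext_Arr[OF _ C GridD[OF restr_grid_in[OF C G]] GridD[OF arrow_grid_in[OF C]]])
    have d: "((0, 1), (0, 1)) \<in> Arr (grid 1 1)" by simp
    show "FArr \<gamma> ((0, 1), (0, 1)) \<in> Arr C" using Fun_simps(2)[OF g' d] .
    fix f assume f: "f \<in> Arr (grid 1 1)"
    have "FArr \<gamma> ((0, 0), (0, 0)) = Ide C (FObj \<gamma> (0, 0))" "FArr \<gamma> ((1, 1), (1, 1)) = Ide C (FObj \<gamma> (1, 1))"
      "Dom C (FArr \<gamma> ((0, 1), (0, 1))) = FObj \<gamma> (0, 0)" "Cod C (FArr \<gamma> ((0, 1), (0, 1))) = FObj \<gamma> (1, 1)"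
      using Fun_simps(5)[OF g', of "(0, 0)"] Fun_simps(5)[OF g', of "(1, 1)"] Fun_simps(3,4)[OF g' d] by simp_all
    then show "FArr (restr_grid ?g (0, 3) (0, 1)) f = FArr (arrow_grid C (FArr \<gamma> ((0, 1), (0, 1)))) f"
      using f unfolding Arr_grid_11 by (auto simp: restr_grid_def arrow_grid_def)
  qed simp_all
  have ends: "FArr ?h ((0, 1), (0, 0)) = Ide D (FObj ?h (1, 0))" "FArr ?h ((2, 3), (1, 1)) = Ide D (FObj ?h (2, 1))"
  proof -
    have *: "FArr ?h (u, v) = Ide D (Dom D (FArr ?h (u, v))) \<and> Cod D (FArr ?h (u, v)) = Dom D (FArr ?h (u, v))"
      if uv: "u = (0, 1) \<and> v = (0, 0) \<or> u = (2, 3) \<and> v = (1, 1)" for u v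
    proof -
      have uv': "u \<in> Arr (ordinal 3)" "v \<in> Arr (ordinal 1)" using uv by auto
      note rg = restr_grid_in[OF C G uv']
      have "\<exists>q t. q \<le> k \<and> t \<le> n \<and> FArr ?h (u, v) = val (restr_grid ?g u v) (q, q) (t, t)"
        using uv
      proof
        assume "u = (0, 1) \<and> v = (0, 0)"
        then show ?thesis using H_FArr[OF G s, of 0 1 0 0] i p by (intro exI[of _ i] exI[of _ p]) simp
      next
        assume "u = (2, 3) \<and> v = (1, 1)"
        then show ?thesis using H_FArr[OF G s, of 2 3 1 1] i p by (intro exI[of _ i'] exI[of _ p']) simp
      qed
      then obtain q t where qt: "q \<le> k" "t \<le> n" "FArr ?h (u, v) = val (restr_grid ?g u v) (q, q) (t, t)" by blast
      have "FObj (H 1 1 (restr_grid ?g u v) (seg (q, q)) (seg (t, t))) (0, 0) \<in> Obj D"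
        using Fun_simps(1)[OF GridD[OF H_Grid[OF rg seg_in seg_in]], of "(q, q)" "(t, t)" "(0, 0)"] qt by simp
      then show ?thesis
        using qt(3) val_Ide[OF rg qt(1,2) const[OF uv]] D by simp
    qed
    show "FArr ?h ((0, 1), (0, 0)) = Ide D (FObj ?h (1, 0))"
      using *[of "(0, 1)" "(0, 0)"] Fun_simps(4)[OF h, of "((0, 1), (0, 0))"] by simp
    show "FArr ?h ((2, 3), (1, 1)) = Ide D (FObj ?h (2, 1))"
      using *[of "(2, 3)" "(1, 1)"] Fun_simps(3)[OF h, of "((2, 3), (1, 1))"] by simp
  qed
  \<comment> \<open>The long diagonal runs at height 0 to column 1, crosses the middle square, and
    ends at height 1. The outer two pieces are identities by \<open>ends\<close>.\<close>
  have "FArr ?h ((0, 3), (0, 1)) = Comp D (FArr ?h ((2, 3), (1, 1))) (Comp D (FArr ?h ((1, 2), (0, 1))) (FArr ?h ((0, 1), (0, 0))))"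
    using Fun_Comp[OF h, of "((2, 3), (1, 1))" "((0, 2), (0, 1))"] Fun_Comp[OF h, of "((1, 2), (0, 1))" "((0, 1), (0, 0))"] by simp
  also have "\<dots> = FArr ?h ((1, 2), (0, 1))"
  proof -
    have "((1, 2), (0, 1)) \<in> Arr (grid 3 1)" by simp
    then have "FArr ?h ((1, 2), (0, 1)) \<in> Arr D" "Dom D (FArr ?h ((1, 2), (0, 1))) = FObj ?h (1, 0)"
      "Cod D (FArr ?h ((1, 2), (0, 1))) = FObj ?h (2, 1)" using Fun_simps(2-4)[OF h, of "((1, 2), (0, 1))"] by simp_all
    then show ?thesis unfolding ends using D by simp
  qed
  finally have "FArr ?h ((0, 3), (0, 1)) = FArr ?h ((1, 2), (0, 1))" .
  moreover have "FArr ?h ((0, 3), (0, 1)) = val (arrow_grid C (FArr \<gamma> ((0, 1), (0, 1)))) (i, i') (p, p')"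
    using H_FArr[OF G s, of 0 3 0 1] unfolding whole by simp
  moreover have "FArr ?h ((1, 2), (0, 1)) = val \<gamma> (i, i') (p, p')"
    using H_FArr[OF G s, of 1 2 0 1] unfolding mid by simp
  ultimately show ?thesis by metis
qed

text \<open>On an arrow, \<open>H_FArr\<close> reduces the left side to \<open>val\<close> of the
  spanned square, and \<open>val_diagonal\<close> replaces this square by the constant one on its
  diagonal, which is how \<open>extension\<close> is defined.\<close>

lemma H_eq:
  assumes g: "\<gamma> \<in> Grid C m j" and a: "\<alpha> \<in> Delta m k" and b: "\<beta> \<in> Delta j n"
  shows "H m j \<gamma> \<alpha> \<beta> = comp_fun (grid m j) extension (adm_grid m j \<gamma> \<alpha> \<beta>)"
proof (rule Fun_ext_Arr[OF _ D GridD[OF H_Grid[OF assms]] GridD[OF adm_grid_Grid[OF C D extension_in assms]]])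
  fix u assume "u \<in> Arr (grid m j)"
  then obtain i i' p p' where u: "u = ((i, i'), (p, p'))" "i \<le> i'" "i' \<le> m" "p \<le> p'" "p' \<le> j"
    unfolding Arr_grid by auto
  have r: "restr_grid \<gamma> (i, i') (p, p') \<in> Grid C 1 1" using u by (intro restr_grid_in[OF C g]) simp_all
  have "FArr (restr_grid \<gamma> (i, i') (p, p')) ((0, 1), (0, 1)) = FArr \<gamma> u" using u by (simp add: restr_grid_def)
  moreover have "FArr \<gamma> u \<in> Arr C" using Fun_simps(2)[OF GridD[OF g], of u] u by simp
  ultimately show "FArr (H m j \<gamma> \<alpha> \<beta>) u = FArr (comp_fun (grid m j) extension (adm_grid m j \<gamma> \<alpha> \<beta>)) u"
    using u H_FArr[OF g a b u(2-5)] val_diagonal[OF r, of "FObj \<alpha> i" "FObj \<alpha> i'" "FObj \<beta> p" "FObj \<beta> p'"]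
    by (simp add: adm_grid_FArr[OF a b] Delta_simps[OF a] Delta_simps[OF b])
qed simp

end

section \<open>Bijectivity of the comparison map\<close>

lemma unflat_flat:
  assumes C: "category C" and s: "\<sigma> \<in> Fun (ordinal j) (level_cat C m)"
  shows "unflat C m j (flat C m j \<sigma>) = \<sigma>"
  by (rule flat_inj[OF C unflat_in[OF C flat_Grid[OF C s]] s]) (simp add: C flat_Grid[OF C s])

lemma flat_both:
  assumes C: "category C" and x: "x \<in> Fun (ordinal n) (level_cat C m)" and t: "\<theta> \<in> Delta m' m" and e: "\<eta> \<in> Delta n' n"
  shows "flat C m' n' (comp_fun (ordinal n') (comp_fun (ordinal n) (level_fun C m' m \<theta> (id_fun C)) x) \<eta>) =
    comp_fun (grid m' n') (flat C m n x) (fun_prod (ordinal m') (ordinal n') \<theta> \<eta>)"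
  using flat_natural[OF C C x t id_fun_in[OF C] e] comp_fun_id[OF GridD[OF comp_Grid[OF C flat_Grid[OF C x] t e]]] by simp

text \<open>Conjugating h with \<open>flat\<close> and \<open>unflat\<close> turns it into a
  \<open>grid_family\<close>, and the functor reconstructed there represents the preimage.\<close>

lemma exp_comparison_surj:
  fixes C :: "('a, 'b) cat" and D :: "('c, 'd) cat"
  assumes C: "category C" and D: "category D"
    and h: "h \<in> sspace_hom (prod_sspace (prod_sspace (classifying_diagram C) (F_sspace k)) (simplex_sspace n)) (classifying_diagram D)"
  shows "\<exists>x\<in>Fun (ordinal n) (level_cat (fun_cat C D) k). exp_comparison C D k n x = h"
proof -
  let ?Q = "prod_sspace (prod_sspace (classifying_diagram C) (F_sspace k)) (simplex_sspace n)"
  define H where "H m j \<gamma> \<alpha> \<beta> = flat D m j (h m j ((unflat C m j \<gamma>, \<alpha>), \<beta>))" for m j \<gamma> \<alpha> \<beta>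
  have hS: "h m j ((\<sigma>, \<alpha>), \<beta>) \<in> Fun (ordinal j) (level_cat D m)"
    if "\<sigma> \<in> Fun (ordinal j) (level_cat C m)" "\<alpha> \<in> Delta m k" "\<beta> \<in> Delta j n" for m j \<sigma> \<alpha> \<beta>
    using sspace_hom_Sim(1)[OF h, of "((\<sigma>, \<alpha>), \<beta>)" m j] that by simp
  interpret grid_family C D k n H
  proof
    fix m j \<gamma> \<alpha> \<beta> assume "\<gamma> \<in> Grid C m j" "\<alpha> \<in> Delta m k" "\<beta> \<in> Delta j n"
    then show "H m j \<gamma> \<alpha> \<beta> \<in> Grid D m j"
      unfolding H_def by (intro flat_Grid[OF D] hS unflat_in[OF C])
  next
    fix m j m' j' \<gamma> \<alpha> \<beta> \<theta> \<eta>
    assume g: "\<gamma> \<in> Grid C m j" and a: "\<alpha> \<in> Delta m k" and b: "\<beta> \<in> Delta j n" and t: "\<theta> \<in> Delta m' m" and e: "\<eta> \<in> Delta j' j"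
    let ?s = "unflat C m j \<gamma>"
    have s: "?s \<in> Fun (ordinal j) (level_cat C m)" by (rule unflat_in[OF C g])
    let ?s1 = "comp_fun (ordinal j) (level_fun C m' m \<theta> (id_fun C)) ?s"
    note s1 = classifying_SAct[OF C s t]
    let ?s2 = "comp_fun (ordinal j') ?s1 \<eta>"
    have s2: "?s2 \<in> Fun (ordinal j') (level_cat C m')" by (rule comp_fun_in[OF _ e s1]) simp
    have eq: "unflat C m' j' (comp_fun (grid m' j') \<gamma> (fun_prod (ordinal m') (ordinal j') \<theta> \<eta>)) = ?s2"
      by (rule flat_inj[OF C unflat_in[OF C comp_Grid[OF C g t e]] s2])
        (simp add: flat_unflat[OF C comp_Grid[OF C g t e]] flat_both[OF C s t e] flat_unflat[OF C g])
    \<comment> \<open>\<open>H_comp\<close> combines two compatibilities of h: the operators inside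
      a level deal with \<eta>, those between levels with \<theta>.\<close>
    have "h m' j' ((?s2, comp_fun (ordinal m') \<alpha> \<theta>), comp_fun (ordinal j') \<beta> \<eta>) =
      comp_fun (ordinal j') (h m' j ((?s1, comp_fun (ordinal m') \<alpha> \<theta>), \<beta>)) \<eta>"
      using sspace_hom_Sim(3)[OF h e, of "((?s1, comp_fun (ordinal m') \<alpha> \<theta>), \<beta>)" m'] s1 Delta_comp[OF t a] b e
        hS[OF s1 Delta_comp[OF t a] b] by simp
    also have "h m' j ((?s1, comp_fun (ordinal m') \<alpha> \<theta>), \<beta>) =
      comp_fun (ordinal j) (level_fun D m' m \<theta> (id_fun D)) (h m j ((?s, \<alpha>), \<beta>))"
      using sspace_homD(2)[OF h t, of "((?s, \<alpha>), \<beta>)" j] s a b t hS[OF s a b] by simp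
    finally show "H m' j' (comp_fun (grid m' j') \<gamma> (fun_prod (ordinal m') (ordinal j') \<theta> \<eta>))
          (comp_fun (ordinal m') \<alpha> \<theta>) (comp_fun (ordinal j') \<beta> \<eta>) =
        comp_fun (grid m' j') (H m j \<gamma> \<alpha> \<beta>) (fun_prod (ordinal m') (ordinal j') \<theta> \<eta>)"
      unfolding H_def eq by (simp add: flat_both[OF D hS[OF s a b] t e])
  qed (fact C D)+
  obtain x where x: "x \<in> Fun (ordinal n) (level_cat (fun_cat C D) k)" and xe: "double_flat C D k n x = extension"
    using double_flat_surj[OF C D extension_in] by blast
  have "exp_comparison C D k n x = h"
  proof (rule exp_hom_ext[OF exp_comparison_Sim[OF C D x] h])
    fix m j \<sigma> \<alpha> \<beta> assume "\<sigma> \<in> Sim (Lev (classifying_diagram C) m) j" and a: "\<alpha> \<in> Delta m k" and b: "\<beta> \<in> Delta j n"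
    then have s: "\<sigma> \<in> Fun (ordinal j) (level_cat C m)" by simp
    show "exp_comparison C D k n x m j ((\<sigma>, \<alpha>), \<beta>) = h m j ((\<sigma>, \<alpha>), \<beta>)"
      using H_eq[OF flat_Grid[OF C s] a b]
      by (intro flat_inj[OF D exp_comparison_apply(1)[OF C D x s a b] hS[OF s a b]])
        (simp add: exp_comparison_apply(2)[OF C D x s a b] xe H_def unflat_flat[OF C s])
  qed
  with x show ?thesis by blast
qed

text \<open>The value at (f, a, b) is the diagonal of the image of the constant square on f with
  segments a and b, so the comparison map remembers the whole functor.\<close>

lemma exp_comparison_inj:
  fixes C :: "('a, 'b) cat" and D :: "('c, 'd) cat"
  assumes C: "category C" and D: "category D" and x: "x \<in> Fun (ordinal n) (level_cat (fun_cat C D) k)"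
    and y: "y \<in> Fun (ordinal n) (level_cat (fun_cat C D) k)" and eq: "exp_comparison C D k n x = exp_comparison C D k n y"
  shows "x = y"
proof (rule double_flat_inj[OF C D x y])
  show "double_flat C D k n x = double_flat C D k n y"
  proof (rule Fun_ext_Arr[OF _ D exp_functors_Fun[OF double_flat_in[OF C D x]] exp_functors_Fun[OF double_flat_in[OF C D y]]])
    fix u assume "u \<in> Arr (prod_cat C (grid k n))"
    then obtain f a b where u: "u = (f, a, b)" "f \<in> Arr C" "a \<in> Arr (ordinal k)" "b \<in> Arr (ordinal n)" by auto
    note g = arrow_grid_in[OF C u(2)]
    note s = unflat_in[OF C g]
    have "comp_fun (grid 1 1) (double_flat C D k n x) (adm_grid 1 1 (arrow_grid C f) (seg a) (seg b)) =
       comp_fun (grid 1 1) (double_flat C D k n y) (adm_grid 1 1 (arrow_grid C f) (seg a) (seg b))"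
      using exp_comparison_apply(2)[OF C D x s seg_in[OF u(3)] seg_in[OF u(4)]]
        exp_comparison_apply(2)[OF C D y s seg_in[OF u(3)] seg_in[OF u(4)]] eq unfolding flat_unflat[OF C g] by simp
    moreover have "FArr (adm_grid 1 1 (arrow_grid C f) (seg a) (seg b)) ((0, 1), (0, 1)) = u"
      using adm_grid_FArr[OF seg_in[OF u(3)] seg_in[OF u(4)], of 0 1 0 1 "arrow_grid C f"] u by (simp add: arrow_grid_def)
    moreover have "FArr (comp_fun (grid 1 1) E A) ((0, 1), (0, 1)) = FArr E (FArr A ((0, 1), (0, 1)))"
      for E :: "('a \<times> nat \<times> nat, 'b \<times> (nat \<times> nat) \<times> (nat \<times> nat), 'c, 'd) funct" and A
      by simp
    ultimately show "FArr (double_flat C D k n x) u = FArr (double_flat C D k n y) u"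
      by metis
  qed (use C in simp)
qed

lemma exp_comparison_iso:
  fixes C :: "('a, 'b) cat" and D :: "('c, 'd) cat"
  assumes C: "category C" and D: "category D"
  shows "sspace_iso (classifying_diagram (fun_cat C D))
    (sspace_exp (classifying_diagram C) (classifying_diagram D)) (exp_comparison C D)"
proof (rule bij_sspace_iso[OF _ _ exp_comparison_in[OF C D]])
  show "is_sspace (classifying_diagram (fun_cat C D))" using C D by (intro is_sspace_classifying_diagram) simp
  show "is_sspace (sspace_exp (classifying_diagram C) (classifying_diagram D))"
    by (intro is_sspace_exp is_sspace_classifying_diagram C D)
  fix k n
  show "bij_betw (exp_comparison C D k n) (Sim (Lev (classifying_diagram (fun_cat C D)) k) n)
      (Sim (Lev (sspace_exp (classifying_diagram C) (classifying_diagram D)) k) n)"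
    by (rule bij_betwI') (use exp_comparison_inj[OF C D] exp_comparison_Sim[OF C D] exp_comparison_surj[OF C D] in \<open>simp_all, blast+\<close>)
qed

section \<open>The classifying diagram is a full embedding\<close>

text \<open>The constant square on an arrow is an admissible simplex, and the diagonal of its image
  is the image of the arrow.\<close>

lemma classifying_map_inj:
  assumes C: "category C" and D: "category D" and f: "f \<in> Fun C D" and g: "g \<in> Fun C D"
    and eq: "classifying_map C f = classifying_map C g"
  shows "f = g"
proof (rule Fun_ext_Arr[OF C D f g])
  fix a assume a: "a \<in> Arr C"
  note G = arrow_grid_in[OF C a] note s = unflat_in[OF C G]
  have "comp_fun (grid 1 1) f (arrow_grid C a) = comp_fun (grid 1 1) g (arrow_grid C a)"
    using flat_map[OF C D s f] flat_map[OF C D s g] eq unfolding flat_unflat[OF C G] by simp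
  from arg_cong[OF this, of "\<lambda>F. FArr F ((0, 1), (0, 1))"]
  show "FArr f a = FArr g a" by (simp add: arrow_grid_def)
qed

text \<open>F(0) and \<Delta>[0] are terminal, so h is a simplex of bidegree (0, 0) in the internal
  hom. By surjectivity of the comparison it comes from a functor on C x [0] x [0], that is, on
  C.\<close>

lemma classifying_map_full:
  fixes C :: "('a, 'b) cat" and D :: "('c, 'd) cat"
  assumes C: "category C" and D: "category D" and h: "h \<in> sspace_hom (classifying_diagram C) (classifying_diagram D)"
  shows "\<exists>f\<in>Fun C D. classifying_map C f = h"
proof -
  let ?Q = "prod_sspace (prod_sspace (classifying_diagram C) (F_sspace 0)) (simplex_sspace 0)"
  note NC = is_sspace_classifying_diagram[OF C]
  note S = is_sspace_Sim[OF NC]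
  \<comment> \<open>h with the two terminal factors added to its source.\<close>
  define h' where "h' m j = (\<lambda>z\<in>Sim (Lev ?Q m) j. h m j (fst (fst z)))" for m j
  have "h' \<in> sspace_hom ?Q (classifying_diagram D)"
    using sspace_hom_Sim[OF h] sspace_homD(2)[OF h] S
    by (intro sspace_homI2) (auto simp: h'_def Delta_comp simp del: classifying_diagram_simps)
  then obtain x where x: "x \<in> Fun (ordinal 0) (level_cat (fun_cat C D) 0)" and xh: "exp_comparison C D 0 0 x = h'"
    using exp_comparison_surj[OF C D] by blast
  note E = exp_functors_Fun[OF double_flat_in[OF C D x]]
  \<comment> \<open>The constant functor to the one-point grid, which supplies the coordinates in
    [0] x [0].\<close>
  define c where "c = \<lparr>FObj = (\<lambda>y\<in>Obj C. (0::nat, 0::nat)), FArr = (\<lambda>f\<in>Arr C. ((0::nat, 0::nat), (0::nat, 0::nat)))\<rparr>"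
  have c: "c \<in> Fun C (grid 0 0)" by (rule FunI) (use C in \<open>simp_all add: c_def\<close>)
  define f where "f = comp_fun C (double_flat C D 0 0 x) (fun_pair C (id_fun C) c)"
  have f: "f \<in> Fun C D" unfolding f_def by (rule comp_fun_in[OF C fun_pair_in[OF C id_fun_in[OF C] c] E])
  have "classifying_map C f = h"
  proof (rule sspace_hom_ext[OF classifying_map_in[OF C D f] h])
    fix m j \<sigma> assume s0: "\<sigma> \<in> Sim (Lev (classifying_diagram C) m) j"
    then have s: "\<sigma> \<in> Fun (ordinal j) (level_cat C m)" by simp
    let ?z = "\<lambda>m. delta_of m (\<lambda>i. 0)"
    have z: "?z m \<in> Delta m 0" "?z j \<in> Delta j 0" by (auto intro: delta_of_in)
    note A = exp_comparison_apply[OF C D x s z]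
    have hs: "exp_comparison C D 0 0 x m j ((\<sigma>, ?z m), ?z j) = h m j \<sigma>" unfolding xh using s z by (simp add: h'_def)
    have g: "flat C m j \<sigma> \<in> Fun (grid m j) C" by (rule GridD[OF flat_Grid[OF C s]])
    have cs: "classifying_map C f m j \<sigma> \<in> Fun (ordinal j) (level_cat D m)"
      using sspace_hom_Sim(1)[OF classifying_map_in[OF C D f] s0] by simp
    have "comp_fun (grid m j) f (flat C m j \<sigma>) = comp_fun (grid m j) (double_flat C D 0 0 x) (adm_grid m j (flat C m j \<sigma>) (?z m) (?z j))"
    proof (rule Fun_ext_Arr[OF _ D comp_fun_in[OF _ g f] comp_fun_in[OF _ adm_grid_in[OF g z] E]])
      fix u assume u: "u \<in> Arr (grid m j)"
      then obtain i i' p p' where "u = ((i, i'), (p, p'))" "i \<le> i'" "i' \<le> m" "p \<le> p'" "p' \<le> j" unfolding Arr_grid by auto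
      then show "FArr (comp_fun (grid m j) f (flat C m j \<sigma>)) u =
        FArr (comp_fun (grid m j) (double_flat C D 0 0 x) (adm_grid m j (flat C m j \<sigma>) (?z m) (?z j))) u"
        using Fun_simps(2)[OF g u] by (simp add: f_def c_def adm_grid_FArr[OF z])
    qed simp_all
    then show "classifying_map C f m j \<sigma> = h m j \<sigma>"
      using A cs by (intro flat_inj[OF D cs]) (simp_all add: hs flat_map[OF C D s f])
  qed
  with f show ?thesis by blast
qed

lemma classifying_map_bij:
  fixes C :: "('a, 'b) cat" and D :: "('c, 'd) cat"
  assumes C: "category C" and D: "category D"
  shows "bij_betw (classifying_map C) (Fun C D) (sspace_hom (classifying_diagram C) (classifying_diagram D))"
  unfolding bij_betw_def inj_on_def
  using classifying_map_inj[OF C D] classifying_map_full[OF C D] classifying_map_in[OF C D] by blast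

text \<open>The vertices of level m are the chains [m] -> C, each recovered as the value at 0 of a
  functor on [0]. So NC determines the set of all chains.\<close>

lemma classifying_diagram_chains:
  fixes C C' :: "('a, 'b) cat"
  assumes C: "category C" and C': "category C'" and eq: "classifying_diagram C = classifying_diagram C'"
  shows "Fun (ordinal m) C = Fun (ordinal m) C'"
proof -
  have *: "Fun (ordinal m) E = (\<lambda>x. FObj x 0) ` Fun (ordinal 0) (level_cat E m)" if E: "category E" for E :: "('a, 'b) cat"
  proof
    show "Fun (ordinal m) E \<subseteq> (\<lambda>x. FObj x 0) ` Fun (ordinal 0) (level_cat E m)"
    proof
      fix F assume "F \<in> Fun (ordinal m) E"
      then have "point_fun (level_cat E m) F \<in> Fun (ordinal 0) (level_cat E m)"
        using E by (intro point_fun_in) (simp_all add: Obj_level_cat)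
      then show "F \<in> (\<lambda>x. FObj x 0) ` Fun (ordinal 0) (level_cat E m)"
        by (intro image_eqI[of _ _ "point_fun (level_cat E m) F"]) simp_all
    qed
  next
    show "(\<lambda>x. FObj x 0) ` Fun (ordinal 0) (level_cat E m) \<subseteq> Fun (ordinal m) E"
    proof
      fix F assume "F \<in> (\<lambda>x. FObj x 0) ` Fun (ordinal 0) (level_cat E m)"
      then obtain x where x: "x \<in> Fun (ordinal 0) (level_cat E m)" and F: "F = FObj x 0" by blast
      show "F \<in> Fun (ordinal m) E" using Fun_simps(1)[OF x, of 0] by (simp add: F Obj_level_cat)
    qed
  qed
  have "Fun (ordinal 0) (level_cat C m) = Fun (ordinal 0) (level_cat C' m)"
    using arg_cong[OF eq, of "\<lambda>X. Sim (Lev X m) 0"] by simp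
  then show ?thesis using *[OF C] *[OF C'] by simp
qed

text \<open>Chains of length 0 show the objects and their identities, chains of length 1 the arrows
  with their ends, chains of length 2 the composites. Elsewhere the operations of both categories
  are \<open>undefined\<close>, so the equality is literal.\<close>

lemma classifying_diagram_inj: "inj_on classifying_diagram {C :: ('a, 'b) cat. category C}"
proof (rule inj_onI, simp)
  fix C C' :: "('a, 'b) cat"
  assume C: "category C" and C': "category C'" and eq: "classifying_diagram C = classifying_diagram C'"
  have ch: "F \<in> Fun (ordinal m) C \<Longrightarrow> F \<in> Fun (ordinal m) C'" "F \<in> Fun (ordinal m) C' \<Longrightarrow> F \<in> Fun (ordinal m) C" for F m
    using classifying_diagram_chains[OF C C' eq] by blast+
  have ob1: "x \<in> Obj B" if "category A" "category B" "\<And>F. F \<in> Fun (ordinal 0) A \<Longrightarrow> F \<in> Fun (ordinal 0) B" "x \<in> Obj A"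
    for x and A B :: "('a, 'b) cat"
    using Fun_simps(1)[OF that(3)[OF point_fun_in[OF that(1,4)]], of 0] by simp
  have ar1: "f \<in> Arr B \<and> Dom B f = Dom A f \<and> Cod B f = Cod A f"
    if "category A" "category B" "\<And>F. F \<in> Fun (ordinal 1) A \<Longrightarrow> F \<in> Fun (ordinal 1) B" "f \<in> Arr A"
    for f and A B :: "('a, 'b) cat"
  proof -
    have F: "arrow_fun A f \<in> Fun (ordinal 1) B" by (rule that(3)[OF arrow_fun_in[OF that(1,4)]])
    show ?thesis using Fun_simps(2-4)[OF F, of "(0, 1)"] by simp
  qed
  have ob: "Obj C = Obj C'" using ob1[OF C C' ch(1)] ob1[OF C' C ch(2)] by blast
  have ar: "Arr C = Arr C'" using ar1[OF C C' ch(1)] ar1[OF C' C ch(2)] by blast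
  have "Dom C f = Dom C' f \<and> Cod C f = Cod C' f" for f
    using ar1[OF C C' ch(1), of f] ar Dom_undef[OF C, of f] Dom_undef[OF C', of f] Cod_undef[OF C, of f] Cod_undef[OF C', of f]
    by (cases "f \<in> Arr C") auto
  then have dc: "Dom C = Dom C'" "Cod C = Cod C'" by auto
  have id: "Ide C x = Ide C' x" for x
  proof (cases "x \<in> Obj C")
    case True
    note F = ch(1)[OF point_fun_in[OF C True]]
    show ?thesis using Fun_simps(5)[OF F, of 0] by simp
  qed (use ob Ide_undef[OF C] Ide_undef[OF C'] in auto)
  have co: "Comp C g f = Comp C' g f" for g f
  proof (cases "composable C g f")
    case True
    then have gf: "g \<in> Arr C" "f \<in> Arr C" "Dom C g = Cod C f" by (auto simp: composable_def)
    note F = ch(1)[OF chain2_in[OF C gf(2,1,3)]]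
    show ?thesis using Fun_Comp[OF F, of "(1, 2)" "(0, 1)"] by simp
  next
    case False
    then have "\<not> composable C' g f" using ar dc by (simp add: composable_def)
    then show ?thesis using Comp_undef[OF C False] Comp_undef[OF C'] by simp
  qed
  show "C = C'" by (rule cat.equality) (use ob ar dc id co in \<open>auto simp: fun_eq_iff\<close>)
qed

section \<open>Geometric realization\<close>

definition point_class where
  "point_class X p = realization_rel X `` {p}"

lemma topspace_pre_realization:
  "((n, x), t) \<in> topspace (pre_realization X) \<longleftrightarrow> x \<in> Sim X n \<and> t \<in> standard_simplex n"
  by (auto simp: pre_realization_def)

lemma topspace_pre_cases:
  assumes "p \<in> topspace (pre_realization X)"
  obtains n x t where "p = ((n, x), t)" "x \<in> Sim X n" "t \<in> standard_simplex n"
  using assms topspace_pre_realization by (metis prod.collapse)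

text \<open>Gives access to the realization through the disjoint union of simplices: continuity out
  of it and openness in it are tested on representatives.\<close>

lemma quotient_map_point_class: "quotient_map (pre_realization X) (realization X) (point_class X)"
proof -
  have ts: "topspace (realization X) = point_class X ` topspace (pre_realization X)"
  proof
    show "topspace (realization X) \<subseteq> point_class X ` topspace (pre_realization X)"
      using openin_quotient_topology[of "pre_realization X" "\<lambda>p. realization_rel X `` {p}" "topspace (realization X)"]
        openin_topspace[of "realization X"]
      unfolding realization_def point_class_def by blast
    have "openin (realization X) (point_class X ` topspace (pre_realization X))"
      unfolding realization_def point_class_def openin_quotient_topology
      by (auto intro!: openin_subtopology_self arg_cong2[where f = openin, THEN iffD1, OF refl _ openin_topspace])
    then show "point_class X ` topspace (pre_realization X) \<subseteq> topspace (realization X)"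
      by (rule openin_subset)
  qed
  show ?thesis
    unfolding quotient_map_def ts
    by (simp add: realization_def openin_quotient_topology) (auto simp: point_class_def[abs_def])
qed

lemma topspace_realization: "topspace (realization X) = point_class X ` topspace (pre_realization X)"
  using quotient_map_point_class[of X] by (simp add: quotient_map_def)

lemma point_class_self: "p \<in> point_class X p"
  by (simp add: point_class_def realization_rel_def)

lemma point_class_eq_iff: "point_class X p = point_class X q \<longleftrightarrow> (p, q) \<in> realization_rel X"
proof
  assume "point_class X p = point_class X q"
  then have "q \<in> point_class X p" using point_class_self by blast
  then show "(p, q) \<in> realization_rel X" by (simp add: point_class_def)
next
  assume pq: "(p, q) \<in> realization_rel X"
  have "sym (gluing X \<union> (gluing X)\<inverse>)" by (rule sym_Un_converse)
  then have s: "sym (realization_rel X)" unfolding realization_rel_def by (rule sym_rtrancl)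
  have t: "trans (realization_rel X)" unfolding realization_rel_def by (rule trans_rtrancl)
  show "point_class X p = point_class X q"
    unfolding point_class_def using pq s t by (auto dest: symD transD)
qed

lemma point_class_glue:
  assumes "\<theta> \<in> Delta m n" "x \<in> Sim X n" "t \<in> standard_simplex m"
  shows "point_class X ((m, Act X m n \<theta> x), t) = point_class X ((n, x), simplex_push m \<theta> t)"
proof -
  have "(((m, Act X m n \<theta> x), t), ((n, x), simplex_push m \<theta> t)) \<in> gluing X"
    using assms unfolding gluing_def by blast
  then show ?thesis unfolding point_class_eq_iff realization_rel_def by blast
qed

text \<open>Induction along a chain of gluings, taken in either direction. All constructions on the
  realization that use representatives are shown to be well defined by this lemma.\<close>

lemma realization_rel_invariant:
  assumes "(p, q) \<in> realization_rel X"
    and "\<And>m n \<theta> x t. \<theta> \<in> Delta m n \<Longrightarrow> x \<in> Sim X n \<Longrightarrow> t \<in> standard_simplex m \<Longrightarrow>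
      f ((m, Act X m n \<theta> x), t) = f ((n, x), simplex_push m \<theta> t)"
  shows "f p = f q"
  using assms(1) unfolding realization_rel_def
proof (induction rule: rtrancl_induct)
  case (step q r)
  then have "f q = f r" using assms(2) unfolding gluing_def by auto
  with step show ?case by simp
qed simp

lemma point_class_invariant:
  assumes "point_class X p = point_class X q"
    and "\<And>m n \<theta> x t. \<theta> \<in> Delta m n \<Longrightarrow> x \<in> Sim X n \<Longrightarrow> t \<in> standard_simplex m \<Longrightarrow>
      f ((m, Act X m n \<theta> x), t) = f ((n, x), simplex_push m \<theta> t)"
  shows "f p = f q"
  using realization_rel_invariant[of p q X f] assms by (simp add: point_class_eq_iff)

text \<open>The definition maps a whole class and saturates the result. Since f commutes with the
  operators, all points of the class give the same class in Y, so one representative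
  suffices.\<close>

lemma realization_map_point_class:
  assumes f: "f \<in> sset_hom X Y"
  shows "realization_map Y f (point_class X ((n, x), t)) = point_class Y ((n, f n x), t)"
proof -
  let ?f = "\<lambda>((n, x), t). ((n, f n x), t)"
  have "point_class Y (?f q) = point_class Y ((n, f n x), t)" if "q \<in> point_class X ((n, x), t)" for q
  proof -
    have "(((n, x), t), q) \<in> realization_rel X" using that by (simp add: point_class_def)
    then have "point_class Y (?f ((n, x), t)) = point_class Y (?f q)"
      by (rule realization_rel_invariant[where f = "\<lambda>q. point_class Y (?f q)"])
        (simp add: sset_homD[OF f] point_class_glue)
    then show ?thesis by simp
  qed
  moreover have "realization_map Y f (point_class X ((n, x), t)) = (\<Union>q\<in>point_class X ((n, x), t). point_class Y (?f q))"
    unfolding realization_map_def point_class_def by blast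
  ultimately show ?thesis using point_class_self[of "((n, x), t)" X] by auto
qed

section \<open>Continuity on disjoint unions of simplices\<close>

lemma continuous_map_sum_topology:
  assumes "\<And>i. i \<in> I \<Longrightarrow> continuous_map (T i) Z (\<lambda>x. f (i, x))"
  shows "continuous_map (sum_topology T I) Z f"
  unfolding continuous_map_def
proof (intro conjI allI impI)
  show "f \<in> topspace (sum_topology T I) \<rightarrow> topspace Z"
    using assms by (fastforce simp: continuous_map_def Pi_iff)
  fix U assume U: "openin Z U"
  have "openin (T i) {x. (i, x) \<in> {p \<in> topspace (sum_topology T I). f p \<in> U}}" if "i \<in> I" for i
  proof -
    have "openin (T i) {x \<in> topspace (T i). f (i, x) \<in> U}"
      using assms[OF that] U by (simp add: continuous_map_def)
    then show ?thesis using that by simp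
  qed
  then show "openin (sum_topology T I) {p \<in> topspace (sum_topology T I). f p \<in> U}"
    unfolding openin_sum_topology by auto
qed

text \<open>A neighbourhood in one summand is a neighbourhood in the union, so continuity is tested
  summand by summand even with an extra parameter. The parameter will be the time of a
  homotopy.\<close>

lemma continuous_map_prod_sum_topology:
  assumes c: "\<And>i. i \<in> I \<Longrightarrow> continuous_map (prod_topology S (T i)) Z (\<lambda>(s, x). f (s, (i, x)))"
  shows "continuous_map (prod_topology S (sum_topology T I)) Z f"
  unfolding continuous_map_def
proof (intro conjI allI impI)
  show "f \<in> topspace (prod_topology S (sum_topology T I)) \<rightarrow> topspace Z"
  proof
    fix z assume "z \<in> topspace (prod_topology S (sum_topology T I))"
    then obtain s i x where z: "z = (s, (i, x))" "s \<in> topspace S" "i \<in> I" "x \<in> topspace (T i)" by auto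
    show "f z \<in> topspace Z" using funcset_mem[OF continuous_map_funspace[OF c[OF z(3)]], of "(s, x)"] z by simp
  qed
  fix U assume U: "openin Z U"
  show "openin (prod_topology S (sum_topology T I)) {p \<in> topspace (prod_topology S (sum_topology T I)). f p \<in> U}"
    unfolding openin_prod_topology_alt
  proof (intro allI impI)
    fix s q assume sq: "(s, q) \<in> {p \<in> topspace (prod_topology S (sum_topology T I)). f p \<in> U}"
    then obtain i x where q: "q = (i, x)" "i \<in> I" "x \<in> topspace (T i)" "s \<in> topspace S" "f (s, (i, x)) \<in> U" by auto
    have W: "openin (prod_topology S (T i)) {p \<in> topspace (prod_topology S (T i)). (case p of (s, x) \<Rightarrow> f (s, (i, x))) \<in> U}"
      using c[OF q(2)] U by (simp add: continuous_map_def)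
    have sx: "(s, x) \<in> {p \<in> topspace (prod_topology S (T i)). (case p of (s, x) \<Rightarrow> f (s, (i, x))) \<in> U}" using q by simp
    obtain A B where AB: "openin S A" "openin (T i) B" "s \<in> A" "x \<in> B"
      "A \<times> B \<subseteq> {p \<in> topspace (prod_topology S (T i)). (case p of (s, x) \<Rightarrow> f (s, (i, x))) \<in> U}"
      using openin_prod_topology_alt[THEN iffD1, rule_format, OF W sx] by (elim exE conjE) (rule that)
    have "openin (sum_topology T I) ({i} \<times> B)"
      unfolding openin_sum_topology
    proof
      show "{i} \<times> B \<subseteq> Sigma I (topspace \<circ> T)" using q AB openin_subset[OF AB(2)] by auto
      show "\<forall>j\<in>I. openin (T j) {x. (j, x) \<in> {i} \<times> B}"
      proof
        fix j assume "j \<in> I"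
        show "openin (T j) {x. (j, x) \<in> {i} \<times> B}" by (cases "j = i") (use AB in auto)
      qed
    qed
    moreover have "A \<times> ({i} \<times> B) \<subseteq> {p \<in> topspace (prod_topology S (sum_topology T I)). f p \<in> U}"
    proof
      fix z assume "z \<in> A \<times> ({i} \<times> B)"
      then obtain a b where z: "z = (a, (i, b))" "a \<in> A" "b \<in> B" by auto
      then have "(a, b) \<in> {p \<in> topspace (prod_topology S (T i)). (case p of (s, x) \<Rightarrow> f (s, (i, x))) \<in> U}"
        using AB(5) by blast
      then show "z \<in> {p \<in> topspace (prod_topology S (sum_topology T I)). f p \<in> U}" using z q(2) by auto
    qed
    ultimately show "\<exists>A B. openin S A \<and> openin (sum_topology T I) B \<and> s \<in> A \<and> q \<in> B \<and>
        A \<times> B \<subseteq> {p \<in> topspace (prod_topology S (sum_topology T I)). f p \<in> U}"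
      using AB q by (intro exI[of _ A] exI[of _ "{i} \<times> B"]) auto
  qed
qed

lemma continuous_map_simplex_class:
  assumes x: "x \<in> Sim X n"
  shows "continuous_map (subtopology (powertop_real UNIV) (standard_simplex n)) (realization X) (\<lambda>t. point_class X ((n, x), t))"
proof -
  have "continuous_map (subtopology (powertop_real UNIV) (standard_simplex n)) (pre_realization X) (\<lambda>t. ((n, x), t))"
    unfolding pre_realization_def
    using continuous_map_component_injection[of "(n, x)" "{(n, x). x \<in> Sim X n}"
        "\<lambda>(n, x). subtopology (powertop_real UNIV) (standard_simplex n)"] x by simp
  from continuous_map_compose[OF this quotient_imp_continuous_map[OF quotient_map_point_class]]
  show ?thesis by (simp add: o_def)
qed

lemma continuous_realization_map:
  assumes f: "f \<in> sset_hom X Y"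
  shows "continuous_map (realization X) (realization Y) (realization_map Y f)"
proof -
  have "continuous_map (pre_realization X) (realization Y) (realization_map Y f \<circ> point_class X)"
    unfolding pre_realization_def
  proof (rule continuous_map_sum_topology)
    fix i :: "nat \<times> 'a" assume "i \<in> {(n, x). x \<in> Sim X n}"
    then obtain n x where i: "i = (n, x)" "x \<in> Sim X n" by auto
    have "continuous_map (subtopology (powertop_real UNIV) (standard_simplex n)) (realization Y) (\<lambda>t. point_class Y ((n, f n x), t))"
      by (rule continuous_map_simplex_class[OF sset_homD(1)[OF f i(2)]])
    then show "continuous_map (case i of (n, x) \<Rightarrow> subtopology (powertop_real UNIV) (standard_simplex n)) (realization Y)
          (\<lambda>t. (realization_map Y f \<circ> point_class X) (i, t))"
      by (simp add: i realization_map_point_class[OF f])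
  qed
  then show ?thesis using continuous_compose_quotient_map_eq[OF quotient_map_point_class] by blast
qed

lemma realization_cases:
  assumes "c \<in> topspace (realization X)"
  obtains n x t where "c = point_class X ((n, x), t)" "x \<in> Sim X n" "t \<in> standard_simplex n"
proof -
  obtain p where p: "p \<in> topspace (pre_realization X)" "c = point_class X p"
    using assms unfolding topspace_realization by blast
  from p(1) show ?thesis
  proof (rule topspace_pre_cases)
    fix n x t assume "p = ((n, x), t)" "x \<in> Sim X n" "t \<in> standard_simplex n"
    then show ?thesis using that p(2) by blast
  qed
qed

lemma point_class_in: "x \<in> Sim X n \<Longrightarrow> t \<in> standard_simplex n \<Longrightarrow> point_class X ((n, x), t) \<in> topspace (realization X)"
  unfolding topspace_realization by (rule imageI) (simp add: topspace_pre_realization)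

lemma realization_map_comp:
  assumes "is_sset X" "f \<in> sset_hom X Y" "g \<in> sset_hom Y Z" "c \<in> topspace (realization X)"
  shows "realization_map Z (sset_comp X g f) c = realization_map Z g (realization_map Y f c)"
  using assms(4)
proof (rule realization_cases)
  fix n x t assume "c = point_class X ((n, x), t)" "x \<in> Sim X n" "t \<in> standard_simplex n"
  then show ?thesis
    by (simp add: realization_map_point_class[OF assms(2)] realization_map_point_class[OF assms(3)]
        realization_map_point_class[OF sset_comp_in[OF assms(2,3,1)]])
qed

lemma realization_map_id:
  assumes "is_sset X" "c \<in> topspace (realization X)"
  shows "realization_map X (sset_id X) c = c"
  using assms(2)
proof (rule realization_cases)
  fix n x t assume "c = point_class X ((n, x), t)" "x \<in> Sim X n" "t \<in> standard_simplex n"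
  then show ?thesis by (simp add: realization_map_point_class[OF sset_id_in[OF assms(1)]])
qed

text \<open>The push adds up coordinates over the fibres of \<theta>, which partition the vertices,
  so the total weight is kept.\<close>

lemma simplex_push_in:
  assumes t: "\<theta> \<in> Delta m n" and s: "s \<in> standard_simplex m"
  shows "simplex_push m \<theta> s \<in> standard_simplex n"
proof -
  have nn: "\<And>i. 0 \<le> s i" and sum: "(\<Sum>i\<le>m. s i) = 1" using s by (auto simp: standard_simplex_def)
  have "(\<Sum>j\<le>n. simplex_push m \<theta> s j) = (\<Sum>j\<le>n. \<Sum>i | i \<in> {..m} \<and> FObj \<theta> i = j. s i)"
    by (simp add: simplex_push_def)
  also have "\<dots> = (\<Sum>i\<le>m. s i)"
    using Delta_le[OF t] by (intro sum.group) auto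
  finally have 1: "(\<Sum>j\<le>n. simplex_push m \<theta> s j) = 1" using sum by simp
  have 2: "0 \<le> simplex_push m \<theta> s j" for j by (simp add: simplex_push_def sum_nonneg nn)
  have 3: "simplex_push m \<theta> s j \<le> 1" for j
    unfolding simplex_push_def sum[symmetric] by (rule sum_mono2) (auto simp: nn)
  have 4: "simplex_push m \<theta> s j = 0" if "j > n" for j
  proof -
    have "{i. i \<le> m \<and> FObj \<theta> i = j} = {}" using Delta_le[OF t] that by fastforce
    then show ?thesis unfolding simplex_push_def by (simp only: sum.empty)
  qed
  show ?thesis using 1 2 3 4 by (simp add: standard_simplex_def)
qed

section \<open>Homotopies from joins\<close>

text \<open>
  If \<open>x\<close> is a simplex of a groupoid nerve and \<open>J n x\<close> joins its images under two isomorphic functors,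
  then sliding the barycentric coordinates from the first to the second half of \<open>J n x\<close>
  is a homotopy; no subdivision of prisms is needed.
\<close>

definition double_delta :: "nat \<Rightarrow> nat \<Rightarrow> delta \<Rightarrow> delta" where
  "double_delta m n \<theta> = delta_of (2 * m + 1) (\<lambda>i. if i \<le> m then FObj \<theta> i else n + 1 + FObj \<theta> (i - m - 1))"

text \<open>At time s the first n + 1 vertices of a simplex of dimension 2n + 1 carry the share 1 -
  s of the weights t and the last n + 1 vertices the share s; the second copy starts at vertex n +
  1, whence the shift.\<close>

definition join_coords :: "nat \<Rightarrow> real \<Rightarrow> (nat \<Rightarrow> real) \<Rightarrow> nat \<Rightarrow> real" where
  "join_coords n s t = (\<lambda>i. if i \<le> n then (1 - s) * t i else s * t (i - n - 1))"

lemma double_delta_in: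
  assumes t: "\<theta> \<in> Delta m n" shows "double_delta m n \<theta> \<in> Delta (2 * m + 1) (2 * n + 1)"
  unfolding double_delta_def
proof (rule delta_of_in)
  fix i j assume "i \<le> j" "j \<le> 2 * m + 1"
  then show "(if i \<le> m then FObj \<theta> i else n + 1 + FObj \<theta> (i - m - 1)) \<le> (if j \<le> m then FObj \<theta> j else n + 1 + FObj \<theta> (j - m - 1))"
    using Delta_mono[OF t, of i j] Delta_mono[OF t, of "i - m - 1" "j - m - 1"] Delta_le[OF t, of i] by auto
next
  fix i assume "i \<le> 2 * m + 1"
  then show "(if i \<le> m then FObj \<theta> i else n + 1 + FObj \<theta> (i - m - 1)) \<le> 2 * n + 1"
    using Delta_le[OF t, of i] Delta_le[OF t, of "i - m - 1"] by auto
qed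

lemma sum_double:
  fixes f :: "nat \<Rightarrow> real"
  shows "(\<Sum>i | i \<le> 2 * m + 1 \<and> P i. f i) = (\<Sum>i | i \<le> m \<and> P i. f i) + (\<Sum>i | i \<le> m \<and> P (i + m + 1). f (i + m + 1))"
proof -
  have "{i. i \<le> 2 * m + 1 \<and> P i} = {i. i \<le> m \<and> P i} \<union> (\<lambda>i. i + m + 1) ` {i. i \<le> m \<and> P (i + m + 1)}"
  proof (intro Set.set_eqI iffI)
    fix i assume i: "i \<in> {i. i \<le> 2 * m + 1 \<and> P i}"
    show "i \<in> {i. i \<le> m \<and> P i} \<union> (\<lambda>i. i + m + 1) ` {i. i \<le> m \<and> P (i + m + 1)}"
    proof (cases "i \<le> m")
      case False
      then have "i = (i - m - 1) + m + 1" by simp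
      then show ?thesis using i by (intro UnI2 image_eqI[of _ _ "i - m - 1"]) auto
    qed (use i in simp)
  qed auto
  moreover have "(\<Sum>i \<in> (\<lambda>i. i + m + 1) ` {i. i \<le> m \<and> P (i + m + 1)}. f i) = (\<Sum>i | i \<le> m \<and> P (i + m + 1). f (i + m + 1))"
    by (subst sum.reindex) (auto simp: inj_on_def)
  moreover have "(\<Sum>i \<in> {i. i \<le> m \<and> P i} \<union> (\<lambda>i. i + m + 1) ` {i. i \<le> m \<and> P (i + m + 1)}. f i) =
    (\<Sum>i \<in> {i. i \<le> m \<and> P i}. f i) + (\<Sum>i \<in> (\<lambda>i. i + m + 1) ` {i. i \<le> m \<and> P (i + m + 1)}. f i)"
    by (rule sum.union_disjoint) auto
  ultimately show ?thesis by simp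
qed

lemma join_coords_in:
  assumes t: "t \<in> standard_simplex n" and s: "s \<in> {0..1}"
  shows "join_coords n s t \<in> standard_simplex (2 * n + 1)"
proof -
  have tt: "\<And>i. 0 \<le> t i" "\<And>i. t i \<le> 1" "\<And>i. i > n \<Longrightarrow> t i = 0" "(\<Sum>i\<le>n. t i) = 1" using t by (auto simp: standard_simplex_def)
  have "(\<Sum>i\<le>2 * n + 1. join_coords n s t i) = (\<Sum>i | i \<le> 2 * n + 1 \<and> True. join_coords n s t i)" by (simp add: atMost_def)
  also have "\<dots> = (\<Sum>i\<le>n. join_coords n s t i) + (\<Sum>i\<le>n. join_coords n s t (i + n + 1))"
    by (subst sum_double) (simp add: atMost_def)
  also have "\<dots> = (1 - s) * (\<Sum>i\<le>n. t i) + s * (\<Sum>i\<le>n. t i)"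
    by (simp add: join_coords_def sum_distrib_left)
  finally have 1: "(\<Sum>i\<le>2 * n + 1. join_coords n s t i) = 1" using tt by simp
  have "0 \<le> join_coords n s t i \<and> join_coords n s t i \<le> 1" for i
    using s tt(1,2) by (auto simp: join_coords_def intro!: mult_le_one)
  moreover have "join_coords n s t i = 0" if "i > 2 * n + 1" for i using that tt(3) by (simp add: join_coords_def)
  ultimately show ?thesis using 1 by (simp add: standard_simplex_def)
qed

text \<open>\<open>double_delta\<close> acts as \<theta> within each half, so the two shares of the
  weights are pushed forward separately. This is what lets the slide respect gluings.\<close>

lemma join_coords_push:
  assumes th: "\<theta> \<in> Delta m n" and t: "t \<in> standard_simplex m"
  shows "simplex_push (2 * m + 1) (double_delta m n \<theta>) (join_coords m s t) = join_coords n s (simplex_push m \<theta> t)"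
proof
  fix j
  have L: "simplex_push (2 * m + 1) (double_delta m n \<theta>) (join_coords m s t) j =
    (\<Sum>i | i \<le> m \<and> FObj \<theta> i = j. (1 - s) * t i) + (\<Sum>i | i \<le> m \<and> n + 1 + FObj \<theta> i = j. s * t i)"
    unfolding simplex_push_def
    by (subst sum_double, intro arg_cong2[where f = "(+)"] sum.cong) (auto simp: double_delta_def join_coords_def)
  show "simplex_push (2 * m + 1) (double_delta m n \<theta>) (join_coords m s t) j = join_coords n s (simplex_push m \<theta> t) j"
  proof (cases "j \<le> n")
    case True
    then have "{i. i \<le> m \<and> n + 1 + FObj \<theta> i = j} = {}" by auto
    then have "(\<Sum>i | i \<le> m \<and> n + 1 + FObj \<theta> i = j. s * t i) = 0" by (simp only: sum.empty)
    then show ?thesis unfolding L using True by (simp add: join_coords_def simplex_push_def sum_distrib_left)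
  next
    case False
    then have "{i. i \<le> m \<and> FObj \<theta> i = j} = {}" using Delta_le[OF th] by auto
    then have "(\<Sum>i | i \<le> m \<and> FObj \<theta> i = j. (1 - s) * t i) = 0" by (simp only: sum.empty)
    moreover have "{i. i \<le> m \<and> n + 1 + FObj \<theta> i = j} = {i. i \<le> m \<and> FObj \<theta> i = j - n - 1}" using False by auto
    ultimately show ?thesis unfolding L using False by (simp add: join_coords_def simplex_push_def sum_distrib_left)
  qed
qed

definition left_delta :: "nat \<Rightarrow> delta" where "left_delta n = delta_of n (\<lambda>i. i)"
definition right_delta :: "nat \<Rightarrow> delta" where "right_delta n = delta_of n (\<lambda>i. n + 1 + i)"

lemma left_right_delta_in: "left_delta n \<in> Delta n (2 * n + 1)" "right_delta n \<in> Delta n (2 * n + 1)"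
  by (auto simp: left_delta_def right_delta_def intro!: delta_of_in)

lemma join_coords_ends:
  assumes t: "t \<in> standard_simplex n"
  shows "join_coords n 0 t = simplex_push n (left_delta n) t" "join_coords n 1 t = simplex_push n (right_delta n) t"
proof -
  have tt: "\<And>i. i > n \<Longrightarrow> t i = 0" using t by (auto simp: standard_simplex_def)
  show "join_coords n 0 t = simplex_push n (left_delta n) t"
  proof
    fix j
    have "simplex_push n (left_delta n) t j = (\<Sum>i\<in>(if j \<le> n then {j} else {}). t i)"
      unfolding simplex_push_def by (rule sum.cong) (auto simp: left_delta_def)
    then show "join_coords n 0 t j = simplex_push n (left_delta n) t j" by (simp add: join_coords_def)
  qed
  show "join_coords n 1 t = simplex_push n (right_delta n) t"
  proof
    fix j
    have "simplex_push n (right_delta n) t j = (\<Sum>i\<in>(if n < j \<and> j - n - 1 \<le> n then {j - n - 1} else {}). t i)"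
      unfolding simplex_push_def by (rule sum.cong) (auto simp: right_delta_def)
    then show "join_coords n 1 t j = simplex_push n (right_delta n) t j" using tt by (simp add: join_coords_def)
  qed
qed

lemma continuous_map_join_coords:
  "continuous_map (prod_topology (top_of_set {0..1}) (subtopology (powertop_real UNIV) (standard_simplex n)))
     (subtopology (powertop_real UNIV) (standard_simplex (2 * n + 1))) (\<lambda>(s, t). join_coords n s t)"
  unfolding continuous_map_in_subtopology
proof
  let ?P = "prod_topology (top_of_set {0..1::real}) (subtopology (powertop_real UNIV) (standard_simplex n))"
  have s: "continuous_map ?P euclideanreal fst"
    using continuous_map_fst[of "top_of_set {0..1::real}"] by (rule continuous_map_into_fulltopology)
  have "continuous_map ?P (powertop_real UNIV) snd"
    using continuous_map_snd by (rule continuous_map_into_fulltopology)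
  then have t: "continuous_map ?P euclideanreal (\<lambda>p. snd p i)" for i
    by (simp add: continuous_map_componentwise_UNIV)
  have "continuous_map ?P euclideanreal (\<lambda>p. join_coords n (fst p) (snd p) i)" for i
    unfolding join_coords_def by (cases "i \<le> n") (auto intro!: continuous_intros s t)
  then show "continuous_map ?P (powertop_real UNIV) (\<lambda>(s, t). join_coords n s t)"
    by (simp add: continuous_map_componentwise_UNIV case_prod_beta)
  show "(\<lambda>(s, t). join_coords n s t) \<in> topspace ?P \<rightarrow> standard_simplex (2 * n + 1)"
    using join_coords_in by auto
qed

text \<open>A gluing by \<theta> moves both halves of the join simultaneously, which is why J has to
  be natural along \<open>double_delta\<close>. Then the slide depends only on the class of a point
  and descends to the realization.\<close>

lemma homotopic_realization_join:
  assumes F: "F \<in> sset_hom X Y" and G: "G \<in> sset_hom X Y"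
    and J: "\<And>n x. x \<in> Sim X n \<Longrightarrow> J n x \<in> Sim Y (2 * n + 1)"
    and Jnat: "\<And>m n \<theta> x. \<theta> \<in> Delta m n \<Longrightarrow> x \<in> Sim X n \<Longrightarrow>
      J m (Act X m n \<theta> x) = Act Y (2 * m + 1) (2 * n + 1) (double_delta m n \<theta>) (J n x)"
    and JF: "\<And>n x. x \<in> Sim X n \<Longrightarrow> Act Y n (2 * n + 1) (left_delta n) (J n x) = F n x"
    and JG: "\<And>n x. x \<in> Sim X n \<Longrightarrow> Act Y n (2 * n + 1) (right_delta n) (J n x) = G n x"
  shows "homotopic_with (\<lambda>_. True) (realization X) (realization Y) (realization_map Y F) (realization_map Y G)"
proof -
  let ?I = "top_of_set {0..1::real}"
  define h where "h = (\<lambda>(s::real, ((n, x), t)). point_class Y ((2 * n + 1, J n x), join_coords n s t))"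
  let ?q = "\<lambda>(s::real, p). (s, point_class X p)"
  have "locally_compact_space ?I" "Hausdorff_space ?I"
    by (auto simp: compact_imp_locally_compact_space compact_space_subtopology Hausdorff_space_subtopology)
  \<comment> \<open>The product with the interval of a quotient map is again a quotient map, the
    interval being locally compact and Hausdorff. Hence a homotopy may be constructed before
    gluing.\<close>
  then have q: "quotient_map (prod_topology ?I (pre_realization X)) (prod_topology ?I (realization X)) ?q"
    by (intro quotient_map_prod_right quotient_map_point_class) auto
  have hc: "continuous_map (prod_topology ?I (pre_realization X)) (realization Y) h"
    unfolding pre_realization_def
  proof (rule continuous_map_prod_sum_topology)
    fix i assume "i \<in> {(n, x). x \<in> Sim X n}"
    then obtain n x where i: "i = (n, x)" "x \<in> Sim X n" by auto
    have "continuous_map (prod_topology ?I (subtopology (powertop_real UNIV) (standard_simplex n))) (realization Y)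
       ((\<lambda>t. point_class Y ((2 * n + 1, J n x), t)) \<circ> (\<lambda>(s, t). join_coords n s t))"
      by (rule continuous_map_compose[OF continuous_map_join_coords continuous_map_simplex_class[OF J[OF i(2)]]])
    then show "continuous_map (prod_topology ?I (case i of (n, x) \<Rightarrow> subtopology (powertop_real UNIV) (standard_simplex n)))
         (realization Y) (\<lambda>(s, t). h (s, i, t))"
      by (simp add: i h_def o_def case_prod_unfold)
  qed
  have hw: "h z = h z'" if z: "z \<in> topspace (prod_topology ?I (pre_realization X))" and z': "z' \<in> topspace (prod_topology ?I (pre_realization X))"
    and eq: "?q z = ?q z'" for z z'
  proof -
    obtain s p p' where zp: "z = (s, p)" "z' = (s, p')" "s \<in> {0..1}" "point_class X p = point_class X p'"
      using z z' eq by (cases z; cases z') auto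
    have "h (s, p) = h (s, p')"
    proof (rule point_class_invariant[OF zp(4), where f = "\<lambda>p. h (s, p)"])
      fix m n \<theta> x t assume th: "\<theta> \<in> Delta m n" and x: "x \<in> Sim X n" and t: "t \<in> standard_simplex m"
      show "h (s, (m, Act X m n \<theta> x), t) = h (s, (n, x), simplex_push m \<theta> t)"
        using point_class_glue[OF double_delta_in[OF th] J[OF x] join_coords_in[OF t zp(3)]]
        unfolding join_coords_push[OF th t] by (simp add: h_def Jnat[OF th x])
    qed
    then show ?thesis by (simp add: zp)
  qed
  have "\<exists>g. continuous_map (prod_topology ?I (realization X)) (realization Y) g \<and>
      (\<forall>z\<in>topspace (prod_topology ?I (pre_realization X)). g (?q z) = h z)"
  proof (rule quotient_map_lift_exists[OF q hc])
    show "h z = h z'" if "z \<in> topspace (prod_topology ?I (pre_realization X))"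
      "z' \<in> topspace (prod_topology ?I (pre_realization X))" "?q z = ?q z'" for z z'
      by (rule hw[OF that])
    fix g assume "continuous_map (prod_topology ?I (realization X)) (realization Y) g"
      and "\<And>z. z \<in> topspace (prod_topology ?I (pre_realization X)) \<Longrightarrow> g (?q z) = h z"
    then show ?thesis by blast
  qed
  then obtain g where g: "continuous_map (prod_topology ?I (realization X)) (realization Y) g"
    and gq: "\<And>z. z \<in> topspace (prod_topology ?I (pre_realization X)) \<Longrightarrow> g (?q z) = h z"
    by blast
  have ends: "g (0, c) = realization_map Y F c" "g (1, c) = realization_map Y G c" if cX: "c \<in> topspace (realization X)" for c
  proof -
    obtain n x t where c: "c = point_class X ((n, x), t)" "x \<in> Sim X n" "t \<in> standard_simplex n"
      by (rule realization_cases[OF cX])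
    have g1: "g (s, c) = point_class Y ((2 * n + 1, J n x), join_coords n s t)" if "s \<in> {0..1}" for s
      using gq[of "(s, ((n, x), t))"] c that by (simp add: h_def topspace_pre_realization)
    show "g (0, c) = realization_map Y F c"
      using g1[of 0] point_class_glue[OF left_right_delta_in(1) J[OF c(2)] c(3)]
      unfolding join_coords_ends(1)[OF c(3)] JF[OF c(2)] c(1) realization_map_point_class[OF F] by simp
    show "g (1, c) = realization_map Y G c"
      using g1[of 1] point_class_glue[OF left_right_delta_in(2) J[OF c(2)] c(3)]
      unfolding join_coords_ends(2)[OF c(3)] JG[OF c(2)] c(1) realization_map_point_class[OF G] by simp
  qed
  show ?thesis
    by (subst homotopic_with) (use g ends in auto)
qed

section \<open>Groupoids\<close>

definition groupoid :: "('o, 'a) cat \<Rightarrow> bool" where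
  "groupoid G \<longleftrightarrow> category G \<and> Arr G \<subseteq> iso_arrows G"

lemma groupoid_level_cat: "category C \<Longrightarrow> groupoid (level_cat C m)"
  by (simp add: groupoid_def level_cat_def)

lemma groupoidD: "groupoid G \<Longrightarrow> category G" "groupoid G \<Longrightarrow> f \<in> Arr G \<Longrightarrow> f \<in> iso_arrows G"
  by (auto simp: groupoid_def)

text \<open>The arrow from vertex \<open>i\<close> to vertex \<open>j\<close> of a simplex, which in a groupoid exists for all \<open>i\<close> and \<open>j\<close>.\<close>

definition tarr :: "('o, 'a) cat \<Rightarrow> (nat, nat \<times> nat, 'o, 'a) funct \<Rightarrow> nat \<Rightarrow> nat \<Rightarrow> 'a" where
  "tarr G \<sigma> i j = Comp G (FArr \<sigma> (0, j)) (inverse_arr G (FArr \<sigma> (0, i)))"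

context
  fixes G :: "('o, 'a) cat" and n :: nat and \<sigma>
  assumes G: "groupoid G" and s: "\<sigma> \<in> Fun (ordinal n) G"
begin

lemma edge0: "i \<le> n \<Longrightarrow> FArr \<sigma> (0, i) \<in> Arr G" "i \<le> n \<Longrightarrow> FArr \<sigma> (0, i) \<in> iso_arrows G"
    "i \<le> n \<Longrightarrow> Dom G (FArr \<sigma> (0, i)) = FObj \<sigma> 0" "i \<le> n \<Longrightarrow> Cod G (FArr \<sigma> (0, i)) = FObj \<sigma> i"
  using Fun_simps(2-4)[OF s, of "(0, i)"] groupoidD(2)[OF G] by auto

lemma tarr_simps:
  "i \<le> n \<Longrightarrow> j \<le> n \<Longrightarrow> tarr G \<sigma> i j \<in> Arr G"
  "i \<le> n \<Longrightarrow> j \<le> n \<Longrightarrow> Dom G (tarr G \<sigma> i j) = FObj \<sigma> i"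
  "i \<le> n \<Longrightarrow> j \<le> n \<Longrightarrow> Cod G (tarr G \<sigma> i j) = FObj \<sigma> j"
  "i \<le> n \<Longrightarrow> tarr G \<sigma> i i = Ide G (FObj \<sigma> i)"
  using groupoidD(1)[OF G] edge0 by (simp_all add: tarr_def)

lemma tarr_comp:
  assumes "i \<le> n" "j \<le> n" "k \<le> n"
  shows "Comp G (tarr G \<sigma> j k) (tarr G \<sigma> i j) = tarr G \<sigma> i k"
  using groupoidD(1)[OF G] edge0[OF assms(1)] edge0[OF assms(2)] edge0[OF assms(3)]
    left_cancel_iso[OF groupoidD(1)[OF G] edge0(2)[OF assms(2)]]
  by (simp add: tarr_def Comp_assoc)

lemma tarr_le:
  assumes "i \<le> j" "j \<le> n"
  shows "tarr G \<sigma> i j = FArr \<sigma> (i, j)"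
proof -
  have e: "FArr \<sigma> (i, j) \<in> Arr G" "Dom G (FArr \<sigma> (i, j)) = FObj \<sigma> i" 
    using Fun_simps(2,3)[OF s, of "(i, j)"] assms by auto
  have "FArr \<sigma> (0, j) = Comp G (FArr \<sigma> (i, j)) (FArr \<sigma> (0, i))"
    using Fun_Comp[OF s, of "(i, j)" "(0, i)"] assms by simp
  then show ?thesis
    using groupoidD(1)[OF G] edge0[of i] edge0[of j] assms e by (simp add: tarr_def Comp_assoc)
qed

text \<open>Restriction along \<theta> replaces the base vertex 0 by \<open>FObj \<theta> 0\<close>.
  This is invisible since transition arrows compose through every intermediate vertex and the
  inverse of one is the transition back.\<close>

lemma tarr_precomp:
  assumes t: "\<theta> \<in> Delta m n" and "i \<le> m" "j \<le> m"
  shows "tarr G (comp_fun (ordinal m) \<sigma> \<theta>) i j = tarr G \<sigma> (FObj \<theta> i) (FObj \<theta> j)"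
proof -
  note L = Delta_le[OF t] and M = Delta_mono[OF t]
  have e: "FArr (comp_fun (ordinal m) \<sigma> \<theta>) (0, q) = tarr G \<sigma> (FObj \<theta> 0) (FObj \<theta> q)" if "q \<le> m" for q
    using that L M by (simp add: Delta_simps[OF t] tarr_le)
  have inv: "inverse_arr G (tarr G \<sigma> a b) = tarr G \<sigma> b a" if "a \<le> n" "b \<le> n" for a b
    using that groupoidD[OF G] tarr_simps tarr_comp by (intro inverse_arr_unique) simp_all
  show ?thesis
    unfolding tarr_def[of G "comp_fun (ordinal m) \<sigma> \<theta>"] e[OF assms(2)] e[OF assms(3)]
    using assms L by (simp add: inv tarr_comp)
qed

lemma tarr_map:
  assumes H: "category H" and F: "F \<in> Fun G H" and "i \<le> n" "j \<le> n"
  shows "tarr H (comp_fun (ordinal n) F \<sigma>) i j = FArr F (tarr G \<sigma> i j)"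
  using assms edge0[of i] edge0[of j] groupoidD(1)[OF G]
  by (simp add: tarr_def Fun_Comp[OF F] Fun_inverse[OF groupoidD(1)[OF G] H F])

end

section \<open>The join of two images of a simplex\<close>

definition halve :: "nat \<Rightarrow> nat \<Rightarrow> nat" where
  "halve n i = (if i \<le> n then i else i - n - 1)"

lemma halve_le: "i \<le> 2 * n + 1 \<Longrightarrow> halve n i \<le> n"
  by (auto simp: halve_def)

definition join_leg where
  "join_leg B F \<alpha> n \<sigma> i = (if i \<le> n then Ide B (FObj F (FObj \<sigma> i)) else \<alpha> (FObj \<sigma> (i - n - 1)))"

text \<open>Every vertex i is reached from F of the underlying vertex of \<sigma> by its leg: an
  identity in the first half, a component of \<alpha> in the second. An arrow of the join goes back
  along one leg, across by F of a transition arrow and out along the other. From the first half to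
  the second the transition may run backwards in \<sigma>, hence the need for a groupoid.\<close>

definition join_simplex where
  "join_simplex A B F \<alpha> n \<sigma> =
     \<lparr>FObj = (\<lambda>i\<in>{..2 * n + 1}. Cod B (join_leg B F \<alpha> n \<sigma> i)),
      FArr = (\<lambda>(i, j)\<in>Arr (ordinal (2 * n + 1)). Comp B (join_leg B F \<alpha> n \<sigma> j)
        (Comp B (FArr F (tarr A \<sigma> (halve n i) (halve n j))) (inverse_arr B (join_leg B F \<alpha> n \<sigma> i))))\<rparr>"

context
  fixes A :: "('o, 'a) cat" and B :: "('p, 'b) cat" and F G \<alpha>
  assumes A: "groupoid A" and B: "groupoid B" and F: "F \<in> Fun A B" and G: "G \<in> Fun A B"
    and al: "\<And>x. x \<in> Obj A \<Longrightarrow> \<alpha> x \<in> Arr B \<and> Dom B (\<alpha> x) = FObj F x \<and> Cod B (\<alpha> x) = FObj G x"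
    and nat: "\<And>f. f \<in> Arr A \<Longrightarrow> Comp B (\<alpha> (Cod A f)) (FArr F f) = Comp B (FArr G f) (\<alpha> (Dom A f))"
begin

lemma join_leg_simps:
  assumes s: "\<sigma> \<in> Fun (ordinal n) A" and i: "i \<le> 2 * n + 1"
  shows "join_leg B F \<alpha> n \<sigma> i \<in> Arr B" "join_leg B F \<alpha> n \<sigma> i \<in> iso_arrows B"
    "Dom B (join_leg B F \<alpha> n \<sigma> i) = FObj F (FObj \<sigma> (halve n i))"
proof -
  have o: "FObj \<sigma> (halve n i) \<in> Obj A" using Fun_simps(1)[OF s, of "halve n i"] halve_le[OF i] by simp
  have fo: "FObj F (FObj \<sigma> (halve n i)) \<in> Obj B" using Fun_simps(1)[OF F o] .
  show 1: "join_leg B F \<alpha> n \<sigma> i \<in> Arr B"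
    using al[OF o] fo groupoidD(1)[OF B] by (auto simp: join_leg_def halve_def)
  show "join_leg B F \<alpha> n \<sigma> i \<in> iso_arrows B" by (rule groupoidD(2)[OF B 1])
  show "Dom B (join_leg B F \<alpha> n \<sigma> i) = FObj F (FObj \<sigma> (halve n i))"
    using al[OF o] fo groupoidD(1)[OF B] by (auto simp: join_leg_def halve_def)
qed

lemma join_simplex_FArr:
  "i \<le> j \<Longrightarrow> j \<le> 2 * n + 1 \<Longrightarrow> FArr (join_simplex A B F \<alpha> n \<sigma>) (i, j) =
    Comp B (join_leg B F \<alpha> n \<sigma> j) (Comp B (FArr F (tarr A \<sigma> (halve n i) (halve n j))) (inverse_arr B (join_leg B F \<alpha> n \<sigma> i)))"
  by (simp add: join_simplex_def)

lemma join_simplex_in: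
  assumes s: "\<sigma> \<in> Fun (ordinal n) A"
  shows "join_simplex A B F \<alpha> n \<sigma> \<in> Fun (ordinal (2 * n + 1)) B"
proof (rule FunI)
  note L = join_leg_simps[OF s]
  note T = tarr_simps(1-3)[OF A s halve_le halve_le]
  have FT: "FArr F (tarr A \<sigma> (halve n i) (halve n j)) \<in> Arr B"
    "Dom B (FArr F (tarr A \<sigma> (halve n i) (halve n j))) = FObj F (FObj \<sigma> (halve n i))"
    "Cod B (FArr F (tarr A \<sigma> (halve n i) (halve n j))) = FObj F (FObj \<sigma> (halve n j))"
    if "i \<le> 2 * n + 1" "j \<le> 2 * n + 1" for i j
    using T that Fun_simps(2-4)[OF F] by simp_all
  {
    fix i assume "i \<in> Obj (ordinal (2 * n + 1))"
    then have i: "i \<le> 2 * n + 1" by simp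
    have o: "FObj \<sigma> (halve n i) \<in> Obj A" using Fun_simps(1)[OF s, of "halve n i"] halve_le[OF i] by simp
    show "FObj (join_simplex A B F \<alpha> n \<sigma>) i \<in> Obj B"
      using i L(1)[OF i] groupoidD(1)[OF B] by (simp add: join_simplex_def)
    have "FArr (join_simplex A B F \<alpha> n \<sigma>) (i, i) = Ide B (Cod B (join_leg B F \<alpha> n \<sigma> i))"
      unfolding join_simplex_FArr[OF order_refl i] tarr_simps(4)[OF A s halve_le[OF i]] Fun_simps(5)[OF F o]
      using L[OF i] groupoidD(1)[OF B] by simp
    then show "FArr (join_simplex A B F \<alpha> n \<sigma>) (Ide (ordinal (2 * n + 1)) i) =
        Ide B (FObj (join_simplex A B F \<alpha> n \<sigma>) i)"
      using i by (simp add: join_simplex_def)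
  }
  {
    fix f assume "f \<in> Arr (ordinal (2 * n + 1))"
    then obtain i j where f: "f = (i, j)" and ij: "i \<le> j" "j \<le> 2 * n + 1" by (auto simp: Arr_ordinal)
    have i: "i \<le> 2 * n + 1" using ij by simp
    have "FArr (join_simplex A B F \<alpha> n \<sigma>) (i, j) \<in> Arr B"
      "Dom B (FArr (join_simplex A B F \<alpha> n \<sigma>) (i, j)) = Cod B (join_leg B F \<alpha> n \<sigma> i)"
      "Cod B (FArr (join_simplex A B F \<alpha> n \<sigma>) (i, j)) = Cod B (join_leg B F \<alpha> n \<sigma> j)"
      unfolding join_simplex_FArr[OF ij] using L[OF i] L[OF ij(2)] FT[OF i ij(2)] groupoidD(1)[OF B] by simp_all
    then show "FArr (join_simplex A B F \<alpha> n \<sigma>) f \<in> Arr B"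
      "Dom B (FArr (join_simplex A B F \<alpha> n \<sigma>) f) = FObj (join_simplex A B F \<alpha> n \<sigma>) (Dom (ordinal (2 * n + 1)) f)"
      "Cod B (FArr (join_simplex A B F \<alpha> n \<sigma>) f) = FObj (join_simplex A B F \<alpha> n \<sigma>) (Cod (ordinal (2 * n + 1)) f)"
      using i ij f by (simp_all add: join_simplex_def)
  }
  fix g f assume "g \<in> Arr (ordinal (2 * n + 1))" "f \<in> Arr (ordinal (2 * n + 1))" "Dom (ordinal (2 * n + 1)) g = Cod (ordinal (2 * n + 1)) f"
  then obtain i j k where gf: "f = (i, j)" "g = (j, k)" "i \<le> j" "j \<le> k" "k \<le> 2 * n + 1" by (auto simp: Arr_ordinal)
  then have le: "i \<le> 2 * n + 1" "j \<le> 2 * n + 1" "i \<le> k" by simp_all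
  let ?l = "join_leg B F \<alpha> n \<sigma>" and ?t = "\<lambda>i j. FArr F (tarr A \<sigma> (halve n i) (halve n j))"
  have tt: "?t i k = Comp B (?t j k) (?t i j)"
    using tarr_comp[OF A s halve_le[OF le(1)] halve_le[OF le(2)] halve_le[OF gf(5)]] T[OF le(1,2)] T[OF le(2) gf(5)]
    by (simp flip: Fun_Comp[OF F])
  \<comment> \<open>The leg at the middle vertex meets its inverse and cancels; the transition
    arrows telescope.\<close>
  have "Comp B (Comp B (?l k) (Comp B (?t j k) (inverse_arr B (?l j)))) (Comp B (?l j) (Comp B (?t i j) (inverse_arr B (?l i)))) =
    Comp B (?l k) (Comp B (Comp B (?t j k) (?t i j)) (inverse_arr B (?l i)))"
    using L[OF le(1)] L[OF le(2)] L[OF gf(5)] FT[OF le(1,2)] FT[OF le(2) gf(5)] groupoidD(1)[OF B]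
      left_cancel_iso[OF groupoidD(1)[OF B] L(2)[OF le(2)]]
    by (simp add: Comp_assoc)
  then show "FArr (join_simplex A B F \<alpha> n \<sigma>) (Comp (ordinal (2 * n + 1)) g f) =
      Comp B (FArr (join_simplex A B F \<alpha> n \<sigma>) g) (FArr (join_simplex A B F \<alpha> n \<sigma>) f)"
    using gf le tt by (simp add: join_simplex_FArr)
qed (simp_all add: join_simplex_def)

lemma nerve_homotopic:
  "homotopic_with (\<lambda>_. True) (realization (nerve A)) (realization (nerve B))
     (realization_map (nerve B) (nerve_map A F)) (realization_map (nerve B) (nerve_map A G))"
proof (rule homotopic_realization_join[where J = "join_simplex A B F \<alpha>"])
  note cA = groupoidD(1)[OF A] and cB = groupoidD(1)[OF B]
  show "nerve_map A F \<in> sset_hom (nerve A) (nerve B)" "nerve_map A G \<in> sset_hom (nerve A) (nerve B)"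
    by (rule nerve_map_in[OF F], rule nerve_map_in[OF G])
  show "join_simplex A B F \<alpha> n x \<in> Sim (nerve B) (2 * n + 1)" if "x \<in> Sim (nerve A) n" for n x
    using join_simplex_in[of x n] that by simp
  {
    fix m n \<theta> x assume t: "\<theta> \<in> Delta m n" and "x \<in> Sim (nerve A) n"
    then have x: "x \<in> Fun (ordinal n) A" by simp
    have x': "comp_fun (ordinal m) x \<theta> \<in> Fun (ordinal m) A" by (rule comp_fun_in[OF _ t x]) simp
    note d = double_delta_in[OF t]
    have dd: "FObj (double_delta m n \<theta>) i = (if i \<le> m then FObj \<theta> i else n + 1 + FObj \<theta> (i - m - 1))" if "i \<le> 2 * m + 1" for i
      using that by (simp add: double_delta_def)
    \<comment> \<open>Doubling \<theta> preserves the two halves and acts as \<theta> on underlying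
      vertices. So both legs and transition arrows match, which is the naturality of the
      join.\<close>
    have h: "halve n (FObj (double_delta m n \<theta>) i) = FObj \<theta> (halve m i)" if "i \<le> 2 * m + 1" for i
      using that Delta_le[OF t, of i] by (auto simp: dd halve_def)
    have l: "join_leg B F \<alpha> m (comp_fun (ordinal m) x \<theta>) i = join_leg B F \<alpha> n x (FObj (double_delta m n \<theta>) i)" if "i \<le> 2 * m + 1" for i
      using that Delta_le[OF t, of i] by (auto simp: dd join_leg_def)
    have "join_simplex A B F \<alpha> m (comp_fun (ordinal m) x \<theta>) =
      comp_fun (ordinal (2 * m + 1)) (join_simplex A B F \<alpha> n x) (double_delta m n \<theta>)"
    proof (rule Fun_ext_Arr[OF _ cB join_simplex_in[OF x'] comp_fun_in[OF _ d join_simplex_in[OF x]]])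
      fix f assume "f \<in> Arr (ordinal (2 * m + 1))"
      then obtain i j where f: "f = (i, j)" and ij: "i \<le> j" "j \<le> 2 * m + 1" by (auto simp: Arr_ordinal)
      have i: "i \<le> 2 * m + 1" using ij by simp
      have "FArr (join_simplex A B F \<alpha> m (comp_fun (ordinal m) x \<theta>)) (i, j) =
        FArr (join_simplex A B F \<alpha> n x) (FArr (double_delta m n \<theta>) (i, j))"
        unfolding Delta_FArr[OF d ij] join_simplex_FArr[OF ij] join_simplex_FArr[OF Delta_mono[OF d ij] Delta_le[OF d ij(2)]]
          l[OF i] l[OF ij(2)] h[OF i] h[OF ij(2)] tarr_precomp[OF A x t halve_le[OF i] halve_le[OF ij(2)]] ..
      then show "FArr (join_simplex A B F \<alpha> m (comp_fun (ordinal m) x \<theta>)) f =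
        FArr (comp_fun (ordinal (2 * m + 1)) (join_simplex A B F \<alpha> n x) (double_delta m n \<theta>)) f"
        using f ij by simp
    qed simp_all
    then show "join_simplex A B F \<alpha> m (Act (nerve A) m n \<theta> x) =
      Act (nerve B) (2 * m + 1) (2 * n + 1) (double_delta m n \<theta>) (join_simplex A B F \<alpha> n x)"
      using t x d join_simplex_in[OF x] by simp
  }
  fix n x assume "x \<in> Sim (nerve A) n"
  then have x: "x \<in> Fun (ordinal n) A" by simp
  note J = join_simplex_in[OF x]
  have X: "FObj x i \<in> Obj A" if "i \<le> n" for i using Fun_simps(1)[OF x, of i] that by simp
  have XA: "FArr x (i, j) \<in> Arr A" "Dom A (FArr x (i, j)) = FObj x i" "Cod A (FArr x (i, j)) = FObj x j" if "i \<le> j" "j \<le> n" for i j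
    using Fun_simps(2-4)[OF x, of "(i, j)"] that by auto
  \<comment> \<open>In the left half all legs are identities, which leaves the image under
    F.\<close>
  have "comp_fun (ordinal n) (join_simplex A B F \<alpha> n x) (left_delta n) = comp_fun (ordinal n) F x"
  proof (rule Fun_ext_Arr[OF _ cB comp_fun_in[OF _ left_right_delta_in(1) J] comp_fun_in[OF _ x F]])
    fix f assume "f \<in> Arr (ordinal n)"
    then obtain i j where f: "f = (i, j)" and ij: "i \<le> j" "j \<le> n" by (auto simp: Arr_ordinal)
    then show "FArr (comp_fun (ordinal n) (join_simplex A B F \<alpha> n x) (left_delta n)) f = FArr (comp_fun (ordinal n) F x) f"
      using XA[OF ij] X[of i] X[of j] cB
      by (simp add: left_delta_def join_simplex_FArr join_leg_def halve_def tarr_le[OF A x] Fun_simps[OF F])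
  qed simp_all
  then show "Act (nerve B) n (2 * n + 1) (left_delta n) (join_simplex A B F \<alpha> n x) = nerve_map A F n x"
    using left_right_delta_in(1) J x by simp
  have "comp_fun (ordinal n) (join_simplex A B F \<alpha> n x) (right_delta n) = comp_fun (ordinal n) G x"
  proof (rule Fun_ext_Arr[OF _ cB comp_fun_in[OF _ left_right_delta_in(2) J] comp_fun_in[OF _ x G]])
    fix f assume "f \<in> Arr (ordinal n)"
    then obtain i j where f: "f = (i, j)" and ij: "i \<le> j" "j \<le> n" by (auto simp: Arr_ordinal)
    have i: "i \<le> n" using ij by simp
    have iso: "\<alpha> (FObj x i) \<in> iso_arrows B" using al[OF X[OF i]] groupoidD(2)[OF B] by simp
    \<comment> \<open>In the right half the legs are components of \<alpha>, and naturality turns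
      the image under F, conjugated by them, into the image under G.\<close>
    have "Comp B (\<alpha> (FObj x j)) (Comp B (FArr F (FArr x (i, j))) (inverse_arr B (\<alpha> (FObj x i)))) =
      Comp B (Comp B (\<alpha> (FObj x j)) (FArr F (FArr x (i, j)))) (inverse_arr B (\<alpha> (FObj x i)))"
      using XA[OF ij] al[OF X[OF i]] al[OF X[OF ij(2)]] iso cB by (simp add: Comp_assoc Fun_simps[OF F])
    also have "\<dots> = Comp B (Comp B (FArr G (FArr x (i, j))) (\<alpha> (FObj x i))) (inverse_arr B (\<alpha> (FObj x i)))"
      using nat[OF XA(1)[OF ij]] XA[OF ij] by simp
    also have "\<dots> = FArr G (FArr x (i, j))"
      using XA[OF ij] al[OF X[OF i]] iso cB by (simp add: Comp_assoc Fun_simps[OF G])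
    finally show "FArr (comp_fun (ordinal n) (join_simplex A B F \<alpha> n x) (right_delta n)) f = FArr (comp_fun (ordinal n) G x) f"
      using f ij by (simp add: right_delta_def join_simplex_FArr join_leg_def halve_def tarr_le[OF A x])
  qed simp_all
  then show "Act (nerve B) n (2 * n + 1) (right_delta n) (join_simplex A B F \<alpha> n x) = nerve_map A G n x"
    using left_right_delta_in(2) J x by simp
qed

end

section \<open>Points of the realization of a groupoid as step functions\<close>

text \<open>
  A point with barycentric coordinates \<open>t\<close> in the simplex \<open>\<sigma>\<close> is recorded by the step function on $[0,1)$
  that takes the values $\sigma_0, \sigma_1, \ldots$ on successive intervals of lengths $t_0, t_1, \ldots$;
  degeneracies and faces with zero coordinates do not change this step function.
\<close>

definition psum :: "(nat \<Rightarrow> real) \<Rightarrow> nat \<Rightarrow> real" where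
  "psum t i = (\<Sum>j\<le>i. t j)"

text \<open>The number of the half-open interval that contains u when the unit interval is cut into
  pieces of lengths t. A vertex of weight 0 is never selected for u in [0, 1), so faces that carry
  no weight do not matter.\<close>

definition idx :: "(nat \<Rightarrow> real) \<Rightarrow> real \<Rightarrow> nat" where
  "idx t u = (LEAST i. u < psum t i)"

lemma idx_le_iff:
  assumes t: "t \<in> standard_simplex n" and u: "u < 1"
  shows "idx t u \<le> i \<longleftrightarrow> u < psum t i"
proof -
  have nn: "\<And>j. 0 \<le> t j" using t by (simp add: standard_simplex_def)
  have mono: "psum t i \<le> psum t j" if "i \<le> j" for i j
    unfolding psum_def using that nn by (intro sum_mono2) auto
  have "u < psum t n" using t u by (simp add: psum_def standard_simplex_def)
  then have "u < psum t (idx t u)" unfolding idx_def by (rule LeastI)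
  then show ?thesis using mono[of "idx t u" i] unfolding idx_def by (auto intro: Least_le)
qed

lemma idx_le: "t \<in> standard_simplex n \<Longrightarrow> u < 1 \<Longrightarrow> idx t u \<le> n"
  using idx_le_iff[of t n u n] by (simp add: psum_def standard_simplex_def)

text \<open>The fibres of a monotone map are blocks of consecutive vertices. Pushing weights forward
  merges the corresponding intervals and labels them by the common image, so the selected index is
  merely relabelled by \<theta>.\<close>

lemma idx_push:
  assumes th: "\<theta> \<in> Delta m n" and t: "t \<in> standard_simplex m" and u: "0 \<le> u" "u < 1"
  shows "idx (simplex_push m \<theta> t) u = FObj \<theta> (idx t u)"
proof -
  let ?I = "idx t u"
  have nn: "\<And>j. 0 \<le> t j" using t by (simp add: standard_simplex_def)
  have I: "?I \<le> m" by (rule idx_le[OF t u(2)])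
  have S: "psum (simplex_push m \<theta> t) k = (\<Sum>i | i \<le> m \<and> FObj \<theta> i \<le> k. t i)" for k
  proof -
    have "psum (simplex_push m \<theta> t) k = (\<Sum>j\<le>k. \<Sum>i | i \<in> {i. i \<le> m \<and> FObj \<theta> i \<le> k} \<and> FObj \<theta> i = j. t i)"
      unfolding psum_def simplex_push_def by (intro sum.cong refl) auto
    also have "\<dots> = (\<Sum>i | i \<le> m \<and> FObj \<theta> i \<le> k. t i)" by (intro sum.group) auto
    finally show ?thesis .
  qed
  have "idx (simplex_push m \<theta> t) u \<le> k \<longleftrightarrow> FObj \<theta> ?I \<le> k" for k
  proof
    assume k: "FObj \<theta> ?I \<le> k"
    have "u < psum t ?I" using idx_le_iff[OF t u(2)] by blast
    also have "psum t ?I \<le> (\<Sum>i | i \<le> m \<and> FObj \<theta> i \<le> k. t i)"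
      unfolding psum_def using I k Delta_mono[OF th _ I] nn by (intro sum_mono2) (auto intro: order_trans)
    finally show "idx (simplex_push m \<theta> t) u \<le> k"
      using idx_le_iff[OF simplex_push_in[OF th t] u(2)] S by simp
  next
    assume "idx (simplex_push m \<theta> t) u \<le> k"
    then have l: "u < (\<Sum>i | i \<le> m \<and> FObj \<theta> i \<le> k. t i)"
      using idx_le_iff[OF simplex_push_in[OF th t] u(2)] S by simp
    show "FObj \<theta> ?I \<le> k"
    proof (rule ccontr)
      assume nk: "\<not> FObj \<theta> ?I \<le> k"
      \<comment> \<open>By monotonicity the indices with image at most k all precede
        \<open>?I\<close>, and the intervals before \<open>?I\<close> have total length at most
        u.\<close>
      have "i < ?I" if "i \<le> m" "FObj \<theta> i \<le> k" for i
        using that nk Delta_mono[OF th, of ?I i] by (meson le_trans not_le)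
      then have "(\<Sum>i | i \<le> m \<and> FObj \<theta> i \<le> k. t i) \<le> (\<Sum>i<?I. t i)"
        using nn by (intro sum_mono2) auto
      also have "\<dots> \<le> u"
      proof (cases ?I)
        case (Suc q)
        then have "\<not> u < psum t q" using idx_le_iff[OF t u(2), of q] by simp
        then show ?thesis using Suc by (simp add: psum_def lessThan_Suc_atMost)
      qed (use u in simp)
      finally show False using l by simp
    qed
  qed
  from this[of "FObj \<theta> ?I"] this[of "idx (simplex_push m \<theta> t) u"] show ?thesis by simp
qed

text \<open>The selected index can change only at a u between the two cumulative sums for some i, so
  the union of these closed intervals is a suitable exceptional set.\<close>

lemma idx_agree:
  assumes s: "s \<in> standard_simplex n" and t: "t \<in> standard_simplex n"
  obtains N where "N \<in> lmeasurable" "measure lebesgue N \<le> (\<Sum>i\<le>n. \<bar>psum s i - psum t i\<bar>)"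
    "\<And>u. u \<in> {0..<1} - N \<Longrightarrow> idx s u = idx t u"
proof
  let ?J = "\<lambda>i. {min (psum s i) (psum t i)..max (psum s i) (psum t i)}"
  let ?N = "\<Union>i\<le>n. ?J i"
  have "?J i \<in> lmeasurable" for i using lmeasurable_cbox[of "min (psum s i) (psum t i)" "max (psum s i) (psum t i)"] by simp
  then show "?N \<in> lmeasurable" by (intro fmeasurable.finite_UN) auto
  have "measure lebesgue ?N \<le> (\<Sum>i\<le>n. measure lebesgue (?J i))"
    by (rule measure_UNION_le) auto
  also have "\<dots> = (\<Sum>i\<le>n. \<bar>psum s i - psum t i\<bar>)"
    by (intro sum.cong) (auto simp: min_def max_def)
  finally show "measure lebesgue ?N \<le> (\<Sum>i\<le>n. \<bar>psum s i - psum t i\<bar>)" .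
  fix u assume u: "u \<in> {0..<1} - ?N"
  have "u < psum s i \<longleftrightarrow> u < psum t i" if "i \<le> n" for i
  proof -
    have "u \<notin> ?J i" using u that by blast
    then show ?thesis by (auto simp: min_def max_def split: if_splits)
  qed
  then have "idx s u \<le> i \<longleftrightarrow> idx t u \<le> i" if "i \<le> n" for i
    using that u by (simp add: idx_le_iff[OF s] idx_le_iff[OF t])
  from this[of "idx s u"] this[of "idx t u"] show "idx s u = idx t u"
    using u idx_le[OF s, of u] idx_le[OF t, of u] by simp
qed

section \<open>The step function of a point\<close>

abbreviation class_space :: "('o, 'a) cat \<Rightarrow> ((nat \<times> (nat, nat \<times> nat, 'o, 'a) funct) \<times> (nat \<Rightarrow> real)) set topology" where
  "class_space G \<equiv> realization (nerve G)"

text \<open>The transition arrow between the values of the step function at u and at v. It is read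
  off from a chosen representative; \<open>step_class\<close> shows that the choice does not
  matter.\<close>

definition step where
  "step G c u v = (case (SOME p. p \<in> c) of ((n, \<sigma>), t) \<Rightarrow> tarr G \<sigma> (idx t u) (idx t v))"

text \<open>Under a gluing, \<open>idx_push\<close> relabels the two indices by \<theta> and
  \<open>tarr_precomp\<close> absorbs the relabelling.\<close>

lemma step_class:
  assumes G: "groupoid G" and u: "u \<in> {0..<1}" "v \<in> {0..<1}"
  shows "step G (point_class (nerve G) ((n, \<sigma>), t)) u v = tarr G \<sigma> (idx t u) (idx t v)"
proof -
  let ?f = "\<lambda>p. case p of ((n, \<sigma>), t) \<Rightarrow> tarr G \<sigma> (idx t u) (idx t v)"
  let ?p = "((n, \<sigma>), t)"
  let ?q = "SOME q. q \<in> point_class (nerve G) ?p"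
  have "?q \<in> point_class (nerve G) ?p" using point_class_self by (rule someI)
  then have "(?p, ?q) \<in> realization_rel (nerve G)" by (simp add: point_class_def)
  then have "?f ?p = ?f ?q"
  proof (rule realization_rel_invariant)
    fix m n \<theta> x t assume "\<theta> \<in> Delta m n" "x \<in> Sim (nerve G) n" "t \<in> standard_simplex m"
    then show "?f ((m, Act (nerve G) m n \<theta> x), t) = ?f ((n, x), simplex_push m \<theta> t)"
      using u idx_le[of t m] by (simp add: tarr_precomp[OF G] idx_push)
  qed
  then show ?thesis by (simp add: step_def)
qed

definition vertex where
  "vertex G c u = Dom G (step G c u u)"

lemma step_simps:
  assumes G: "groupoid G" and c: "c \<in> topspace (class_space G)"
  shows "u \<in> {0..<1} \<Longrightarrow> v \<in> {0..<1} \<Longrightarrow> step G c u v \<in> Arr G"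
    and "u \<in> {0..<1} \<Longrightarrow> v \<in> {0..<1} \<Longrightarrow> Dom G (step G c u v) = vertex G c u"
    and "u \<in> {0..<1} \<Longrightarrow> v \<in> {0..<1} \<Longrightarrow> Cod G (step G c u v) = vertex G c v"
    and "u \<in> {0..<1} \<Longrightarrow> v \<in> {0..<1} \<Longrightarrow> w \<in> {0..<1} \<Longrightarrow> Comp G (step G c v w) (step G c u v) = step G c u w"
    and "u \<in> {0..<1} \<Longrightarrow> step G c u u = Ide G (vertex G c u)"
    and "u \<in> {0..<1} \<Longrightarrow> vertex G c u \<in> Obj G"
proof -
  obtain n \<sigma> t where c: "c = point_class (nerve G) ((n, \<sigma>), t)" and s: "\<sigma> \<in> Fun (ordinal n) G" and t: "t \<in> standard_simplex n"
    using c by (rule realization_cases) auto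
  have I: "idx t u \<le> n" if "u \<in> {0..<1}" for u using idx_le[OF t] that by simp
  note T = tarr_simps[OF G s]
  have V: "vertex G c u = FObj \<sigma> (idx t u)" if "u \<in> {0..<1}" for u
    unfolding vertex_def c step_class[OF G that that] using T(2) I[OF that] by simp
  show "u \<in> {0..<1} \<Longrightarrow> v \<in> {0..<1} \<Longrightarrow> step G c u v \<in> Arr G"
    "u \<in> {0..<1} \<Longrightarrow> v \<in> {0..<1} \<Longrightarrow> Dom G (step G c u v) = vertex G c u"
    "u \<in> {0..<1} \<Longrightarrow> v \<in> {0..<1} \<Longrightarrow> Cod G (step G c u v) = vertex G c v"
    "u \<in> {0..<1} \<Longrightarrow> step G c u u = Ide G (vertex G c u)"
    using T I V unfolding c by (simp_all add: step_class[OF G])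
  show "u \<in> {0..<1} \<Longrightarrow> v \<in> {0..<1} \<Longrightarrow> w \<in> {0..<1} \<Longrightarrow> Comp G (step G c v w) (step G c u v) = step G c u w"
    unfolding c using I tarr_comp[OF G s] by (simp add: step_class[OF G])
  show "u \<in> {0..<1} \<Longrightarrow> vertex G c u \<in> Obj G"
    using V Fun_simps(1)[OF s, of "idx t u"] I by simp
qed

text \<open>Closeness in measure of step functions together with their transition arrows. The
  exceptional set is kept as an explicit argument so that several such sets can be united and
  avoided at once.\<close>

definition close_off where
  "close_off G \<epsilon> N c d \<longleftrightarrow> N \<in> lmeasurable \<and> measure lebesgue N < \<epsilon> \<and>
     (\<forall>u\<in>{0..<1::real} - N. \<forall>v\<in>{0..<1} - N. step G c u v = step G d u v)"

definition close_points where
  "close_points G \<epsilon> c d \<longleftrightarrow> (\<exists>N. close_off G \<epsilon> N c d)"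

lemma close_off_sym: "close_off G \<epsilon> N c d \<Longrightarrow> close_off G \<epsilon> N d c"
  by (simp add: close_off_def)

lemma close_off_trans:
  assumes "close_off G \<delta> M c d" "close_off G \<epsilon> N d e"
  shows "close_off G (\<delta> + \<epsilon>) (M \<union> N) c e"
proof -
  have "measure lebesgue (M \<union> N) \<le> measure lebesgue M + measure lebesgue N"
    using assms by (intro measure_Un_le) (auto simp: close_off_def)
  then show ?thesis using assms by (auto simp: close_off_def fmeasurable.Un)
qed

lemma close_off_mono: "close_off G \<delta> M c d \<Longrightarrow> \<delta> \<le> \<epsilon> \<Longrightarrow> close_off G \<epsilon> M c d"
  by (auto simp: close_off_def)

text \<open>A set of measure below 1 cannot cover [0, 1).\<close>

lemma close_off_witness:
  assumes "close_off G \<epsilon> N c d" "\<epsilon> \<le> 1"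
  obtains w where "w \<in> {0..<1} - N"
proof -
  have "\<not> {0..<1} \<subseteq> N"
  proof (rule notI)
    assume "{0..<1} \<subseteq> N"
    then have "measure lebesgue {0..<1::real} \<le> measure lebesgue N"
      using assms by (intro measure_mono_fmeasurable) (auto simp: close_off_def)
    then show False using assms by (simp add: close_off_def)
  qed
  then show ?thesis using that by blast
qed

text \<open>Openness is tested in each simplex. The strict bound leaves a margin \<eta>, and by
  \<open>idx_agree\<close> a change of the coordinates whose cumulative sums move by less than
  \<eta> in total enlarges the exceptional set by less than that margin.\<close>

lemma openin_close_points:
  assumes G: "groupoid G"
  shows "openin (class_space G) {d \<in> topspace (class_space G). close_points G \<epsilon> c d}"
proof -
  let ?U = "{d \<in> topspace (class_space G). close_points G \<epsilon> c d}"
  define W where "W = {p \<in> topspace (pre_realization (nerve G)). point_class (nerve G) p \<in> ?U}"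
  have "openin (pre_realization (nerve G)) W"
    unfolding pre_realization_def openin_sum_topology
  proof (intro conjI ballI)
    show "W \<subseteq> Sigma {(n, x). x \<in> Sim (nerve G) n} (topspace \<circ> (\<lambda>(n, x). subtopology (powertop_real UNIV) (standard_simplex n)))"
      unfolding W_def pre_realization_def by auto
    fix i assume "i \<in> {(n, x). x \<in> Sim (nerve G) n}"
    then obtain n \<sigma> where i: "i = (n, \<sigma>)" and s: "\<sigma> \<in> Fun (ordinal n) G" by auto
    let ?T = "subtopology (powertop_real UNIV) (standard_simplex n)"
    let ?V = "{t. (i, t) \<in> W}"
    have V: "t \<in> ?V \<longleftrightarrow> t \<in> standard_simplex n \<and> close_points G \<epsilon> c (point_class (nerve G) ((n, \<sigma>), t))" for t
      using s point_class_in[of \<sigma> "nerve G" n t] by (auto simp: i W_def topspace_pre_realization)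
    have "openin ?T ?V"
    proof (subst openin_subopen, rule ballI)
      fix t assume "t \<in> ?V"
      then have t: "t \<in> standard_simplex n" and "close_points G \<epsilon> c (point_class (nerve G) ((n, \<sigma>), t))" using V by auto
      then obtain N where N: "close_off G \<epsilon> N c (point_class (nerve G) ((n, \<sigma>), t))" by (auto simp: close_points_def)
      define \<eta> where "\<eta> = \<epsilon> - measure lebesgue N"
      have \<eta>: "\<eta> > 0" using N by (simp add: \<eta>_def close_off_def)
      define f where "f t' = (\<Sum>i\<le>n. \<bar>psum t i - psum t' i\<bar>)" for t'
      have "continuous_map ?T euclideanreal f"
        unfolding f_def psum_def
        by (intro continuous_intros continuous_map_real_abs) auto
      then have "openin ?T {t' \<in> topspace ?T. f t' \<in> {..<\<eta>}}"
        by (rule openin_continuous_map_preimage) simp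
      moreover have "t \<in> {t' \<in> topspace ?T. f t' \<in> {..<\<eta>}}" using t \<eta> by (simp add: f_def)
      moreover have "{t' \<in> topspace ?T. f t' \<in> {..<\<eta>}} \<subseteq> ?V"
      proof
        fix t' assume "t' \<in> {t' \<in> topspace ?T. f t' \<in> {..<\<eta>}}"
        then have t': "t' \<in> standard_simplex n" and f: "f t' < \<eta>" by auto
        obtain M where M: "M \<in> lmeasurable" "measure lebesgue M \<le> f t'" "\<And>u. u \<in> {0..<1} - M \<Longrightarrow> idx t u = idx t' u"
          using idx_agree[OF t t'] unfolding f_def by blast
        have "close_off G \<eta> M (point_class (nerve G) ((n, \<sigma>), t)) (point_class (nerve G) ((n, \<sigma>), t'))"
          using M f by (auto simp: close_off_def step_class[OF G])
        then have "close_off G (\<epsilon> + \<eta>) (N \<union> M) c (point_class (nerve G) ((n, \<sigma>), t'))"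
          by (rule close_off_trans[OF N])
        \<comment> \<open>Transitivity alone only gives the bound
          \<open>\<epsilon> + \<eta>\<close>; counting the actual measures brings it back below
          \<open>\<epsilon>\<close>.\<close>
        moreover have "measure lebesgue (N \<union> M) \<le> measure lebesgue N + measure lebesgue M"
          using N M by (intro measure_Un_le) (auto simp: close_off_def)
        ultimately have "close_off G \<epsilon> (N \<union> M) c (point_class (nerve G) ((n, \<sigma>), t'))"
          using M(2) f by (auto simp: close_off_def \<eta>_def)
        then show "t' \<in> ?V" using t' V by (auto simp: close_points_def)
      qed
      ultimately show "\<exists>W. openin ?T W \<and> t \<in> W \<and> W \<subseteq> ?V" by blast
    qed
    then show "openin (case i of (n, x) \<Rightarrow> subtopology (powertop_real UNIV) (standard_simplex n)) {x. (i, x) \<in> W}"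
      by (simp add: i)
  qed
  moreover have "?U \<subseteq> topspace (class_space G)" by blast
  note quotient_map_point_class[of "nerve G", unfolded quotient_map_def, THEN conjunct2, rule_format, OF this]
  ultimately show ?thesis unfolding W_def by (rule iffD1[rotated])
qed

text \<open>From the base vertex of c to its value at a point w where c and d agree, and back to the
  base vertex of d. The base vertices themselves may differ, because the first interval can shrink
  to nothing under an arbitrarily small change.\<close>

definition transport where
  "transport G c d = (let w = (SOME w. \<exists>N. close_off G (1/2) N c d \<and> w \<in> {0..<1} - N) in
     Comp G (step G d w 0) (step G c 0 w))"

context
  fixes G :: "('o, 'a) cat"
  assumes G: "groupoid G"
begin

text \<open>Two points off the same exceptional set give the same arrow, since the transition
  between them is the same for c and for d. Different exceptional sets are linked by a point that
  avoids both.\<close>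

lemma transport_eq:
  assumes c: "c \<in> topspace (class_space G)" and d: "d \<in> topspace (class_space G)"
    and N: "close_off G (1/2) N c d" and w: "w \<in> {0..<1} - N"
  shows "transport G c d = Comp G (step G d w 0) (step G c 0 w)"
proof -
  note C = step_simps[OF G c] and D = step_simps[OF G d]
  have *: "Comp G (step G d x 0) (step G c 0 x) = Comp G (step G d y 0) (step G c 0 y)"
    if M: "close_off G (1/2) M c d" and x: "x \<in> {0..<1} - M" and y: "y \<in> {0..<1} - M" for x y M
  proof -
    have e: "step G c x y = step G d x y" using M x y by (auto simp: close_off_def)
    have "Comp G (step G d x 0) (step G c 0 x) = Comp G (Comp G (step G d y 0) (step G d x y)) (step G c 0 x)"
      using x y by (simp add: D(4))
    also have "\<dots> = Comp G (step G d y 0) (Comp G (step G c x y) (step G c 0 x))"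
      using x y C(1-3)[of 0 x] C(1-3)[of x y] D(1-3)[of x y] D(1-3)[of y 0] groupoidD(1)[OF G] e
      by (simp add: Comp_assoc)
    also have "\<dots> = Comp G (step G d y 0) (step G c 0 y)" using x y by (simp add: C(4))
    finally show ?thesis .
  qed
  define v where "v = (SOME w. \<exists>N. close_off G (1/2) N c d \<and> w \<in> {0..<1} - N)"
  have "\<exists>M. close_off G (1/2) M c d \<and> v \<in> {0..<1} - M"
    unfolding v_def by (rule someI_ex) (use N w in blast)
  then obtain M where M: "close_off G (1/2) M c d" and v: "v \<in> {0..<1} - M" by blast
  \<comment> \<open>Two exceptional sets of measure below 1/2 cannot cover [0, 1) together; this is
    where the constant 1/2 comes from.\<close>
  have "close_off G (1/2 + 1/2) (N \<union> M) c c" by (rule close_off_trans[OF N close_off_sym[OF M]])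
  then obtain x where x: "x \<in> {0..<1} - (N \<union> M)" by (rule close_off_witness) simp_all
  have "transport G c d = Comp G (step G d v 0) (step G c 0 v)"
    by (simp add: transport_def v_def Let_def)
  also have "\<dots> = Comp G (step G d x 0) (step G c 0 x)" using *[OF M v] x by blast
  also have "\<dots> = Comp G (step G d w 0) (step G c 0 w)" using *[OF N _ w] x by blast
  finally show ?thesis .
qed

lemma transport_simps:
  assumes c: "c \<in> topspace (class_space G)" and d: "d \<in> topspace (class_space G)" and cd: "close_points G (1/2) c d"
  shows "transport G c d \<in> Arr G" "Dom G (transport G c d) = vertex G c 0" "Cod G (transport G c d) = vertex G d 0"
proof -
  obtain N where N: "close_off G (1/2) N c d" using cd by (auto simp: close_points_def)
  obtain w where w: "w \<in> {0..<1} - N" using close_off_witness[OF N] by auto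
  have "vertex G c w = vertex G d w" using N w by (simp add: vertex_def close_off_def)
  then show "transport G c d \<in> Arr G" "Dom G (transport G c d) = vertex G c 0" "Cod G (transport G c d) = vertex G d 0"
    unfolding transport_eq[OF c d N w]
    using w groupoidD(1)[OF G] step_simps(1-3)[OF G c, of 0 w] step_simps(1-3)[OF G d, of w 0] by simp_all
qed

text \<open>Two sets of measure below 1/4 leave a point w at which all three step functions agree,
  and their union still stays below 1/2. At w the excursion to the base vertex of d cancels.\<close>

lemma transport_comp:
  assumes c: "c \<in> topspace (class_space G)" and d: "d \<in> topspace (class_space G)" and e: "e \<in> topspace (class_space G)"
    and cd: "close_points G (1/4) c d" and de: "close_points G (1/4) d e"
  shows "Comp G (transport G d e) (transport G c d) = transport G c e"
proof -
  obtain M N where M: "close_off G (1/4) M c d" and N: "close_off G (1/4) N d e" using cd de by (auto simp: close_points_def)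
  have MN: "close_off G (1/2) (M \<union> N) c e" using close_off_trans[OF M N] by simp
  obtain w where w: "w \<in> {0..<1} - (M \<union> N)" using close_off_witness[OF MN] by auto
  have v: "vertex G c w = vertex G d w" "vertex G d w = vertex G e w" using M N w by (simp_all add: vertex_def close_off_def)
  have w': "w \<in> {0..<1}" "w \<in> {0..<1} - M" "w \<in> {0..<1} - N" using w by auto
  have M2: "close_off G (1/2) M c d" and N2: "close_off G (1/2) N d e"
    using close_off_mono[OF M, of "1/2"] close_off_mono[OF N, of "1/2"] by simp_all
  have "Comp G (Comp G (step G e w 0) (step G d 0 w)) (Comp G (step G d w 0) (step G c 0 w)) =
    Comp G (step G e w 0) (Comp G (Comp G (step G d 0 w) (step G d w 0)) (step G c 0 w))"
    using w' v groupoidD(1)[OF G] step_simps(1-3)[OF G c, of 0 w] step_simps(1-3)[OF G d, of w 0]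
      step_simps(1-3)[OF G d, of 0 w] step_simps(1-3)[OF G e, of w 0]
    by (simp add: Comp_assoc)
  also have "\<dots> = Comp G (step G e w 0) (step G c 0 w)"
    using w' v groupoidD(1)[OF G] step_simps(1-3)[OF G c, of 0 w] step_simps(4)[OF G d, of w 0 w] step_simps(5)[OF G d, of w]
    by simp
  finally show ?thesis
    unfolding transport_eq[OF c d M2 w'(2)] transport_eq[OF d e N2 w'(3)] transport_eq[OF c e MN w] .
qed

lemma transport_Ide:
  assumes c: "c \<in> topspace (class_space G)"
  shows "transport G c c = Ide G (vertex G c 0)"
proof -
  have N: "close_off G (1/2) {} c c" by (simp add: close_off_def)
  have "0 \<in> {0..<1::real} - {}" by simp
  from transport_eq[OF c c N this] show ?thesis
    using step_simps(5,6)[OF G c, of 0] groupoidD(1)[OF G] by simp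
qed

end

section \<open>Holonomy\<close>

text \<open>
  Nearby points have step functions that agree off a set of small measure, which determines a transport
  between their base vertices. A potential trivialises the transport along a map into the realization;
  it exists because transport along rays converges after finitely many subdivisions.
\<close>

definition potential where
  "potential G S \<gamma> a g \<longleftrightarrow>
     (\<forall>z\<in>S. \<gamma> z \<in> topspace (class_space G) \<and> g z \<in> Arr G \<and> Dom G (g z) = a \<and> Cod G (g z) = vertex G (\<gamma> z) 0) \<and>
     (\<exists>\<delta>>0. \<forall>z\<in>S. \<forall>z'\<in>S. dist z z' < \<delta> \<longrightarrow>
        close_points G (1/2) (\<gamma> z) (\<gamma> z') \<and> g z' = Comp G (transport G (\<gamma> z) (\<gamma> z')) (g z))"

text \<open>Connectedness in a finite form: the segment from 0 to z stays in the convex set and is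
  cut into pieces shorter than \<delta>.\<close>

lemma ray_induct:
  fixes S :: "'v::real_normed_vector set"
  assumes S: "convex S" "0 \<in> S" and z: "z \<in> S" and d: "\<delta> > 0" and P0: "P 0"
    and step: "\<And>x y. x \<in> S \<Longrightarrow> y \<in> S \<Longrightarrow> dist x y < \<delta> \<Longrightarrow> P x \<Longrightarrow> P y"
  shows "P z"
proof -
  obtain N :: nat where N: "norm z / \<delta> < real N" using reals_Archimedean2 by blast
  then have N0: "N > 0" using d by (cases N) (auto simp: divide_less_0_iff not_less)
  have mem: "(real i / real N) *\<^sub>R z \<in> S" if "i \<le> N" for i
    using convexD_alt[OF S(1) S(2) z, of "real i / real N"] that N0 by simp
  have "P ((real i / real N) *\<^sub>R z)" if "i \<le> N" for i
    using that
  proof (induction i)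
    case (Suc i)
    have "(real (Suc i) / real N) *\<^sub>R z - (real i / real N) *\<^sub>R z = (1 / real N) *\<^sub>R z"
      by (simp add: add_divide_distrib scaleR_left_distrib)
    then have "dist ((real i / real N) *\<^sub>R z) ((real (Suc i) / real N) *\<^sub>R z) = norm z / real N"
      by (subst dist_commute) (simp add: dist_norm del: of_nat_Suc)
    also have "\<dots> < \<delta>" using N N0 d by (simp add: field_simps)
    finally have dd: "dist ((real i / real N) *\<^sub>R z) ((real (Suc i) / real N) *\<^sub>R z) < \<delta>" .
    have i: "i \<le> N" using Suc.prems by simp
    show ?case by (rule step[OF mem[OF i] mem[OF Suc.prems] dd Suc.IH[OF i]])
  qed (use P0 in simp)
  from this[of N] show ?thesis using N0 by simp
qed

text \<open>A Lebesgue number for the cover by the open sets of points that are 1/8-close to some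
  given value. Two points in one member are then 1/4-close, as \<open>transport_comp\<close>
  asks.\<close>

lemma uniformly_close:
  fixes \<gamma> :: "'v::real_normed_vector \<Rightarrow> _"
  assumes G: "groupoid G" and S: "compact S" and g: "continuous_map (top_of_set S) (class_space G) \<gamma>"
  obtains \<delta> where "\<delta> > 0" "\<And>z z'. z \<in> S \<Longrightarrow> z' \<in> S \<Longrightarrow> dist z z' < \<delta> \<Longrightarrow> close_points G (1/4) (\<gamma> z) (\<gamma> z')"
proof -
  have "\<exists>T. open T \<and> {x \<in> S. \<gamma> x \<in> topspace (class_space G) \<and> close_points G (1/8) (\<gamma> z) (\<gamma> x)} = S \<inter> T" for z
  proof -
    have "openin (top_of_set S) {x \<in> topspace (top_of_set S). \<gamma> x \<in> {d \<in> topspace (class_space G). close_points G (1/8) (\<gamma> z) d}}"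
      by (rule openin_continuous_map_preimage[OF g openin_close_points[OF G]])
    then show ?thesis by (auto simp: openin_open)
  qed
  then obtain T where T: "\<And>z. open (T z)"
    "\<And>z. {x \<in> S. \<gamma> x \<in> topspace (class_space G) \<and> close_points G (1/8) (\<gamma> z) (\<gamma> x)} = S \<inter> T z" by metis
  have R: "\<gamma> x \<in> topspace (class_space G)" if "x \<in> S" for x
    using funcset_mem[OF continuous_map_funspace[OF g], of x] that by simp
  have "close_points G (1/8) c c" for c by (auto simp: close_points_def close_off_def intro!: exI[of _ "{}"])
  then have "S \<subseteq> \<Union>(range T)" using T(2) R by blast
  then obtain e where e: "e > 0" "\<And>x. x \<in> S \<Longrightarrow> \<exists>B\<in>range T. ball x e \<subseteq> B"
    using Heine_Borel_lemma[OF S, of "range T"] T(1) by (metis rangeE)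
  show ?thesis
  proof
    show "e > 0" by (rule e)
    fix z z' assume z: "z \<in> S" "z' \<in> S" "dist z z' < e"
    then obtain y where "ball z e \<subseteq> T y" using e(2) by blast
    then have "z \<in> S \<inter> T y" "z' \<in> S \<inter> T y" using z e(1) by auto
    then have "close_points G (1/8) (\<gamma> y) (\<gamma> z)" "close_points G (1/8) (\<gamma> y) (\<gamma> z')" unfolding T(2)[symmetric] by auto
    then obtain M N where "close_off G (1/8) M (\<gamma> y) (\<gamma> z)" "close_off G (1/8) N (\<gamma> y) (\<gamma> z')" by (auto simp: close_points_def)
    from close_off_trans[OF close_off_sym[OF this(1)] this(2)]
    show "close_points G (1/4) (\<gamma> z) (\<gamma> z')" by (auto simp: close_points_def)
  qed
qed

lemma close_points_mono: "close_points G \<delta> c d \<Longrightarrow> \<delta> \<le> \<epsilon> \<Longrightarrow> close_points G \<epsilon> c d"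
  unfolding close_points_def using close_off_mono by blast

primrec ray_transport where
  "ray_transport G \<gamma> N z 0 = Ide G (vertex G (\<gamma> 0) 0)"
| "ray_transport G \<gamma> N z (Suc i) = Comp G (transport G (\<gamma> ((real i / real N) *\<^sub>R z)) (\<gamma> ((real (Suc i) / real N) *\<^sub>R z)))
     (ray_transport G \<gamma> N z i)"

text \<open>The potential at z is the product of transports along the subdivided segment from 0 to
  z. Subdivided segments to nearby points bound a strip of small squares on which transport
  commutes, so by induction their products differ exactly by the transport between the end
  points.\<close>

lemma potential_exists:
  fixes \<gamma> :: "'v::real_normed_vector \<Rightarrow> _"
  assumes G: "groupoid G" and S: "compact S" "convex S" "0 \<in> S" and g: "continuous_map (top_of_set S) (class_space G) \<gamma>"
  shows "\<exists>h. potential G S \<gamma> (vertex G (\<gamma> 0) 0) h \<and> h 0 = Ide G (vertex G (\<gamma> 0) 0)"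
proof -
  note cG = groupoidD(1)[OF G]
  have R: "\<gamma> x \<in> topspace (class_space G)" if "x \<in> S" for x
    using funcset_mem[OF continuous_map_funspace[OF g], of x] that by simp
  obtain \<delta> where d: "\<delta> > 0" and cl: "\<And>z z'. z \<in> S \<Longrightarrow> z' \<in> S \<Longrightarrow> dist z z' < \<delta> \<Longrightarrow> close_points G (1/4) (\<gamma> z) (\<gamma> z')"
    using uniformly_close[OF G S(1) g] by metis
  obtain B where B: "\<And>z. z \<in> S \<Longrightarrow> norm z \<le> B" using compact_imp_bounded[OF S(1)] by (auto simp: bounded_iff)
  \<comment> \<open>One number of subdivisions for all rays: by the bound B the pieces of every
    segment are shorter than \<delta> / 2.\<close>
  obtain N :: nat where N: "2 * B / \<delta> < real N" using reals_Archimedean2 by blast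
  have "0 \<le> B" using B[OF S(3)] by simp
  then have "0 \<le> 2 * B / \<delta>" using d by simp
  then have N0: "N > 0" using N by (cases N) auto
  define r where "r z i = (real i / real N) *\<^sub>R z" for z :: 'v and i
  have r0: "r z 0 = 0" "r z N = z" for z using N0 by (simp_all add: r_def)
  have mem: "r z i \<in> S" if "z \<in> S" "i \<le> N" for z i
    unfolding r_def using convexD_alt[OF S(2,3) that(1), of "real i / real N"] that N0 by simp
  have ds: "dist (r z i) (r z (Suc i)) < \<delta> / 2" if "z \<in> S" for z i
  proof -
    have "r z (Suc i) - r z i = (1 / real N) *\<^sub>R z" by (simp add: r_def add_divide_distrib scaleR_left_distrib)
    then have "dist (r z i) (r z (Suc i)) = norm z / real N"
      by (subst dist_commute) (simp add: dist_norm)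
    also have "\<dots> < \<delta> / 2" using B[OF that] N N0 d by (simp add: field_simps)
    finally show ?thesis .
  qed
  have dz: "dist (r z i) (r z' i) \<le> dist z z'" if "i \<le> N" for z z' i
  proof -
    have "dist (r z i) (r z' i) = \<bar>real i / real N\<bar> * dist z z'"
      by (simp add: r_def dist_norm flip: scaleR_diff_right)
    also have "\<dots> \<le> 1 * dist z z'" using that N0 by (intro mult_right_mono) auto
    finally show ?thesis by simp
  qed
  define h where "h z i = ray_transport G \<gamma> N z i" for z i
  have hS: "h z (Suc i) = Comp G (transport G (\<gamma> (r z i)) (\<gamma> (r z (Suc i)))) (h z i)" for z i by (simp add: h_def r_def)
  have h0: "h z 0 = Ide G (vertex G (\<gamma> 0) 0)" for z by (simp add: h_def)
  have cl2: "close_points G (1/2) (\<gamma> x) (\<gamma> y)" if "x \<in> S" "y \<in> S" "dist x y < \<delta>" for x y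
    using close_points_mono[OF cl[OF that]] by simp
  note tr = transport_simps[OF G R R cl2] and tc = transport_comp[OF G R R R cl cl]
  have hh: "h z i \<in> Arr G \<and> Dom G (h z i) = vertex G (\<gamma> 0) 0 \<and> Cod G (h z i) = vertex G (\<gamma> (r z i)) 0" if "z \<in> S" "i \<le> N" for z i
    using that(2)
  proof (induction i)
    case 0
    then show ?case using cG step_simps(6)[OF G R[OF S(3)], of 0] by (simp add: h0 r0)
  next
    case (Suc i)
    have i: "i \<le> N" "Suc i \<le> N" using Suc.prems by simp_all
    have "dist (r z i) (r z (Suc i)) < \<delta>" using ds[OF that(1), of i] d by simp
    from tr[OF mem[OF that(1) i(1)] mem[OF that(1) i(2)] mem[OF that(1) i(1)] mem[OF that(1) i(2)] this]
    show ?case using Suc.IH i cG by (simp add: hS)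
  qed
  have near: "Comp G (transport G (\<gamma> (r z i)) (\<gamma> (r z' i))) (h z i) = h z' i"
    if z: "z \<in> S" "z' \<in> S" "dist z z' < \<delta> / 2" and i: "i \<le> N" for z z' i
    using i
  proof (induction i)
    case 0
    then show ?case using cG step_simps(6)[OF G R[OF S(3)], of 0] transport_Ide[OF G R[OF S(3)]] by (simp add: h0 r0)
  next
    case (Suc i)
    have i: "i \<le> N" "Suc i \<le> N" using Suc.prems by simp_all
    note m = mem[OF z(1) i(1)] mem[OF z(1) i(2)] mem[OF z(2) i(1)] mem[OF z(2) i(2)]
    have d1: "dist (r z i) (r z (Suc i)) < \<delta>" "dist (r z' i) (r z' (Suc i)) < \<delta>"
      "dist (r z i) (r z' i) < \<delta>" "dist (r z (Suc i)) (r z' (Suc i)) < \<delta>"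
      using ds[OF z(1), of i] ds[OF z(2), of i] dz[OF i(1), of z z'] dz[OF i(2), of z z'] z(3) d by simp_all
    let ?a = "\<gamma> (r z i)" and ?b = "\<gamma> (r z (Suc i))" and ?a' = "\<gamma> (r z' i)" and ?b' = "\<gamma> (r z' (Suc i))"
    note A = tr[OF m(1,2) m(1,2) d1(1)] tr[OF m(2,4) m(2,4) d1(4)] tr[OF m(1,3) m(1,3) d1(3)] tr[OF m(3,4) m(3,4) d1(2)]
    \<comment> \<open>Both ways round the small square are equal to the transport along its
      diagonal, from \<open>?a\<close> to \<open>?b'\<close>.\<close>
    have "Comp G (transport G ?b ?b') (h z (Suc i)) = Comp G (Comp G (transport G ?b ?b') (transport G ?a ?b)) (h z i)"
      using A hh[OF z(1) i(1)] cG by (simp add: hS Comp_assoc)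
    also have "Comp G (transport G ?b ?b') (transport G ?a ?b) = transport G ?a ?b'"
      by (rule tc[OF m(1,2,4) m(1,2) d1(1) m(2,4) d1(4)])
    also have "\<dots> = Comp G (transport G ?a' ?b') (transport G ?a ?a')"
      by (rule tc[OF m(1,3,4) m(1,3) d1(3) m(3,4) d1(2), symmetric])
    also have "Comp G (Comp G (transport G ?a' ?b') (transport G ?a ?a')) (h z i) =
        Comp G (transport G ?a' ?b') (Comp G (transport G ?a ?a') (h z i))"
      using A hh[OF z(1) i(1)] cG by (simp add: Comp_assoc)
    finally show ?case using Suc.IH i by (simp add: hS)
  qed
  have "potential G S \<gamma> (vertex G (\<gamma> 0) 0) (\<lambda>z. h z N)"
    unfolding potential_def
  proof (intro conjI ballI exI[of _ "\<delta> / 2"] impI)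
    show "\<delta> / 2 > 0" using d by simp
    fix z assume z: "z \<in> S"
    show "\<gamma> z \<in> topspace (class_space G)" by (rule R[OF z])
    show "h z N \<in> Arr G" "Dom G (h z N) = vertex G (\<gamma> 0) 0" "Cod G (h z N) = vertex G (\<gamma> z) 0"
      using hh[OF z order_refl] by (simp_all add: r0)
    fix z' assume z': "z' \<in> S" "dist z z' < \<delta> / 2"
    show "close_points G (1/2) (\<gamma> z) (\<gamma> z')" using cl2[OF z z'(1)] z' d by simp
    show "h z' N = Comp G (transport G (\<gamma> z) (\<gamma> z')) (h z N)" using near[OF z z' order_refl] by (simp add: r0)
  qed
  moreover have "h 0 i = Ide G (vertex G (\<gamma> 0) 0)" for i
  proof (induction i)
    case (Suc i)
    have "r 0 i = 0" for i by (simp add: r_def)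
    then show ?case
      using Suc cG step_simps(6)[OF G R[OF S(3)], of 0] transport_Ide[OF G R[OF S(3)]] by (simp add: hS)
  qed (simp add: h0)
  ultimately show ?thesis by blast
qed

text \<open>Transport multiplies on the left, so a constant factor q on the right is propagated
  along rays. Two potentials of the same map hence differ by their discrepancy at 0.\<close>

lemma potential_unique:
  fixes \<gamma> :: "'v::real_normed_vector \<Rightarrow> _"
  assumes G: "groupoid G" and S: "convex S" "0 \<in> S" and g: "potential G S \<gamma> a g" and h: "potential G S \<gamma> b h"
    and q: "q \<in> Arr G" "Dom G q = b" "Cod G q = a" and 0: "h 0 = Comp G (g 0) q" and z: "z \<in> S"
  shows "h z = Comp G (g z) q"
proof -
  obtain d where d: "d > 0" "\<And>z z'. z \<in> S \<Longrightarrow> z' \<in> S \<Longrightarrow> dist z z' < d \<Longrightarrow>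
      close_points G (1/2) (\<gamma> z) (\<gamma> z') \<and> g z' = Comp G (transport G (\<gamma> z) (\<gamma> z')) (g z)"
    using g unfolding potential_def by blast
  obtain e where e: "e > 0" "\<And>z z'. z \<in> S \<Longrightarrow> z' \<in> S \<Longrightarrow> dist z z' < e \<Longrightarrow>
      close_points G (1/2) (\<gamma> z) (\<gamma> z') \<and> h z' = Comp G (transport G (\<gamma> z) (\<gamma> z')) (h z)"
    using h unfolding potential_def by blast
  have P: "\<gamma> z \<in> topspace (class_space G)" "g z \<in> Arr G" "Dom G (g z) = a" "Cod G (g z) = vertex G (\<gamma> z) 0" if "z \<in> S" for z
    using g that unfolding potential_def by auto
  have "min d e > 0" using d e by simp
  from S z this 0 show ?thesis
  proof (rule ray_induct[where P = "\<lambda>z. h z = Comp G (g z) q"])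
    fix x y assume x: "x \<in> S" and y: "y \<in> S" and xy: "dist x y < min d e" and IH: "h x = Comp G (g x) q"
    have c: "close_points G (1/2) (\<gamma> x) (\<gamma> y)" using d(2)[OF x y] xy by simp
    note t = transport_simps[OF G P(1)[OF x] P(1)[OF y] c]
    have "h y = Comp G (transport G (\<gamma> x) (\<gamma> y)) (Comp G (g x) q)" using e(2)[OF x y] xy IH by simp
    also have "\<dots> = Comp G (Comp G (transport G (\<gamma> x) (\<gamma> y)) (g x)) q"
      using t P[OF x] q groupoidD(1)[OF G] by (simp add: Comp_assoc)
    finally show "h y = Comp G (g y) q" using d(2)[OF x y] xy by simp
  qed
qed

text \<open>The end value of a potential that starts at an identity. It is a relation, witnessed by
  any normalised potential, so that witnesses can be pushed forward along functors.\<close>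

definition holonomy where
  "holonomy G \<gamma> a \<longleftrightarrow> (\<exists>g. potential G {0..1::real} \<gamma> (vertex G (\<gamma> 0) 0) g \<and> g 0 = Ide G (vertex G (\<gamma> 0) 0) \<and> g 1 = a)"

lemma holonomy_exists:
  assumes G: "groupoid G" and g: "continuous_map (top_of_set {0..1}) (class_space G) \<gamma>"
  shows "\<exists>a. holonomy G \<gamma> a"
  using potential_exists[OF G _ _ _ g] by (auto simp: holonomy_def)

lemma holonomy_Arr:
  assumes "holonomy G \<gamma> a"
  shows "a \<in> Arr G" "Dom G a = vertex G (\<gamma> 0) 0" "Cod G a = vertex G (\<gamma> 1) 0" "\<gamma> 0 \<in> topspace (class_space G)"
proof -
  obtain g where g: "potential G {0..1::real} \<gamma> (vertex G (\<gamma> 0) 0) g" and 1: "g 1 = a"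
    using assms by (auto simp: holonomy_def)
  have "0 \<in> {0..1::real}" "1 \<in> {0..1::real}" by simp_all
  with g show "a \<in> Arr G" "Dom G a = vertex G (\<gamma> 0) 0" "Cod G a = vertex G (\<gamma> 1) 0" "\<gamma> 0 \<in> topspace (class_space G)"
    unfolding potential_def 1[symmetric] by blast+
qed

lemma holonomy_potential:
  assumes G: "groupoid G" and a: "holonomy G \<gamma> a" and g: "potential G {0..1} \<gamma> b g"
  shows "g 1 = Comp G a (g 0)"
proof -
  obtain h where h: "potential G {0..1::real} \<gamma> (vertex G (\<gamma> 0) 0) h" and h0: "h 0 = Ide G (vertex G (\<gamma> 0) 0)" and h1: "h 1 = a"
    using a by (auto simp: holonomy_def)
  have "0 \<in> {0..1::real}" by simp
  then have g0: "g 0 \<in> Arr G" "Dom G (g 0) = b" "Cod G (g 0) = vertex G (\<gamma> 0) 0" using g unfolding potential_def by blast+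
  have "g 0 = Comp G (h 0) (g 0)" using g0 h0 groupoidD(1)[OF G] by simp
  from potential_unique[OF G _ _ h g g0 this, of 1] show ?thesis by (simp add: h1)
qed

text \<open>Used for the sides of a square, which are isometric copies of the unit interval; the
  same \<delta> therefore serves for the restriction.\<close>

lemma potential_subset:
  fixes f :: "'w::metric_space \<Rightarrow> 'v::metric_space"
  assumes g: "potential G S \<gamma> a g" and f: "\<And>z. z \<in> T \<Longrightarrow> f z \<in> S" and i: "\<And>z z'. dist (f z) (f z') = dist z z'"
  shows "potential G T (\<lambda>z. \<gamma> (f z)) a (\<lambda>z. g (f z))"
proof -
  obtain \<delta> where d: "\<delta> > 0" "\<And>z z'. z \<in> S \<Longrightarrow> z' \<in> S \<Longrightarrow> dist z z' < \<delta> \<Longrightarrow>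
      close_points G (1/2) (\<gamma> z) (\<gamma> z') \<and> g z' = Comp G (transport G (\<gamma> z) (\<gamma> z')) (g z)"
    using g unfolding potential_def by blast
  have P: "\<gamma> z \<in> topspace (class_space G) \<and> g z \<in> Arr G \<and> Dom G (g z) = a \<and> Cod G (g z) = vertex G (\<gamma> z) 0" if "z \<in> S" for z
    using g that unfolding potential_def by blast
  show ?thesis
    unfolding potential_def
  proof (intro conjI ballI exI[of _ \<delta>] impI)
    fix z assume z: "z \<in> T"
    show "\<gamma> (f z) \<in> topspace (class_space G)" "g (f z) \<in> Arr G" "Dom G (g (f z)) = a"
      "Cod G (g (f z)) = vertex G (\<gamma> (f z)) 0" using P[OF f[OF z]] by blast+
    fix z' assume z': "z' \<in> T" "dist z z' < \<delta>"
    then have "dist (f z) (f z') < \<delta>" by (simp add: i)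
    from d(2)[OF f[OF z] f[OF z'(1)] this]
    show "close_points G (1/2) (\<gamma> (f z)) (\<gamma> (f z'))"
      "g (f z') = Comp G (transport G (\<gamma> (f z)) (\<gamma> (f z'))) (g (f z))" by blast+
  qed (rule d(1))
qed

text \<open>A potential on the filled square restricts to each side, and its value at the far corner
  can be computed both ways round. This is homotopy invariance with moving end points.\<close>

lemma holonomy_square:
  fixes \<Gamma> :: "real \<times> real \<Rightarrow> _"
  assumes G: "groupoid G" and c: "continuous_map (top_of_set ({0..1} \<times> {0..1})) (class_space G) \<Gamma>"
    and b: "holonomy G (\<lambda>t. \<Gamma> (0, t)) b" and t: "holonomy G (\<lambda>t. \<Gamma> (1, t)) t"
    and l: "holonomy G (\<lambda>s. \<Gamma> (s, 0)) l" and r: "holonomy G (\<lambda>s. \<Gamma> (s, 1)) r"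
  shows "Comp G t l = Comp G r b"
proof -
  let ?S = "{0..1::real} \<times> {0..1::real}"
  have "compact ?S" "convex ?S" "0 \<in> ?S" by (auto simp: compact_Times convex_Times zero_prod_def)
  from potential_exists[OF G this c] obtain g where g: "potential G ?S \<Gamma> (vertex G (\<Gamma> 0) 0) g"
    and g0: "g 0 = Ide G (vertex G (\<Gamma> 0) 0)" by blast
  have P: "potential G {0..1} (\<lambda>t. \<Gamma> (s, t)) (vertex G (\<Gamma> 0) 0) (\<lambda>t. g (s, t))"
    and Q: "potential G {0..1} (\<lambda>t. \<Gamma> (t, s)) (vertex G (\<Gamma> 0) 0) (\<lambda>t. g (t, s))" if "s \<in> {0..1}" for s
    using potential_subset[OF g, of "{0..1}" "\<lambda>t. (s, t)"] potential_subset[OF g, of "{0..1}" "\<lambda>t. (t, s)"] that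
    by (simp_all add: dist_Pair_Pair)
  have "g (0, 1) = Comp G b (g (0, 0))" "g (1, 1) = Comp G t (g (1, 0))" "g (1, 0) = Comp G l (g (0, 0))" "g (1, 1) = Comp G r (g (0, 1))"
    using holonomy_potential[OF G b P] holonomy_potential[OF G t P] holonomy_potential[OF G l Q] holonomy_potential[OF G r Q] by simp_all
  moreover have "g (0, 0) = Ide G (vertex G (\<Gamma> (0, 0)) 0)" using g0 by (simp add: zero_prod_def)
  ultimately show ?thesis
    using holonomy_Arr(1-3)[OF b] holonomy_Arr(1-3)[OF t] holonomy_Arr(1-3)[OF l] holonomy_Arr(1-3)[OF r] groupoidD(1)[OF G] by simp
qed

section \<open>Functors and holonomy\<close>

lemma step_map:
  assumes G: "groupoid G" and H: "groupoid H" and F: "F \<in> Fun G H" and c: "c \<in> topspace (class_space G)"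
    and u: "u \<in> {0..<1}" "v \<in> {0..<1}"
  shows "step H (realization_map (nerve H) (nerve_map G F) c) u v = FArr F (step G c u v)"
proof -
  obtain n \<sigma> t where c: "c = point_class (nerve G) ((n, \<sigma>), t)" and s: "\<sigma> \<in> Fun (ordinal n) G" and t: "t \<in> standard_simplex n"
    using c by (rule realization_cases) auto
  show ?thesis
    unfolding c realization_map_point_class[OF nerve_map_in[OF F]] step_class[OF H u] step_class[OF G u]
    using s u idx_le[OF t] by (simp add: tarr_map[OF G s groupoidD(1)[OF H] F])
qed

lemma realization_map_in:
  "f \<in> sset_hom X Y \<Longrightarrow> c \<in> topspace (realization X) \<Longrightarrow> realization_map Y f c \<in> topspace (realization Y)"
  using funcset_mem[OF continuous_map_funspace[OF continuous_realization_map]] by blast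

lemma vertex_map:
  assumes G: "groupoid G" and H: "groupoid H" and F: "F \<in> Fun G H" and c: "c \<in> topspace (class_space G)"
    and u: "u \<in> {0..<1}"
  shows "vertex H (realization_map (nerve H) (nerve_map G F) c) u = FObj F (vertex G c u)"
  unfolding vertex_def step_map[OF assms u] using step_simps(1)[OF G c u u] by (simp add: Fun_simps[OF F])

text \<open>A functor commutes with \<open>step\<close>, so exceptional sets remain exceptional sets
  and transports go to transports. Hence it carries a potential to a potential.\<close>

lemma holonomy_map:
  assumes G: "groupoid G" and H: "groupoid H" and F: "F \<in> Fun G H" and a: "holonomy G \<gamma> a"
  shows "holonomy H (\<lambda>t. realization_map (nerve H) (nerve_map G F) (\<gamma> t)) (FArr F a)"
proof -
  let ?f = "realization_map (nerve H) (nerve_map G F)"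
  obtain g where g: "potential G {0..1::real} \<gamma> (vertex G (\<gamma> 0) 0) g" and g0: "g 0 = Ide G (vertex G (\<gamma> 0) 0)" and g1: "g 1 = a"
    using a by (auto simp: holonomy_def)
  have P: "\<gamma> z \<in> topspace (class_space G)" "g z \<in> Arr G" "Dom G (g z) = vertex G (\<gamma> 0) 0" "Cod G (g z) = vertex G (\<gamma> z) 0" if "z \<in> {0..1}" for z
    using g that unfolding potential_def by auto
  obtain d where d: "d > 0" "\<And>z z'. z \<in> {0..1} \<Longrightarrow> z' \<in> {0..1} \<Longrightarrow> dist z z' < d \<Longrightarrow>
      close_points G (1/2) (\<gamma> z) (\<gamma> z') \<and> g z' = Comp G (transport G (\<gamma> z) (\<gamma> z')) (g z)"
    using g unfolding potential_def by blast
  note fin = realization_map_in[OF nerve_map_in[OF F] P(1)]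
  have z0: "0 \<in> {0..1::real}" "0 \<in> {0..<1::real}" by simp_all
  note V = vertex_map[OF G H F P(1) z0(2)]
  have "potential H {0..1} (\<lambda>t. ?f (\<gamma> t)) (vertex H (?f (\<gamma> 0)) 0) (\<lambda>t. FArr F (g t))"
    unfolding potential_def
  proof (intro conjI ballI exI[of _ d] impI)
    show "d > 0" by (rule d)
    fix z :: real assume z: "z \<in> {0..1}"
    show "?f (\<gamma> z) \<in> topspace (class_space H)" by (rule fin[OF z])
    show "FArr F (g z) \<in> Arr H" "Dom H (FArr F (g z)) = vertex H (?f (\<gamma> 0)) 0" "Cod H (FArr F (g z)) = vertex H (?f (\<gamma> z)) 0"
      using P[OF z] V[OF z] V[OF z0(1)] by (simp_all add: Fun_simps[OF F])
    fix z' :: real assume z': "z' \<in> {0..1}" "dist z z' < d"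
    obtain N where N: "close_off G (1/2) N (\<gamma> z) (\<gamma> z')" using d(2)[OF z z'] by (auto simp: close_points_def)
    have N': "close_off H (1/2) N (?f (\<gamma> z)) (?f (\<gamma> z'))"
      using N by (simp add: close_off_def step_map[OF G H F P(1)[OF z]] step_map[OF G H F P(1)[OF z'(1)]])
    then show "close_points H (1/2) (?f (\<gamma> z)) (?f (\<gamma> z'))" by (auto simp: close_points_def)
    obtain w where w: "w \<in> {0..<1} - N" using close_off_witness[OF N] by auto
    then have w': "w \<in> {0..<1}" by simp
    have vw: "vertex G (\<gamma> z) w = vertex G (\<gamma> z') w" using N w by (simp add: vertex_def close_off_def)
    have "transport H (?f (\<gamma> z)) (?f (\<gamma> z')) = FArr F (transport G (\<gamma> z) (\<gamma> z'))"
      unfolding transport_eq[OF H fin[OF z] fin[OF z'(1)] N' w] transport_eq[OF G P(1)[OF z] P(1)[OF z'(1)] N w]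
        step_map[OF G H F P(1)[OF z] z0(2) w'] step_map[OF G H F P(1)[OF z'(1)] w' z0(2)]
      using step_simps(1-3)[OF G P(1)[OF z] z0(2) w'] step_simps(1-3)[OF G P(1)[OF z'(1)] w' z0(2)] vw
      by (simp add: Fun_Comp[OF F])
    then show "FArr F (g z') = Comp H (transport H (?f (\<gamma> z)) (?f (\<gamma> z'))) (FArr F (g z))"
      using d(2)[OF z z'] P[OF z] transport_simps[OF G P(1)[OF z] P(1)[OF z'(1)]] by (simp add: Fun_Comp[OF F])
  qed
  then show ?thesis
    unfolding holonomy_def using g0 g1 V[OF z0(1)] step_simps(6)[OF G P(1)[OF z0(1)] z0(2)] by (auto simp: Fun_simps[OF F])
qed

section \<open>The path in the realization given by an arrow\<close>

definition edge_coords :: "real \<Rightarrow> nat \<Rightarrow> real" where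
  "edge_coords t = (\<lambda>i. if i = 0 then 1 - t else if i = 1 then t else 0)"

definition vertex_class where
  "vertex_class G x = point_class (nerve G) ((0, point_fun G x), \<lambda>i. if i = 0 then 1 else 0)"

definition edge_class where
  "edge_class G q t = point_class (nerve G) ((1, arrow_fun G q), edge_coords t)"

lemma edge_coords_in: "t \<in> {0..1} \<Longrightarrow> edge_coords t \<in> standard_simplex 1"
  by (auto simp: edge_coords_def standard_simplex_def)

lemma vertex_class_in:
  assumes "category G" "x \<in> Obj G"
  shows "vertex_class G x \<in> topspace (class_space G)"
  unfolding vertex_class_def using assms point_fun_in[OF assms] by (intro point_class_in) auto

lemma edge_class_in:
  assumes "category G" "q \<in> Arr G" "t \<in> {0..1}"
  shows "edge_class G q t \<in> topspace (class_space G)"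
  unfolding edge_class_def using arrow_fun_in[OF assms(1,2)] edge_coords_in[OF assms(3)] by (intro point_class_in) auto

text \<open>The two maps [0] -> [1] glue the ends of the edge to the vertices.\<close>

lemma edge_class_ends:
  assumes G: "category G" and q: "q \<in> Arr G"
  shows "edge_class G q 0 = vertex_class G (Dom G q)" "edge_class G q 1 = vertex_class G (Cod G q)"
proof -
  have *: "edge_class G q (real i) = vertex_class G (FObj (arrow_fun G q) i)" if i: "i = 0 \<or> i = 1" for i
  proof -
    let ?d = "delta_of 0 (\<lambda>_. i)"
    have d: "?d \<in> Delta 0 1" using i by (auto intro!: delta_of_in)
    have a: "arrow_fun G q \<in> Fun (ordinal 1) G" by (rule arrow_fun_in[OF G q])
    have "FObj (arrow_fun G q) i \<in> Obj G" using i Fun_simps(1)[OF a, of i] by auto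
    then have "comp_fun (ordinal 0) (arrow_fun G q) ?d = point_fun G (FObj (arrow_fun G q) i)"
      by (intro Fun_ext_Arr[OF _ G comp_fun_in[OF _ d a] point_fun_in[OF G]]) (use i in \<open>auto simp: Arr_ordinal_0\<close>)
    moreover have "simplex_push 0 ?d (\<lambda>i. if i = 0 then 1 else 0) = edge_coords (real i)"
    proof
      fix j
      have "simplex_push 0 ?d (\<lambda>i. if i = 0 then 1 else 0) j = (\<Sum>q\<in>(if j = i then {0::nat} else {}). if q = 0 then 1 else (0::real))"
        unfolding simplex_push_def by (rule sum.cong) auto
      then show "simplex_push 0 ?d (\<lambda>i. if i = 0 then 1 else 0) j = edge_coords (real i) j"
        using i by (auto simp: edge_coords_def)
    qed
    moreover have "(\<lambda>i. if i = 0 then 1 else 0) \<in> standard_simplex 0" by simp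
    ultimately show ?thesis
      unfolding vertex_class_def edge_class_def
      using point_class_glue[OF d, of "arrow_fun G q" "nerve G" "\<lambda>i. if i = 0 then 1 else 0"] a d by simp
  qed
  from *[of 0] *[of 1] show "edge_class G q 0 = vertex_class G (Dom G q)" "edge_class G q 1 = vertex_class G (Cod G q)"
    by simp_all
qed

lemma vertex_vertex_class:
  assumes G: "groupoid G" and x: "x \<in> Obj G"
  shows "vertex G (vertex_class G x) 0 = x"
proof -
  note s = point_fun_in[OF groupoidD(1)[OF G] x]
  have "(\<lambda>i. if i = 0 then 1 else 0) \<in> standard_simplex 0" by simp
  from idx_le[OF this, of 0] have "idx (\<lambda>i. if i = 0 then 1 else 0) 0 = 0" by simp
  then show ?thesis
    unfolding vertex_def vertex_class_def using tarr_simps(2)[OF G s, of 0 0] by (simp add: step_class[OF G])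
qed

lemma map_vertex_class:
  assumes G: "category G" and H: "category H" and F: "F \<in> Fun G H" and x: "x \<in> Obj G"
  shows "realization_map (nerve H) (nerve_map G F) (vertex_class G x) = vertex_class H (FObj F x)"
proof -
  note s = point_fun_in[OF G x]
  have fx: "FObj F x \<in> Obj H" using Fun_simps(1)[OF F x] .
  have "comp_fun (ordinal 0) F (point_fun G x) = point_fun H (FObj F x)"
    by (intro Fun_ext_Arr[OF _ H comp_fun_in[OF _ s F] point_fun_in[OF H fx]]) (auto simp: Arr_ordinal_0 Fun_simps[OF F] x)
  then show ?thesis
    unfolding vertex_class_def realization_map_point_class[OF nerve_map_in[OF F]] using s by simp
qed

lemma map_edge_class:
  assumes G: "category G" and H: "category H" and F: "F \<in> Fun G H" and q: "q \<in> Arr G"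
  shows "realization_map (nerve H) (nerve_map G F) (edge_class G q t) = edge_class H (FArr F q) t"
proof -
  note s = arrow_fun_in[OF G q]
  have fq: "FArr F q \<in> Arr H" using Fun_simps(2)[OF F q] .
  have s': "arrow_fun G q \<in> Fun (ordinal (Suc 0)) G" using s by simp
  have "comp_fun (ordinal 1) F (arrow_fun G q) = arrow_fun H (FArr F q)"
    by (intro Fun_ext_Arr[OF _ H comp_fun_in[OF _ s F] arrow_fun_in[OF H fq]])
      (use G q in \<open>auto simp: Arr_ordinal_1 Fun_simps[OF F]\<close>)
  then show ?thesis
    unfolding edge_class_def realization_map_point_class[OF nerve_map_in[OF F]] using s s' by simp
qed

lemma continuous_edge_class:
  assumes G: "category G" and q: "q \<in> Arr G"
  shows "continuous_map (top_of_set {0..1}) (class_space G) (edge_class G q)"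
proof -
  have "continuous_map (top_of_set {0..1}) (subtopology (powertop_real UNIV) (standard_simplex 1)) edge_coords"
    unfolding continuous_map_in_subtopology continuous_map_componentwise_UNIV
  proof (intro conjI allI)
    fix i show "continuous_map (top_of_set {0..1}) euclideanreal (\<lambda>t. edge_coords t i)"
      unfolding edge_coords_def by (cases "i = 0"; cases "i = 1") (auto intro!: continuous_intros)
  qed (use edge_coords_in in auto)
  from continuous_map_compose[OF this continuous_map_simplex_class[of "arrow_fun G q" "nerve G" 1]]
  show ?thesis using arrow_fun_in[OF G q] by (simp add: edge_class_def[abs_def] o_def)
qed

text \<open>The base vertex is read at u = 0, where the index is 0 as long as the first weight 1 - t
  is positive and jumps to 1 at t = 1. So the potential is an identity for t < 1, and the jump at
  the end contributes exactly q.\<close>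

lemma holonomy_edge_class:
  assumes G: "groupoid G" and q: "q \<in> Arr G"
  shows "holonomy G (edge_class G q) q"
proof -
  note cG = groupoidD(1)[OF G]
  note s = arrow_fun_in[OF cG q]
  let ?s = "arrow_fun G q"
  have z: "0 \<in> {0..<1::real}" by simp
  have I: "idx (edge_coords t) u \<le> 1" if "t \<in> {0..1}" "u \<in> {0..<1}" for t u
    using idx_le[OF edge_coords_in[OF that(1)]] that(2) by simp
  have St: "step G (edge_class G q t) u v = tarr G ?s (idx (edge_coords t) u) (idx (edge_coords t) v)" if "u \<in> {0..<1}" "v \<in> {0..<1}" for t u v
    unfolding edge_class_def by (rule step_class[OF G that])
  define g where "g t = tarr G ?s 0 (idx (edge_coords t) 0)" for t
  have V: "vertex G (edge_class G q t) 0 = FObj ?s (idx (edge_coords t) 0)" if "t \<in> {0..1}" for t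
    unfolding vertex_def St[OF z z] using tarr_simps(2)[OF G s] I[OF that z] by simp
  have i0: "idx (edge_coords 0) 0 = 0"
  proof -
    have "idx (edge_coords 0) 0 \<le> 0"
      unfolding idx_le_iff[OF edge_coords_in[of 0, simplified] zero_less_one] by (simp add: psum_def edge_coords_def)
    then show ?thesis by simp
  qed
  have i1: "idx (edge_coords 1) 0 = 1"
  proof -
    have "\<not> idx (edge_coords 1) 0 \<le> 0"
      unfolding idx_le_iff[OF edge_coords_in[of 1, simplified] zero_less_one] by (simp add: psum_def edge_coords_def)
    then show ?thesis using I[of 1 0] by simp
  qed
  have "potential G {0..1} (edge_class G q) (Dom G q) g"
    unfolding potential_def
  proof (intro conjI ballI exI[of _ "1/4"] impI)
    fix t :: real assume t: "t \<in> {0..1}"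
    show tin: "edge_class G q t \<in> topspace (class_space G)" by (rule edge_class_in[OF cG q t])
    show "g t \<in> Arr G" "Dom G (g t) = Dom G q" "Cod G (g t) = vertex G (edge_class G q t) 0"
      unfolding g_def V[OF t] using tarr_simps(1-3)[OF G s, of 0 "idx (edge_coords t) 0"] I[OF t z] by simp_all
    fix t' :: real assume t': "t' \<in> {0..1}" and d: "dist t t' < 1/4"
    have t'in: "edge_class G q t' \<in> topspace (class_space G)" by (rule edge_class_in[OF cG q t'])
    obtain N where N: "N \<in> lmeasurable" "measure lebesgue N \<le> (\<Sum>i\<le>1. \<bar>psum (edge_coords t) i - psum (edge_coords t') i\<bar>)"
      "\<And>u. u \<in> {0..<1} - N \<Longrightarrow> idx (edge_coords t) u = idx (edge_coords t') u"
      using idx_agree[OF edge_coords_in[OF t] edge_coords_in[OF t']] by blast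
    \<comment> \<open>Only the cut between the two intervals moves, namely from 1 - t to 1 - t', so
      a distance below 1/4 is amply close.\<close>
    have "(\<Sum>i\<le>1. \<bar>psum (edge_coords t) i - psum (edge_coords t') i\<bar>) = \<bar>t - t'\<bar>"
      by (simp add: psum_def edge_coords_def)
    then have N': "close_off G (1/2) N (edge_class G q t) (edge_class G q t')"
      unfolding close_off_def using N d by (simp add: St dist_real_def)
    then show "close_points G (1/2) (edge_class G q t) (edge_class G q t')" by (auto simp: close_points_def)
    obtain w where w: "w \<in> {0..<1} - N" using close_off_witness[OF N'] by auto
    then have w': "w \<in> {0..<1}" by simp
    have "transport G (edge_class G q t) (edge_class G q t') = tarr G ?s (idx (edge_coords t) 0) (idx (edge_coords t') 0)"
      unfolding transport_eq[OF G tin t'in N' w] St[OF w' z] St[OF z w'] N(3)[OF w]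
      by (rule tarr_comp[OF G s I[OF t z] I[OF t' w'] I[OF t' z]])
    then show "g t' = Comp G (transport G (edge_class G q t) (edge_class G q t')) (g t)"
      unfolding g_def using tarr_comp[OF G s, of 0] I[OF t z] I[OF t' z] by simp
  qed simp
  moreover have "vertex G (edge_class G q 0) 0 = Dom G q" using V[of 0] by (simp add: i0)
  moreover have "g 0 = Ide G (Dom G q)" unfolding g_def i0 using tarr_simps(4)[OF G s, of 0] by simp
  moreover have "g 1 = q" unfolding g_def i1 using tarr_le[OF G s, of 0 1] by simp
  ultimately show ?thesis unfolding holonomy_def by auto
qed

section \<open>Groupoids with homotopy equivalent realizations\<close>

text \<open>Take for \<tau> c the holonomy of the track of c under the homotopy. The tracks of the
  points of a path \<gamma> fill a square, so \<open>holonomy_square\<close> makes \<tau> natural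
  with respect to holonomy along paths.\<close>

lemma homotopy_tracks:
  fixes h :: "real \<times> 'p \<Rightarrow> _"
  assumes G: "groupoid G" and h: "continuous_map (prod_topology (top_of_set {0..1}) R) (class_space G) h"
  obtains \<tau> where
    "\<And>c. c \<in> topspace R \<Longrightarrow> \<tau> c \<in> Arr G \<and> Dom G (\<tau> c) = vertex G (h (0, c)) 0 \<and> Cod G (\<tau> c) = vertex G (h (1, c)) 0"
    "\<And>\<gamma> b t. continuous_map (top_of_set {0..1}) R \<gamma> \<Longrightarrow> holonomy G (\<lambda>t. h (0, \<gamma> t)) b \<Longrightarrow> holonomy G (\<lambda>t. h (1, \<gamma> t)) t \<Longrightarrow>
      Comp G t (\<tau> (\<gamma> 0)) = Comp G (\<tau> (\<gamma> 1)) b"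
proof
  define \<tau> where "\<tau> c = (SOME a. holonomy G (\<lambda>s. h (s, c)) a)" for c
  have \<tau>: "holonomy G (\<lambda>s. h (s, c)) (\<tau> c)" if c: "c \<in> topspace R" for c
  proof -
    have "continuous_map (top_of_set {0..1}) (prod_topology (top_of_set {0..1}) R) (\<lambda>s::real. (s, c))"
      using c by (intro continuous_map_pairedI) (auto simp: continuous_map_id[unfolded id_def])
    from continuous_map_compose[OF this h]
    have "continuous_map (top_of_set {0..1}) (class_space G) (\<lambda>s. h (s, c))" by (simp add: o_def)
    from someI_ex[OF holonomy_exists[OF G this]] show ?thesis by (simp add: \<tau>_def)
  qed
  show "\<tau> c \<in> Arr G \<and> Dom G (\<tau> c) = vertex G (h (0, c)) 0 \<and> Cod G (\<tau> c) = vertex G (h (1, c)) 0" if "c \<in> topspace R" for c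
    using holonomy_Arr[OF \<tau>[OF that]] by simp
  fix \<gamma> b t
  assume g: "continuous_map (top_of_set {0..1}) R \<gamma>" and b: "holonomy G (\<lambda>t. h (0, \<gamma> t)) b" and t: "holonomy G (\<lambda>t. h (1, \<gamma> t)) t"
  have ends: "\<gamma> 0 \<in> topspace R" "\<gamma> 1 \<in> topspace R" using funcset_mem[OF continuous_map_funspace[OF g]] by simp_all
  have "continuous_map (prod_topology (top_of_set {0..1}) (top_of_set {0..1})) (prod_topology (top_of_set {0..1}) R)
      (\<lambda>p::real \<times> real. (fst p, (\<gamma> \<circ> snd) p))"
    by (rule continuous_map_pairedI[OF continuous_map_fst continuous_map_compose[OF continuous_map_snd g]])
  from continuous_map_compose[OF this h]
  have "continuous_map (top_of_set ({0..1} \<times> {0..1})) (class_space G) (\<lambda>p::real \<times> real. h (fst p, \<gamma> (snd p)))"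
    by (simp add: o_def prod_topology_subtopology_eu)
  from holonomy_square[OF G this] b t \<tau>[OF ends(1)] \<tau>[OF ends(2)]
  show "Comp G t (\<tau> (\<gamma> 0)) = Comp G (\<tau> (\<gamma> 1)) b" by simp
qed

text \<open>Through holonomy the continuous inverse k assigns an object \<open>k0 y\<close> to each
  object and an arrow \<open>K q\<close> to each arrow of H. The tracks T and T' of the two
  homotopies make r conjugate to \<open>K (FArr F r)\<close> (fact A) and q conjugate to
  \<open>FArr F (K q)\<close> (fact B). T' gives essential surjectivity, A faithfulness, and A with
  B fullness.\<close>

lemma homotopy_equivalence_groupoids:
  fixes G :: "('o, 'a) cat" and H :: "('p, 'b) cat"
  assumes G: "groupoid G" and H: "groupoid H" and F: "F \<in> Fun G H"
    and he: "homotopy_equivalence_map (class_space G) (class_space H) (realization_map (nerve H) (nerve_map G F))"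
  shows "y \<in> Obj H \<Longrightarrow> \<exists>x\<in>Obj G. \<exists>q\<in>Arr H. Dom H q = FObj F x \<and> Cod H q = y"
    and "r \<in> Arr G \<Longrightarrow> r' \<in> Arr G \<Longrightarrow> Dom G r = Dom G r' \<Longrightarrow> Cod G r = Cod G r' \<Longrightarrow> FArr F r = FArr F r' \<Longrightarrow> r = r'"
    and "x \<in> Obj G \<Longrightarrow> x' \<in> Obj G \<Longrightarrow> q \<in> Arr H \<Longrightarrow> Dom H q = FObj F x \<Longrightarrow> Cod H q = FObj F x' \<Longrightarrow>
      \<exists>r\<in>Arr G. Dom G r = x \<and> Cod G r = x' \<and> FArr F r = q"
proof -
  note cG = groupoidD(1)[OF G] and cH = groupoidD(1)[OF H]
  let ?f = "realization_map (nerve H) (nerve_map G F)"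
  obtain k where k: "continuous_map (class_space H) (class_space G) k"
    and kf: "homotopic_with (\<lambda>_. True) (class_space G) (class_space G) (k \<circ> ?f) id"
    and fk: "homotopic_with (\<lambda>_. True) (class_space H) (class_space H) (?f \<circ> k) id"
    using he unfolding homotopy_equivalence_map_def by blast
  obtain h1 where h1: "continuous_map (prod_topology (top_of_set {0..1::real}) (class_space G)) (class_space G) h1"
    "\<And>c. h1 (0, c) = k (?f c)" "\<And>c. h1 (1, c) = c"
  proof -
    from kf obtain h where "continuous_map (prod_topology (top_of_set {0..1::real}) (class_space G)) (class_space G) h"
      "\<forall>c. h (0, c) = (k \<circ> ?f) c" "\<forall>c. h (1, c) = id c"
      unfolding homotopic_with_def by (elim exE conjE)
    then show ?thesis by (intro that[of h]) simp_all
  qed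
  obtain h2 where h2: "continuous_map (prod_topology (top_of_set {0..1::real}) (class_space H)) (class_space H) h2"
    "\<And>c. h2 (0, c) = ?f (k c)" "\<And>c. h2 (1, c) = c"
  proof -
    from fk obtain h where "continuous_map (prod_topology (top_of_set {0..1::real}) (class_space H)) (class_space H) h"
      "\<forall>c. h (0, c) = (?f \<circ> k) c" "\<forall>c. h (1, c) = id c"
      unfolding homotopic_with_def by (elim exE conjE)
    then show ?thesis by (intro that[of h]) simp_all
  qed
  have kin: "k c \<in> topspace (class_space G)" if "c \<in> topspace (class_space H)" for c
    using funcset_mem[OF continuous_map_funspace[OF k] that] .
  define K where "K q = (SOME a. holonomy G (\<lambda>t. k (edge_class H q t)) a)" for q
  have K: "holonomy G (\<lambda>t. k (edge_class H q t)) (K q)" if q: "q \<in> Arr H" for q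
    using someI_ex[OF holonomy_exists[OF G continuous_map_compose[OF continuous_edge_class[OF cH q] k]]] by (simp add: K_def o_def)
  obtain \<tau> where \<tau>: "\<And>c. c \<in> topspace (class_space G) \<Longrightarrow> \<tau> c \<in> Arr G \<and> Dom G (\<tau> c) = vertex G (h1 (0, c)) 0 \<and> Cod G (\<tau> c) = vertex G (h1 (1, c)) 0"
    and \<tau>n: "\<And>\<gamma> b t. continuous_map (top_of_set {0..1}) (class_space G) \<gamma> \<Longrightarrow> holonomy G (\<lambda>t. h1 (0, \<gamma> t)) b \<Longrightarrow> holonomy G (\<lambda>t. h1 (1, \<gamma> t)) t \<Longrightarrow>
      Comp G t (\<tau> (\<gamma> 0)) = Comp G (\<tau> (\<gamma> 1)) b"
    using homotopy_tracks[OF G h1(1)] by blast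
  obtain \<tau>' where \<tau>': "\<And>c. c \<in> topspace (class_space H) \<Longrightarrow> \<tau>' c \<in> Arr H \<and> Dom H (\<tau>' c) = vertex H (h2 (0, c)) 0 \<and> Cod H (\<tau>' c) = vertex H (h2 (1, c)) 0"
    and \<tau>'n: "\<And>\<gamma> b t. continuous_map (top_of_set {0..1}) (class_space H) \<gamma> \<Longrightarrow> holonomy H (\<lambda>t. h2 (0, \<gamma> t)) b \<Longrightarrow> holonomy H (\<lambda>t. h2 (1, \<gamma> t)) t \<Longrightarrow>
      Comp H t (\<tau>' (\<gamma> 0)) = Comp H (\<tau>' (\<gamma> 1)) b"
    using homotopy_tracks[OF H h2(1)] by blast
  \<comment> \<open>k may send a vertex into the interior of a simplex; the base vertex of the image
    point stands in for it.\<close>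
  define k0 where "k0 y = vertex G (k (vertex_class H y)) 0" for y
  define T where "T x = \<tau> (vertex_class G x)" for x
  define T' where "T' y = \<tau>' (vertex_class H y)" for y
  have zero: "0 \<in> {0..<1::real}" by simp
  have T: "T x \<in> Arr G" "Dom G (T x) = k0 (FObj F x)" "Cod G (T x) = x" if x: "x \<in> Obj G" for x
    using \<tau>[OF vertex_class_in[OF cG x]] map_vertex_class[OF cG cH F x] vertex_vertex_class[OF G x]
    by (simp_all add: T_def k0_def h1(2,3))
  have T': "T' y \<in> Arr H" "Dom H (T' y) = FObj F (k0 y)" "Cod H (T' y) = y" "k0 y \<in> Obj G" if y: "y \<in> Obj H" for y
    using \<tau>'[OF vertex_class_in[OF cH y]] vertex_vertex_class[OF H y] kin[OF vertex_class_in[OF cH y]]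
      vertex_map[OF G H F kin[OF vertex_class_in[OF cH y]] zero] step_simps(6)[OF G kin[OF vertex_class_in[OF cH y]] zero]
    by (simp_all add: T'_def k0_def h2(2,3))
  have KA: "K q \<in> Arr G" "Dom G (K q) = k0 (Dom H q)" "Cod G (K q) = k0 (Cod H q)" if q: "q \<in> Arr H" for q
    using holonomy_Arr[OF K[OF q]] edge_class_ends[OF cH q] by (simp_all add: k0_def)
  \<comment> \<open>Naturality of the tracks along the edge path of r: at time 0 the homotopy shows
    k applied to the edge of \<open>FArr F r\<close>, at time 1 the edge itself.\<close>
  have A: "Comp G r (T (Dom G r)) = Comp G (T (Cod G r)) (K (FArr F r))" if r: "r \<in> Arr G" for r
  proof -
    have "holonomy G (\<lambda>t. h1 (0, edge_class G r t)) (K (FArr F r))"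
      using K[OF Fun_simps(2)[OF F r]] by (simp add: h1(2) map_edge_class[OF cG cH F r])
    moreover have "holonomy G (\<lambda>t. h1 (1, edge_class G r t)) r"
      using holonomy_edge_class[OF G r] by (simp add: h1(3))
    ultimately show ?thesis
      using \<tau>n[OF continuous_edge_class[OF cG r]] edge_class_ends[OF cG r] by (simp add: T_def)
  qed
  have B: "Comp H q (T' (Dom H q)) = Comp H (T' (Cod H q)) (FArr F (K q))" if q: "q \<in> Arr H" for q
  proof -
    have "holonomy H (\<lambda>t. h2 (0, edge_class H q t)) (FArr F (K q))"
      using holonomy_map[OF G H F K[OF q]] by (simp add: h2(2))
    moreover have "holonomy H (\<lambda>t. h2 (1, edge_class H q t)) q"
      using holonomy_edge_class[OF H q] by (simp add: h2(3))
    ultimately show ?thesis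
      using \<tau>'n[OF continuous_edge_class[OF cH q]] edge_class_ends[OF cH q] by (simp add: T'_def)
  qed
  show "\<exists>x\<in>Obj G. \<exists>q\<in>Arr H. Dom H q = FObj F x \<and> Cod H q = y" if "y \<in> Obj H"
    using T'[OF that] by blast
  show "r = r'" if r: "r \<in> Arr G" "r' \<in> Arr G" and e: "Dom G r = Dom G r'" "Cod G r = Cod G r'" "FArr F r = FArr F r'"
  proof (rule iso_cancel_right[OF cG groupoidD(2)[OF G T(1)]])
    show "Dom G r' \<in> Obj G" using r cG by simp
    then show "Dom G r = Cod G (T (Dom G r'))" "Dom G r' = Cod G (T (Dom G r'))" using T e by simp_all
    show "Comp G r (T (Dom G r')) = Comp G r' (T (Dom G r'))" using A[OF r(1)] A[OF r(2)] e by simp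
  qed (use r in auto)
  show "\<exists>r\<in>Arr G. Dom G r = x \<and> Cod G r = x' \<and> FArr F r = q"
    if x: "x \<in> Obj G" "x' \<in> Obj G" and q: "q \<in> Arr H" "Dom H q = FObj F x" "Cod H q = FObj F x'"
  proof -
    note I = groupoidD(2)[OF G T(1)[OF x(1)]] groupoidD(2)[OF G T(1)[OF x(2)]]
    \<comment> \<open>The only candidate that A permits for an arrow whose image under F is
      q.\<close>
    define r where "r = Comp G (T x') (Comp G (K q) (inverse_arr G (T x)))"
    have r: "r \<in> Arr G" "Dom G r = x" "Cod G r = x'"
      using cG x q T[OF x(1)] T[OF x(2)] KA[OF q(1)] I by (simp_all add: r_def)
    have Fr: "FArr F r \<in> Arr H" "Dom H (FArr F r) = FObj F x" "Cod H (FArr F r) = FObj F x'"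
      using r by (simp_all add: Fun_simps[OF F])
    have "Comp G (T x') (K (FArr F r)) = Comp G r (T x)" using A[OF r(1)] r by simp
    also have "\<dots> = Comp G (T x') (K q)"
      using cG x q T[OF x(1)] T[OF x(2)] KA[OF q(1)] I by (simp add: r_def Comp_assoc)
    finally have "K (FArr F r) = K q"
      using iso_cancel_left[OF cG I(2) KA(1)[OF Fr(1)] _ KA(1)[OF q(1)]] KA[OF Fr(1)] KA[OF q(1)] Fr q T[OF x(2)] by simp
    \<comment> \<open>By B an arrow with given ends is determined by its value under K, since T' is
      invertible.\<close>
    then have "Comp H (FArr F r) (T' (FObj F x)) = Comp H q (T' (FObj F x))"
      using B[OF Fr(1)] B[OF q(1)] Fr q by simp
    moreover have "FObj F x \<in> Obj H" using Fun_simps(1)[OF F x(1)] .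
    ultimately have "FArr F r = q"
      by (intro iso_cancel_right[OF cH groupoidD(2)[OF H T'(1)] Fr(1) _ q(1), of "FObj F x"]) (use T'[of "FObj F x"] Fr q in simp_all)
    then show ?thesis using r by blast
  qed
qed

section \<open>Equivalences and levelwise weak equivalences\<close>

lemma Arr_level_cat:
  assumes "category C"
  shows "\<beta> \<in> Arr (level_cat C m) \<longleftrightarrow> \<beta> \<in> Nat_trans (ordinal m) C \<and> (\<forall>i\<le>m. NComp \<beta> i \<in> iso_arrows C)"
  using assms by (auto simp: level_cat_def iso_arrows_fun_cat)

lemma level_cat_simps:
  assumes C: "category C"
  shows "\<beta> \<in> Arr (level_cat C m) \<Longrightarrow> Dom (level_cat C m) \<beta> = NSrc \<beta>"
    "\<beta> \<in> Arr (level_cat C m) \<Longrightarrow> Cod (level_cat C m) \<beta> = NTgt \<beta>"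
    "\<beta> \<in> Arr (level_cat C m) \<Longrightarrow> \<alpha> \<in> Arr (level_cat C m) \<Longrightarrow>
      Comp (level_cat C m) \<beta> \<alpha> = Comp (fun_cat (ordinal m) C) \<beta> \<alpha>"
  by (auto simp: level_cat_def dest!: iso_arrows_Arr)

abbreviation level_map where
  "level_map C f m \<equiv> level_fun C m m (id_fun (ordinal m)) f"

lemma level_map_simps:
  assumes C: "category C"
  shows "P \<in> Fun (ordinal m) C \<Longrightarrow> FObj (level_map C f m) P = comp_fun (ordinal m) f P"
    and "\<beta> \<in> Arr (level_cat C m) \<Longrightarrow> NSrc (FArr (level_map C f m) \<beta>) = comp_fun (ordinal m) f (NSrc \<beta>)"
    and "\<beta> \<in> Arr (level_cat C m) \<Longrightarrow> NTgt (FArr (level_map C f m) \<beta>) = comp_fun (ordinal m) f (NTgt \<beta>)"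
    and "\<beta> \<in> Arr (level_cat C m) \<Longrightarrow> i \<le> m \<Longrightarrow> NComp (FArr (level_map C f m) \<beta>) i = FArr f (NComp \<beta> i)"
proof -
  show "P \<in> Fun (ordinal m) C \<Longrightarrow> FObj (level_map C f m) P = comp_fun (ordinal m) f P"
    by (simp add: level_fun_def comp_fun_id)
  assume b: "\<beta> \<in> Arr (level_cat C m)"
  then have i: "\<beta> \<in> iso_arrows (fun_cat (ordinal m) C)" and n: "\<beta> \<in> Nat_trans (ordinal m) C"
    using Arr_level_cat[OF C] by (simp_all add: level_cat_def)
  show "NSrc (FArr (level_map C f m) \<beta>) = comp_fun (ordinal m) f (NSrc \<beta>)"
    "NTgt (FArr (level_map C f m) \<beta>) = comp_fun (ordinal m) f (NTgt \<beta>)"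
    using i n by (simp_all add: level_fun_def comp_fun_id[OF Nat_simps(1)[OF n]] comp_fun_id[OF Nat_simps(2)[OF n]])
  show "i \<le> m \<Longrightarrow> NComp (FArr (level_map C f m) \<beta>) i = FArr f (NComp \<beta> i)"
    using i n by (simp add: level_fun_def)
qed

lemma point_fun_eq:
  assumes C: "category C" and P: "P \<in> Fun (ordinal 0) C"
  shows "P = point_fun C (FObj P 0)"
proof (rule Fun_ext_Arr[OF _ C P point_fun_in[OF C]])
  show o: "FObj P 0 \<in> Obj C" using Fun_simps(1)[OF P, of 0] by simp
  fix f assume "f \<in> Arr (ordinal 0)"
  then show "FArr P f = FArr (point_fun C (FObj P 0)) f" using Fun_simps(5)[OF P, of 0] by (simp add: Arr_ordinal_0)
qed simp

lemma map_point_fun: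
  assumes C: "category C" and D: "category D" and f: "f \<in> Fun C D" and x: "x \<in> Obj C"
  shows "comp_fun (ordinal 0) f (point_fun C x) = point_fun D (FObj f x)"
  using point_fun_eq[OF D comp_fun_in[OF _ point_fun_in[OF C x] f]] by simp

definition point_nat where
  "point_nat C p = \<lparr>NSrc = point_fun C (Dom C p), NTgt = point_fun C (Cod C p), NComp = (\<lambda>i\<in>{..0::nat}. p)\<rparr>"

lemma point_nat_in:
  assumes C: "category C" and p: "p \<in> iso_arrows C"
  shows "point_nat C p \<in> Arr (level_cat C 0)"
proof -
  have p': "p \<in> Arr C" using p by simp
  have "point_nat C p \<in> Nat_trans (ordinal 0) C"
    by (rule NatI) (use C p' in \<open>simp_all add: point_nat_def point_fun_in Arr_ordinal_0\<close>)
  then show ?thesis using p by (simp add: Arr_level_cat[OF C] point_nat_def)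
qed

lemma map_point_nat:
  assumes C: "category C" and D: "category D" and f: "f \<in> Fun C D" and p: "p \<in> iso_arrows C"
  shows "FArr (level_map C f 0) (point_nat C p) = point_nat D (FArr f p)"
proof -
  note n = point_nat_in[OF C p]
  have p': "p \<in> Arr C" using p by simp
  note fp = Fun_iso[OF C f p]
  have "FArr (level_map C f 0) (point_nat C p) \<in> Arr (level_cat D 0)"
    using Fun_simps(2)[OF level_fun_in[OF C D Delta_id f] n] .
  then have 1: "FArr (level_map C f 0) (point_nat C p) \<in> Nat_trans (ordinal 0) D" by (simp add: Arr_level_cat[OF D])
  have 2: "point_nat D (FArr f p) \<in> Nat_trans (ordinal 0) D" using point_nat_in[OF D fp] by (simp add: Arr_level_cat[OF D])
  show ?thesis
    by (rule Nat_ext[OF 1 2])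
      (use p' C in \<open>simp_all add: level_map_simps(2-4)[OF C n]\<close>,
       simp_all add: point_nat_def map_point_fun[OF C D f] Fun_simps[OF f])
qed

text \<open>An object of level 1 is an arrow, and an isomorphism there is a commutative square with
  invertible sides. Essential surjectivity of level 1 thus lifts an arrow of D up to isomorphisms at
  its ends, which level 0 lifts in turn. Fullness of level 1, applied to an identity square, gives
  faithfulness.\<close>

lemma weak_equivalence_imp:
  fixes C :: "('a, 'b) cat" and D :: "('c, 'd) cat"
  assumes C: "category C" and D: "category D" and f: "f \<in> Fun C D"
    and w: "levelwise_weak_equivalence (classifying_diagram C) (classifying_diagram D) (classifying_map C f)"
  shows weq_surj: "y \<in> Obj D \<Longrightarrow> \<exists>x\<in>Obj C. \<exists>p\<in>iso_arrows D. Dom D p = FObj f x \<and> Cod D p = y"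
    and weq_iso_full: "x \<in> Obj C \<Longrightarrow> x' \<in> Obj C \<Longrightarrow> p \<in> iso_arrows D \<Longrightarrow> Dom D p = FObj f x \<Longrightarrow> Cod D p = FObj f x' \<Longrightarrow>
      \<exists>r\<in>iso_arrows C. Dom C r = x \<and> Cod C r = x' \<and> FArr f r = p"
    and weq_full: "x \<in> Obj C \<Longrightarrow> x' \<in> Obj C \<Longrightarrow> b \<in> Arr D \<Longrightarrow> Dom D b = FObj f x \<Longrightarrow> Cod D b = FObj f x' \<Longrightarrow>
      \<exists>a\<in>Arr C. Dom C a = x \<and> Cod C a = x' \<and> FArr f a = b"
    and weq_faithful: "a \<in> Arr C \<Longrightarrow> a' \<in> Arr C \<Longrightarrow> Dom C a = Dom C a' \<Longrightarrow> Cod C a = Cod C a' \<Longrightarrow> FArr f a = FArr f a' \<Longrightarrow> a = a'"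
proof -
  have he: "homotopy_equivalence_map (class_space (level_cat C m)) (class_space (level_cat D m))
      (realization_map (nerve (level_cat D m)) (nerve_map (level_cat C m) (level_map C f m)))" for m
    using w unfolding levelwise_weak_equivalence_def weak_equivalence_def classifying_map_eq by simp
  note E = homotopy_equivalence_groupoids[OF groupoid_level_cat[OF C] groupoid_level_cat[OF D] level_fun_in[OF C D Delta_id f] he]
  note L = level_map_simps[OF C] and S = level_cat_simps[OF D] and SC = level_cat_simps[OF C]
  have nat: "\<beta> \<in> Nat_trans (ordinal m) B" "i \<le> m \<Longrightarrow> NComp \<beta> i \<in> iso_arrows B"
    if "category B" "\<beta> \<in> Arr (level_cat B m)" for \<beta> m i and B :: "('u, 'v) cat"
    using that(2) Arr_level_cat[OF that(1)] by auto
  show surj: "\<exists>x\<in>Obj C. \<exists>p\<in>iso_arrows D. Dom D p = FObj f x \<and> Cod D p = y" if y: "y \<in> Obj D" for y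
  proof -
    have "point_fun D y \<in> Obj (level_cat D 0)" using point_fun_in[OF D y] by (simp add: Obj_level_cat)
    from E(1)[OF this] obtain P \<beta> where P: "P \<in> Fun (ordinal 0) C" and b: "\<beta> \<in> Arr (level_cat D 0)"
      and ends: "NSrc \<beta> = comp_fun (ordinal 0) f P" "NTgt \<beta> = point_fun D y"
      by (auto simp: Obj_level_cat S L)
    note n = nat[OF D b]
    have "NComp \<beta> 0 \<in> iso_arrows D" "Dom D (NComp \<beta> 0) = FObj f (FObj P 0)" "Cod D (NComp \<beta> 0) = y"
      using n(2)[of 0] Nat_simps(4,5)[OF n(1), of 0] ends by simp_all
    then show ?thesis using Fun_simps(1)[OF P, of 0] by auto
  qed
  show iso_full: "\<exists>r\<in>iso_arrows C. Dom C r = x \<and> Cod C r = x' \<and> FArr f r = p"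
    if x: "x \<in> Obj C" "x' \<in> Obj C" and p: "p \<in> iso_arrows D" "Dom D p = FObj f x" "Cod D p = FObj f x'" for x x' p
  proof -
    have "\<exists>r\<in>Arr (level_cat C 0). Dom (level_cat C 0) r = point_fun C x \<and> Cod (level_cat C 0) r = point_fun C x' \<and>
        FArr (level_map C f 0) r = point_nat D p"
    proof (rule E(3))
      show "point_fun C x \<in> Obj (level_cat C 0)" "point_fun C x' \<in> Obj (level_cat C 0)"
        using point_fun_in[OF C] x by (simp_all add: Obj_level_cat)
      show pn: "point_nat D p \<in> Arr (level_cat D 0)" by (rule point_nat_in[OF D p(1)])
      show "Dom (level_cat D 0) (point_nat D p) = FObj (level_map C f 0) (point_fun C x)"
        "Cod (level_cat D 0) (point_nat D p) = FObj (level_map C f 0) (point_fun C x')"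
        using x p by (simp_all add: S[OF pn] L point_fun_in[OF C] map_point_fun[OF C D f]) (simp_all add: point_nat_def)
    qed
    then obtain r where r: "r \<in> Arr (level_cat C 0)" "NSrc r = point_fun C x" "NTgt r = point_fun C x'"
      and e: "FArr (level_map C f 0) r = point_nat D p" by (auto simp: SC)
    note n = nat[OF C r(1)]
    have "NComp r 0 \<in> iso_arrows C" "Dom C (NComp r 0) = x" "Cod C (NComp r 0) = x'"
      using n(2)[of 0] Nat_simps(4,5)[OF n(1), of 0] r by simp_all
    moreover have "FArr f (NComp r 0) = p"
      using arg_cong[OF e, of "\<lambda>u. NComp u 0"] by (simp add: L(4)[OF r(1)] point_nat_def)
    ultimately show ?thesis by blast
  qed
  have iso_faithful: "r = r'" if r: "r \<in> iso_arrows C" "r' \<in> iso_arrows C" and d: "Dom C r = Dom C r'" "Cod C r = Cod C r'"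
    and e: "FArr f r = FArr f r'" for r r'
  proof -
    note i = point_nat_in[OF C r(1)] point_nat_in[OF C r(2)]
    have "point_nat C r = point_nat C r'"
      by (rule E(2)[OF i]) (use d e in \<open>simp_all add: SC[OF i(1)] SC[OF i(2)] map_point_nat[OF C D f r(1)] map_point_nat[OF C D f r(2)]\<close>,
        simp_all add: point_nat_def)
    from arg_cong[OF this, of "\<lambda>u. NComp u 0"] show ?thesis by (simp add: point_nat_def)
  qed
  show "\<exists>a\<in>Arr C. Dom C a = x \<and> Cod C a = x' \<and> FArr f a = b"
    if x: "x \<in> Obj C" "x' \<in> Obj C" and b: "b \<in> Arr D" "Dom D b = FObj f x" "Cod D b = FObj f x'" for x x' b
  proof -
    \<comment> \<open>As an object of level 1, b is isomorphic to the image of some arrow P of C.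
      The ends of the isomorphism \<beta> join images of objects of C, so they lift along
      \<open>iso_full\<close>.\<close>
    have "arrow_fun D b \<in> Obj (level_cat D 1)" using arrow_fun_in[OF D b(1)] by (simp add: Obj_level_cat)
    from E(1)[OF this] obtain P \<beta> where P: "P \<in> Obj (level_cat C 1)" and be: "\<beta> \<in> Arr (level_cat D 1)"
      and ends: "Dom (level_cat D 1) \<beta> = FObj (level_map C f 1) P" "Cod (level_cat D 1) \<beta> = arrow_fun D b" by blast
    have P': "P \<in> Fun (ordinal 1) C" using P by (simp only: Obj_level_cat)
    note n = nat[OF D be]
    have ends': "NSrc \<beta> = comp_fun (ordinal 1) f P" "NTgt \<beta> = arrow_fun D b"
      using ends unfolding S(1)[OF be] S(2)[OF be] L(1)[OF P'] by simp_all
    have P01: "FArr P (0, 1) \<in> Arr C" "Dom C (FArr P (0, 1)) = FObj P 0" "Cod C (FArr P (0, 1)) = FObj P 1" "FObj P 0 \<in> Obj C" "FObj P 1 \<in> Obj C"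
      using Fun_simps(2-4)[OF P', of "(0, 1)"] Fun_simps(1)[OF P'] by simp_all
    have B: "NComp \<beta> 0 \<in> iso_arrows D" "NComp \<beta> 1 \<in> iso_arrows D" "Dom D (NComp \<beta> 0) = FObj f (FObj P 0)" "Cod D (NComp \<beta> 0) = FObj f x"
      "Dom D (NComp \<beta> 1) = FObj f (FObj P 1)" "Cod D (NComp \<beta> 1) = FObj f x'"
      using n(2)[of 0] n(2)[of 1] Nat_simps(4,5)[OF n(1), of 0] Nat_simps(4,5)[OF n(1), of 1] ends' b by simp_all
    have sq: "Comp D (NComp \<beta> 1) (FArr f (FArr P (0, 1))) = Comp D b (NComp \<beta> 0)"
      using Nat_nat[OF n(1), of "(0, 1)"] ends' by simp
    obtain p where p: "p \<in> iso_arrows C" "Dom C p = FObj P 0" "Cod C p = x" "FArr f p = NComp \<beta> 0"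
      using iso_full[OF P01(4) x(1) B(1,3,4)] by blast
    obtain q where q: "q \<in> iso_arrows C" "Dom C q = FObj P 1" "Cod C q = x'" "FArr f q = NComp \<beta> 1"
      using iso_full[OF P01(5) x(2) B(2,5,6)] by blast
    \<comment> \<open>Correct the arrow P by the lifted isomorphisms p and q at its two
      ends.\<close>
    let ?a = "Comp C q (Comp C (FArr P (0, 1)) (inverse_arr C p))"
    have a: "?a \<in> Arr C" "Dom C ?a = x" "Cod C ?a = x'" using C p q P01 by simp_all
    have ap: "Comp C ?a p = Comp C q (FArr P (0, 1))" using C p q P01 by (simp add: Comp_assoc)
    have "Comp D (FArr f ?a) (NComp \<beta> 0) = FArr f (Comp C ?a p)"
      using a p by (simp add: Fun_Comp[OF f])
    also have "\<dots> = Comp D b (NComp \<beta> 0)" unfolding ap using q P01 sq by (simp add: Fun_Comp[OF f])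
    finally have "FArr f ?a = b"
      by (rule iso_cancel_right[OF D B(1), rotated 4]) (use a b B in \<open>simp_all add: Fun_simps[OF f]\<close>)
    then show ?thesis using a by blast
  qed
  show "a = a'" if a: "a \<in> Arr C" "a' \<in> Arr C" and d: "Dom C a = Dom C a'" "Cod C a = Cod C a'" and e: "FArr f a = FArr f a'" for a a'
  proof -
    note A = arrow_fun_in[OF C a(1)] and A' = arrow_fun_in[OF C a(2)]
    have fA: "comp_fun (ordinal 1) f (arrow_fun C a) = arrow_fun D (FArr f a)" if a: "a \<in> Arr C" for a
      by (intro Fun_ext_Arr[OF _ D comp_fun_in[OF _ arrow_fun_in[OF C a] f] arrow_fun_in[OF D Fun_simps(2)[OF f a]]])
        (use a C in \<open>auto simp: Arr_ordinal_1 Fun_simps[OF f]\<close>)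
    have o: "arrow_fun C a \<in> Obj (level_cat C 1)" "arrow_fun C a' \<in> Obj (level_cat C 1)" using A A' by (simp_all only: Obj_level_cat)
    have lf: "FObj (level_map C f 1) (arrow_fun C a) = FObj (level_map C f 1) (arrow_fun C a')"
      unfolding L(1)[OF A] L(1)[OF A'] fA[OF a(1)] fA[OF a(2)] e ..
    let ?P = "FObj (level_map C f 1) (arrow_fun C a)"
    have Po: "?P \<in> Obj (level_cat D 1)" using Fun_simps(1)[OF level_fun_in[OF C D Delta_id f] o(1)] .
    note cD = category_level_cat[OF D, of 1]
    \<comment> \<open>a and a' have the same image in level 1. Its identity lifts to an isomorphism
      r from a to a' by fullness.\<close>
    have "\<exists>r\<in>Arr (level_cat C 1). Dom (level_cat C 1) r = arrow_fun C a \<and> Cod (level_cat C 1) r = arrow_fun C a' \<and>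
       FArr (level_map C f 1) r = Ide (level_cat D 1) ?P"
      by (rule E(3)[OF o Ide_in[OF cD Po] Dom_Ide[OF cD Po] trans[OF Cod_Ide[OF cD Po] lf]])
    then obtain r where r: "r \<in> Arr (level_cat C 1)" "Dom (level_cat C 1) r = arrow_fun C a" "Cod (level_cat C 1) r = arrow_fun C a'"
       and re: "FArr (level_map C f 1) r = Ide (level_cat D 1) ?P" by blast
    note n = nat[OF C r(1)]
    have r': "NSrc r = arrow_fun C a" "NTgt r = arrow_fun C a'" using r(2,3) unfolding SC(1)[OF r(1)] SC(2)[OF r(1)] by simp_all
    have fr: "FArr f (NComp r i) = Ide D (FObj f (FObj (arrow_fun C a) i))" if i: "i \<le> 1" for i
    proof -
      have "?P \<in> Fun (ordinal 1) D" using Po by (simp only: Obj_level_cat)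
      then have "NComp (Ide (level_cat D 1) ?P) i = Ide D (FObj ?P i)" using i by (simp add: level_cat_def)
      then show ?thesis unfolding L(1)[OF A] L(4)[OF r(1) i, symmetric] re using i by simp
    qed
    \<comment> \<open>The components of r lie over identities, so they are identities by
      faithfulness on isomorphisms; the square r then says that a and a' are equal.\<close>
    have "NComp r i = Ide C (FObj (arrow_fun C a) i)" if i: "i \<le> 1" and oo: "FObj (arrow_fun C a') i = FObj (arrow_fun C a) i" for i
    proof (rule iso_faithful)
      have ob: "FObj (arrow_fun C a) i \<in> Obj C" using Fun_simps(1)[OF A] i by simp
      show "NComp r i \<in> iso_arrows C" using n(2)[OF i] .
      show "Ide C (FObj (arrow_fun C a) i) \<in> iso_arrows C" using C ob by simp
      have "i \<in> Obj (ordinal 1)" using i by simp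
      from Nat_simps(4,5)[OF n(1) this]
      show "Dom C (NComp r i) = Dom C (Ide C (FObj (arrow_fun C a) i))" "Cod C (NComp r i) = Cod C (Ide C (FObj (arrow_fun C a) i))"
        using C ob oo by (simp_all add: r')
      show "FArr f (NComp r i) = FArr f (Ide C (FObj (arrow_fun C a) i))" using fr[OF i] ob by (simp add: Fun_simps[OF f])
    qed
    from this[of 0] this[of 1] have "NComp r 0 = Ide C (Dom C a)" "NComp r 1 = Ide C (Cod C a)" using d by simp_all
    moreover have "Comp C (NComp r 1) a = Comp C a' (NComp r 0)" using Nat_nat[OF n(1), of "(0, 1)"] r' by simp
    ultimately show ?thesis using a d C by simp
  qed
qed

text \<open>The inverse functor picks preimages up to the isomorphisms e and lifts conjugated
  arrows. Faithfulness transfers the functor laws and the naturality of the unit from D to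
  C.\<close>

lemma fully_faithful_imp_equivalence:
  fixes C :: "('a, 'b) cat" and D :: "('c, 'd) cat"
  assumes C: "category C" and D: "category D" and f: "f \<in> Fun C D"
    and surj: "\<And>y. y \<in> Obj D \<Longrightarrow> \<exists>x\<in>Obj C. \<exists>p\<in>iso_arrows D. Dom D p = FObj f x \<and> Cod D p = y"
    and iso_full: "\<And>x x' p. x \<in> Obj C \<Longrightarrow> x' \<in> Obj C \<Longrightarrow> p \<in> iso_arrows D \<Longrightarrow> Dom D p = FObj f x \<Longrightarrow> Cod D p = FObj f x' \<Longrightarrow>
      \<exists>r\<in>iso_arrows C. Dom C r = x \<and> Cod C r = x' \<and> FArr f r = p"
    and full: "\<And>x x' b. x \<in> Obj C \<Longrightarrow> x' \<in> Obj C \<Longrightarrow> b \<in> Arr D \<Longrightarrow> Dom D b = FObj f x \<Longrightarrow> Cod D b = FObj f x' \<Longrightarrow>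
      \<exists>a\<in>Arr C. Dom C a = x \<and> Cod C a = x' \<and> FArr f a = b"
    and faithful: "\<And>a a'. a \<in> Arr C \<Longrightarrow> a' \<in> Arr C \<Longrightarrow> Dom C a = Dom C a' \<Longrightarrow> Cod C a = Cod C a' \<Longrightarrow> FArr f a = FArr f a' \<Longrightarrow> a = a'"
  shows "equivalence_of_categories C D f"
proof -
  obtain g e where g: "\<And>y. y \<in> Obj D \<Longrightarrow> g y \<in> Obj C" and e: "\<And>y. y \<in> Obj D \<Longrightarrow> e y \<in> iso_arrows D"
    "\<And>y. y \<in> Obj D \<Longrightarrow> Dom D (e y) = FObj f (g y)" "\<And>y. y \<in> Obj D \<Longrightarrow> Cod D (e y) = y"
    using surj by metis
  \<comment> \<open>b conjugated by the isomorphisms e, so that it runs between images of f and can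
    be lifted.\<close>
  define rhs where "rhs b = Comp D (inverse_arr D (e (Cod D b))) (Comp D b (e (Dom D b)))" for b
  have rhs: "rhs b \<in> Arr D" "Dom D (rhs b) = FObj f (g (Dom D b))" "Cod D (rhs b) = FObj f (g (Cod D b))"
    if "b \<in> Arr D" for b
    using that D e[of "Dom D b"] e[of "Cod D b"] by (simp_all add: rhs_def)
  have "\<exists>a. a \<in> Arr C \<and> Dom C a = g (Dom D b) \<and> Cod C a = g (Cod D b) \<and> FArr f a = rhs b" if "b \<in> Arr D" for b
    using full[OF _ _ rhs(1)[OF that], of "g (Dom D b)" "g (Cod D b)"] that D g rhs by auto
  then obtain ga where ga: "\<And>b. b \<in> Arr D \<Longrightarrow> ga b \<in> Arr C" "\<And>b. b \<in> Arr D \<Longrightarrow> Dom C (ga b) = g (Dom D b)"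
    "\<And>b. b \<in> Arr D \<Longrightarrow> Cod C (ga b) = g (Cod D b)" "\<And>b. b \<in> Arr D \<Longrightarrow> FArr f (ga b) = rhs b" by metis
  define G where "G = \<lparr>FObj = (\<lambda>y\<in>Obj D. g y), FArr = (\<lambda>b\<in>Arr D. ga b)\<rparr>"
  have Gs: "y \<in> Obj D \<Longrightarrow> FObj G y = g y" "b \<in> Arr D \<Longrightarrow> FArr G b = ga b" for y b by (simp_all add: G_def)
  have e_rhs: "Comp D (e (Cod D b)) (rhs b) = Comp D b (e (Dom D b))" if "b \<in> Arr D" for b
    using that D e[of "Dom D b"] e[of "Cod D b"] by (simp add: rhs_def left_cancel_inverse)
  have G: "G \<in> Fun D C"
  proof (rule FunI)
    fix y assume y: "y \<in> Obj D"
    show "FObj G y \<in> Obj C" using y g by (simp add: Gs)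
    have "ga (Ide D y) = Ide C (g y)"
      by (rule faithful) (use y C D g ga e[OF y] in \<open>simp_all add: rhs_def Fun_simps[OF f]\<close>)
    then show "FArr G (Ide D y) = Ide C (FObj G y)" using y D by (simp add: Gs)
  next
    fix b' b assume b: "b' \<in> Arr D" "b \<in> Arr D" "Dom D b' = Cod D b"
    have "rhs (Comp D b' b) = Comp D (rhs b') (rhs b)"
    proof -
      have o: "Dom D b \<in> Obj D" "Cod D b \<in> Obj D" "Cod D b' \<in> Obj D" using b D by simp_all
      show ?thesis
        using b D e[OF o(1)] e[OF o(2)] e[OF o(3)] by (simp add: rhs_def Comp_assoc left_cancel_inverse)
    qed
    then have "ga (Comp D b' b) = Comp C (ga b') (ga b)"
      by (intro faithful) (use b C D ga in \<open>simp_all add: Fun_Comp[OF f]\<close>)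
    then show "FArr G (Comp D b' b) = Comp C (FArr G b') (FArr G b)" using b D by (simp add: Gs)
  qed (use D ga in \<open>simp_all add: Gs\<close>, simp_all add: G_def)
  have fG: "comp_fun D f G \<in> Fun D D" and Gf: "comp_fun C G f \<in> Fun C C"
    using comp_fun_in[OF D G f] comp_fun_in[OF C f G] by simp_all
  have "naturally_isomorphic D D (comp_fun D f G) (id_fun D)"
  proof -
    define \<epsilon> where "\<epsilon> = \<lparr>NSrc = comp_fun D f G, NTgt = id_fun D, NComp = (\<lambda>y\<in>Obj D. e y)\<rparr>"
    have "\<epsilon> \<in> Nat_trans D D"
      by (rule NatI) (use D e e_rhs fG id_fun_in[OF D] in \<open>simp_all add: \<epsilon>_def Gs ga(4)\<close>)
    then show ?thesis
      unfolding naturally_isomorphic_def using e(1) by (intro bexI[of _ \<epsilon>]) (simp_all add: iso_arrows_fun_cat[OF D D], simp_all add: \<epsilon>_def)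
  qed
  moreover have "naturally_isomorphic C C (comp_fun C G f) (id_fun C)"
  proof -
    \<comment> \<open>The unit at x is a lift of the counit at f x; the lift is an isomorphism since
      \<open>iso_full\<close> provides lifts within the isomorphisms of C.\<close>
    have "\<exists>r. r \<in> iso_arrows C \<and> Dom C r = g (FObj f x) \<and> Cod C r = x \<and> FArr f r = e (FObj f x)" if x: "x \<in> Obj C" for x
      using iso_full[OF g[OF Fun_simps(1)[OF f x]] x e(1)[OF Fun_simps(1)[OF f x]]] e[OF Fun_simps(1)[OF f x]] by auto
    then obtain n where n: "\<And>x. x \<in> Obj C \<Longrightarrow> n x \<in> iso_arrows C" "\<And>x. x \<in> Obj C \<Longrightarrow> Dom C (n x) = g (FObj f x)"
      "\<And>x. x \<in> Obj C \<Longrightarrow> Cod C (n x) = x" "\<And>x. x \<in> Obj C \<Longrightarrow> FArr f (n x) = e (FObj f x)" by metis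
    define \<eta> where "\<eta> = \<lparr>NSrc = comp_fun C G f, NTgt = id_fun C, NComp = (\<lambda>x\<in>Obj C. n x)\<rparr>"
    have "\<eta> \<in> Nat_trans C C"
    proof (rule NatI)
      fix a assume a: "a \<in> Arr C"
      have o: "Dom C a \<in> Obj C" "Cod C a \<in> Obj C" using a C by simp_all
      have fa: "FArr f a \<in> Arr D" "Dom D (FArr f a) = FObj f (Dom C a)" "Cod D (FArr f a) = FObj f (Cod C a)"
        using a by (simp_all add: Fun_simps[OF f])
      have gs: "ga (FArr f a) \<in> Arr C" "Dom C (ga (FArr f a)) = g (FObj f (Dom C a))" "Cod C (ga (FArr f a)) = g (FObj f (Cod C a))"
        using ga(1-3)[OF fa(1)] fa by simp_all
      have "Comp C (n (Cod C a)) (ga (FArr f a)) = Comp C a (n (Dom C a))"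
      proof (rule faithful)
        have "FArr f (Comp C (n (Cod C a)) (ga (FArr f a))) = Comp D (e (FObj f (Cod C a))) (rhs (FArr f a))"
          using n[OF o(2)] gs ga(4)[OF fa(1)] by (simp add: Fun_Comp[OF f])
        also have "\<dots> = Comp D (FArr f a) (e (FObj f (Dom C a)))" using e_rhs[OF fa(1)] fa by simp
        also have "\<dots> = FArr f (Comp C a (n (Dom C a)))" using n[OF o(1)] a by (simp add: Fun_Comp[OF f])
        finally show "FArr f (Comp C (n (Cod C a)) (ga (FArr f a))) = FArr f (Comp C a (n (Dom C a)))" .
      qed (use C a o n[OF o(1)] n[OF o(2)] gs in simp_all)
      then show "Comp C (NComp \<eta> (Cod C a)) (FArr (NSrc \<eta>) a) = Comp C (FArr (NTgt \<eta>) a) (NComp \<eta> (Dom C a))"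
        using a o fa by (simp add: \<eta>_def Gs)
    qed (use C n Gf id_fun_in[OF C] in \<open>simp_all add: \<eta>_def Gs Fun_simps[OF f]\<close>)
    then show ?thesis
      unfolding naturally_isomorphic_def using n(1) by (intro bexI[of _ \<eta>]) (simp_all add: iso_arrows_fun_cat[OF C C], simp_all add: \<eta>_def)
  qed
  ultimately show ?thesis unfolding equivalence_of_categories_def using f G by blast
qed

text \<open>Whiskering the isomorphism from u to v with a chain P gives an isomorphism
  \<open>w P\<close> of level m, natural in P. So the two functors between level groupoids are
  isomorphic and \<open>nerve_homotopic\<close> applies.\<close>

lemma level_homotopic:
  fixes C :: "('a, 'b) cat" and D :: "('c, 'd) cat"
  assumes C: "category C" and D: "category D" and uv: "naturally_isomorphic C D u v"
  shows "homotopic_with (\<lambda>_. True) (class_space (level_cat C m)) (class_space (level_cat D m))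
    (realization_map (nerve (level_cat D m)) (classifying_map C u m)) (realization_map (nerve (level_cat D m)) (classifying_map C v m))"
proof -
  obtain \<alpha> where "\<alpha> \<in> iso_arrows (fun_cat C D)" and "Dom (fun_cat C D) \<alpha> = u" "Cod (fun_cat C D) \<alpha> = v"
    using uv unfolding naturally_isomorphic_def by blast
  then have a: "\<alpha> \<in> Nat_trans C D" and ai: "\<And>x. x \<in> Obj C \<Longrightarrow> NComp \<alpha> x \<in> iso_arrows D" and s: "NSrc \<alpha> = u" "NTgt \<alpha> = v"
    by (auto simp: iso_arrows_fun_cat[OF C D])
  have u: "u \<in> Fun C D" and v: "v \<in> Fun C D" using Nat_simps(1,2)[OF a] s by simp_all
  define w where "w P = \<lparr>NSrc = comp_fun (ordinal m) u P, NTgt = comp_fun (ordinal m) v P, NComp = (\<lambda>i\<in>{..m}. NComp \<alpha> (FObj P i))\<rparr>" for P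
  have w: "w P \<in> Arr (level_cat D m)" if P: "P \<in> Fun (ordinal m) C" for P
  proof -
    have "w P \<in> Nat_trans (ordinal m) D"
    proof (rule NatI)
      show "NSrc (w P) \<in> Fun (ordinal m) D" "NTgt (w P) \<in> Fun (ordinal m) D"
        using comp_fun_in[OF _ P u] comp_fun_in[OF _ P v] by (simp_all add: w_def)
    next
      fix i assume i: "i \<in> Obj (ordinal m)"
      have "FObj P i \<in> Obj C" using Fun_simps(1)[OF P i] .
      then show "NComp (w P) i \<in> Arr D" "Dom D (NComp (w P) i) = FObj (NSrc (w P)) i" "Cod D (NComp (w P) i) = FObj (NTgt (w P)) i"
        using i Nat_simps(3-5)[OF a, of "FObj P i"] s by (simp_all add: w_def)
    next
      fix h assume h: "h \<in> Arr (ordinal m)"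
      then have o: "Dom (ordinal m) h \<in> {..m}" "Cod (ordinal m) h \<in> {..m}"
        using Dom_in[OF category_ordinal h] Cod_in[OF category_ordinal h] by simp_all
      show "Comp D (NComp (w P) (Cod (ordinal m) h)) (FArr (NSrc (w P)) h) = Comp D (FArr (NTgt (w P)) h) (NComp (w P) (Dom (ordinal m) h))"
        using h o Nat_nat[OF a Fun_simps(2)[OF P h]] s by (simp add: w_def Fun_simps[OF P])
    qed (simp add: w_def)
    then show ?thesis using Fun_simps(1)[OF P] ai by (simp add: Arr_level_cat[OF D] w_def)
  qed
  note L = level_map_simps[OF C] and SD = level_cat_simps[OF D] and SC = level_cat_simps[OF C]
  have cL: "category (level_cat D m)" using D by simp
  show ?thesis
    unfolding classifying_map_eq
  proof (rule nerve_homotopic[where \<alpha> = w])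
    show "groupoid (level_cat C m)" "groupoid (level_cat D m)" by (rule groupoid_level_cat[OF C], rule groupoid_level_cat[OF D])
    show lu: "level_map C u m \<in> Fun (level_cat C m) (level_cat D m)" and lv: "level_map C v m \<in> Fun (level_cat C m) (level_cat D m)"
      by (rule level_fun_in[OF C D Delta_id u], rule level_fun_in[OF C D Delta_id v])
    fix P assume "P \<in> Obj (level_cat C m)"
    then have P: "P \<in> Fun (ordinal m) C" by (simp add: Obj_level_cat)
    show "w P \<in> Arr (level_cat D m) \<and> Dom (level_cat D m) (w P) = FObj (level_map C u m) P \<and> Cod (level_cat D m) (w P) = FObj (level_map C v m) P"
      using w[OF P] by (simp add: SD[OF w[OF P]] L(1)[OF P]) (simp add: w_def)
  next
    fix \<beta> assume b: "\<beta> \<in> Arr (level_cat C m)"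
    have bn: "\<beta> \<in> Nat_trans (ordinal m) C" using b by (simp add: Arr_level_cat[OF C])
    note lu = level_fun_in[OF C D Delta_id u, of m] and lv = level_fun_in[OF C D Delta_id v, of m]
    note P = Nat_simps(1)[OF bn] and Q = Nat_simps(2)[OF bn]
    note ub = Fun_simps(2)[OF lu b] and vb = Fun_simps(2)[OF lv b]
    have nt: "x \<in> Arr (level_cat D m) \<Longrightarrow> x \<in> Nat_trans (ordinal m) D" for x by (simp add: Arr_level_cat[OF D])
    have e1: "NSrc (w (NTgt \<beta>)) = NTgt (FArr (level_map C u m) \<beta>)" by (simp add: w_def L(3)[OF b])
    have e2: "NSrc (FArr (level_map C v m) \<beta>) = NTgt (w (NSrc \<beta>))" by (simp add: w_def L(2)[OF b])
    have "Comp (fun_cat (ordinal m) D) (w (NTgt \<beta>)) (FArr (level_map C u m) \<beta>) =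
      Comp (fun_cat (ordinal m) D) (FArr (level_map C v m) \<beta>) (w (NSrc \<beta>))"
    proof (rule Nat_ext[OF Comp_fun_cat_in[OF _ D nt[OF ub] nt[OF w[OF Q]] e1] Comp_fun_cat_in[OF _ D nt[OF w[OF P]] nt[OF vb] e2]])
      fix i assume i: "i \<in> Obj (ordinal m)"
      then have i': "i \<le> m" by simp
      note B = Nat_simps(3-5)[OF bn i]
      show "NComp (Comp (fun_cat (ordinal m) D) (w (NTgt \<beta>)) (FArr (level_map C u m) \<beta>)) i =
        NComp (Comp (fun_cat (ordinal m) D) (FArr (level_map C v m) \<beta>) (w (NSrc \<beta>))) i"
        using nt[OF ub] nt[OF vb] nt[OF w[OF P]] nt[OF w[OF Q]] e1 e2 i i' Nat_nat[OF a B(1)] s B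
        by (simp add: L(4)[OF b i']) (simp add: w_def)
    next
      show "NSrc (Comp (fun_cat (ordinal m) D) (w (NTgt \<beta>)) (FArr (level_map C u m) \<beta>)) =
        NSrc (Comp (fun_cat (ordinal m) D) (FArr (level_map C v m) \<beta>) (w (NSrc \<beta>)))"
        unfolding fun_cat_simps(8)[OF nt[OF w[OF Q]] nt[OF ub] e1] fun_cat_simps(8)[OF nt[OF vb] nt[OF w[OF P]] e2]
        by (simp add: w_def L(2)[OF b])
      show "NTgt (Comp (fun_cat (ordinal m) D) (w (NTgt \<beta>)) (FArr (level_map C u m) \<beta>)) =
        NTgt (Comp (fun_cat (ordinal m) D) (FArr (level_map C v m) \<beta>) (w (NSrc \<beta>)))"
        unfolding fun_cat_simps(9)[OF nt[OF w[OF Q]] nt[OF ub] e1] fun_cat_simps(9)[OF nt[OF vb] nt[OF w[OF P]] e2]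
        by (simp add: w_def L(3)[OF b])
    qed simp_all
    then show "Comp (level_cat D m) (w (Cod (level_cat C m) \<beta>)) (FArr (level_map C u m) \<beta>) =
      Comp (level_cat D m) (FArr (level_map C v m) \<beta>) (w (Dom (level_cat C m) \<beta>))"
      by (simp add: SC[OF b] SD(3)[OF w[OF Q] ub] SD(3)[OF vb w[OF P]])
  qed
qed

text \<open>The realization of Ng in the same level is a homotopy inverse: by functoriality the
  round trips are realizations of N applied to composites that are isomorphic to identities.\<close>

lemma equivalence_imp_weak_equivalence:
  fixes C :: "('a, 'b) cat" and D :: "('c, 'd) cat"
  assumes C: "category C" and D: "category D" and eq: "equivalence_of_categories C D f"
  shows "levelwise_weak_equivalence (classifying_diagram C) (classifying_diagram D) (classifying_map C f)"
proof -
  obtain g where f: "f \<in> Fun C D" and g: "g \<in> Fun D C"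
    and gf: "naturally_isomorphic C C (comp_fun C g f) (id_fun C)" and fg: "naturally_isomorphic D D (comp_fun D f g) (id_fun D)"
    using eq unfolding equivalence_of_categories_def by blast
  have F: "classifying_map C f \<in> sspace_hom (classifying_diagram C) (classifying_diagram D)" by (rule classifying_map_in[OF C D f])
  have hom: "classifying_map A k m \<in> sset_hom (nerve (level_cat A m)) (nerve (level_cat B m))"
    if "category A" "category B" "k \<in> Fun A B" for A :: "('u, 'v) cat" and B :: "('w, 'x) cat" and k m
    using sspace_homD(1)[OF classifying_map_in[OF that], of m] by simp
  \<comment> \<open>Stated for arbitrary categories and types so that it serves both round trips,
    with C and D exchanged.\<close>
  have H: "homotopic_with (\<lambda>_. True) (class_space (level_cat A m)) (class_space (level_cat A m))
      (realization_map (nerve (level_cat A m)) (classifying_map B l m) \<circ> realization_map (nerve (level_cat B m)) (classifying_map A k m)) id"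
    if A: "category A" and B: "category B" and k: "k \<in> Fun A B" and l: "l \<in> Fun B A" and n: "naturally_isomorphic A A (comp_fun A l k) (id_fun A)"
    for A :: "('u, 'v) cat" and B :: "('w, 'x) cat" and k l m
  proof (rule homotopic_with_eq[OF level_homotopic[OF A A n, of m]])
    fix c assume c: "c \<in> topspace (class_space (level_cat A m))"
    have i: "is_sset (nerve (level_cat A m))" using A by simp
    have "classifying_map A (comp_fun A l k) m = sset_comp (nerve (level_cat A m)) (classifying_map B l m) (classifying_map A k m)"
      using classifying_map_comp[OF A B A k l] by (simp add: sspace_comp_def)
    then show "(realization_map (nerve (level_cat A m)) (classifying_map B l m) \<circ> realization_map (nerve (level_cat B m)) (classifying_map A k m)) c =
      realization_map (nerve (level_cat A m)) (classifying_map A (comp_fun A l k) m) c"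
      using realization_map_comp[OF i hom[OF A B k] hom[OF B A l] c] by simp
    have "classifying_map A (id_fun A) m = sset_id (nerve (level_cat A m))"
      using classifying_map_id[OF A] by (simp add: sspace_id_def)
    then show "id c = realization_map (nerve (level_cat A m)) (classifying_map A (id_fun A) m) c"
      using realization_map_id[OF i c] by simp
  qed simp
  show ?thesis
    unfolding levelwise_weak_equivalence_def weak_equivalence_def homotopy_equivalence_map_def classifying_diagram_simps
  proof (intro conjI allI exI)
    fix m
    show "continuous_map (class_space (level_cat D m)) (class_space (level_cat C m)) (realization_map (nerve (level_cat C m)) (classifying_map D g m))"
      by (rule continuous_realization_map[OF hom[OF D C g]])
    show "continuous_map (class_space (level_cat C m)) (class_space (level_cat D m)) (realization_map (nerve (level_cat D m)) (classifying_map C f m))"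
      by (rule continuous_realization_map[OF hom[OF C D f]])
    show "homotopic_with (\<lambda>_. True) (class_space (level_cat C m)) (class_space (level_cat C m))
       (realization_map (nerve (level_cat C m)) (classifying_map D g m) \<circ> realization_map (nerve (level_cat D m)) (classifying_map C f m)) id"
      by (rule H[OF C D f g gf])
    show "homotopic_with (\<lambda>_. True) (class_space (level_cat D m)) (class_space (level_cat D m))
       (realization_map (nerve (level_cat D m)) (classifying_map C f m) \<circ> realization_map (nerve (level_cat C m)) (classifying_map D g m)) id"
      by (rule H[OF D C g f fg])
    show "classifying_map C f m \<in> sset_hom (nerve (level_cat C m)) (nerve (level_cat D m))" by (rule hom[OF C D f])
  qed (rule F)
qed

lemma equivalence_iff_weak_equivalence:
  assumes C: "category C" and D: "category D" and f: "f \<in> Fun C D"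
  shows "equivalence_of_categories C D f \<longleftrightarrow>
    levelwise_weak_equivalence (classifying_diagram C) (classifying_diagram D) (classifying_map C f)"
proof
  assume w: "levelwise_weak_equivalence (classifying_diagram C) (classifying_diagram D) (classifying_map C f)"
  note W = weak_equivalence_imp[OF C D f w]
  show "equivalence_of_categories C D f"
    by (rule fully_faithful_imp_equivalence[OF C D f W])
qed (rule equivalence_imp_weak_equivalence[OF C D])

theorem theorem3p7:
  shows
    "(\<exists>\<phi> :: ('a, 'b) cat \<Rightarrow> ('c, 'd) cat \<Rightarrow>
          nat \<Rightarrow> nat \<Rightarrow> ('a \<times> 'c, 'b \<times> 'd) csimp \<Rightarrow> ('a, 'b) csimp \<times> ('c, 'd) csimp.
        (\<forall>C D. category C \<longrightarrow> category D \<longrightarrow>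
           sspace_iso (classifying_diagram (prod_cat C D))
             (prod_sspace (classifying_diagram C) (classifying_diagram D)) (\<phi> C D)) \<and>
        (\<forall>C C' D D' u v. category C \<longrightarrow> category C' \<longrightarrow> category D \<longrightarrow> category D' \<longrightarrow>
           u \<in> Fun C C' \<longrightarrow> v \<in> Fun D D' \<longrightarrow>
           sspace_comp (classifying_diagram (prod_cat C D))
             (\<phi> C' D') (classifying_map (prod_cat C D) (fun_prod C D u v)) =
           sspace_comp (classifying_diagram (prod_cat C D))
             (prod_sspace_map (classifying_diagram C) (classifying_diagram D)
               (classifying_map C u) (classifying_map D v)) (\<phi> C D))) \<and>
     (\<exists>\<psi> :: ('a, 'b) cat \<Rightarrow> ('c, 'd) cat \<Rightarrow>
          nat \<Rightarrow> nat \<Rightarrow> (('a, 'b, 'c, 'd) funct, ('a, 'b, 'c, 'd) nattr) csimp \<Rightarrow>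
            (nat \<Rightarrow> nat \<Rightarrow> (('a, 'b) csimp \<times> delta) \<times> delta \<Rightarrow> ('c, 'd) csimp).
        (\<forall>C D. category C \<longrightarrow> category D \<longrightarrow>
           sspace_iso (classifying_diagram (fun_cat C D))
             (sspace_exp (classifying_diagram C) (classifying_diagram D)) (\<psi> C D)) \<and>
        (\<forall>C C' D D' u v. category C \<longrightarrow> category C' \<longrightarrow> category D \<longrightarrow> category D' \<longrightarrow>
           u \<in> Fun C' C \<longrightarrow> v \<in> Fun D D' \<longrightarrow>
           sspace_comp (classifying_diagram (fun_cat C D))
             (\<psi> C' D') (classifying_map (fun_cat C D) (fun_cat_map C' C D u v)) =
           sspace_comp (classifying_diagram (fun_cat C D))
             (sspace_exp_map (classifying_diagram C') (classifying_diagram C) (classifying_diagram D)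
               (classifying_map C' u) (classifying_map D v)) (\<psi> C D))) \<and>
     (\<forall>C :: ('a, 'b) cat. category C \<longrightarrow>
        is_sspace (classifying_diagram C) \<and>
        classifying_map C (id_fun C) = sspace_id (classifying_diagram C)) \<and>
     (\<forall>(C :: ('a, 'b) cat) (D :: ('c, 'd) cat) (E :: ('e, 'f) cat) f g.
        category C \<longrightarrow> category D \<longrightarrow> category E \<longrightarrow> f \<in> Fun C D \<longrightarrow> g \<in> Fun D E \<longrightarrow>
        classifying_map C (comp_fun C g f) =
        sspace_comp (classifying_diagram C) (classifying_map D g) (classifying_map C f)) \<and>
     (\<forall>(C :: ('a, 'b) cat) (D :: ('c, 'd) cat). category C \<longrightarrow> category D \<longrightarrow>
        bij_betw (classifying_map C) (Fun C D)
          (sspace_hom (classifying_diagram C) (classifying_diagram D))) \<and>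
     inj_on classifying_diagram {C :: ('a, 'b) cat. category C} \<and>
     (\<forall>(C :: ('a, 'b) cat) (D :: ('c, 'd) cat) f. category C \<longrightarrow> category D \<longrightarrow> f \<in> Fun C D \<longrightarrow>
        (equivalence_of_categories C D f \<longleftrightarrow>
         levelwise_weak_equivalence (classifying_diagram C) (classifying_diagram D)
           (classifying_map C f)))"
  by (intro conjI exI[of _ product_comparison] exI[of _ exp_comparison];
    intro conjI allI impI product_comparison_iso product_comparison_natural exp_comparison_iso exp_comparison_natural
      is_sspace_classifying_diagram classifying_map_id classifying_map_comp classifying_map_bij
      classifying_diagram_inj equivalence_iff_weak_equivalence; assumption?)

end
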